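(* Let the standing assumptions on $A$, $Q$, $W^Q$, $X_0$ and $F$ stated in the context hold. Let $\{X(t)\}_{t\ge0}$ be the mild solution of $$\mathrm{d}X(t)=AX(t)\,\mathrm{d}t+F(X(t))\,\mathrm{d}t+\mathrm{d}W^Q(t),\quad t>0,\qquad X(0)=X_0,$$ and let $\{X^n(t)\}_{t\ge0}$ be the solution of $$\mathrm{d}X^n(t)=A_nX^n(t)\,\mathrm{d}t+P_nF(X^n(t))\,\mathrm{d}t+P_n\,\mathrm{d}W^Q(t),\quad t>0,\qquad X^n(0)=P_nX_0.$$ Then for every $\Phi\in C_b^2(H,\mathbb{R})$ and every (arbitrarily small) $\epsilon>0$ there exists $C>0$, independent of $T$ and $n$, such that for all $T>0$ and $n\in\mathbb{N}$ $$\big|\mathbb{E}[\Phi(X(T))]-\mathbb{E}[\Phi(X^n(T))]\big|\le C\lambda_n^{-\beta+\epsilon}.$$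
   Context: Setting. $(H,\langle\cdot,\cdot\rangle,\|\cdot\|)$ is a real separable Hilbert space; $\mathcal{L}(H)$ and $\mathcal{L}_2(H)$ denote bounded linear and Hilbert--Schmidt operators on $H$; $\mathbb{N}=\{1,2,\dots\}$. $C_b^2(H,\mathbb{R})$ is the space of (not necessarily bounded) maps $H\to\mathbb{R}$ having continuous and bounded Fréchet derivatives up to order 2. Assumption on $A$: $A:\mathcal{D}(A)\subset H\to H$ is a densely defined, self-adjoint, negative definite linear operator, not necessarily bounded but with compact inverse. Hence there are an orthonormal basis $\{e_i\}_{i\in\mathbb{N}}$ of $H$ and reals $0<\lambda_1\le\lambda_2\le\cdots\to\infty$ with $-Ae_i=\lambda_ie_i$. $E(t)=e^{tA}$ is the generated semigroup. Fractional powers $(-A)^\gamma$, $\gamma\in\mathbb{R}$, are defined spectrally; $\dot H^\gamma=\mathcal{D}((-A)^{\gamma/2})$ with norm $\|\varphi\|_\gamma=\|(-A)^{\gamma/2}\varphi\|$. Assumptions on $Q,W^Q,X_0,F$: $\{W^Q(t)\}_{t\ge0}$ is a cylindrical $Q$-Wiener process on a filtered probability space $(\Omega,\mathcal{F},\mathbb{P};\{\mathcal{F}_t\}_{t\ge0})$, where $Q:H\to H$ is a self-adjoint, positive definite bounded linear operator commuting with $A$, so that $Qe_i=q_ie_i$ and $W^Q(t)=\sum_{i=1}^\infty\sqrt{q_i}\,\beta_i(t)e_i$ with independent real Brownian motions $\beta_i$; and $\|(-A)^{\frac{\beta-1}{2}}Q^{1/2}\|_{\mathcal{L}_2(H)}<\infty$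 for some $\beta\in(0,1]$ (this is the $\beta$ in the claim). The initial value $X_0\in\dot H^{\max(2\beta,1)}$ is deterministic. The map $F:H\to H$ is twice differentiable and satisfies $\langle\varphi_1-\varphi_2,F(\varphi_1)-F(\varphi_2)\rangle\le L_F\|\varphi_1-\varphi_2\|^2$ for all $\varphi_1,\varphi_2\in H$, with $L_F<\lambda_1$; and there are $L>0$, $\delta\in[1,2)$, $\eta\in[0,1)$ with $\|F'(\varphi)\psi\|\le L\|\psi\|$ for $\varphi,\psi\in H$; $\|(-A)^{-\delta/2}F'(\varphi)\psi\|\le L(1+\|\varphi\|_1)\|\psi\|_{-1}$ for $\varphi\in\dot H^1,\psi\in H$; $\|(-A)^{-\eta}F''(\varphi)(\psi_1,\psi_2)\|\le L\|\psi_1\|\|\psi_2\|$ for $\varphi,\psi_1,\psi_2\in H$. Under these assumptions the mild solution exists uniquely: $X(t)=E(t)X_0+\int_0^tE(t-s)F(X(s))\,\mathrm{d}s+\int_0^tE(t-s)\,\mathrm{d}W^Q(s)$, $t\ge0$, $\mathbb{P}$-a.s. Galerkin notation: $H_n=\mathrm{span}\{e_1,\dots,e_n\}$, $P_n:H\to H_n$ is $P_n\varphi=\sum_{i=1}^n\langle e_i,\varphi\rangle e_i$, and $A_n=AP_n:H_n\to H_n$. *)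

theory Defs
  imports "HOL-Probability.Probability"
begin

text \<open>
  The real separable Hilbert space \<open>H\<close> is a type of sort
  \<open>{real_inner, banach, second_countable_topology}\<close>. Index sets are \<open>{1..}\<close>, so
  \<open>e 0\<close>, \<open>lam 0\<close>, \<open>q 0\<close> and \<open>B 0\<close> carry no meaning. Processes are functions on
  \<open>real\<close> of which only the values at times \<open>t \<ge> 0\<close> matter.
\<close>

section \<open>Operators\<close>

definition orthonormal_basis :: "(nat \<Rightarrow> 'a::real_inner) \<Rightarrow> bool" where
  "orthonormal_basis e \<longleftrightarrow>
     (\<forall>i\<ge>1. \<forall>j\<ge>1. inner (e i) (e j) = (if i = j then 1 else 0)) \<and>
     closure (span (e ` {1..})) = UNIV"

text \<open>An unbounded operator is a pair of a domain \<open>D\<close> and a function \<open>A\<close> whose values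
  outside \<open>D\<close> are irrelevant.\<close>

definition linear_operator_on :: "'a::real_vector set \<Rightarrow> ('a \<Rightarrow> 'a) \<Rightarrow> bool" where
  "linear_operator_on D A \<longleftrightarrow>
     subspace D \<and> (\<forall>x\<in>D. \<forall>y\<in>D. A (x + y) = A x + A y) \<and>
     (\<forall>c. \<forall>x\<in>D. A (c *\<^sub>R x) = c *\<^sub>R A x)"

text \<open>The left-hand side of the last equivalence says that \<open>(y, z)\<close> belongs to the graph of
  the adjoint, the right-hand side that it belongs to the graph of \<open>A\<close>. So the domain of the
  adjoint is exactly \<open>D\<close>; symmetry alone would be weaker.\<close>

definition self_adjoint_operator :: "'a::real_inner set \<Rightarrow> ('a \<Rightarrow> 'a) \<Rightarrow> bool" where
  "self_adjoint_operator D A \<longleftrightarrow>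
     linear_operator_on D A \<and> closure D = UNIV \<and>
     (\<forall>y z. (\<forall>x\<in>D. inner (A x) y = inner x z) \<longleftrightarrow> y \<in> D \<and> z = A y)"

definition positive_definite_on :: "'a::real_inner set \<Rightarrow> ('a \<Rightarrow> 'a) \<Rightarrow> bool" where
  "positive_definite_on D A \<longleftrightarrow> (\<forall>x\<in>D. x \<noteq> 0 \<longrightarrow> inner (A x) x > 0)"

definition negative_definite_on :: "'a::real_inner set \<Rightarrow> ('a \<Rightarrow> 'a) \<Rightarrow> bool" where
  "negative_definite_on D A \<longleftrightarrow> (\<forall>x\<in>D. x \<noteq> 0 \<longrightarrow> inner (A x) x < 0)"

definition compact_operator :: "('a::real_normed_vector \<Rightarrow> 'b::real_normed_vector) \<Rightarrow> bool" where
  "compact_operator T \<longleftrightarrow> linear T \<and> (\<forall>S. bounded S \<longrightarrow> compact (closure (T ` S)))"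

definition has_compact_inverse :: "'a::real_normed_vector set \<Rightarrow> ('a \<Rightarrow> 'a) \<Rightarrow> bool" where
  "has_compact_inverse D A \<longleftrightarrow> bij_betw A D UNIV \<and> compact_operator (inv_into D A)"

text \<open>\<open>R\<close> is the (unique) positive self-adjoint square root of \<open>Q\<close>.\<close>

definition is_positive_sqrt :: "('a::real_inner \<Rightarrow> 'a) \<Rightarrow> ('a \<Rightarrow> 'a) \<Rightarrow> bool" where
  "is_positive_sqrt Q R \<longleftrightarrow>
     bounded_linear R \<and> (\<forall>x y. inner (R x) y = inner x (R y)) \<and>
     (\<forall>x. inner (R x) x \<ge> 0) \<and> (\<forall>x. R (R x) = Q x)"

text \<open>The value of the sum does not depend on the choice of the orthonormal basis.\<close>

definition hilbert_schmidt :: "('a::real_inner \<Rightarrow> 'a) \<Rightarrow> bool" where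
  "hilbert_schmidt T \<longleftrightarrow>
     bounded_linear T \<and>
     (\<exists>b. orthonormal_basis b \<and> (\<lambda>i. (norm (T (b i)))\<^sup>2) summable_on {1..})"

definition strongly_continuous_semigroup :: "(real \<Rightarrow> 'a::real_normed_vector \<Rightarrow> 'a) \<Rightarrow> bool" where
  "strongly_continuous_semigroup E \<longleftrightarrow>
     (\<forall>t\<ge>0. bounded_linear (E t)) \<and> (\<forall>x. E 0 x = x) \<and>
     (\<forall>s\<ge>0. \<forall>t\<ge>0. \<forall>x. E (s + t) x = E s (E t x)) \<and>
     (\<forall>x. ((\<lambda>t. E t x) \<longlongrightarrow> x) (at_right 0))"

text \<open>\<open>(D, A)\<close> is the infinitesimal generator of \<open>E\<close>, that is, \<open>E t = exp (t A)\<close>.\<close>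

definition generates_semigroup ::
    "'a::real_normed_vector set \<Rightarrow> ('a \<Rightarrow> 'a) \<Rightarrow> (real \<Rightarrow> 'a \<Rightarrow> 'a) \<Rightarrow> bool" where
  "generates_semigroup D A E \<longleftrightarrow>
     strongly_continuous_semigroup E \<and>
     (\<forall>x y. ((\<lambda>h. (E h x - x) /\<^sub>R h) \<longlongrightarrow> y) (at_right 0) \<longleftrightarrow> x \<in> D \<and> y = A x)"

text \<open>Spectral fractional powers \<open>(-A)^\<gamma>\<close>, where \<open>- A (e i) = lam i *\<^sub>R e i\<close>. Elements
  outside \<open>H\<close> of the spaces of negative order are not represented; for \<open>\<gamma> \<le> 0\<close> the domain
  below is all of \<open>H\<close>.\<close>

definition frac_dom :: "(nat \<Rightarrow> 'a::real_inner) \<Rightarrow> (nat \<Rightarrow> real) \<Rightarrow> real \<Rightarrow> 'a set" where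
  "frac_dom e lam \<gamma> = {x. (\<lambda>i. (lam i powr \<gamma> * inner (e i) x)\<^sup>2) summable_on {1..}}"

definition frac_pow :: "(nat \<Rightarrow> 'a::real_inner) \<Rightarrow> (nat \<Rightarrow> real) \<Rightarrow> real \<Rightarrow> 'a \<Rightarrow> 'a" where
  "frac_pow e lam \<gamma> x = infsum (\<lambda>i. (lam i powr \<gamma> * inner (e i) x) *\<^sub>R e i) {1..}"

definition Hdot :: "(nat \<Rightarrow> 'a::real_inner) \<Rightarrow> (nat \<Rightarrow> real) \<Rightarrow> real \<Rightarrow> 'a set" where
  "Hdot e lam \<gamma> = frac_dom e lam (\<gamma> / 2)"

definition Hdot_norm :: "(nat \<Rightarrow> 'a::real_inner) \<Rightarrow> (nat \<Rightarrow> real) \<Rightarrow> real \<Rightarrow> 'a \<Rightarrow> real" where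
  "Hdot_norm e lam \<gamma> x = norm (frac_pow e lam (\<gamma> / 2) x)"

definition galerkin_proj :: "(nat \<Rightarrow> 'a::real_inner) \<Rightarrow> nat \<Rightarrow> 'a \<Rightarrow> 'a" where
  "galerkin_proj e n x = (\<Sum>i=1..n. inner (e i) x *\<^sub>R e i)"

text \<open>\<open>\<Phi>\<close> itself need not be bounded.\<close>

definition Cb2 :: "('a::real_normed_vector \<Rightarrow> real) \<Rightarrow> bool" where
  "Cb2 \<Phi> \<longleftrightarrow>
     (\<exists>(D1 :: 'a \<Rightarrow> 'a \<Rightarrow>\<^sub>L real) (D2 :: 'a \<Rightarrow> 'a \<Rightarrow>\<^sub>L ('a \<Rightarrow>\<^sub>L real)).
        (\<forall>x. (\<Phi> has_derivative blinfun_apply (D1 x)) (at x)) \<and>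
        (\<forall>x. (D1 has_derivative blinfun_apply (D2 x)) (at x)) \<and>
        continuous_on UNIV D1 \<and> continuous_on UNIV D2 \<and>
        bounded (range D1) \<and> bounded (range D2))"

section \<open>The driving noise\<close>

definition filtration_of :: "'w measure \<Rightarrow> (real \<Rightarrow> 'w measure) \<Rightarrow> bool" where
  "filtration_of M Fil \<longleftrightarrow>
     (\<forall>t\<ge>0. space (Fil t) = space M \<and> sets (Fil t) \<subseteq> sets M) \<and>
     (\<forall>s\<ge>0. \<forall>t\<ge>s. sets (Fil s) \<subseteq> sets (Fil t))"

definition adapted :: "(real \<Rightarrow> 'w measure) \<Rightarrow> (real \<Rightarrow> 'w \<Rightarrow> 'a::topological_space) \<Rightarrow> bool" where
  "adapted Fil X \<longleftrightarrow> (\<forall>t\<ge>0. X t \<in> borel_measurable (Fil t))"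

definition jointly_measurable :: "'w measure \<Rightarrow> (real \<Rightarrow> 'w \<Rightarrow> 'a::topological_space) \<Rightarrow> bool" where
  "jointly_measurable M X \<longleftrightarrow>
     (\<lambda>(t, \<omega>). X t \<omega>) \<in> borel_measurable (restrict_space borel {0..} \<Otimes>\<^sub>M M)"

definition brownian_motion ::
    "'w measure \<Rightarrow> (real \<Rightarrow> 'w measure) \<Rightarrow> (real \<Rightarrow> 'w \<Rightarrow> real) \<Rightarrow> bool" where
  "brownian_motion M Fil b \<longleftrightarrow>
     adapted Fil b \<and>
     (AE \<omega> in M. b 0 \<omega> = 0) \<and>
     (AE \<omega> in M. continuous_on {0..} (\<lambda>t. b t \<omega>)) \<and>
     (\<forall>s\<ge>0. \<forall>t>s. distributed M lborel (\<lambda>\<omega>. b t \<omega> - b s \<omega>) (normal_density 0 (sqrt (t - s)))) \<and>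
     (\<forall>s\<ge>0. prob_space.indep_set M (sets (Fil s))
        (sets (vimage_algebra (space M) (\<lambda>\<omega>. \<lambda>t\<in>{s..}. b t \<omega> - b s \<omega>)
          (PiM {s..} (\<lambda>_. borel)))))"

text \<open>The coordinate Brownian motions \<open>B 1, B 2, \<dots>\<close> of a cylindrical Wiener process. The
  last clause makes the future increments of the whole family independent of the past; this
  does not follow from the corresponding property of the single \<open>B i\<close>.

  The cylindrical \<open>Q\<close>-Wiener process is the formal series of \<open>sqrt (q i) * B i t *\<^sub>R e i\<close>
  over \<open>i \<ge> 1\<close>, which need not converge in \<open>H\<close>. It is therefore represented by the triple
  of \<open>e\<close>, \<open>q\<close> and \<open>B\<close>.\<close>

definition wiener_coordinates ::
    "'w measure \<Rightarrow> (real \<Rightarrow> 'w measure) \<Rightarrow> (nat \<Rightarrow> real \<Rightarrow> 'w \<Rightarrow> real) \<Rightarrow> bool" where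
  "wiener_coordinates M Fil B \<longleftrightarrow>
     (\<forall>i\<ge>1. brownian_motion M Fil (B i)) \<and>
     prob_space.indep_vars M (\<lambda>_. PiM {0..} (\<lambda>_. borel)) (\<lambda>i \<omega>. \<lambda>t\<in>{0..}. B i t \<omega>) {1..} \<and>
     (\<forall>s\<ge>0. prob_space.indep_set M (sets (Fil s))
        (sets (vimage_algebra (space M)
          (\<lambda>\<omega>. \<lambda>k\<in>{1..} \<times> {s..}. B (fst k) (snd k) \<omega> - B (fst k) s \<omega>)
          (PiM ({1..} \<times> {s..}) (\<lambda>_. borel)))))"

section \<open>Stochastic integrals of deterministic integrands\<close>

text \<open>A list of triples \<open>(a, c, x)\<close> stands for the step function with value \<open>x\<close> on
  \<open>{a<..c}\<close> (values add up where intervals overlap).\<close>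

definition step_fun :: "(real \<times> real \<times> 'a::real_vector) list \<Rightarrow> real \<Rightarrow> 'a" where
  "step_fun p s = (\<Sum>(a, c, x)\<leftarrow>p. indicat_real {a<..c} s *\<^sub>R x)"

definition step_integral ::
    "(real \<Rightarrow> 'w \<Rightarrow> real) \<Rightarrow> (real \<times> real \<times> 'a::real_vector) list \<Rightarrow> 'w \<Rightarrow> 'a" where
  "step_integral b p \<omega> = (\<Sum>(a, c, x)\<leftarrow>p. (b c \<omega> - b a \<omega>) *\<^sub>R x)"

text \<open>\<open>I\<close> is a version of the Ito integral over \<open>[0, t]\<close> of the function \<open>g\<close> with
  respect to the real Brownian motion \<open>b\<close>: the mean-square limit of the integrals of step
  functions converging to \<open>g\<close> in \<open>L\<^sup>2([0, t]; H)\<close>.\<close>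

definition has_wiener_integral ::
    "'w measure \<Rightarrow> (real \<Rightarrow> 'w \<Rightarrow> real) \<Rightarrow>
     (real \<Rightarrow> 'a::{real_inner,banach,second_countable_topology}) \<Rightarrow> real \<Rightarrow> ('w \<Rightarrow> 'a) \<Rightarrow> bool" where
  "has_wiener_integral M b g t I \<longleftrightarrow>
     set_borel_measurable lborel {0..t} g \<and> I \<in> borel_measurable M \<and>
     (\<exists>p. (\<forall>k. \<forall>(a, c, x)\<in>set (p k). 0 \<le> a \<and> a \<le> c \<and> c \<le> t) \<and>
        (\<lambda>k. \<integral>\<^sup>+ s\<in>{0..t}. ennreal ((norm (g s - step_fun (p k) s))\<^sup>2) \<partial>lborel) \<longlonglongrightarrow> 0 \<and>
        (\<lambda>k. \<integral>\<^sup>+ \<omega>. ennreal ((norm (I \<omega> - step_integral b (p k) \<omega>))\<^sup>2) \<partial>M) \<longlonglongrightarrow> 0)"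

text \<open>\<open>I\<close> is a version of the integral over \<open>[0, t]\<close> of the operator-valued \<open>\<Psi>\<close> with
  respect to the cylindrical \<open>Q\<close>-Wiener process given by \<open>e\<close>, \<open>q\<close>, \<open>B\<close>: the mean-square
  limit of the partial sums over \<open>i\<close> of \<open>sqrt (q i)\<close> times the integral of
  \<open>\<Psi>(s) (e i)\<close> against \<open>B i\<close>.\<close>

definition has_Q_wiener_integral ::
    "'w measure \<Rightarrow> (nat \<Rightarrow> 'a) \<Rightarrow> (nat \<Rightarrow> real) \<Rightarrow> (nat \<Rightarrow> real \<Rightarrow> 'w \<Rightarrow> real) \<Rightarrow>
     (real \<Rightarrow> 'a \<Rightarrow> 'a::{real_inner,banach,second_countable_topology}) \<Rightarrow> real \<Rightarrow> ('w \<Rightarrow> 'a) \<Rightarrow> bool" where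
  "has_Q_wiener_integral M e q B \<Psi> t I \<longleftrightarrow>
     I \<in> borel_measurable M \<and>
     (\<exists>J. (\<forall>i\<ge>1. has_wiener_integral M (B i) (\<lambda>s. \<Psi> s (e i)) t (J i)) \<and>
        (\<lambda>N. \<integral>\<^sup>+ \<omega>. ennreal ((norm (I \<omega> - (\<Sum>i=1..N. sqrt (q i) *\<^sub>R J i \<omega>)))\<^sup>2) \<partial>M) \<longlonglongrightarrow> 0)"

section \<open>Solutions\<close>

text \<open>Path continuity and moment bounds are not part of the definitions: only the integrals
  over the paths have to exist almost surely, and the equation holds almost surely at each
  time, with an exceptional set that may depend on the time.\<close>

definition mild_solution ::
    "'w measure \<Rightarrow> (real \<Rightarrow> 'w measure) \<Rightarrow> (real \<Rightarrow> 'a \<Rightarrow> 'a) \<Rightarrow> ('a \<Rightarrow> 'a) \<Rightarrow>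
     (nat \<Rightarrow> 'a) \<Rightarrow> (nat \<Rightarrow> real) \<Rightarrow> (nat \<Rightarrow> real \<Rightarrow> 'w \<Rightarrow> real) \<Rightarrow>
     'a \<Rightarrow> (real \<Rightarrow> 'w \<Rightarrow> 'a::{real_inner,banach,second_countable_topology}) \<Rightarrow> bool" where
  "mild_solution M Fil E F e q B X0 X \<longleftrightarrow>
     adapted Fil X \<and> jointly_measurable M X \<and>
     (\<forall>t\<ge>0.
        (AE \<omega> in M. set_integrable lborel {0..t} (\<lambda>s. X s \<omega>)) \<and>
        (AE \<omega> in M. set_integrable lborel {0..t} (\<lambda>s. E (t - s) (F (X s \<omega>)))) \<and>
        (\<exists>Z. has_Q_wiener_integral M e q B (\<lambda>s. E (t - s)) t Z \<and>
          (AE \<omega> in M. X t \<omega> =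
             E t X0 + set_lebesgue_integral lborel {0..t} (\<lambda>s. E (t - s) (F (X s \<omega>))) + Z \<omega>)))"

text \<open>Solutions in \<open>span {e 1, \<dots>, e n}\<close> of the projected equation in integral form. The last
  term is \<open>P\<^sub>n W(t)\<close>, the integral over \<open>[0, t]\<close> of the constant \<open>P\<^sub>n\<close> against the
  noise.\<close>

definition galerkin_solution ::
    "'w measure \<Rightarrow> (real \<Rightarrow> 'w measure) \<Rightarrow> ('a \<Rightarrow> 'a) \<Rightarrow> ('a \<Rightarrow> 'a) \<Rightarrow>
     (nat \<Rightarrow> 'a) \<Rightarrow> (nat \<Rightarrow> real) \<Rightarrow> (nat \<Rightarrow> real \<Rightarrow> 'w \<Rightarrow> real) \<Rightarrow>
     'a \<Rightarrow> nat \<Rightarrow> (real \<Rightarrow> 'w \<Rightarrow> 'a::{real_inner,banach,second_countable_topology}) \<Rightarrow> bool" where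
  "galerkin_solution M Fil A F e q B X0 n X \<longleftrightarrow>
     adapted Fil X \<and> jointly_measurable M X \<and>
     (\<forall>t\<ge>0. \<forall>\<omega>\<in>space M. X t \<omega> \<in> span (e ` {1..n})) \<and>
     (\<forall>t\<ge>0.
        (AE \<omega> in M. set_integrable lborel {0..t}
           (\<lambda>s. A (galerkin_proj e n (X s \<omega>)) + galerkin_proj e n (F (X s \<omega>)))) \<and>
        (AE \<omega> in M. X t \<omega> =
           galerkin_proj e n X0 +
           set_lebesgue_integral lborel {0..t}
             (\<lambda>s. A (galerkin_proj e n (X s \<omega>)) + galerkin_proj e n (F (X s \<omega>))) +
           (\<Sum>i=1..n. (sqrt (q i) * B i t \<omega>) *\<^sub>R e i)))"

end

theory Submission imports Defs begin

text \<open>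
  The proof rests on a symmetry of the noise. Fix levels \<open>n < N\<close> and let \<open>y\<close> be the Galerkin
  solution of level \<open>n\<close>. Let \<open>x\<^sup>+\<close> and \<open>x\<^sup>-\<close> be the Galerkin solutions of level \<open>N\<close> driven by
  the given noise and by the noise whose modes above \<open>n\<close> have changed sign. Both have the same
  law, so twice the weak error between the levels is the mean of \<open>\<Phi> x\<^sup>+ + \<Phi> x\<^sup>- - 2 \<Phi> y\<close>.
  Expanding \<open>\<Phi>\<close> at \<open>y\<close> bounds this by the mean of \<open>\<parallel>x\<^sup>+ + x\<^sup>- - 2 y\<parallel>\<close> and the mean squares of
  \<open>\<parallel>x\<^sup>+ - y\<parallel>\<close> and \<open>\<parallel>x\<^sup>- - y\<parallel>\<close>. The strong error is of order \<open>\<lambda>\<^sub>n\<close> to the power \<open>- \<beta> / 2\<close>, so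
  its square already has the right order.

  The second difference \<open>x\<^sup>+ + x\<^sup>- - 2 y\<close> is smaller than the two first differences. In the
  high modes \<open>x\<^sup>+\<close> and \<open>x\<^sup>-\<close> consist of opposite Ornstein-Uhlenbeck processes, which cancel,
  and of terms of order \<open>\<lambda>\<^sub>n\<close> to the power \<open>- \<beta>\<close>. In the low modes the noise cancels. What
  remains is an equation with the dissipative linear drift \<open>F' y\<close>, driven by the high-mode
  terms and by the second-order Taylor remainders of \<open>F\<close> at \<open>y\<close>. These remainders are
  quadratic in the strong error, but they are bounded only after an application of \<open>(- A)\<close> to
  the power \<open>- \<eta>\<close>; as \<open>\<eta> < 1\<close>, the smoothing of the semigroup makes up for that. Since the
  one-sided Lipschitz constant of \<open>F\<close> lies below \<open>\<lambda>\<^sub>1\<close>, all equations are contractive, and no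
  bound grows with time or with \<open>N\<close>.

  The estimates are made for the exponential Euler chain on a time grid, where every bound is
  an induction over the steps (\<open>two_levels.weak_error\<close>) and the constants do not depend on the
  step size. Two limits lead to the theorem. At a fixed level the chain converges almost
  surely to the Galerkin solution (\<open>euler_tendsto_galerkin\<close>), and the Galerkin solutions
  converge almost surely to the mild solution (\<open>galerkin_tendsto_mild\<close>). Both hold path by
  path, with the noise a fixed continuous function, once the stochastic convolution is
  rewritten as an ordinary integral of the Brownian paths (\<open>wiener_integral_formula\<close>). As
  second moments stay bounded, the expectations converge as well (\<open>weak_convergence_rate\<close>).
\<close>

section \<open>Orthonormal expansions\<close>

text \<open>Operators that are diagonal in the basis, restricted to the modes in \<open>I\<close>. Depending on \<open>c\<close>
  this is a Galerkin projection, the semigroup, the generator or a fractional power on a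
  Galerkin space.\<close>

definition diag :: "(nat \<Rightarrow> 'a::real_inner) \<Rightarrow> nat set \<Rightarrow> (nat \<Rightarrow> real) \<Rightarrow> 'a \<Rightarrow> 'a" where
  "diag e I c z = (\<Sum>i\<in>I. (c i * inner (e i) z) *\<^sub>R e i)"

lemma galerkin_proj_eq_diag: "galerkin_proj e n = diag e {1..n} (\<lambda>_. 1)"
  by (simp add: galerkin_proj_def diag_def fun_eq_iff)

locale onb =
  fixes e :: "nat \<Rightarrow> 'a::{real_inner,banach,second_countable_topology}"
  assumes basis: "orthonormal_basis e"
begin

lemma inner_basis: "i \<ge> 1 \<Longrightarrow> j \<ge> 1 \<Longrightarrow> inner (e i) (e j) = (if i = j then 1 else 0)"
  using basis by (simp add: orthonormal_basis_def)

lemma norm_basis: "i \<ge> 1 \<Longrightarrow> norm (e i) = 1"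
  using inner_basis[of i i] by (simp add: norm_eq_sqrt_inner)

lemma inner_basis_sum:
  assumes "finite I" "I \<subseteq> {1..}" "j \<ge> 1"
  shows "inner (e j) (\<Sum>i\<in>I. a i *\<^sub>R e i) = (if j \<in> I then a j else 0)"
proof -
  have "inner (e j) (\<Sum>i\<in>I. a i *\<^sub>R e i) = (\<Sum>i\<in>I. a i * inner (e j) (e i))"
    by (simp add: inner_sum_right)
  also have "\<dots> = (\<Sum>i\<in>I. if j = i then a i else 0)"
    using assms inner_basis by (intro sum.cong refl) auto
  also have "\<dots> = (if j \<in> I then a j else 0)" using assms(1) by simp
  finally show ?thesis .
qed

lemma norm_basis_sum:
  assumes "finite I" "I \<subseteq> {1..}"
  shows "(norm (\<Sum>i\<in>I. a i *\<^sub>R e i))\<^sup>2 = (\<Sum>i\<in>I. (a i)\<^sup>2)"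
proof -
  have "(norm (\<Sum>i\<in>I. a i *\<^sub>R e i))\<^sup>2 = (\<Sum>j\<in>I. a j * inner (e j) (\<Sum>i\<in>I. a i *\<^sub>R e i))"
    by (subst power2_norm_eq_inner, subst inner_sum_left) simp
  also have "\<dots> = (\<Sum>j\<in>I. (a j)\<^sup>2)"
    using assms by (intro sum.cong refl) (auto simp: inner_basis_sum power2_eq_square subset_iff)
  finally show ?thesis .
qed

lemma inner_diag:
  assumes "finite I" "I \<subseteq> {1..}" "j \<ge> 1"
  shows "inner (e j) (diag e I c z) = (if j \<in> I then c j * inner (e j) z else 0)"
  unfolding diag_def using inner_basis_sum[OF assms] by simp

lemma norm_diag:
  assumes "finite I" "I \<subseteq> {1..}"
  shows "(norm (diag e I c z))\<^sup>2 = (\<Sum>i\<in>I. (c i * inner (e i) z)\<^sup>2)"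
  unfolding diag_def by (rule norm_basis_sum[OF assms])

lemma bessel:
  assumes "finite I" "I \<subseteq> {1..}"
  shows "(\<Sum>i\<in>I. (inner (e i) z)\<^sup>2) \<le> (norm z)\<^sup>2"
proof -
  let ?p = "diag e I (\<lambda>_. 1) z"
  have "inner z ?p = (\<Sum>i\<in>I. (inner (e i) z)\<^sup>2)"
    by (simp add: diag_def inner_sum_right power2_eq_square inner_commute)
  then have "(norm (z - ?p))\<^sup>2 = (norm z)\<^sup>2 - (\<Sum>i\<in>I. (inner (e i) z)\<^sup>2)"
    using norm_diag[OF assms, of "\<lambda>_. 1" z]
    by (simp add: power2_norm_eq_inner inner_diff_left inner_diff_right inner_commute)
  then show ?thesis using zero_le_power2[of "norm (z - ?p)"] by linarith
qed

lemma norm_diag_le: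
  assumes "finite I" "I \<subseteq> {1..}" and c: "\<And>i. i \<in> I \<Longrightarrow> \<bar>c i\<bar> \<le> m" and "m \<ge> 0"
  shows "norm (diag e I c z) \<le> m * norm z"
proof -
  have c2: "(c i)\<^sup>2 \<le> m\<^sup>2" if "i \<in> I" for i
    using c[OF that] \<open>m \<ge> 0\<close> abs_le_square_iff[of "c i" m] by simp
  have "(norm (diag e I c z))\<^sup>2 \<le> (\<Sum>i\<in>I. m\<^sup>2 * (inner (e i) z)\<^sup>2)"
    unfolding norm_diag[OF assms(1,2)] power_mult_distrib
    by (intro sum_mono mult_right_mono c2) auto
  also have "\<dots> \<le> (m * norm z)\<^sup>2"
    unfolding sum_distrib_left[symmetric] power_mult_distrib
    by (intro mult_left_mono bessel[OF assms(1,2)]) simp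
  finally show ?thesis by (rule power2_le_imp_le) (simp add: \<open>m \<ge> 0\<close>)
qed

lemma diag_diag:
  assumes "finite J" "J \<subseteq> {1..}" "I \<subseteq> J"
  shows "diag e I c (diag e J d z) = diag e I (\<lambda>i. c i * d i) z"
  using assms unfolding diag_def[of e I]
  by (intro sum.cong refl) (subst inner_diag, auto simp: subset_iff)

lemma bounded_linear_diag: "bounded_linear (diag e I c)"
proof -
  have "bounded_linear (\<lambda>z. (c i * inner (e i) z) *\<^sub>R e i)" for i
    by (rule bounded_linear_compose[OF bounded_linear_scaleR_left
          bounded_linear_compose[OF bounded_linear_mult_right bounded_linear_inner_right]])
  then show ?thesis unfolding diag_def[abs_def] by (intro bounded_linear_sum)
qed

lemma linear_diag: "linear (diag e I c)"
  by (rule bounded_linear.linear[OF bounded_linear_diag])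

lemma diag_add: "diag e I c (x + y) = diag e I c x + diag e I c y"
  and diag_diff: "diag e I c (x - y) = diag e I c x - diag e I c y"
  and diag_scaleR: "diag e I c (r *\<^sub>R x) = r *\<^sub>R diag e I c x"
  and diag_zero: "diag e I c 0 = 0"
  and diag_minus: "diag e I c (- x) = - diag e I c x"
  using linear_diag[of I c]
  by (simp_all add: linear_add linear_diff linear_scale linear_0 linear_neg)

lemma measurable_diag [measurable]: "diag e I c \<in> borel_measurable borel"
  by (rule borel_measurable_continuous_onI) (rule linear_continuous_on[OF bounded_linear_diag])

lemma diag_split:
  assumes "finite I" "finite J" "I \<inter> J = {}"
  shows "diag e (I \<union> J) c z = diag e I c z + diag e J c z"
  unfolding diag_def using assms by (simp add: sum.union_disjoint)

text \<open>The projections eventually fix every element of the dense span of the basis, and they are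
  contractions.\<close>

lemma galerkin_proj_tendsto: "(\<lambda>N. galerkin_proj e N x) \<longlonglongrightarrow> x"
proof (rule LIMSEQ_I)
  fix r :: real assume r: "r > 0"
  have "x \<in> closure (span (e ` {1..}))" using basis by (simp add: orthonormal_basis_def)
  then obtain y where y: "y \<in> span (e ` {1..})" "norm (y - x) < r / 2"
    using r unfolding closure_approachable dist_norm by (meson half_gt_zero)
  have "\<exists>N. \<forall>m\<ge>N. galerkin_proj e m y = y"
    using y(1)
  proof (induction rule: span_induct_alt)
    case base
    show ?case by (simp add: galerkin_proj_eq_diag diag_zero)
  next
    case (step c v u)
    then obtain N i where N: "\<forall>m\<ge>N. galerkin_proj e m u = u" and i: "v = e i" "i \<ge> 1" by auto
    have "galerkin_proj e m (e i) = e i" if "m \<ge> i" for m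
    proof -
      have "galerkin_proj e m (e i) = (\<Sum>j\<in>{1..m}. if j = i then e i else 0)"
        unfolding galerkin_proj_def using i by (intro sum.cong refl) (auto simp: inner_basis)
      then show ?thesis using i that by simp
    qed
    then have "\<forall>m\<ge>max N i. galerkin_proj e m (c *\<^sub>R v + u) = c *\<^sub>R v + u"
      using N i by (simp add: galerkin_proj_eq_diag diag_add diag_scaleR)
    then show ?case by blast
  qed
  then obtain N where N: "\<And>m. m \<ge> N \<Longrightarrow> galerkin_proj e m y = y" by blast
  have "norm (galerkin_proj e m x - x) < r" if "m \<ge> N" for m
  proof -
    have "norm (galerkin_proj e m (x - y)) \<le> norm (x - y)"
      using norm_diag_le[of "{1..m}" "\<lambda>_. 1" 1 "x - y"] by (simp add: galerkin_proj_eq_diag)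
    moreover have "norm (galerkin_proj e m x - x) = norm (galerkin_proj e m (x - y) + (y - x))"
      using N[OF that] by (simp add: galerkin_proj_eq_diag diag_diff)
    moreover have "norm (galerkin_proj e m (x - y) + (y - x)) \<le> norm (galerkin_proj e m (x - y)) + norm (y - x)"
      by (rule norm_triangle_ineq)
    moreover have "norm (x - y) = norm (y - x)" by (rule norm_minus_commute)
    ultimately show ?thesis using y(2) by linarith
  qed
  then show "\<exists>N. \<forall>m\<ge>N. norm (galerkin_proj e m x - x) < r" by blast
qed

lemma bessel_summable: "(\<lambda>i. (inner (e i) x)\<^sup>2) summable_on {1..}"
  by (rule nonneg_bdd_above_summable_on)
     (auto intro!: bdd_aboveI2[where M = "(norm x)\<^sup>2"] bessel simp: subset_iff)

lemma parseval: "((\<lambda>i. (inner (e i) x)\<^sup>2) has_sum (norm x)\<^sup>2) {1..}"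
proof -
  let ?f = "\<lambda>i. (inner (e i) x)\<^sup>2"
  have "(\<lambda>N. sum ?f {1..N}) \<longlonglongrightarrow> infsum ?f {1..}"
  proof -
    have "filterlim (\<lambda>N. {1..N}) (finite_subsets_at_top {1::nat..}) sequentially"
      unfolding filterlim_finite_subsets_at_top
    proof (intro allI impI)
      fix Y :: "nat set" assume Y: "finite Y \<and> Y \<subseteq> {1..}"
      show "\<forall>\<^sub>F N in sequentially. finite {1..N} \<and> Y \<subseteq> {1..N} \<and> {1..N} \<subseteq> {1..}"
        using eventually_ge_at_top[of "Max (insert 0 Y)"]
        by eventually_elim (use Y in auto)
    qed
    then show ?thesis
      by (rule filterlim_compose[OF has_sum_infsum[OF bessel_summable[of x], unfolded has_sum_def]])
  qed
  moreover have "(\<lambda>N. sum ?f {1..N}) \<longlonglongrightarrow> (norm x)\<^sup>2"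
  proof -
    have "sum ?f {1..N} = (norm (galerkin_proj e N x))\<^sup>2" for N
      by (simp add: galerkin_proj_eq_diag norm_diag)
    then show ?thesis
      using tendsto_power[OF tendsto_norm[OF galerkin_proj_tendsto[of x]], of 2] by (simp only:)
  qed
  ultimately have eq: "infsum ?f {1..} = (norm x)\<^sup>2" by (rule LIMSEQ_unique)
  show ?thesis by (rule has_sum_infsum[OF bessel_summable[of x], unfolded eq])
qed

text \<open>The Riesz-Fischer theorem: by orthogonality the norm of a block of the series is
  controlled by the same block of the series of squares.\<close>

lemma summable_on_basis:
  assumes "(\<lambda>i. (a i)\<^sup>2) summable_on {1..}"
  shows "(\<lambda>i. a i *\<^sub>R e i) summable_on {1..}"
proof -
  let ?g = "\<lambda>i. (a i)\<^sup>2"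
  let ?s = "\<lambda>F. \<Sum>i\<in>F. a i *\<^sub>R e i"
  have gs: "(?g has_sum infsum ?g {1..}) {1..}" using assms by (rule has_sum_infsum)
  have tail: "\<exists>N. \<forall>F. finite F \<longrightarrow> F \<subseteq> {1..} \<longrightarrow> F \<inter> {1..N} = {} \<longrightarrow> norm (?s F) < r"
    if r: "r > 0" for r
  proof -
    have "\<forall>\<^sub>F F in finite_subsets_at_top {1..}. dist (sum ?g F) (infsum ?g {1..}) < r\<^sup>2 / 2"
      using gs r unfolding has_sum_def by (intro tendstoD) auto
    then obtain F0 where F0': "finite F0 \<and> F0 \<subseteq> {1..} \<and> (\<forall>F. finite F \<and> F0 \<subseteq> F \<and> F \<subseteq> {1..} \<longrightarrow>
        dist (sum ?g F) (infsum ?g {1..}) < r\<^sup>2 / 2)"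
      unfolding eventually_finite_subsets_at_top by (elim exE)
    then have F0: "finite F0" "F0 \<subseteq> {1..}"
      "\<And>F. finite F \<Longrightarrow> F0 \<subseteq> F \<Longrightarrow> F \<subseteq> {1..} \<Longrightarrow> dist (sum ?g F) (infsum ?g {1..}) < r\<^sup>2 / 2"
      by auto
    define N where "N = Max (insert 0 F0)"
    have sub: "F0 \<subseteq> {1..N}" using F0 unfolding N_def by auto
    have "norm (?s F) < r" if F: "finite F" "F \<subseteq> {1..}" "F \<inter> {1..N} = {}" for F
    proof -
      have "sum ?g (F \<union> {1..N}) = sum ?g F + sum ?g {1..N}"
        using F by (intro sum.union_disjoint) auto
      moreover have "dist (sum ?g (F \<union> {1..N})) (infsum ?g {1..}) < r\<^sup>2 / 2"
        using F sub by (intro F0(3)) auto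
      moreover have "dist (sum ?g {1..N}) (infsum ?g {1..}) < r\<^sup>2 / 2"
        using sub by (intro F0(3)) auto
      ultimately have "sum ?g F < r\<^sup>2" unfolding dist_real_def by linarith
      then have "(norm (?s F))\<^sup>2 < r\<^sup>2" using norm_basis_sum[OF F(1,2)] by simp
      then show ?thesis using r by (simp add: power2_less_imp_less)
    qed
    then show ?thesis by blast
  qed
  have "Cauchy (\<lambda>N. ?s {1..N})"
    unfolding Cauchy_altdef2
  proof (intro allI impI)
    fix r :: real assume "r > 0"
    then obtain N where N: "\<And>F. finite F \<Longrightarrow> F \<subseteq> {1..} \<Longrightarrow> F \<inter> {1..N} = {} \<Longrightarrow> norm (?s F) < r"
      using tail by blast
    have "dist (?s {1..n}) (?s {1..N}) < r" if "n \<ge> N" for n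
    proof -
      have "{1..n} = {1..N} \<union> {N<..n}" using that by auto
      then have "?s {1..n} = ?s {1..N} + ?s {N<..n}"
        by (simp only:) (rule sum.union_disjoint, auto)
      moreover have "norm (?s {N<..n}) < r" by (rule N) auto
      ultimately show ?thesis by (simp add: dist_norm)
    qed
    then show "\<exists>N. \<forall>n\<ge>N. dist (?s {1..n}) (?s {1..N}) < r" by blast
  qed
  then obtain x where x: "(\<lambda>N. ?s {1..N}) \<longlonglongrightarrow> x" using Cauchy_convergent_iff convergent_def by blast
  have "((\<lambda>i. a i *\<^sub>R e i) has_sum x) {1..}"
    unfolding has_sum_def tendsto_iff eventually_finite_subsets_at_top
  proof (intro allI impI)
    fix r :: real assume r: "r > 0"
    obtain N where N: "\<And>F. finite F \<Longrightarrow> F \<subseteq> {1..} \<Longrightarrow> F \<inter> {1..N} = {} \<Longrightarrow> norm (?s F) < r / 2"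
      using tail[of "r / 2"] r by auto
    obtain N' where N': "\<And>n. n \<ge> N' \<Longrightarrow> dist (?s {1..n}) x < r / 2"
      using x r unfolding lim_sequentially by (meson half_gt_zero)
    define m where "m = max N N'"
    have "dist (?s F) x < r" if F: "finite F" "{1..m} \<subseteq> F" "F \<subseteq> {1..}" for F
    proof -
      have "?s F = ?s {1..m} + ?s (F - {1..m})"
        using F by (metis add.commute sum.subset_diff)
      moreover have "norm (?s (F - {1..m})) < r / 2"
        using F by (intro N) (auto simp: m_def)
      moreover have "dist (?s {1..m}) x < r / 2" by (rule N') (simp add: m_def)
      ultimately show ?thesis
        using norm_triangle_ineq[of "?s {1..m} - x" "?s (F - {1..m})"]
        by (simp add: dist_norm algebra_simps)
    qed
    then show "\<exists>X. finite X \<and> X \<subseteq> {1..} \<and>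
        (\<forall>Y. finite Y \<and> X \<subseteq> Y \<and> Y \<subseteq> {1..} \<longrightarrow> dist (?s Y) x < r)"
      by (intro exI[of _ "{1..m}"]) auto
  qed
  then show ?thesis by (auto simp: summable_on_def)
qed

text \<open>For a nonpositive power the coefficients \<open>lam i powr \<gamma>\<close> are bounded, so the defining
  series converges and its coordinates can be read off term by term.\<close>

lemma inner_frac_pow:
  assumes lam: "\<And>i. i \<ge> 1 \<Longrightarrow> 0 < lam i" "\<And>i. i \<ge> 1 \<Longrightarrow> lam 1 \<le> lam i" and "\<gamma> \<le> 0" "i \<ge> 1"
  shows "inner (e i) (frac_pow e lam \<gamma> x) = lam i powr \<gamma> * inner (e i) x"
proof -
  let ?a = "\<lambda>i. lam i powr \<gamma> * inner (e i) x"
  have "(\<lambda>i. (lam 1 powr \<gamma>)\<^sup>2 * (inner (e i) x)\<^sup>2) summable_on {1..}"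
    by (intro summable_on_cmult_right bessel_summable)
  then have "(\<lambda>i. (?a i)\<^sup>2) summable_on {1..}"
  proof (rule summable_on_comparison_test)
    fix j :: nat assume "j \<in> {1..}"
    then have j: "j \<ge> 1" by simp
    have "lam j powr \<gamma> \<le> lam 1 powr \<gamma>"
      using lam(1)[of 1] lam(2)[OF j] \<open>\<gamma> \<le> 0\<close> by (intro powr_mono2') auto
    then show "(?a j)\<^sup>2 \<le> (lam 1 powr \<gamma>)\<^sup>2 * (inner (e j) x)\<^sup>2"
      by (auto simp: power_mult_distrib intro!: mult_right_mono power_mono)
  qed simp
  then have "((\<lambda>i. ?a i *\<^sub>R e i) has_sum frac_pow e lam \<gamma> x) {1..}"
    unfolding frac_pow_def by (intro has_sum_infsum summable_on_basis)
  then have "((\<lambda>j. inner (e i) (?a j *\<^sub>R e j)) has_sum inner (e i) (frac_pow e lam \<gamma> x)) {1..}"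
    by (rule has_sum_bounded_linear[OF bounded_linear_inner_right])
  moreover have "((\<lambda>j. inner (e i) (?a j *\<^sub>R e j)) has_sum ?a i) {1..}"
  proof -
    have "((\<lambda>j. inner (e i) (?a j *\<^sub>R e j)) has_sum (\<Sum>j\<in>{i}. inner (e i) (?a j *\<^sub>R e j))) {1..}"
      by (rule has_sum_finite_neutralI[where B = "{i}"]) (use assms(4) in \<open>auto simp: inner_basis\<close>)
    then show ?thesis using assms(4) by (simp add: inner_basis)
  qed
  ultimately show ?thesis by (rule has_sum_unique)
qed

lemma norm_diag_frac_pow_le:
  assumes lam: "\<And>i. i \<ge> 1 \<Longrightarrow> 0 < lam i" "\<And>i. i \<ge> 1 \<Longrightarrow> lam 1 \<le> lam i" and "\<gamma> \<le> 0"
    and I: "finite I" "I \<subseteq> {1..}"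
  shows "norm (diag e I (\<lambda>i. lam i powr \<gamma>) x) \<le> norm (frac_pow e lam \<gamma> x)"
proof -
  have "diag e I (\<lambda>i. lam i powr \<gamma>) x = diag e I (\<lambda>_. 1) (frac_pow e lam \<gamma> x)"
    unfolding diag_def using I inner_frac_pow[where lam = lam, OF lam \<open>\<gamma> \<le> 0\<close>, of _ x]
    by (intro sum.cong refl) auto
  then show ?thesis using norm_diag_le[OF I, of "\<lambda>_. 1" 1 "frac_pow e lam \<gamma> x"] by simp
qed

text \<open>The Hilbert-Schmidt condition may be witnessed by a basis \<open>b\<close> other than \<open>e\<close>. Parseval's
  identity in \<open>b\<close>, after moving the self-adjoint \<open>R\<close> to the other side, shows that the
  \<open>i\<close>-th coordinates contribute exactly \<open>q i * lam i powr (2 * \<gamma>)\<close>; Bessel's inequality in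
  \<open>e\<close> then bounds any finite sum of these contributions.\<close>

lemma noise_trace_bound:
  assumes lam: "\<And>i. i \<ge> 1 \<Longrightarrow> 0 < lam i" "\<And>i. i \<ge> 1 \<Longrightarrow> lam 1 \<le> lam i"
    and Q: "\<And>i. i \<ge> 1 \<Longrightarrow> Q (e i) = q i *\<^sub>R e i" and R: "is_positive_sqrt Q R" and "\<gamma> \<le> 0"
    and hs: "hilbert_schmidt (\<lambda>x. frac_pow e lam \<gamma> (R x))"
  shows "\<exists>C. \<forall>I. finite I \<longrightarrow> I \<subseteq> {1..} \<longrightarrow> (\<Sum>i\<in>I. q i * lam i powr (2 * \<gamma>)) \<le> C"
proof -
  let ?T = "\<lambda>x. frac_pow e lam \<gamma> (R x)"
  obtain b where b: "orthonormal_basis b" and bs: "(\<lambda>k. (norm (?T (b k)))\<^sup>2) summable_on {1..}"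
    using hs by (auto simp: hilbert_schmidt_def)
  interpret b: onb b by unfold_locales (rule b)
  have sym: "inner (R x) y = inner x (R y)" and RR: "R (R x) = Q x" for x y
    using R by (auto simp: is_positive_sqrt_def)
  have nR: "(norm (R (e i)))\<^sup>2 = q i" if "i \<ge> 1" for i
    using sym[of "e i" "R (e i)"] that
    by (simp add: power2_norm_eq_inner RR Q inner_basis)
  have "(\<Sum>i\<in>I. q i * lam i powr (2 * \<gamma>)) \<le> infsum (\<lambda>k. (norm (?T (b k)))\<^sup>2) {1..}"
    if I: "finite I" "I \<subseteq> {1..}" for I
  proof -
    have "((\<lambda>k. (inner (e i) (?T (b k)))\<^sup>2) has_sum (q i * lam i powr (2 * \<gamma>))) {1..}" if "i \<in> I" for i
    proof -
      have i: "i \<ge> 1" using that I by auto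
      have "(inner (e i) (?T (b k)))\<^sup>2 = lam i powr (2 * \<gamma>) * (inner (b k) (R (e i)))\<^sup>2" for k
        using inner_frac_pow[where lam = lam, OF lam \<open>\<gamma> \<le> 0\<close> i, of "R (b k)"] sym[of "e i" "b k"]
        by (simp add: power_mult_distrib inner_commute power2_eq_square[of "lam i powr \<gamma>"]
            powr_add[symmetric])
      then show ?thesis
        using has_sum_cmult_right[OF b.parseval[of "R (e i)"], of "lam i powr (2 * \<gamma>)"] nR[OF i]
        by (simp add: mult.commute)
    qed
    with I(1) have "((\<lambda>k. \<Sum>i\<in>I. (inner (e i) (?T (b k)))\<^sup>2) has_sum (\<Sum>i\<in>I. q i * lam i powr (2 * \<gamma>))) {1..}"
    proof (induction I rule: finite_induct)
      case (insert j J)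
      show ?case
        unfolding sum.insert[OF insert.hyps(1,2)] by (intro has_sum_add insert.IH insert.prems) auto
    qed simp
    then show ?thesis
      by (rule has_sum_mono[OF _ has_sum_infsum[OF bs]]) (use bessel[OF I] in auto)
  qed
  then show ?thesis by blast
qed

text \<open>A regular initial value has small high modes: a weight of order \<open>2 * \<beta>\<close> in the eigenvalues
  is traded for smallness.\<close>

lemma initial_value_tail:
  assumes lam: "\<And>i. i \<ge> 1 \<Longrightarrow> 0 < lam i" "\<And>i. i \<ge> 1 \<Longrightarrow> lam 1 \<le> lam i"
    and x: "x \<in> Hdot e lam \<mu>" and \<mu>: "0 \<le> 2 * \<beta>" "2 * \<beta> \<le> \<mu>"
  shows "\<exists>C\<ge>0. \<forall>I n. finite I \<longrightarrow> I \<subseteq> {1..} \<longrightarrow> n \<ge> 1 \<longrightarrow> (\<forall>i\<in>I. lam n \<le> lam i) \<longrightarrow>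
     (\<Sum>i\<in>I. (inner (e i) x)\<^sup>2) \<le> C * lam n powr (- 2 * \<beta>)"
proof -
  let ?f = "\<lambda>i. (lam i powr (\<mu> / 2) * inner (e i) x)\<^sup>2"
  let ?S = "infsum ?f {1..}"
  have fs: "?f summable_on {1..}" using x by (simp add: Hdot_def frac_dom_def)
  have S0: "?S \<ge> 0" by (rule infsum_nonneg) simp
  have "(\<Sum>i\<in>I. (inner (e i) x)\<^sup>2) \<le> (lam 1 powr (2 * \<beta> - \<mu>) * ?S) * lam n powr (- 2 * \<beta>)"
    if I: "finite I" "I \<subseteq> {1..}" and n: "n \<ge> 1" and le: "\<forall>i\<in>I. lam n \<le> lam i" for I n
  proof -
    have "(inner (e i) x)\<^sup>2 \<le> (lam 1 powr (2 * \<beta> - \<mu>) * lam n powr (- 2 * \<beta>)) * ?f i" if i: "i \<in> I" for i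
    proof -
      have i1: "i \<ge> 1" using i I by auto
      have "lam i powr (-\<mu>) = lam i powr (2 * \<beta> - \<mu>) * lam i powr (- 2 * \<beta>)"
        by (simp add: powr_add[symmetric])
      also have "\<dots> \<le> lam 1 powr (2 * \<beta> - \<mu>) * lam n powr (- 2 * \<beta>)"
        using lam(1)[of 1] lam(1)[OF n] lam(2)[OF i1] le i \<mu>
        by (intro mult_mono powr_mono2') auto
      finally have "lam i powr (-\<mu>) * ?f i \<le> (lam 1 powr (2 * \<beta> - \<mu>) * lam n powr (- 2 * \<beta>)) * ?f i"
        by (rule mult_right_mono) simp
      moreover have "lam i powr (-\<mu>) * ?f i = (inner (e i) x)\<^sup>2"
        using lam(1)[OF i1] by (simp add: power_mult_distrib powr_power powr_minus mult.commute)
      ultimately show ?thesis by simp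
    qed
    then have "(\<Sum>i\<in>I. (inner (e i) x)\<^sup>2) \<le> (lam 1 powr (2 * \<beta> - \<mu>) * lam n powr (- 2 * \<beta>)) * sum ?f I"
      by (simp add: sum_distrib_left sum_mono)
    also have "\<dots> \<le> (lam 1 powr (2 * \<beta> - \<mu>) * lam n powr (- 2 * \<beta>)) * ?S"
      using finite_sum_le_infsum[OF fs I] by (intro mult_left_mono) auto
    finally show ?thesis by (simp add: mult_ac)
  qed
  then show ?thesis using S0 by (intro exI[of _ "lam 1 powr (2 * \<beta> - \<mu>) * ?S"]) auto
qed

end

section \<open>The semigroup on eigenvectors\<close>

text \<open>The Banach-Steinhaus theorem. By Baire, one of the closed sets \<open>S k\<close> on which all \<open>T n\<close>
  are bounded by \<open>k\<close> contains a ball; differences of points of the ball point in every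
  direction.\<close>

lemma uniform_boundedness_sequence:
  fixes T :: "nat \<Rightarrow> 'a::banach \<Rightarrow> 'b::real_normed_vector"
  assumes lin: "\<And>n. bounded_linear (T n)" and pw: "\<And>x. bounded (range (\<lambda>n. T n x))"
  shows "\<exists>K. \<forall>n x. norm (T n x) \<le> K * norm x"
proof -
  define S where "S k = {x. \<forall>n. norm (T n x) \<le> real k}" for k :: nat
  have cl: "closed (S k)" for k
  proof -
    have "S k = (\<Inter>n. {x. norm (T n x) \<le> real k})" by (auto simp: S_def)
    moreover have "closed {x. norm (T n x) \<le> real k}" for n
      by (intro closed_Collect_le continuous_on_norm linear_continuous_on lin continuous_on_const)
    ultimately show ?thesis by auto
  qed
  have cover: "(\<Union>k. S k) = UNIV"
  proof -
    have "\<exists>k. x \<in> S k" for x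
    proof -
      obtain b where b: "\<And>n. norm (T n x) \<le> b"
        using pw[of x] by (auto simp: bounded_iff)
      obtain k :: nat where "b \<le> real k" using real_arch_simple by blast
      then have "norm (T n x) \<le> real k" for n using b[of n] by linarith
      then show ?thesis by (auto simp: S_def)
    qed
    then show ?thesis by auto
  qed
  have "\<exists>k. interior (S k) \<noteq> {}"
  proof (rule ccontr)
    assume "\<not> ?thesis"
    then have "(euclidean :: 'a topology) interior_of \<Union>(range S) = {}"
      by (intro Baire_category_alt disjI1 completely_metrizable_space_euclidean)
         (auto simp: cl)
    then show False using cover by simp
  qed
  then obtain k x r where r: "r > 0" "ball x r \<subseteq> S k"
    unfolding mem_interior[symmetric] ex_in_conv[symmetric] by (auto simp: mem_interior)
  have "norm (T n y) \<le> (4 * real k / r) * norm y" for n y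
  proof (cases "y = 0")
    case True
    then show ?thesis using bounded_linear.linear[OF lin[of n]] by (simp add: linear_0)
  next
    case False
    define a where "a = r / (2 * norm y)"
    have a: "a > 0" using r False by (simp add: a_def)
    have "x \<in> S k" "x + a *\<^sub>R y \<in> S k"
      using r False by (auto intro!: subsetD[OF r(2)] simp: dist_norm a_def)
    then have "norm (T n x) \<le> real k" "norm (T n (x + a *\<^sub>R y)) \<le> real k" by (auto simp: S_def)
    moreover have "T n (x + a *\<^sub>R y) = T n x + a *\<^sub>R T n y"
      using bounded_linear.linear[OF lin[of n]] by (simp add: linear_add linear_scale)
    ultimately have "norm (a *\<^sub>R T n y) \<le> 2 * real k"
      using norm_triangle_ineq4[of "T n x + a *\<^sub>R T n y" "T n x"] by simp
    then have "norm (T n y) \<le> 2 * real k / a" using a by (simp add: field_simps)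
    then show ?thesis by (simp add: a_def)
  qed
  then show ?thesis by blast
qed

text \<open>Otherwise there are times \<open>t m\<close> tending to 0 with norms of \<open>E (t m)\<close> tending to infinity,
  although \<open>E (t m) x\<close> converges for every \<open>x\<close>.\<close>

lemma semigroup_locally_bounded:
  fixes E :: "real \<Rightarrow> 'a::banach \<Rightarrow> 'a"
  assumes "strongly_continuous_semigroup E"
  shows "\<exists>K \<tau>. \<tau> > 0 \<and> (\<forall>t x. 0 \<le> t \<longrightarrow> t \<le> \<tau> \<longrightarrow> norm (E t x) \<le> K * norm x)"
proof (rule ccontr)
  assume neg: "\<not> ?thesis"
  have "\<exists>t. 0 \<le> t \<and> t \<le> 1 / (real m + 1) \<and> (\<exists>x. norm (E t x) > real m * norm x)" for m
  proof -
    have "\<not> (\<forall>t x. 0 \<le> t \<longrightarrow> t \<le> 1 / (real m + 1) \<longrightarrow> norm (E t x) \<le> real m * norm x)"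
    proof
      assume "\<forall>t x. 0 \<le> t \<longrightarrow> t \<le> 1 / (real m + 1) \<longrightarrow> norm (E t x) \<le> real m * norm x"
      moreover have "1 / (real m + 1) > 0" by simp
      ultimately show False using neg by blast
    qed
    then show ?thesis by (auto simp: not_le)
  qed
  then obtain t where t: "\<And>m. 0 \<le> t m" "\<And>m. t m \<le> 1 / (real m + 1)"
    "\<And>m. \<exists>x. norm (E (t m) x) > real m * norm x"
    by metis
  have "t \<longlonglongrightarrow> 0"
  proof (rule real_tendsto_sandwich[of "\<lambda>_. 0" _ _ "\<lambda>m. 1 / (real m + 1)"])
    show "(\<lambda>m. 1 / (real m + 1)) \<longlonglongrightarrow> 0"
      using LIMSEQ_inverse_real_of_nat by (simp add: inverse_eq_divide add.commute)
  qed (use t in auto)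
  have "(\<lambda>m. E (t m) x) \<longlonglongrightarrow> x" for x
  proof -
    have E: "((\<lambda>s. E s x) \<longlongrightarrow> x) (at_right 0)" and E0: "E 0 x = x"
      using assms by (auto simp: strongly_continuous_semigroup_def)
    have "((\<lambda>s. E s x) \<longlongrightarrow> E 0 x) (at 0 within {0..})"
      using E E0 unfolding at_within_Ici_at_right by simp
    then have "continuous (at 0 within {0..}) (\<lambda>s. E s x)" by (simp add: continuous_within)
    then have "(\<lambda>m. E (t m) x) \<longlonglongrightarrow> E 0 x"
      using \<open>t \<longlonglongrightarrow> 0\<close> t(1) unfolding continuous_within_sequentially comp_def by auto
    then show ?thesis using E0 by simp
  qed
  then have "bounded (range (\<lambda>m. E (t m) x))" for x
    using convergent_imp_bounded by blast
  moreover have "bounded_linear (E (t m))" for m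
    using assms t(1) by (auto simp: strongly_continuous_semigroup_def)
  ultimately obtain K where K: "\<And>m x. norm (E (t m) x) \<le> K * norm x"
    using uniform_boundedness_sequence[of "\<lambda>m. E (t m)"] by auto
  obtain m :: nat where m: "K \<le> real m" using real_arch_simple by blast
  obtain x where "norm (E (t m) x) > real m * norm x" using t(3) by blast
  moreover have "norm (E (t m) x) \<le> real m * norm x"
    using K[of m x] m mult_right_mono[OF m norm_ge_zero[of x]] by linarith
  ultimately show False by simp
qed

text \<open>The generator yields only \<open>E h v = exp (- l h) v + o(h)\<close>. A time \<open>s\<close> is split into \<open>k\<close>
  steps of length \<open>s / k\<close>; because the semigroup is bounded near 0, the \<open>k\<close> errors of size
  \<open>o(s / k)\<close> add up to something that vanishes as \<open>k\<close> grows. The semigroup law carries the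
  identity from short times to all times.\<close>

lemma semigroup_eigenvector:
  fixes E :: "real \<Rightarrow> 'a::banach \<Rightarrow> 'a"
  assumes gen: "generates_semigroup D A E" and v: "v \<in> D" "A v = - (l *\<^sub>R v)" and "l \<ge> 0" "t \<ge> 0"
  shows "E t v = exp (- (l * t)) *\<^sub>R v"
proof -
  have sg: "strongly_continuous_semigroup E" using gen by (simp add: generates_semigroup_def)
  then have lin: "\<And>t. t \<ge> 0 \<Longrightarrow> bounded_linear (E t)" and E0: "\<And>x. E 0 x = x"
    and add: "\<And>s t x. s \<ge> 0 \<Longrightarrow> t \<ge> 0 \<Longrightarrow> E (s + t) x = E s (E t x)"
    by (auto simp: strongly_continuous_semigroup_def)
  define \<delta> where "\<delta> h = E h v - exp (- (l * h)) *\<^sub>R v" for h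
  have d: "((\<lambda>h. norm (\<delta> h) / h) \<longlongrightarrow> 0) (at_right 0)"
  proof -
    have 1: "((\<lambda>h. (E h v - v) /\<^sub>R h) \<longlongrightarrow> - (l *\<^sub>R v)) (at_right 0)"
      using gen v by (auto simp: generates_semigroup_def)
    have "((\<lambda>h. exp (- (l * h))) has_field_derivative - l) (at 0)"
      by (auto intro!: derivative_eq_intros)
    then have "((\<lambda>h. (exp (- (l * h)) - 1) / h) \<longlongrightarrow> - l) (at 0)"
      by (simp add: DERIV_def)
    then have "((\<lambda>h. ((exp (- (l * h)) - 1) / h) *\<^sub>R v) \<longlongrightarrow> (- l) *\<^sub>R v) (at 0)"
      by (rule tendsto_scaleR) simp
    then have "((\<lambda>h. (exp (- (l * h)) *\<^sub>R v - v) /\<^sub>R h) \<longlongrightarrow> - (l *\<^sub>R v)) (at 0)"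
      by (simp add: algebra_simps divide_inverse)
    then have 2: "((\<lambda>h. (exp (- (l * h)) *\<^sub>R v - v) /\<^sub>R h) \<longlongrightarrow> - (l *\<^sub>R v)) (at_right 0)"
      by (rule tendsto_mono[rotated]) (simp add: at_le)
    have "((\<lambda>h. norm ((E h v - v) /\<^sub>R h - (exp (- (l * h)) *\<^sub>R v - v) /\<^sub>R h)) \<longlongrightarrow> 0) (at_right 0)"
      using tendsto_norm[OF tendsto_diff[OF 1 2]] by simp
    moreover have "\<forall>\<^sub>F h in at_right 0. norm ((E h v - v) /\<^sub>R h - (exp (- (l * h)) *\<^sub>R v - v) /\<^sub>R h) = norm (\<delta> h) / h"
      using eventually_at_right_less[of "0::real"]
      by eventually_elim (simp add: \<delta>_def scaleR_diff_right[symmetric] divide_inverse mult.commute)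
    ultimately show ?thesis by (rule Lim_transform_eventually)
  qed
  obtain K \<tau> where \<tau>: "\<tau> > 0" and K: "\<And>t x. 0 \<le> t \<Longrightarrow> t \<le> \<tau> \<Longrightarrow> norm (E t x) \<le> K * norm x"
    using semigroup_locally_bounded[OF sg] by blast
  have short: "E s v = exp (- (l * s)) *\<^sub>R v" if s: "0 \<le> s" "s \<le> \<tau>" for s
  proof (cases "s = 0")
    case False
    then have s0: "s > 0" using s by simp
    define B where "B = max K 0"
    \<comment> \<open>\<open>\<delta> h\<close> is the defect of one step; the factors \<open>exp (- (l * h))\<close> do not amplify earlier
      defects.\<close>
    have step: "norm (E (real k * h) v - exp (- (l * (real k * h))) *\<^sub>R v) \<le> real k * (B * norm (\<delta> h))"
      if h: "h \<ge> 0" "real k * h \<le> \<tau>" for k h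
      using h(2)
    proof (induction k)
      case 0
      then show ?case by (simp add: E0)
    next
      case (Suc k)
      have k0: "0 \<le> real k * h" using h(1) by simp
      have "h + real k * h \<le> \<tau>" using Suc.prems by (simp add: distrib_right)
      then have kh: "real k * h \<le> \<tau>" "h \<le> \<tau>" "0 \<le> real k * h"
        using k0 h(1) by linarith+
      have lE: "linear (E (real k * h))" using bounded_linear.linear[OF lin[OF kh(3)]] .
      have "E (real (Suc k) * h) v = E (real k * h) (E h v)"
        using add[OF kh(3) h(1)] by (simp add: algebra_simps)
      also have "\<dots> = E (real k * h) (\<delta> h) + exp (- (l * h)) *\<^sub>R E (real k * h) v"
        using lE by (simp add: \<delta>_def linear_diff linear_scale)
      finally have veq: "E (real (Suc k) * h) v - exp (- (l * (real (Suc k) * h))) *\<^sub>R v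
          = E (real k * h) (\<delta> h) + exp (- (l * h)) *\<^sub>R (E (real k * h) v - exp (- (l * (real k * h))) *\<^sub>R v)"
        by (simp add: algebra_simps exp_add[symmetric])
      have "norm (E (real k * h) (\<delta> h)) \<le> max K 0 * norm (\<delta> h)"
        using K[OF kh(3,1), of "\<delta> h"] mult_right_mono[of K "max K 0" "norm (\<delta> h)"] by simp
      moreover have "exp (- (l * h)) * norm (E (real k * h) v - exp (- (l * (real k * h))) *\<^sub>R v)
          \<le> 1 * (real k * (B * norm (\<delta> h)))"
        using Suc.IH[OF kh(1)] \<open>l \<ge> 0\<close> h(1) by (intro mult_mono) auto
      moreover have "norm (E (real k * h) (\<delta> h) + exp (- (l * h)) *\<^sub>R (E (real k * h) v - exp (- (l * (real k * h))) *\<^sub>R v))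
          \<le> norm (E (real k * h) (\<delta> h)) + exp (- (l * h)) * norm (E (real k * h) v - exp (- (l * (real k * h))) *\<^sub>R v)"
        by (rule order_trans[OF norm_triangle_ineq]) simp
      moreover have "real (Suc k) * (B * norm (\<delta> h)) = B * norm (\<delta> h) + real k * (B * norm (\<delta> h))"
        by (simp add: algebra_simps)
      ultimately show ?case unfolding veq B_def by linarith
    qed
    have le: "norm (E s v - exp (- (l * s)) *\<^sub>R v) \<le> (B * s) * (norm (\<delta> (s / real (Suc k))) / (s / real (Suc k)))" for k
    proof -
      have eq: "real (Suc k) * (s / real (Suc k)) = s" by simp
      have "norm (E s v - exp (- (l * s)) *\<^sub>R v) \<le> real (Suc k) * (B * norm (\<delta> (s / real (Suc k))))"
        using step[of "s / real (Suc k)" "Suc k", unfolded eq] s0 s(2) by simp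
      also have "\<dots> = (B * s) * (norm (\<delta> (s / real (Suc k))) / (s / real (Suc k)))"
        using s0 by simp
      finally show ?thesis .
    qed
    have "filterlim (\<lambda>k. s / real (Suc k)) (at_right 0) sequentially"
    proof (rule tendsto_imp_filterlim_at_right)
      show "(\<lambda>k. s / real (Suc k)) \<longlonglongrightarrow> 0"
        using tendsto_mult_right[OF LIMSEQ_inverse_real_of_nat, of s] by (simp add: divide_inverse mult.commute)
    qed (use s0 in auto)
    then have "(\<lambda>k. (B * s) * (norm (\<delta> (s / real (Suc k))) / (s / real (Suc k)))) \<longlonglongrightarrow> (B * s) * 0"
      by (intro tendsto_mult tendsto_const filterlim_compose[OF d])
    then have "norm (E s v - exp (- (l * s)) *\<^sub>R v) \<le> (B * s) * 0"
      by (rule LIMSEQ_le_const) (use le in blast)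
    then show ?thesis by simp
  qed (simp add: E0)
  obtain k :: nat where k: "t / \<tau> \<le> real k" using real_arch_simple by blast
  define s where "s = t / real (Suc k)"
  have s: "0 \<le> s" "s \<le> \<tau>" "t = real (Suc k) * s"
    using k \<tau> \<open>t \<ge> 0\<close> by (auto simp: s_def field_simps)
  have "E (real j * s) v = exp (- (l * (real j * s))) *\<^sub>R v" for j
  proof (induction j)
    case (Suc j)
    have js: "0 \<le> real j * s" using s by simp
    have js': "real (Suc j) * s = s + real j * s" by (simp add: algebra_simps)
    have "E (real (Suc j) * s) v = E s (exp (- (l * (real j * s))) *\<^sub>R v)"
      unfolding js' add[OF s(1) js] by (simp only: Suc.IH)
    also have "\<dots> = exp (- (l * (real j * s))) *\<^sub>R (exp (- (l * s)) *\<^sub>R v)"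
      using bounded_linear.linear[OF lin[OF s(1)]] short[OF s(1,2)] by (simp add: linear_scale)
    also have "\<dots> = exp (- (l * (real (Suc j) * s))) *\<^sub>R v"
      unfolding js' by (simp add: exp_add[symmetric] algebra_simps)
    finally show ?case .
  qed (simp add: E0)
  then show ?thesis using s(3) by metis
qed

text \<open>Both sides are continuous in \<open>x\<close> and agree on the span of the basis.\<close>

lemma (in onb) inner_semigroup:
  assumes gen: "generates_semigroup D A E" and eig: "\<And>i. i \<ge> 1 \<Longrightarrow> e i \<in> D \<and> - A (e i) = lam i *\<^sub>R e i"
    and lam: "\<And>i. i \<ge> 1 \<Longrightarrow> 0 < lam i" and "t \<ge> 0" "i \<ge> 1"
  shows "inner (e i) (E t x) = exp (- (lam i * t)) * inner (e i) x"
proof -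
  have lin: "bounded_linear (E t)"
    using gen \<open>t \<ge> 0\<close> by (auto simp: generates_semigroup_def strongly_continuous_semigroup_def)
  have Ej: "E t (e j) = exp (- (lam j * t)) *\<^sub>R e j" if "j \<ge> 1" for j
  proof (rule semigroup_eigenvector[OF gen])
    have "- (- A (e j)) = - (lam j *\<^sub>R e j)" using eig[OF that] by simp
    then show "A (e j) = - (lam j *\<^sub>R e j)" by simp
  qed (use eig[OF that] lam[OF that] \<open>t \<ge> 0\<close> in auto)
  have "inner (e i) (E t (galerkin_proj e N x)) = exp (- (lam i * t)) * inner (e i) (galerkin_proj e N x)" for N
  proof -
    have "E t (galerkin_proj e N x) = (\<Sum>j=1..N. (inner (e j) x * exp (- (lam j * t))) *\<^sub>R e j)"
      unfolding galerkin_proj_def using bounded_linear.linear[OF lin] Ej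
      by (simp add: linear_sum linear_scale)
    then show ?thesis
      using \<open>i \<ge> 1\<close> by (simp add: galerkin_proj_def inner_basis_sum)
  qed
  moreover have "(\<lambda>N. inner (e i) (E t (galerkin_proj e N x))) \<longlonglongrightarrow> inner (e i) (E t x)"
    by (intro tendsto_inner tendsto_const bounded_linear.tendsto[OF lin] galerkin_proj_tendsto)
  moreover have "(\<lambda>N. exp (- (lam i * t)) * inner (e i) (galerkin_proj e N x)) \<longlonglongrightarrow> exp (- (lam i * t)) * inner (e i) x"
    by (intro tendsto_mult tendsto_inner tendsto_const galerkin_proj_tendsto)
  ultimately show ?thesis using LIMSEQ_unique by (simp only:)
qed

section \<open>Smoothing and recursions in discrete time\<close>

text \<open>Concavity of \<open>x powr p\<close>: its graph lies below the tangent at \<open>b\<close>.\<close>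

lemma powr_diff_ge_tangent:
  fixes a b p :: real
  assumes "0 \<le> a" "a < b" "0 < p" "p \<le> 1"
  shows "p * b powr (p - 1) * (b - a) \<le> b powr p - a powr p"
proof (cases "a = 0")
  case True
  have "p * b powr (p - 1) * b = p * b powr p"
    using assms by (simp add: powr_mult_base mult.commute)
  also have "\<dots> \<le> 1 * b powr p" using assms by (intro mult_right_mono) auto
  finally show ?thesis using True assms by simp
next
  case False
  have "(a / b) powr p * 1 powr (1 - p) \<le> p * (a / b) + (1 - p) * 1"
    using assms False by (intro Youngs_inequality_0) auto
  then have "a powr p / b powr p \<le> 1 - p * (1 - a / b)"
    using assms by (simp add: powr_divide algebra_simps)
  then have "a powr p \<le> (1 - p * (1 - a / b)) * b powr p"
    using assms by (simp add: divide_le_eq)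
  moreover have "p * b powr (p - 1) * (b - a) = p * (1 - a / b) * b powr p"
    using assms by (simp add: powr_diff field_simps)
  ultimately show ?thesis by (simp add: algebra_simps)
qed

text \<open>An increasing function with values in \<open>[0, 1]\<close> whose derivative dominates a multiple of
  \<open>l powr \<eta> * exp (- (l * t))\<close>, uniformly in all \<open>l\<close> above a positive number. Sums of the
  smoothing kernel over a time grid are thereby compared with telescoping sums, and stay
  bounded for all step sizes and all times.\<close>

definition smoothing_profile :: "real \<Rightarrow> real \<Rightarrow> real" where
  "smoothing_profile \<eta> t = t powr (1 - \<eta>) / (1 + t powr (1 - \<eta>))"

lemma smoothing_profile_bounds: "0 \<le> smoothing_profile \<eta> t" "smoothing_profile \<eta> t \<le> 1"
proof -
  have "0 \<le> t powr (1 - \<eta>)" by simp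
  then have "0 < 1 + t powr (1 - \<eta>)" by linarith
  then show "0 \<le> smoothing_profile \<eta> t" "smoothing_profile \<eta> t \<le> 1"
    by (simp_all add: smoothing_profile_def)
qed

lemma powr_exp_bounds:
  fixes x \<eta> :: real
  assumes "0 < x" "0 \<le> \<eta>" "\<eta> < 1"
  shows "x powr \<eta> * exp (- x) \<le> 1" "x powr (2 - \<eta>) * exp (- x) \<le> 2"
proof -
  have e: "1 + x + x\<^sup>2 / 2 \<le> exp x" using exp_lower_Taylor_quadratic[of x] assms by simp
  have "x powr \<eta> \<le> 1 + x"
  proof (cases "x \<le> 1")
    case True then show ?thesis using powr_le1[of \<eta> x] assms by simp
  next
    case False then show ?thesis using powr_mono[of \<eta> 1 x] assms by simp
  qed
  then have "x powr \<eta> \<le> exp x" using e zero_le_power2[of x] by linarith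
  then show "x powr \<eta> * exp (- x) \<le> 1" by (simp add: exp_minus field_simps)
  have "x powr (2 - \<eta>) \<le> 1 + x\<^sup>2"
  proof (cases "x \<le> 1")
    case True then show ?thesis using powr_le1[of "2 - \<eta>" x] assms by (smt (verit) zero_le_power2)
  next
    case False
    then have "x powr (2 - \<eta>) \<le> x powr 2" using assms by (intro powr_mono) auto
    then show ?thesis using assms by simp
  qed
  then have "x powr (2 - \<eta>) \<le> 2 * exp x" using e assms(1) by linarith
  then show "x powr (2 - \<eta>) * exp (- x) \<le> 2" by (simp add: exp_minus field_simps)
qed

text \<open>Near 0 the supremum over \<open>l\<close> of the kernel behaves like \<open>t powr (- \<eta>)\<close>, just as the
  derivative of the profile; for large \<open>t\<close> that derivative decays only like
  \<open>t powr (\<eta> - 2)\<close>, slower than the exponential.\<close>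

lemma smoothing_increment:
  fixes l l1 h \<eta> :: real
  assumes l: "0 < l1" "l1 \<le> l" and h: "h > 0" and \<eta>: "0 \<le> \<eta>" "\<eta> < 1"
  shows "h * (l powr \<eta> * exp (- (l * (real (Suc m) * h)))) \<le>
    (2 + 4 * l1 powr (- 2 * (1 - \<eta>))) / (1 - \<eta>) *
      (smoothing_profile \<eta> (real (Suc m) * h) - smoothing_profile \<eta> (real m * h))"
proof -
  define p where "p = 1 - \<eta>"
  define t where "t = real (Suc m) * h"
  define a where "a = real m * h"
  have p: "0 < p" "p \<le> 1" using \<eta> by (auto simp: p_def)
  have t: "0 < t" "0 \<le> a" "a < t" "t - a = h" using h by (auto simp: t_def a_def algebra_simps intro: add_pos_nonneg)
  have l0: "0 < l" using l by simp
  define C where "C = (2 + 4 * l1 powr (- 2 * p)) / p"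
  have C0: "C \<ge> 0" using p by (simp add: C_def add_nonneg_nonneg)
  \<comment> \<open>Boundedness of \<open>x powr \<eta> * exp (- x)\<close> at \<open>x = l * t\<close> handles the constant part of
    \<open>(1 + t powr p)\<^sup>2\<close>, that of \<open>x powr (2 - \<eta>) * exp (- x)\<close> the growing part.\<close>
  have key: "l powr \<eta> * exp (- (l * t)) * (1 + t powr p)\<^sup>2 \<le> C * p * t powr (p - 1)"
  proof -
    have x: "0 < l * t" using l0 t by simp
    have "(1 + t powr p)\<^sup>2 \<le> 2 + 2 * (t powr p)\<^sup>2"
      using zero_le_power2[of "1 - t powr p"] by (simp add: power2_eq_square algebra_simps)
    then have "(l * t) powr \<eta> * exp (- (l * t)) * (1 + t powr p)\<^sup>2
      \<le> (l * t) powr \<eta> * exp (- (l * t)) * (2 + 2 * (t powr p)\<^sup>2)"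
      by (intro mult_left_mono) auto
    also have "\<dots> = 2 * ((l * t) powr \<eta> * exp (- (l * t)))
        + 2 * l powr (- 2 * p) * ((l * t) powr (2 - \<eta>) * exp (- (l * t)))"
    proof -
      have "(l * t) powr \<eta> * (t powr p)\<^sup>2 = l powr (- 2 * p) * (l * t) powr (2 - \<eta>)"
        using l0 t p by (simp add: powr_mult power2_eq_square powr_add[symmetric] p_def
            mult.assoc mult.left_commute)
      then show ?thesis by (simp add: algebra_simps)
    qed
    also have "\<dots> \<le> 2 * 1 + 2 * l1 powr (- 2 * p) * 2"
      using powr_exp_bounds[OF x \<eta>] l p by (intro add_mono mult_mono powr_mono2') auto
    also have "\<dots> = C * p" using p by (simp add: C_def)
    finally have "(l powr \<eta> * t powr \<eta>) * exp (- (l * t)) * (1 + t powr p)\<^sup>2 \<le> C * p"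
      using l0 t by (simp add: powr_mult)
    then have "l powr \<eta> * exp (- (l * t)) * (1 + t powr p)\<^sup>2 * (t powr \<eta> * t powr (- \<eta>)) \<le> C * p * t powr (- \<eta>)"
      using mult_right_mono[of "(l powr \<eta> * t powr \<eta>) * exp (- (l * t)) * (1 + t powr p)\<^sup>2" "C * p" "t powr (- \<eta>)"]
      by (simp add: mult_ac)
    moreover have "t powr \<eta> * t powr (- \<eta>) = 1" using t by (simp add: powr_add[symmetric])
    ultimately show ?thesis by (simp add: p_def)
  qed
  have pos: "0 < 1 + t powr p" "0 < 1 + a powr p" by (simp_all add: add_pos_nonneg)
  have "h * (p * t powr (p - 1)) \<le> t powr p - a powr p"
    using powr_diff_ge_tangent[OF t(2,3) p] t(4) by (simp add: mult_ac)
  then have "h * (p * t powr (p - 1)) / (1 + t powr p)\<^sup>2 \<le> (t powr p - a powr p) / (1 + t powr p)\<^sup>2"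
    by (intro divide_right_mono) auto
  also have "\<dots> \<le> (t powr p - a powr p) / ((1 + a powr p) * (1 + t powr p))"
    using t p pos unfolding power2_eq_square
    by (intro divide_left_mono mult_right_mono) (auto intro!: powr_mono2 add_left_mono)
  also have "\<dots> = smoothing_profile \<eta> t - smoothing_profile \<eta> a"
    using pos unfolding smoothing_profile_def p_def[symmetric] by (simp add: field_simps)
  finally have inc: "h * (p * t powr (p - 1)) / (1 + t powr p)\<^sup>2 \<le> smoothing_profile \<eta> t - smoothing_profile \<eta> a" .
  have "l powr \<eta> * exp (- (l * t)) \<le> C * (p * t powr (p - 1)) / (1 + t powr p)\<^sup>2"
    using key pos by (simp add: le_divide_eq mult.assoc)
  then have "h * (l powr \<eta> * exp (- (l * t))) \<le> h * (C * (p * t powr (p - 1)) / (1 + t powr p)\<^sup>2)"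
    using h by (intro mult_left_mono) auto
  also have "\<dots> = C * (h * (p * t powr (p - 1)) / (1 + t powr p)\<^sup>2)" by simp
  also have "\<dots> \<le> C * (smoothing_profile \<eta> t - smoothing_profile \<eta> a)"
    using inc C0 by (rule mult_left_mono)
  finally show ?thesis unfolding C_def p_def t_def a_def .
qed

context prob_space
begin

text \<open>Integrability is part of the bound, so that both propagate by the same rules.\<close>

definition mean_le :: "('a \<Rightarrow> real) \<Rightarrow> real \<Rightarrow> bool" where
  "mean_le f C \<longleftrightarrow> integrable M f \<and> expectation f \<le> C"

lemma mean_leD: "mean_le f C \<Longrightarrow> integrable M f" "mean_le f C \<Longrightarrow> expectation f \<le> C"
  "mean_le f C \<Longrightarrow> f \<in> borel_measurable M"
  by (auto simp: mean_le_def)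

lemma mean_le_const: "c \<le> C \<Longrightarrow> mean_le (\<lambda>_. c) C"
  by (simp add: mean_le_def prob_space)

lemma mean_le_dominated:
  assumes "mean_le g A" "f \<in> borel_measurable M" "\<And>\<omega>. 0 \<le> f \<omega>" "\<And>\<omega>. f \<omega> \<le> g \<omega>" "A \<le> C"
  shows "mean_le f C"
proof -
  have "integrable M f"
    by (rule Bochner_Integration.integrable_bound[OF mean_leD(1)[OF assms(1)] assms(2)])
       (use assms(3,4) order_trans[OF assms(4) abs_ge_self] in \<open>auto intro!: AE_I2\<close>)
  moreover have "expectation f \<le> expectation g"
    by (rule integral_mono) (use calculation assms mean_leD in auto)
  ultimately show ?thesis using assms(5) mean_leD(2)[OF assms(1)] by (simp add: mean_le_def)
qed

lemma mean_le_add: "mean_le f A \<Longrightarrow> mean_le g B \<Longrightarrow> mean_le (\<lambda>\<omega>. f \<omega> + g \<omega>) (A + B)"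
  by (auto simp: mean_le_def)

lemma mean_le_cmult: "mean_le f A \<Longrightarrow> 0 \<le> c \<Longrightarrow> mean_le (\<lambda>\<omega>. c * f \<omega>) (c * A)"
  by (auto simp: mean_le_def mult_left_mono)

lemma mean_le_sum:
  "(\<And>i. i \<in> I \<Longrightarrow> mean_le (f i) (A i)) \<Longrightarrow> mean_le (\<lambda>\<omega>. \<Sum>i\<in>I. f i \<omega>) (\<Sum>i\<in>I. A i)"
  by (auto simp: mean_le_def intro!: sum_mono)

lemma mean_le_mono: "mean_le f A \<Longrightarrow> A \<le> C \<Longrightarrow> mean_le f C"
  by (auto simp: mean_le_def)

text \<open>A convex combination of variables with mean at most \<open>C\<close> has mean at most \<open>C\<close>. The error
  recursions of the chain are brought into this form, which is why their bounds are
  uniform in the number of steps.\<close>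

lemma mean_le_recursion:
  assumes \<theta>: "0 \<le> \<theta>" "\<theta> \<le> 1" and meas: "\<And>j. a j \<in> borel_measurable M"
    and nonneg: "\<And>j \<omega>. 0 \<le> a j \<omega>" and step: "\<And>j \<omega>. a (Suc j) \<omega> \<le> (1 - \<theta>) * a j \<omega> + \<theta> * m j \<omega>"
    and init: "mean_le (a 0) C" and m: "\<And>j. mean_le (m j) C"
  shows "mean_le (a j) C"
proof (induction j)
  case (Suc j)
  have "mean_le (\<lambda>\<omega>. (1 - \<theta>) * a j \<omega> + \<theta> * m j \<omega>) ((1 - \<theta>) * C + \<theta> * C)"
    using \<theta> by (intro mean_le_add mean_le_cmult Suc m) auto
  then show ?case
    by (rule mean_le_dominated[OF _ meas nonneg step]) (simp add: algebra_simps)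
qed (rule init)

lemma convex_square:
  fixes a b x \<theta> :: real
  assumes "0 \<le> x" "x \<le> (1 - \<theta>) * a + \<theta> * b" "0 \<le> \<theta>" "\<theta> \<le> 1"
  shows "x\<^sup>2 \<le> (1 - \<theta>) * a\<^sup>2 + \<theta> * b\<^sup>2"
proof -
  have "x\<^sup>2 \<le> ((1 - \<theta>) * a + \<theta> * b)\<^sup>2" using assms by (intro power_mono) auto
  also have "\<dots> = (1 - \<theta>) * a\<^sup>2 + \<theta> * b\<^sup>2 - \<theta> * (1 - \<theta>) * (a - b)\<^sup>2"
    by (simp add: power2_eq_square algebra_simps)
  also have "\<dots> \<le> (1 - \<theta>) * a\<^sup>2 + \<theta> * b\<^sup>2" using assms by simp
  finally show ?thesis .
qed

text \<open>Squaring is convex, so the squares satisfy a recursion of the same form.\<close>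

lemma mean_square_recursion:
  assumes \<theta>: "0 \<le> \<theta>" "\<theta> \<le> 1" and meas: "\<And>j. a j \<in> borel_measurable M"
    and nonneg: "\<And>j \<omega>. 0 \<le> a j \<omega>" and step: "\<And>j \<omega>. a (Suc j) \<omega> \<le> (1 - \<theta>) * a j \<omega> + \<theta> * m j \<omega>"
    and init: "mean_le (\<lambda>\<omega>. (a 0 \<omega>)\<^sup>2) C" and m: "\<And>j. mean_le (\<lambda>\<omega>. (m j \<omega>)\<^sup>2) C"
  shows "mean_le (\<lambda>\<omega>. (a j \<omega>)\<^sup>2) C"
  by (rule mean_le_recursion[where \<theta> = \<theta> and m = "\<lambda>j \<omega>. (m j \<omega>)\<^sup>2", OF \<theta>])
     (use meas init m in \<open>auto intro!: convex_square nonneg step \<theta>\<close>)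

end

lemma norm_add_sq_le:
  fixes x y :: "'a::real_normed_vector"
  shows "(norm (x + y))\<^sup>2 \<le> 2 * (norm x)\<^sup>2 + 2 * (norm y)\<^sup>2"
proof -
  have "(norm (x + y))\<^sup>2 \<le> (norm x + norm y)\<^sup>2"
    by (intro power_mono norm_triangle_ineq norm_ge_zero)
  also have "\<dots> \<le> 2 * (norm x)\<^sup>2 + 2 * (norm y)\<^sup>2"
    using zero_le_power2[of "norm x - norm y"] by (simp add: power2_eq_square algebra_simps)
  finally show ?thesis .
qed

section \<open>Dissipative semilinear equations in spectral coordinates\<close>

text \<open>The data of the equation in the coordinates given by \<open>e\<close>. The margin \<open>c\<close> is the distance
  of the one-sided Lipschitz constant of \<open>F\<close> from \<open>lam 1\<close>. The assumption \<open>F_taylor\<close>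
  expresses the bound on the second derivative by finite sums, \<open>noise_trace\<close> the
  Hilbert-Schmidt condition, and \<open>initial_tail\<close> the regularity of the initial value.\<close>

locale semilinear = onb e for e :: "nat \<Rightarrow> 'a::{real_inner,banach,second_countable_topology}" +
  fixes lam q :: "nat \<Rightarrow> real" and F :: "'a \<Rightarrow> 'a" and F' :: "'a \<Rightarrow> 'a \<Rightarrow> 'a"
    and L c \<beta> \<eta> CQ CX :: real and X0 :: 'a
  assumes lam_pos: "\<And>i. i \<ge> 1 \<Longrightarrow> 0 < lam i"
    and lam_mono: "\<And>i j. 1 \<le> i \<Longrightarrow> i \<le> j \<Longrightarrow> lam i \<le> lam j"
    and q_nonneg: "\<And>i. i \<ge> 1 \<Longrightarrow> 0 \<le> q i"
    and L_pos: "L > 0" and c_pos: "c > 0" and beta: "0 < \<beta>" "\<beta> \<le> 1" and eta: "0 \<le> \<eta>" "\<eta> < 1"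
    and F_lipschitz: "\<And>x y. norm (F x - F y) \<le> L * norm (x - y)"
    and F_dissipative: "\<And>x y. inner (x - y) (F x - F y) \<le> (lam 1 - c) * (norm (x - y))\<^sup>2"
    and F'_linear: "\<And>x. linear (F' x)"
    and F'_bound: "\<And>x v. norm (F' x v) \<le> L * norm v"
    and F'_dissipative: "\<And>x v. inner v (F' x v) \<le> (lam 1 - c) * (norm v)\<^sup>2"
    and F_taylor: "\<And>I x y. finite I \<Longrightarrow> I \<subseteq> {1..} \<Longrightarrow>
      norm (diag e I (\<lambda>i. lam i powr (- \<eta>)) (F x - F y - F' y (x - y))) \<le> L * (norm (x - y))\<^sup>2"
    and noise_trace: "\<And>I. finite I \<Longrightarrow> I \<subseteq> {1..} \<Longrightarrow> (\<Sum>i\<in>I. q i * lam i powr (\<beta> - 1)) \<le> CQ"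
    and initial_tail: "\<And>I n. finite I \<Longrightarrow> I \<subseteq> {1..} \<Longrightarrow> n \<ge> 1 \<Longrightarrow> (\<forall>i\<in>I. lam n \<le> lam i) \<Longrightarrow>
      (\<Sum>i\<in>I. (inner (e i) X0)\<^sup>2) \<le> CX * lam n powr (- 2 * \<beta>)"
    and CX_nonneg: "CX \<ge> 0"
begin

lemma CQ_nonneg: "CQ \<ge> 0"
  using noise_trace[of "{}"] by simp

text \<open>One step of the exponential Euler scheme. The explicit drift increases the squared norm at
  most by the factor \<open>1 + 2 h (lam 1 - c) + h\<^sup>2 L\<^sup>2\<close>, the semigroup reduces it by
  \<open>exp (- 2 lam 1 h)\<close>. For \<open>h L\<^sup>2 \<le> c\<close> the norm is thus multiplied by at most
  \<open>exp (- c h / 2)\<close>, hence by at most \<open>1 - \<theta>\<close>, and the forcing is absorbed into the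
  remaining weight \<open>\<theta>\<close>.\<close>

lemma contraction_step:
  assumes I: "finite I" "I \<subseteq> {1..}" and h: "h > 0" "h * L\<^sup>2 \<le> c" "c * h \<le> 2"
    and g: "inner z g \<le> (lam 1 - c) * (norm z)\<^sup>2" "norm g \<le> L * norm z"
    and \<theta>: "\<theta> = (c * h / 2) / (1 + c * h / 2)"
  shows "norm (diag e I (\<lambda>i. exp (- (lam i * h))) (z + h *\<^sub>R g + h *\<^sub>R b))
    \<le> (1 - \<theta>) * norm z + \<theta> * ((4 / c) * norm b)"
proof -
  have lam1: "lam 1 > 0" using lam_pos by simp
  have ch: "c * h > 0" using h c_pos by simp
  have S: "norm (diag e I (\<lambda>i. exp (- (lam i * h))) x) \<le> exp (- (lam 1 * h)) * norm x" for x
  proof (rule norm_diag_le[OF I])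
    fix i assume "i \<in> I"
    then have "i \<ge> 1" using I by auto
    then show "\<bar>exp (- (lam i * h))\<bar> \<le> exp (- (lam 1 * h))" using lam_mono[of 1 i] h by simp
  qed simp
  let ?a = "2 * h * (lam 1 - c) + h\<^sup>2 * L\<^sup>2"
  have "(norm (z + h *\<^sub>R g))\<^sup>2 = (norm z)\<^sup>2 + 2 * h * inner z g + h\<^sup>2 * (norm g)\<^sup>2"
    unfolding power2_norm_eq_inner
    by (simp add: inner_add_left inner_add_right inner_commute[of g z] power2_eq_square algebra_simps)
  also have "\<dots> \<le> (norm z)\<^sup>2 + 2 * h * ((lam 1 - c) * (norm z)\<^sup>2) + h\<^sup>2 * (L * norm z)\<^sup>2"
    using g h by (intro add_mono mult_left_mono power_mono) auto
  also have "\<dots> = (1 + ?a) * (norm z)\<^sup>2" by (simp add: power_mult_distrib algebra_simps)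
  also have "\<dots> \<le> exp ?a * (norm z)\<^sup>2" by (intro mult_right_mono exp_ge_add_one_self) auto
  also have "\<dots> = (exp (?a / 2) * norm z)\<^sup>2"
  proof -
    have "exp ?a = exp (?a / 2 + ?a / 2)" by (simp only: field_sum_of_halves)
    then show ?thesis by (simp only: exp_add power2_eq_square power_mult_distrib mult_ac)
  qed
  finally have "norm (z + h *\<^sub>R g) \<le> exp (?a / 2) * norm z"
    by (rule power2_le_imp_le) simp
  then have "norm (diag e I (\<lambda>i. exp (- (lam i * h))) (z + h *\<^sub>R g)) \<le> exp (- (lam 1 * h)) * (exp (?a / 2) * norm z)"
    using S[of "z + h *\<^sub>R g"] by (meson exp_ge_zero mult_left_mono order_trans)
  also have "\<dots> = exp (- (lam 1 * h) + ?a / 2) * norm z"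
    by (simp only: exp_add mult.assoc)
  also have "\<dots> \<le> (1 / (1 + c * h / 2)) * norm z"
  proof (rule mult_right_mono)
    have "h * (h * L\<^sup>2) \<le> h * c" using h by (intro mult_left_mono) auto
    then have "- (lam 1 * h) + ?a / 2 \<le> - (c * h / 2)"
    proof -
      have "?a / 2 = lam 1 * h - c * h + h * (h * L\<^sup>2) / 2"
        by (simp add: power2_eq_square field_simps)
      then show ?thesis using \<open>h * (h * L\<^sup>2) \<le> h * c\<close> by (simp only: mult.commute[of h c])
    qed
    then have "exp (- (lam 1 * h) + ?a / 2) \<le> exp (- (c * h / 2))" by simp
    also have "\<dots> \<le> 1 / (1 + c * h / 2)"
      using exp_ge_add_one_self[of "c * h / 2"] ch by (simp add: exp_minus field_simps)
    finally show "exp (- (lam 1 * h) + ?a / 2) \<le> 1 / (1 + c * h / 2)" .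
  qed simp
  also have "1 / (1 + c * h / 2) = 1 - \<theta>"
    using ch by (simp add: \<theta> field_simps)
  finally have 1: "norm (diag e I (\<lambda>i. exp (- (lam i * h))) (z + h *\<^sub>R g)) \<le> (1 - \<theta>) * norm z" .
  have "norm (diag e I (\<lambda>i. exp (- (lam i * h))) (h *\<^sub>R b)) \<le> exp (- (lam 1 * h)) * (h * norm b)"
    using S[of "h *\<^sub>R b"] h by simp
  also have "\<dots> \<le> 1 * (h * norm b)" using lam1 h by (intro mult_right_mono) auto
  also have "\<dots> \<le> \<theta> * (4 / c) * norm b"
  proof -
    have "1 * (1 + c * h / 2) \<le> 2" using h by simp
    then have "h * (1 * (1 + c * h / 2)) \<le> h * 2" using h(1) by (intro mult_left_mono) auto
    then have "h \<le> h * 2 / (1 + c * h / 2)" using ch by (subst pos_le_divide_eq) auto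
    also have "\<dots> = \<theta> * (4 / c)" using ch c_pos unfolding \<theta> by (simp add: field_simps add_pos_pos)
    finally have "h \<le> \<theta> * (4 / c)" .
    then show ?thesis unfolding mult_1 by (rule mult_right_mono) simp
  qed
  finally have 2: "norm (diag e I (\<lambda>i. exp (- (lam i * h))) (h *\<^sub>R b)) \<le> \<theta> * ((4 / c) * norm b)"
    by (simp only: mult.assoc)
  show ?thesis
    unfolding diag_add[of I _ "z + h *\<^sub>R g"]
    by (rule order_trans[OF norm_triangle_ineq add_mono[OF 1 2]])
qed

text \<open>On modes with eigenvalues above \<open>lam n\<close> the semigroup alone contracts so strongly that a
  forcing term is divided by \<open>lam n\<close>.\<close>

lemma high_mode_step:
  assumes J: "finite J" "J \<subseteq> {1..}" "\<forall>i\<in>J. lam n \<le> lam i" and n: "n \<ge> 1" and h: "h > 0"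
    and \<theta>: "\<theta> = lam n * h / (1 + lam n * h)"
  shows "norm (diag e J (\<lambda>i. exp (- (lam i * h))) (r + h *\<^sub>R f)) \<le> (1 - \<theta>) * norm r + \<theta> * (norm f / lam n)"
proof -
  have l: "lam n > 0" "lam n * h > 0" using lam_pos[OF n] h by auto
  have "norm (diag e J (\<lambda>i. exp (- (lam i * h))) (r + h *\<^sub>R f)) \<le> exp (- (lam n * h)) * norm (r + h *\<^sub>R f)"
    using J h by (intro norm_diag_le) auto
  also have "\<dots> \<le> (1 / (1 + lam n * h)) * (norm r + h * norm f)"
  proof (intro mult_mono)
    show "exp (- (lam n * h)) \<le> 1 / (1 + lam n * h)"
      using exp_ge_add_one_self[of "lam n * h"] l by (simp add: exp_minus field_simps)
    show "norm (r + h *\<^sub>R f) \<le> norm r + h * norm f"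
      using norm_triangle_ineq[of r "h *\<^sub>R f"] h by simp
  qed (use l in auto)
  also have "\<dots> = (1 - \<theta>) * norm r + \<theta> * (norm f / lam n)"
  proof -
    have "1 / (1 + lam n * h) = 1 - \<theta>" using l by (simp add: \<theta> field_simps)
    moreover have "1 / (1 + lam n * h) * h = \<theta> / lam n" using l by (simp add: \<theta>)
    ultimately show ?thesis by (simp add: distrib_left mult.assoc[symmetric])
  qed
  finally show ?thesis .
qed

lemma lam_powr_le:
  assumes "n \<ge> 1" "a \<le> b" shows "lam n powr a \<le> lam 1 powr (a - b) * lam n powr b"
proof -
  have "lam n powr a = lam n powr (a - b) * lam n powr b" by (simp add: powr_add[symmetric])
  also have "\<dots> \<le> lam 1 powr (a - b) * lam n powr b"
    using lam_pos[of 1] lam_mono[of 1 n] assms by (intro mult_right_mono powr_mono2') auto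
  finally show ?thesis .
qed

text \<open>The summand is the stationary variance of the \<open>i\<close>-th Ornstein-Uhlenbeck mode. Of the
  factor \<open>1 / lam i\<close>, the power \<open>- \<beta>\<close> is bounded by that of \<open>lam n\<close>, and the rest is the
  weight in the trace condition.\<close>

lemma stationary_variance_bound:
  assumes I: "finite I" "I \<subseteq> {1..}" "\<forall>i\<in>I. lam n \<le> lam i" and n: "n \<ge> 1"
  shows "(\<Sum>i\<in>I. q i / (2 * lam i)) \<le> CQ / 2 * lam n powr (- \<beta>)"
proof -
  have "(\<Sum>i\<in>I. q i / (2 * lam i)) \<le> (\<Sum>i\<in>I. (lam n powr (- \<beta>) / 2) * (q i * lam i powr (\<beta> - 1)))"
  proof (rule sum_mono)
    fix i assume i: "i \<in> I"
    then have li: "i \<ge> 1" "lam i > 0" using I lam_pos by auto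
    have "lam i powr (- 1) = lam i powr (- \<beta>) * lam i powr (\<beta> - 1)" by (simp add: powr_add[symmetric])
    also have "\<dots> \<le> lam n powr (- \<beta>) * lam i powr (\<beta> - 1)"
      using i I n lam_pos beta by (intro mult_right_mono powr_mono2') auto
    finally have "q i / 2 * lam i powr (- 1) \<le> q i / 2 * (lam n powr (- \<beta>) * lam i powr (\<beta> - 1))"
      using q_nonneg[OF li(1)] by (intro mult_left_mono) auto
    moreover have "q i / (2 * lam i) = q i / 2 * lam i powr (- 1)"
      using li by (simp add: powr_minus_divide)
    moreover have "(lam n powr (- \<beta>) / 2) * (q i * lam i powr (\<beta> - 1))
        = q i / 2 * (lam n powr (- \<beta>) * lam i powr (\<beta> - 1))" by simp
    ultimately show "q i / (2 * lam i) \<le> (lam n powr (- \<beta>) / 2) * (q i * lam i powr (\<beta> - 1))"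
      by (simp only:)
  qed
  also have "\<dots> \<le> (lam n powr (- \<beta>) / 2) * CQ"
    unfolding sum_distrib_left[symmetric] using noise_trace[OF I(1,2)] by (intro mult_left_mono) auto
  also have "\<dots> = CQ / 2 * lam n powr (- \<beta>)" by simp
  finally show ?thesis .
qed

text \<open>Second moments of the Ornstein-Uhlenbeck part, of the remaining part of the chain, and of
  \<open>F\<close> along the chain (\<open>K_ou\<close>, \<open>K_drift\<close>, \<open>K_F\<close>); of the high modes without and with their
  Ornstein-Uhlenbeck part (\<open>K_high\<close>, \<open>K_tail\<close>); of the strong error (\<open>K_strong\<close>); the
  smoothing constant; and the two parts of the second difference (\<open>K_remainder\<close>,
  \<open>K_linear\<close>). They are fixed before the step size, the number of steps and the levels
  appear, and so cannot depend on them.\<close>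

definition "K_ou = CQ / 2 * lam 1 powr (- \<beta>)"
definition "K_drift = (norm X0)\<^sup>2 + (16 / c\<^sup>2) * (2 * (norm (F 0))\<^sup>2 + 2 * L\<^sup>2 * K_ou)"
definition "K_F = 2 * (norm (F 0))\<^sup>2 + 2 * L\<^sup>2 * (2 * K_drift + 2 * K_ou)"
definition "K_high = CX + K_F * lam 1 powr (2 * \<beta> - 2)"
definition "K_tail = 2 * (K_high * lam 1 powr (- \<beta>)) + CQ"
definition "K_strong = 2 * ((16 * L\<^sup>2 / c\<^sup>2) * K_tail) + 2 * K_tail"
definition "K_smooth = (2 + 4 * lam 1 powr (- 2 * (1 - \<eta>))) / (1 - \<eta>)"
definition "K_remainder = K_smooth * (2 * L * K_strong)"
definition "K_linear = (4 * L / c) * (K_remainder + K_high + 1)"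

lemma K_nonneg: "0 \<le> K_ou" "0 \<le> K_drift" "0 \<le> K_F" "0 \<le> K_high" "0 \<le> K_tail" "0 \<le> K_strong"
  "0 \<le> K_smooth" "0 \<le> K_remainder" "0 \<le> K_linear"
proof -
  show 1: "0 \<le> K_ou" by (simp add: K_ou_def CQ_nonneg)
  show 2: "0 \<le> K_drift" unfolding K_drift_def using 1
    by (intro add_nonneg_nonneg mult_nonneg_nonneg divide_nonneg_nonneg zero_le_power2) simp_all
  show 3: "0 \<le> K_F" unfolding K_F_def using 1 2
    by (intro add_nonneg_nonneg mult_nonneg_nonneg zero_le_power2) simp_all
  show 4: "0 \<le> K_high" unfolding K_high_def using 3 CX_nonneg
    by (intro add_nonneg_nonneg mult_nonneg_nonneg) simp_all
  show 5: "0 \<le> K_tail" unfolding K_tail_def using 4 CQ_nonneg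
    by (intro add_nonneg_nonneg mult_nonneg_nonneg) simp_all
  show 6: "0 \<le> K_strong" unfolding K_strong_def using 5
    by (intro add_nonneg_nonneg mult_nonneg_nonneg divide_nonneg_nonneg zero_le_power2) simp_all
  show 7: "0 \<le> K_smooth" unfolding K_smooth_def using eta
    by (intro add_nonneg_nonneg mult_nonneg_nonneg divide_nonneg_nonneg) simp_all
  show 8: "0 \<le> K_remainder" unfolding K_remainder_def using 6 7 L_pos
    by (intro mult_nonneg_nonneg) simp_all
  show "0 \<le> K_linear" unfolding K_linear_def using 8 4 L_pos c_pos
    by (intro add_nonneg_nonneg mult_nonneg_nonneg divide_nonneg_nonneg) simp_all
qed

lemma lam_powr_minus_beta_le: "n \<ge> 1 \<Longrightarrow> lam n powr (- 2 * \<beta>) \<le> lam 1 powr (- \<beta>) * lam n powr (- \<beta>)"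
  using lam_powr_le[of n "- 2 * \<beta>" "- \<beta>"] beta by simp

end

section \<open>The exponential Euler chain\<close>

lemma (in onb) diag_cong_inner:
  "(\<And>i. i \<in> I \<Longrightarrow> inner (e i) x = inner (e i) y) \<Longrightarrow> diag e I c x = diag e I c y"
  unfolding diag_def by (intro sum.cong refl) simp

lemma (in semilinear) F_continuous: "continuous_on UNIV F"
proof (rule continuous_onI)
  fix x \<epsilon> assume "(\<epsilon>::real) > 0"
  then show "\<exists>d>0. \<forall>x'\<in>UNIV. dist x' x < d \<longrightarrow> dist (F x') (F x) \<le> \<epsilon>"
    using L_pos order_trans[OF F_lipschitz[of _ x] less_imp_le]
    by (intro exI[of _ "\<epsilon> / L"]) (auto simp: dist_norm field_simps)
qed

lemma (in semilinear) measurable_F [measurable]: "F \<in> borel_measurable borel"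
  by (rule borel_measurable_continuous_onI[OF F_continuous])

lemma (in semilinear) F_growth: "(norm (F x))\<^sup>2 \<le> 2 * (norm (F 0))\<^sup>2 + 2 * L\<^sup>2 * (norm x)\<^sup>2"
proof -
  have "(norm (F 0 + (F x - F 0)))\<^sup>2 \<le> 2 * (norm (F 0))\<^sup>2 + 2 * (norm (F x - F 0))\<^sup>2"
    by (rule norm_add_sq_le)
  also have "(norm (F x - F 0))\<^sup>2 \<le> (L * norm x)\<^sup>2"
    using F_lipschitz[of x 0] by (intro power_mono) auto
  finally show ?thesis by (simp add: power_mult_distrib)
qed

text \<open>What the chain uses of the noise: \<open>\<xi> i j\<close> is the increment of the \<open>i\<close>-th Brownian motion
  over the \<open>j\<close>-th grid interval and \<open>G j\<close> the history up to the \<open>j\<close>-th grid point. The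
  assumption \<open>noise_symmetric\<close> is the invariance under reflection on which the weak
  estimate is built.\<close>

locale semilinear_grid = semilinear e lam q F F' L c \<beta> \<eta> CQ CX X0 + prob_space M
  for e :: "nat \<Rightarrow> 'a::{real_inner,banach,second_countable_topology}" and lam q F F' L c \<beta> \<eta> CQ CX X0
    and M :: "'w measure" +
  fixes h :: real and \<xi> :: "nat \<Rightarrow> nat \<Rightarrow> 'w \<Rightarrow> real" and G :: "nat \<Rightarrow> 'w measure"
  assumes h: "h > 0" "h * L\<^sup>2 \<le> c" "c * h \<le> 2"
    and G_sub: "\<And>j. space (G j) = space M" "\<And>j. sets (G j) \<subseteq> sets M"
    and G_mono: "\<And>j. sets (G j) \<subseteq> sets (G (Suc j))"
    and xi_measurable: "\<And>i j. i \<ge> 1 \<Longrightarrow> \<xi> i j \<in> borel_measurable (G (Suc j))"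
    and xi_mean: "\<And>i j. i \<ge> 1 \<Longrightarrow> integrable M (\<xi> i j)" "\<And>i j. i \<ge> 1 \<Longrightarrow> expectation (\<xi> i j) = 0"
    and xi_variance: "\<And>i j. i \<ge> 1 \<Longrightarrow> integrable M (\<lambda>\<omega>. (\<xi> i j \<omega>)\<^sup>2)"
      "\<And>i j. i \<ge> 1 \<Longrightarrow> expectation (\<lambda>\<omega>. (\<xi> i j \<omega>)\<^sup>2) = h"
    and xi_indep: "\<And>i j Y. i \<ge> 1 \<Longrightarrow> Y \<in> borel_measurable (G j) \<Longrightarrow> indep_var borel Y borel (\<xi> i j)"
    and noise_indep: "\<And>I \<sigma> j Y. finite I \<Longrightarrow> I \<subseteq> {1..} \<Longrightarrow> Y \<in> borel_measurable (G j) \<Longrightarrow>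
      indep_var borel Y borel (\<lambda>\<omega>. \<Sum>i\<in>I. (\<sigma> i * sqrt (q i) * \<xi> i j \<omega>) *\<^sub>R e i)"
    and noise_symmetric: "\<And>I \<sigma> j. finite I \<Longrightarrow> I \<subseteq> {1..} \<Longrightarrow> (\<And>i. \<sigma> i = 1 \<or> \<sigma> i = - 1) \<Longrightarrow>
      distr M borel (\<lambda>\<omega>. \<Sum>i\<in>I. (\<sigma> i * sqrt (q i) * \<xi> i j \<omega>) *\<^sub>R e i)
      = distr M borel (\<lambda>\<omega>. \<Sum>i\<in>I. (1 * sqrt (q i) * \<xi> i j \<omega>) *\<^sub>R e i)"
begin

definition noise :: "nat set \<Rightarrow> (nat \<Rightarrow> real) \<Rightarrow> nat \<Rightarrow> 'w \<Rightarrow> 'a" where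
  "noise I \<sigma> j \<omega> = (\<Sum>i\<in>I. (\<sigma> i * sqrt (q i) * \<xi> i j \<omega>) *\<^sub>R e i)"

abbreviation S :: "nat set \<Rightarrow> 'a \<Rightarrow> 'a" where
  "S I \<equiv> diag e I (\<lambda>i. exp (- (lam i * h)))"

abbreviation P :: "nat set \<Rightarrow> 'a \<Rightarrow> 'a" where "P I \<equiv> diag e I (\<lambda>_. 1)"

abbreviation weight :: real where "weight \<equiv> (c * h / 2) / (1 + c * h / 2)"

text \<open>The exponential Euler scheme on the modes in \<open>I\<close>, where the noise of mode \<open>i\<close> carries the
  sign \<open>\<sigma> i\<close>.\<close>

primrec chain :: "nat set \<Rightarrow> (nat \<Rightarrow> real) \<Rightarrow> nat \<Rightarrow> 'w \<Rightarrow> 'a" where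
  "chain I \<sigma> 0 \<omega> = P I X0"
| "chain I \<sigma> (Suc j) \<omega> = S I (chain I \<sigma> j \<omega> + h *\<^sub>R F (chain I \<sigma> j \<omega>) + noise I \<sigma> j \<omega>)"

text \<open>The scheme with \<open>F = 0\<close> and initial value 0: the Ornstein-Uhlenbeck part. A sign of the
  noise simply multiplies it.\<close>

primrec ou_mode :: "nat \<Rightarrow> nat \<Rightarrow> 'w \<Rightarrow> real" where
  "ou_mode i 0 \<omega> = 0"
| "ou_mode i (Suc j) \<omega> = exp (- (lam i * h)) * (ou_mode i j \<omega> + sqrt (q i) * \<xi> i j \<omega>)"

definition ou :: "nat set \<Rightarrow> (nat \<Rightarrow> real) \<Rightarrow> nat \<Rightarrow> 'w \<Rightarrow> 'a" where
  "ou I \<sigma> j \<omega> = (\<Sum>i\<in>I. (\<sigma> i * ou_mode i j \<omega>) *\<^sub>R e i)"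

lemma measurable_G_Suc: "f \<in> borel_measurable (G j) \<Longrightarrow> f \<in> borel_measurable (G (Suc j))"
  by (rule measurable_mono[THEN subsetD, OF order_refl refl G_mono, rotated]) (auto simp: G_sub)

lemma measurable_G: "f \<in> borel_measurable (G j) \<Longrightarrow> f \<in> borel_measurable M"
  by (rule measurable_mono[THEN subsetD, OF order_refl refl G_sub(2), rotated]) (auto simp: G_sub)

lemma ou_mode_measurable: "i \<ge> 1 \<Longrightarrow> ou_mode i j \<in> borel_measurable (G j)"
proof (induction j)
  case (Suc j)
  note [measurable] = measurable_G_Suc[OF Suc.IH[OF Suc.prems]] xi_measurable[OF Suc.prems, of j]
  show ?case unfolding ou_mode.simps[abs_def] by measurable
qed (simp add: ou_mode.simps[abs_def])

lemma ou_Suc: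
  assumes "finite I" "I \<subseteq> {1..}"
  shows "ou I \<sigma> (Suc j) \<omega> = S I (ou I \<sigma> j \<omega> + noise I \<sigma> j \<omega>)"
  unfolding diag_def
proof -
  have "inner (e i) (ou I \<sigma> j \<omega> + noise I \<sigma> j \<omega>) = \<sigma> i * (ou_mode i j \<omega> + sqrt (q i) * \<xi> i j \<omega>)"
    if "i \<in> I" for i
    using that assms by (auto simp: ou_def noise_def inner_add_right inner_basis_sum algebra_simps subset_iff)
  then show "ou I \<sigma> (Suc j) \<omega> = (\<Sum>i\<in>I. (exp (- (lam i * h)) * inner (e i) (ou I \<sigma> j \<omega> + noise I \<sigma> j \<omega>)) *\<^sub>R e i)"
    unfolding ou_def[of I \<sigma> "Suc j"] by (intro sum.cong refl) (simp add: mult.left_commute)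
qed

lemma ou_0: "ou I \<sigma> 0 \<omega> = 0"
  by (simp add: ou_def)

lemma ou_measurable [measurable]: "I \<subseteq> {1..} \<Longrightarrow> ou I \<sigma> j \<in> borel_measurable M"
  unfolding ou_def[abs_def]
  by (intro borel_measurable_sum borel_measurable_scaleR borel_measurable_times borel_measurable_const
      measurable_G[OF ou_mode_measurable]) auto

lemma noise_measurable: "I \<subseteq> {1..} \<Longrightarrow> noise I \<sigma> j \<in> borel_measurable (G (Suc j))"
  unfolding noise_def[abs_def]
  by (intro borel_measurable_sum borel_measurable_scaleR borel_measurable_times borel_measurable_const
      xi_measurable) auto

lemma chain_measurable_G: "I \<subseteq> {1..} \<Longrightarrow> chain I \<sigma> j \<in> borel_measurable (G j)"
proof (induction j)
  case (Suc j)
  note [measurable] = measurable_G_Suc[OF Suc.IH[OF Suc.prems]] noise_measurable[OF Suc.prems, of \<sigma> j]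
  show ?case unfolding chain.simps[abs_def] by measurable
qed (simp add: chain.simps[abs_def])

lemma chain_measurable [measurable]: "I \<subseteq> {1..} \<Longrightarrow> chain I \<sigma> j \<in> borel_measurable M"
  by (rule measurable_G[OF chain_measurable_G])

text \<open>The variance evolves by \<open>v \<mapsto> exp (- 2 lam i h) (v + q i h)\<close>, which does not leave the
  interval up to \<open>q i / (2 * lam i)\<close>.\<close>

lemma ou_mode_moments:
  assumes i: "i \<ge> 1"
  shows "integrable M (ou_mode i j) \<and> mean_le (\<lambda>\<omega>. (ou_mode i j \<omega>)\<^sup>2) (q i / (2 * lam i))"
proof (induction j)
  case 0
  show ?case using q_nonneg[OF i] lam_pos[OF i] by (auto simp: ou_mode.simps[abs_def] intro!: mean_le_const)
next
  case (Suc j)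
  let ?o = "ou_mode i j" and ?x = "\<xi> i j" and ?a = "exp (- (lam i * h))" and ?s = "sqrt (q i)"
  have io: "integrable M ?o" and vo: "mean_le (\<lambda>\<omega>. (?o \<omega>)\<^sup>2) (q i / (2 * lam i))" using Suc.IH by auto
  have ind: "indep_var borel ?o borel ?x" by (rule xi_indep[OF i ou_mode_measurable[OF i]])
  have iox: "integrable M (\<lambda>\<omega>. ?o \<omega> * ?x \<omega>)"
    by (rule indep_var_integrable[OF ind io xi_mean(1)[OF i]])
  have eox: "expectation (\<lambda>\<omega>. ?o \<omega> * ?x \<omega>) = 0"
    using indep_var_lebesgue_integral[OF ind io xi_mean(1)[OF i]] xi_mean(2)[OF i] by simp
  have eq: "(ou_mode i (Suc j) \<omega>)\<^sup>2 = ?a\<^sup>2 * ((?o \<omega>)\<^sup>2 + 2 * ?s * (?o \<omega> * ?x \<omega>) + q i * (?x \<omega>)\<^sup>2)" for \<omega>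
    unfolding ou_mode.simps power_mult_distrib[of ?a] power2_sum power_mult_distrib[of ?s]
    using q_nonneg[OF i] by (simp add: mult_ac)
  have int: "integrable M (\<lambda>\<omega>. (ou_mode i (Suc j) \<omega>)\<^sup>2)"
    unfolding eq using mean_leD(1)[OF vo] iox xi_variance(1)[OF i]
    by (intro integrable_mult_right integrable_add) auto
  have "expectation (\<lambda>\<omega>. (ou_mode i (Suc j) \<omega>)\<^sup>2) = ?a\<^sup>2 * (expectation (\<lambda>\<omega>. (?o \<omega>)\<^sup>2) + q i * h)"
    unfolding eq using mean_leD(1)[OF vo] iox xi_variance[OF i, of j] eox by simp
  also have "\<dots> \<le> ?a\<^sup>2 * (q i / (2 * lam i) + q i * h)"
    using mean_leD(2)[OF vo] by (intro mult_left_mono) auto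
  also have "\<dots> = (q i / (2 * lam i)) * (?a\<^sup>2 * (1 + 2 * lam i * h))"
    using lam_pos[OF i] by (simp add: field_simps)
  also have "\<dots> \<le> (q i / (2 * lam i)) * 1"
  proof (rule mult_left_mono)
    have "?a\<^sup>2 = exp (- (2 * lam i * h))" by (simp add: power2_eq_square exp_add[symmetric])
    moreover have "1 + 2 * lam i * h \<le> exp (2 * lam i * h)" by (rule exp_ge_add_one_self)
    ultimately show "?a\<^sup>2 * (1 + 2 * lam i * h) \<le> 1"
      by (simp add: exp_minus divide_le_eq inverse_eq_divide)
  qed (use q_nonneg[OF i] lam_pos[OF i] in simp)
  finally have "mean_le (\<lambda>\<omega>. (ou_mode i (Suc j) \<omega>)\<^sup>2) (q i / (2 * lam i))"
    using int by (simp add: mean_le_def)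
  moreover have "integrable M (ou_mode i (Suc j))"
    unfolding ou_mode.simps[abs_def] using io xi_mean(1)[OF i] by simp
  ultimately show ?case by (intro conjI)
qed

lemma ou_second_moment:
  assumes I: "finite I" "I \<subseteq> {1..}" "\<forall>i\<in>I. lam n \<le> lam i" and n: "n \<ge> 1"
    and \<sigma>: "\<And>i. \<sigma> i = 1 \<or> \<sigma> i = - 1"
  shows "mean_le (\<lambda>\<omega>. (norm (ou I \<sigma> j \<omega>))\<^sup>2) (CQ / 2 * lam n powr (- \<beta>))"
proof -
  have \<sigma>2: "(\<sigma> i)\<^sup>2 = 1" for i using \<sigma>[of i] by auto
  have "(norm (ou I \<sigma> j \<omega>))\<^sup>2 = (\<Sum>i\<in>I. (ou_mode i j \<omega>)\<^sup>2)" for \<omega>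
    unfolding ou_def norm_basis_sum[OF I(1,2)] by (simp add: power_mult_distrib \<sigma>2)
  then show ?thesis
    using mean_le_mono[OF mean_le_sum stationary_variance_bound[OF I n]] ou_mode_moments I
    by (auto simp: subset_iff)
qed

lemma weight_bounds: "0 \<le> weight" "weight \<le> 1"
proof -
  have "c * h > 0" using c_pos h by simp
  then show "0 \<le> weight" "weight \<le> 1" by simp_all
qed

lemma P_S: "finite J \<Longrightarrow> J \<subseteq> {1..} \<Longrightarrow> I \<subseteq> J \<Longrightarrow> P I (S J x) = S I x"
  by (subst diag_diag) auto

lemma S_P: "finite J \<Longrightarrow> J \<subseteq> {1..} \<Longrightarrow> I \<subseteq> J \<Longrightarrow> S I (P J x) = S I x"
  by (subst diag_diag) auto

lemma chain_range: "finite I \<Longrightarrow> I \<subseteq> {1..} \<Longrightarrow> P I (chain I \<sigma> j \<omega>) = chain I \<sigma> j \<omega>"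
  by (cases j) (simp_all add: P_S diag_diag)

text \<open>Subtracting the Ornstein-Uhlenbeck part removes the noise, so that the contraction applies
  path by path, with forcing \<open>F (ou I \<sigma> j \<omega>)\<close>.\<close>

lemma drift_second_moment:
  assumes I: "finite I" "I \<subseteq> {1..}" and \<sigma>: "\<And>i. \<sigma> i = 1 \<or> \<sigma> i = - 1"
  shows "mean_le (\<lambda>\<omega>. (norm (chain I \<sigma> j \<omega> - ou I \<sigma> j \<omega>))\<^sup>2) K_drift"
proof (rule mean_square_recursion[OF weight_bounds, where m = "\<lambda>j \<omega>. (4 / c) * norm (F (ou I \<sigma> j \<omega>))"])
  note [measurable] = ou_measurable[OF I(2)] chain_measurable[OF I(2)]
  show "(\<lambda>\<omega>. norm (chain I \<sigma> j \<omega> - ou I \<sigma> j \<omega>)) \<in> borel_measurable M" for j by measurable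
  show "norm (chain I \<sigma> (Suc j) \<omega> - ou I \<sigma> (Suc j) \<omega>)
      \<le> (1 - weight) * norm (chain I \<sigma> j \<omega> - ou I \<sigma> j \<omega>)
        + weight * ((4 / c) * norm (F (ou I \<sigma> j \<omega>)))" for j \<omega>
  proof -
    let ?x = "chain I \<sigma> j \<omega>" and ?o = "ou I \<sigma> j \<omega>"
    have "chain I \<sigma> (Suc j) \<omega> - ou I \<sigma> (Suc j) \<omega> = S I ((?x - ?o) + h *\<^sub>R (F ?x - F ?o) + h *\<^sub>R F ?o)"
      unfolding chain.simps ou_Suc[OF I] diag_diff[symmetric] by (simp add: algebra_simps)
    then show ?thesis
      using contraction_step[OF I h F_dissipative F_lipschitz refl, of ?x ?o "F ?o"] by simp
  qed
  show "mean_le (\<lambda>\<omega>. (norm (chain I \<sigma> 0 \<omega> - ou I \<sigma> 0 \<omega>))\<^sup>2) K_drift"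
  proof -
    have "norm (P I X0) \<le> norm X0" using norm_diag_le[OF I, of "\<lambda>_. 1" 1 X0] by simp
    then have "(norm (P I X0))\<^sup>2 \<le> (norm X0)\<^sup>2" by (intro power_mono) auto
    also have "\<dots> \<le> K_drift" unfolding K_drift_def using K_nonneg(1) by simp
    finally show ?thesis by (simp add: ou_0 mean_le_const)
  qed
  show "mean_le (\<lambda>\<omega>. ((4 / c) * norm (F (ou I \<sigma> j \<omega>)))\<^sup>2) K_drift" for j
  proof -
    have "mean_le (\<lambda>\<omega>. (norm (ou I \<sigma> j \<omega>))\<^sup>2) K_ou"
      unfolding K_ou_def using I lam_mono by (intro ou_second_moment \<sigma>) auto
    then have "mean_le (\<lambda>\<omega>. (16 / c\<^sup>2) * (2 * (norm (F 0))\<^sup>2 + 2 * L\<^sup>2 * (norm (ou I \<sigma> j \<omega>))\<^sup>2))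
       ((16 / c\<^sup>2) * (2 * (norm (F 0))\<^sup>2 + 2 * L\<^sup>2 * K_ou))"
      by (intro mean_le_cmult mean_le_add mean_le_const) auto
    then show ?thesis
    proof (rule mean_le_dominated)
      show "((4 / c) * norm (F (ou I \<sigma> j \<omega>)))\<^sup>2 \<le> (16 / c\<^sup>2) * (2 * (norm (F 0))\<^sup>2 + 2 * L\<^sup>2 * (norm (ou I \<sigma> j \<omega>))\<^sup>2)" for \<omega>
        unfolding power_mult_distrib power_divide
        using F_growth[of "ou I \<sigma> j \<omega>"] by (intro mult_mono) auto
    qed (use c_pos in \<open>simp_all add: K_drift_def\<close>)
  qed
qed simp

lemma chain_second_moment:
  assumes I: "finite I" "I \<subseteq> {1..}" and \<sigma>: "\<And>i. \<sigma> i = 1 \<or> \<sigma> i = - 1"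
  shows "mean_le (\<lambda>\<omega>. (norm (chain I \<sigma> j \<omega>))\<^sup>2) (2 * K_drift + 2 * K_ou)"
proof -
  note [measurable] = ou_measurable[OF I(2)] chain_measurable[OF I(2)]
  have "mean_le (\<lambda>\<omega>. (norm (ou I \<sigma> j \<omega>))\<^sup>2) K_ou"
    unfolding K_ou_def using I lam_mono by (intro ou_second_moment \<sigma>) auto
  then have "mean_le (\<lambda>\<omega>. 2 * (norm (chain I \<sigma> j \<omega> - ou I \<sigma> j \<omega>))\<^sup>2 + 2 * (norm (ou I \<sigma> j \<omega>))\<^sup>2)
      (2 * K_drift + 2 * K_ou)"
    by (intro mean_le_add mean_le_cmult drift_second_moment I \<sigma>) auto
  then show ?thesis
  proof (rule mean_le_dominated)
    show "(norm (chain I \<sigma> j \<omega>))\<^sup>2 \<le> 2 * (norm (chain I \<sigma> j \<omega> - ou I \<sigma> j \<omega>))\<^sup>2 + 2 * (norm (ou I \<sigma> j \<omega>))\<^sup>2" for \<omega>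
      using norm_add_sq_le[of "chain I \<sigma> j \<omega> - ou I \<sigma> j \<omega>" "ou I \<sigma> j \<omega>"] by simp
  qed auto
qed

lemma drift_value_second_moment:
  assumes I: "finite I" "I \<subseteq> {1..}" and \<sigma>: "\<And>i. \<sigma> i = 1 \<or> \<sigma> i = - 1"
  shows "mean_le (\<lambda>\<omega>. (norm (F (chain I \<sigma> j \<omega>)))\<^sup>2) K_F"
proof -
  note [measurable] = chain_measurable[OF I(2)]
  have "mean_le (\<lambda>\<omega>. 2 * (norm (F 0))\<^sup>2 + 2 * L\<^sup>2 * (norm (chain I \<sigma> j \<omega>))\<^sup>2) K_F"
    unfolding K_F_def by (intro mean_le_add mean_le_cmult mean_le_const chain_second_moment I \<sigma>) auto
  then show ?thesis
    by (rule mean_le_dominated) (use F_growth in auto)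
qed

text \<open>Without its Ornstein-Uhlenbeck part the high-mode component is driven by \<open>F\<close> along the
  chain, which gains the factor \<open>1 / lam n\<close>, and starts from the tail of the initial
  value. As \<open>\<beta> \<le> 1\<close>, both are of order \<open>lam n powr (- \<beta>)\<close>, twice the order of the
  Ornstein-Uhlenbeck part.\<close>

lemma high_modes_second_moment:
  assumes I: "finite I" "I \<subseteq> {1..}" and J: "J \<subseteq> I" "\<forall>i\<in>J. lam n \<le> lam i" and n: "n \<ge> 1"
    and \<sigma>: "\<And>i. \<sigma> i = 1 \<or> \<sigma> i = - 1"
  shows "mean_le (\<lambda>\<omega>. (norm (P J (chain I \<sigma> j \<omega>) - ou J \<sigma> j \<omega>))\<^sup>2) (K_high * lam n powr (- 2 * \<beta>))"
proof -
  have J': "finite J" "J \<subseteq> {1..}" using I J finite_subset by auto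
  have l: "lam n > 0" "lam n * h > 0" using lam_pos[OF n] h by auto
  note [measurable] = ou_measurable[OF J'(2)] chain_measurable[OF I(2)]
  let ?\<theta> = "lam n * h / (1 + lam n * h)"
  have \<theta>: "0 \<le> ?\<theta>" "?\<theta> \<le> 1" using l by simp_all
  show ?thesis
  proof (rule mean_square_recursion[OF \<theta>, where m = "\<lambda>j \<omega>. norm (F (chain I \<sigma> j \<omega>)) / lam n"])
    show "(\<lambda>\<omega>. norm (P J (chain I \<sigma> j \<omega>) - ou J \<sigma> j \<omega>)) \<in> borel_measurable M" for j by measurable
    show "norm (P J (chain I \<sigma> (Suc j) \<omega>) - ou J \<sigma> (Suc j) \<omega>)
      \<le> (1 - ?\<theta>) * norm (P J (chain I \<sigma> j \<omega>) - ou J \<sigma> j \<omega>) + ?\<theta> * (norm (F (chain I \<sigma> j \<omega>)) / lam n)" for j \<omega>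
    proof -
      let ?x = "chain I \<sigma> j \<omega>" and ?o = "ou J \<sigma> j \<omega>"
      have nJ: "S J (noise I \<sigma> j \<omega>) = S J (noise J \<sigma> j \<omega>)"
        using I J J' by (intro diag_cong_inner) (auto simp: noise_def inner_basis_sum subset_iff)
      have "P J (chain I \<sigma> (Suc j) \<omega>) = S J ?x + S J (h *\<^sub>R F ?x) + S J (noise I \<sigma> j \<omega>)"
        unfolding chain.simps P_S[OF I J(1)] diag_add ..
      also have "\<dots> = S J (P J ?x) + S J (h *\<^sub>R F ?x) + S J (noise J \<sigma> j \<omega>)"
        unfolding nJ S_P[OF J' order_refl] ..
      finally have "P J (chain I \<sigma> (Suc j) \<omega>) - ou J \<sigma> (Suc j) \<omega> = S J ((P J ?x - ?o) + h *\<^sub>R F ?x)"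
        unfolding ou_Suc[OF J'] by (simp add: diag_add diag_diff)
      then show ?thesis using high_mode_step[OF J' J(2) n h(1) refl, of "P J ?x - ?o" "F ?x"] by simp
    qed
    have K: "CX * lam n powr (- 2 * \<beta>) \<le> K_high * lam n powr (- 2 * \<beta>)"
      unfolding K_high_def using K_nonneg(3) by (intro mult_right_mono) auto
    have "(norm (P J X0))\<^sup>2 \<le> CX * lam n powr (- 2 * \<beta>)"
      unfolding norm_diag[OF J'] using initial_tail[OF J' n J(2)] by simp
    moreover have "P J (P I X0) = P J X0" using I J by (subst diag_diag) auto
    ultimately show "mean_le (\<lambda>\<omega>. (norm (P J (chain I \<sigma> 0 \<omega>) - ou J \<sigma> 0 \<omega>))\<^sup>2) (K_high * lam n powr (- 2 * \<beta>))"
      using K by (auto simp: ou_0 intro!: mean_le_const)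
    show "mean_le (\<lambda>\<omega>. (norm (F (chain I \<sigma> j \<omega>)) / lam n)\<^sup>2) (K_high * lam n powr (- 2 * \<beta>))" for j
    proof -
      have "mean_le (\<lambda>\<omega>. (lam n powr (- 2)) * (norm (F (chain I \<sigma> j \<omega>)))\<^sup>2) (lam n powr (- 2) * K_F)"
        by (intro mean_le_cmult drift_value_second_moment I \<sigma>) auto
      moreover have "lam n powr (- 2) * K_F \<le> K_high * lam n powr (- 2 * \<beta>)"
      proof -
        have "lam n powr (- 2) * K_F \<le> lam 1 powr (- 2 - - 2 * \<beta>) * lam n powr (- 2 * \<beta>) * K_F"
          using beta by (intro mult_right_mono lam_powr_le n K_nonneg) auto
        also have "\<dots> = K_F * lam 1 powr (2 * \<beta> - 2) * lam n powr (- 2 * \<beta>)" by (simp add: add.commute)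
        also have "\<dots> \<le> K_high * lam n powr (- 2 * \<beta>)"
          unfolding K_high_def using CX_nonneg by (intro mult_right_mono) auto
        finally show ?thesis .
      qed
      moreover have "(norm (F (chain I \<sigma> j \<omega>)) / lam n)\<^sup>2 = (lam n powr (- 2)) * (norm (F (chain I \<sigma> j \<omega>)))\<^sup>2" for \<omega>
        using l by (simp add: power_divide powr_minus divide_inverse power_mult_distrib power_inverse)
      ultimately show ?thesis by (simp add: mean_le_mono)
    qed
  qed simp
qed

text \<open>The chain is Markov: the law of the next state depends only on the law of the present
  state and on the law of the independent noise, and neither sees the signs.\<close>

lemma chain_law_symmetric:
  assumes I: "finite I" "I \<subseteq> {1..}" and \<sigma>: "\<And>i. \<sigma> i = 1 \<or> \<sigma> i = - 1"
  shows "distr M borel (chain I \<sigma> j) = distr M borel (chain I (\<lambda>_. 1) j)"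
proof (induction j)
  case 0
  show ?case by (simp add: chain.simps[abs_def])
next
  case (Suc j)
  define g where "g = (\<lambda>(x, w). S I (x + h *\<^sub>R F x + w))"
  have g [measurable]: "g \<in> borel_measurable (borel \<Otimes>\<^sub>M borel)" unfolding g_def by measurable
  have law: "distr M borel (chain I \<tau> (Suc j))
      = distr (distr M borel (chain I \<tau> j) \<Otimes>\<^sub>M distr M borel (noise I \<tau> j)) borel g" for \<tau>
  proof -
    have ind: "indep_var borel (chain I \<tau> j) borel (noise I \<tau> j)"
      unfolding noise_def[abs_def] by (rule noise_indep[OF I chain_measurable_G[OF I(2)]])
    have [measurable]: "noise I \<tau> j \<in> borel_measurable M" by (rule measurable_G[OF noise_measurable[OF I(2)]])
    note [measurable] = chain_measurable[OF I(2), of \<tau> j]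
    have "distr M borel (chain I \<tau> (Suc j)) = distr M borel (g \<circ> (\<lambda>\<omega>. (chain I \<tau> j \<omega>, noise I \<tau> j \<omega>)))"
      by (rule distr_cong) (simp_all add: g_def)
    also have "\<dots> = distr (distr M (borel \<Otimes>\<^sub>M borel) (\<lambda>\<omega>. (chain I \<tau> j \<omega>, noise I \<tau> j \<omega>))) borel g"
      by (rule distr_distr[symmetric]) measurable
    finally show ?thesis using ind unfolding indep_var_distribution_eq by simp
  qed
  have "distr M borel (noise I \<sigma> j) = distr M borel (noise I (\<lambda>_. 1) j)"
    unfolding noise_def[abs_def] by (rule noise_symmetric[OF I \<sigma>])
  then show ?case unfolding law Suc.IH by simp
qed

end

section \<open>Two Galerkin levels and reflected high modes\<close>

text \<open>Coupling of level \<open>n\<close> with level \<open>N\<close>: \<open>refined 1\<close> and \<open>refined (- 1)\<close> are chains of level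
  \<open>N\<close> with the same noise in the low modes and opposite noise in the high modes, \<open>coarse\<close>
  is the chain of level \<open>n\<close> with that low-mode noise.\<close>

locale two_levels = semilinear_grid e lam q F F' L c \<beta> \<eta> CQ CX X0 M h \<xi> G
  for e :: "nat \<Rightarrow> 'a::{real_inner,banach,second_countable_topology}" and lam q F F' L c \<beta> \<eta> CQ CX X0
    and M :: "'w measure" and h \<xi> G +
  fixes n N :: nat
  assumes n: "1 \<le> n" "n \<le> N"
begin

definition flip :: "real \<Rightarrow> nat \<Rightarrow> real" where "flip s i = (if i \<le> n then 1 else s)"

abbreviation low :: "nat set" where "low \<equiv> {1..n}"
abbreviation high :: "nat set" where "high \<equiv> {n<..N}"
abbreviation refined :: "real \<Rightarrow> nat \<Rightarrow> 'w \<Rightarrow> 'a" where "refined s \<equiv> chain {1..N} (flip s)"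
abbreviation coarse :: "nat \<Rightarrow> 'w \<Rightarrow> 'a" where "coarse \<equiv> chain low (\<lambda>_. 1)"
text \<open>The high modes of the second difference consist of these terms alone, since the
  Ornstein-Uhlenbeck parts of the two refined chains are opposite.\<close>

definition rest :: "real \<Rightarrow> nat \<Rightarrow> 'w \<Rightarrow> 'a" where
  "rest s j \<omega> = P high (refined s j \<omega>) - ou high (flip s) j \<omega>"
definition remainder :: "real \<Rightarrow> nat \<Rightarrow> 'w \<Rightarrow> 'a" where
  "remainder s j \<omega> = F (refined s j \<omega>) - F (coarse j \<omega>) - F' (coarse j \<omega>) (refined s j \<omega> - coarse j \<omega>)"

lemma level_sets: "finite low" "low \<subseteq> {1..}" "finite high" "high \<subseteq> {1..}" "finite {1..N}" "{1..N} \<subseteq> {1..}"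
  "low \<subseteq> {1..N}" "high \<subseteq> {1..N}" "low \<inter> high = {}" "low \<union> high = {1..N}" "\<forall>i\<in>high. lam n \<le> lam i"
  using n lam_mono[OF n(1)] by auto

lemma flip_sign: "s = 1 \<or> s = - 1 \<Longrightarrow> flip s i = 1 \<or> flip s i = - 1"
  by (auto simp: flip_def)

lemma refined_split: "refined s j \<omega> = P low (refined s j \<omega>) + P high (refined s j \<omega>)"
  using diag_split[OF level_sets(1,3,9), of "\<lambda>_. 1" "refined s j \<omega>"]
    chain_range[OF level_sets(5,6), of "flip s" j \<omega>]
  by (simp only: level_sets(10))

lemma measurable_levels [measurable]:
  "refined s j \<in> borel_measurable M" "coarse j \<in> borel_measurable M"
  "rest s j \<in> borel_measurable M"
proof -
  show 1: "refined s j \<in> borel_measurable M" "coarse j \<in> borel_measurable M"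
    by (rule chain_measurable, rule level_sets)+
  note [measurable] = 1 ou_measurable[OF level_sets(4)]
  show "rest s j \<in> borel_measurable M" unfolding rest_def[abs_def] by measurable
qed

lemma rest_second_moment:
  "s = 1 \<or> s = - 1 \<Longrightarrow> mean_le (\<lambda>\<omega>. (norm (rest s j \<omega>))\<^sup>2) (K_high * lam n powr (- 2 * \<beta>))"
  unfolding rest_def by (intro high_modes_second_moment level_sets n flip_sign)

text \<open>From the second moment by \<open>r \<le> (a r\<^sup>2 + 1 / a) / 2\<close> with \<open>a = lam n powr \<beta>\<close>, which stays
  within the rules for \<open>mean_le\<close>.\<close>

lemma rest_first_moment:
  assumes "s = 1 \<or> s = - 1"
  shows "mean_le (\<lambda>\<omega>. norm (rest s j \<omega>)) ((K_high + 1) / 2 * lam n powr (- \<beta>))"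
proof -
  let ?l = "lam n powr (- \<beta>)"
  have l: "?l > 0" "lam n powr \<beta> > 0" using lam_pos[OF n(1)] by auto
  have ll: "lam n powr \<beta> * ?l = 1" using lam_pos[OF n(1)] by (simp add: powr_add[symmetric])
  have "mean_le (\<lambda>\<omega>. (1 / 2) * (lam n powr \<beta> * (norm (rest s j \<omega>))\<^sup>2 + ?l))
      ((1 / 2) * (lam n powr \<beta> * (K_high * lam n powr (- 2 * \<beta>)) + ?l))"
    by (intro mean_le_cmult mean_le_add mean_le_const rest_second_moment assms) (use l in auto)
  then show ?thesis
  proof (rule mean_le_dominated)
    show "norm (rest s j \<omega>) \<le> (1 / 2) * (lam n powr \<beta> * (norm (rest s j \<omega>))\<^sup>2 + ?l)" for \<omega>
    proof -
      let ?r = "norm (rest s j \<omega>)"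
      have "0 \<le> ?l * (lam n powr \<beta> * ?r - 1)\<^sup>2" using l by (intro mult_nonneg_nonneg) auto
      also have "\<dots> = (lam n powr \<beta> * ?l) * (lam n powr \<beta> * ?r\<^sup>2) - 2 * (lam n powr \<beta> * ?l) * ?r + ?l"
        by (simp add: power2_eq_square algebra_simps)
      finally show ?thesis unfolding ll by simp
    qed
    have "lam n powr \<beta> * lam n powr (- 2 * \<beta>) = ?l" by (simp add: powr_add[symmetric])
    then have "lam n powr \<beta> * (K_high * lam n powr (- 2 * \<beta>)) = K_high * ?l"
      by (simp only: mult.left_commute[of _ K_high])
    then show "(1 / 2) * (lam n powr \<beta> * (K_high * lam n powr (- 2 * \<beta>)) + ?l) \<le> (K_high + 1) / 2 * ?l"
      by (simp only:) (simp add: field_simps)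
  qed auto
qed

lemma tail_second_moment:
  assumes s: "s = 1 \<or> s = - 1"
  shows "mean_le (\<lambda>\<omega>. (norm (P high (refined s j \<omega>)))\<^sup>2) (K_tail * lam n powr (- \<beta>))"
proof -
  have "mean_le (\<lambda>\<omega>. 2 * (norm (rest s j \<omega>))\<^sup>2 + 2 * (norm (ou high (flip s) j \<omega>))\<^sup>2)
      (2 * (K_high * lam n powr (- 2 * \<beta>)) + 2 * (CQ / 2 * lam n powr (- \<beta>)))"
    by (intro mean_le_add mean_le_cmult rest_second_moment ou_second_moment flip_sign level_sets n s) auto
  then show ?thesis
  proof (rule mean_le_dominated)
    show "(norm (P high (refined s j \<omega>)))\<^sup>2 \<le> 2 * (norm (rest s j \<omega>))\<^sup>2 + 2 * (norm (ou high (flip s) j \<omega>))\<^sup>2" for \<omega>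
      using norm_add_sq_le[of "rest s j \<omega>" "ou high (flip s) j \<omega>"] by (simp add: rest_def)
    have "K_high * lam n powr (- 2 * \<beta>) \<le> K_high * (lam 1 powr (- \<beta>) * lam n powr (- \<beta>))"
      by (intro mult_left_mono lam_powr_minus_beta_le n K_nonneg)
    then show "2 * (K_high * lam n powr (- 2 * \<beta>)) + 2 * (CQ / 2 * lam n powr (- \<beta>)) \<le> K_tail * lam n powr (- \<beta>)"
      by (simp add: K_tail_def algebra_simps)
  qed auto
qed

lemma S_noise_low: "S low (noise {1..N} (flip s) j \<omega>) = S low (noise low (\<lambda>_. 1) j \<omega>)"
  using level_sets by (intro diag_cong_inner) (auto simp: noise_def inner_basis_sum subset_iff flip_def)

lemma P_low_refined_Suc:
  "P low (refined s (Suc j) \<omega>) = S low (P low (refined s j \<omega>) + h *\<^sub>R F (refined s j \<omega>) + noise low (\<lambda>_. 1) j \<omega>)"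
  unfolding chain.simps P_S[OF level_sets(5,6,7)] diag_add S_noise_low S_P[OF level_sets(1,2) order_refl] ..

text \<open>In the low modes both chains have the same noise. The difference contracts, and its
  forcing is the effect of the missing high modes on \<open>F\<close>.\<close>

lemma strong_error_low:
  assumes s: "s = 1 \<or> s = - 1"
  shows "mean_le (\<lambda>\<omega>. (norm (P low (refined s j \<omega>) - coarse j \<omega>))\<^sup>2) ((16 * L\<^sup>2 / c\<^sup>2) * K_tail * lam n powr (- \<beta>))"
proof (rule mean_square_recursion[OF weight_bounds, where j = j
      and a = "\<lambda>j \<omega>. norm (P low (refined s j \<omega>) - coarse j \<omega>)"
      and m = "\<lambda>j \<omega>. (4 / c) * norm (F (refined s j \<omega>) - F (P low (refined s j \<omega>)))"])
  show "(\<lambda>\<omega>. norm (P low (refined s j \<omega>) - coarse j \<omega>)) \<in> borel_measurable M" for j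
    by measurable
  show "norm (P low (refined s (Suc j) \<omega>) - coarse (Suc j) \<omega>)
      \<le> (1 - weight) * norm (P low (refined s j \<omega>) - coarse j \<omega>)
        + weight * ((4 / c) * norm (F (refined s j \<omega>) - F (P low (refined s j \<omega>))))" for j \<omega>
  proof -
    let ?x = "refined s j \<omega>" and ?p = "P low (refined s j \<omega>)" and ?y = "coarse j \<omega>"
    have "P low (refined s (Suc j) \<omega>) - coarse (Suc j) \<omega> = S low ((?p - ?y) + h *\<^sub>R (F ?p - F ?y) + h *\<^sub>R (F ?x - F ?p))"
      unfolding P_low_refined_Suc chain.simps(2)[of low] diag_diff[symmetric] by (simp add: algebra_simps)
    then show ?thesis
      using contraction_step[OF level_sets(1,2) h F_dissipative F_lipschitz refl, of ?p ?y "F ?x - F ?p"] by simp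
  qed
  have "P low (P {1..N} X0) = P low X0" using level_sets by (subst diag_diag) auto
  then show "mean_le (\<lambda>\<omega>. (norm (P low (refined s 0 \<omega>) - coarse 0 \<omega>))\<^sup>2) ((16 * L\<^sup>2 / c\<^sup>2) * K_tail * lam n powr (- \<beta>))"
    using K_nonneg by (simp add: mean_le_const)
  show "mean_le (\<lambda>\<omega>. ((4 / c) * norm (F (refined s j \<omega>) - F (P low (refined s j \<omega>))))\<^sup>2) ((16 * L\<^sup>2 / c\<^sup>2) * K_tail * lam n powr (- \<beta>))" for j
  proof -
    have "mean_le (\<lambda>\<omega>. (16 * L\<^sup>2 / c\<^sup>2) * (norm (P high (refined s j \<omega>)))\<^sup>2) ((16 * L\<^sup>2 / c\<^sup>2) * (K_tail * lam n powr (- \<beta>)))"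
      by (intro mean_le_cmult tail_second_moment s) auto
    then show ?thesis
    proof (rule mean_le_dominated)
      fix \<omega>
      have "norm (F (refined s j \<omega>) - F (P low (refined s j \<omega>))) \<le> L * norm (P high (refined s j \<omega>))"
        using F_lipschitz[of "refined s j \<omega>" "P low (refined s j \<omega>)"] refined_split[of s j \<omega>]
        by (metis add_diff_cancel_left')
      then have "((4 / c) * norm (F (refined s j \<omega>) - F (P low (refined s j \<omega>))))\<^sup>2 \<le> ((4 / c) * (L * norm (P high (refined s j \<omega>))))\<^sup>2"
        using c_pos by (intro power_mono mult_left_mono) auto
      then show "((4 / c) * norm (F (refined s j \<omega>) - F (P low (refined s j \<omega>))))\<^sup>2 \<le> (16 * L\<^sup>2 / c\<^sup>2) * (norm (P high (refined s j \<omega>)))\<^sup>2"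
        by (simp add: power_mult_distrib power_divide)
    qed (simp_all add: mult.assoc)
  qed
qed simp

lemma strong_error:
  assumes s: "s = 1 \<or> s = - 1"
  shows "mean_le (\<lambda>\<omega>. (norm (refined s j \<omega> - coarse j \<omega>))\<^sup>2) (K_strong * lam n powr (- \<beta>))"
proof -
  have "mean_le (\<lambda>\<omega>. 2 * (norm (P low (refined s j \<omega>) - coarse j \<omega>))\<^sup>2 + 2 * (norm (P high (refined s j \<omega>)))\<^sup>2)
      (2 * ((16 * L\<^sup>2 / c\<^sup>2) * K_tail * lam n powr (- \<beta>)) + 2 * (K_tail * lam n powr (- \<beta>)))"
    by (intro mean_le_add mean_le_cmult strong_error_low tail_second_moment s) auto
  then show ?thesis
  proof (rule mean_le_dominated)
    fix \<omega>
    have "refined s j \<omega> - coarse j \<omega> = (P low (refined s j \<omega>) - coarse j \<omega>) + P high (refined s j \<omega>)"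
      by (subst refined_split) simp
    then show "(norm (refined s j \<omega> - coarse j \<omega>))\<^sup>2 \<le> 2 * (norm (P low (refined s j \<omega>) - coarse j \<omega>))\<^sup>2 + 2 * (norm (P high (refined s j \<omega>)))\<^sup>2"
      using norm_add_sq_le by metis
    show "2 * ((16 * L\<^sup>2 / c\<^sup>2) * K_tail * lam n powr (- \<beta>)) + 2 * (K_tail * lam n powr (- \<beta>)) \<le> K_strong * lam n powr (- \<beta>)"
      unfolding K_strong_def by (simp add: distrib_right mult.assoc)
  qed auto
qed

text \<open>The contribution of the Taylor remainders to the second difference. It is treated apart,
  because the remainders are controlled only after an application of
  \<open>diag e low (\<lambda>i. lam i powr (- \<eta>))\<close>.\<close>

primrec remainder_sum :: "nat \<Rightarrow> 'w \<Rightarrow> 'a" where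
  "remainder_sum 0 \<omega> = 0"
| "remainder_sum (Suc j) \<omega> = S low (remainder_sum j \<omega> + h *\<^sub>R (remainder 1 j \<omega> + remainder (- 1) j \<omega>))"

abbreviation defect :: "nat \<Rightarrow> 'w \<Rightarrow> real" where
  "defect j \<omega> \<equiv> L * (norm (refined 1 j \<omega> - coarse j \<omega>))\<^sup>2 + L * (norm (refined (- 1) j \<omega> - coarse j \<omega>))\<^sup>2"

lemma remainder_sum_unroll:
  "remainder_sum j \<omega> = (\<Sum>m<j. h *\<^sub>R diag e low (\<lambda>i. exp (- (lam i * (real (j - m) * h)))) (remainder 1 m \<omega> + remainder (- 1) m \<omega>))"
proof (induction j)
  case (Suc j)
  have step: "S low (diag e low (\<lambda>i. exp (- (lam i * (real (j - m) * h)))) x)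
      = diag e low (\<lambda>i. exp (- (lam i * (real (Suc j - m) * h)))) x" if "m < j" for m x
  proof -
    have "exp (- (lam i * h)) * exp (- (lam i * (real (j - m) * h))) = exp (- (lam i * (real (Suc j - m) * h)))" for i
    proof -
      have "real (Suc j - m) = real (j - m) + 1" using that by (simp add: of_nat_diff)
      then have "- (lam i * (real (Suc j - m) * h)) = - (lam i * h) + - (lam i * (real (j - m) * h))"
        by (simp add: algebra_simps)
      then show ?thesis by (simp only: exp_add)
    qed
    then show ?thesis using level_sets by (subst diag_diag) auto
  qed
  let ?R = "\<lambda>m. remainder 1 m \<omega> + remainder (- 1) m \<omega>"
  have "remainder_sum (Suc j) \<omega> = S low (remainder_sum j \<omega>) + S low (h *\<^sub>R ?R j)"
    unfolding remainder_sum.simps by (rule diag_add)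
  also have "S low (remainder_sum j \<omega>)
      = (\<Sum>m<j. h *\<^sub>R diag e low (\<lambda>i. exp (- (lam i * (real (Suc j - m) * h)))) (?R m))"
    unfolding Suc.IH linear_sum[OF linear_diag] diag_scaleR by (intro sum.cong refl) (simp only: step lessThan_iff)
  also have "S low (h *\<^sub>R ?R j) = h *\<^sub>R diag e low (\<lambda>i. exp (- (lam i * (real (Suc j - j) * h)))) (?R j)"
    by (simp add: diag_scaleR)
  finally show ?case unfolding sum.lessThan_Suc .
qed simp

definition remainder_bound :: "nat \<Rightarrow> 'w \<Rightarrow> real" where
  "remainder_bound j \<omega> = (\<Sum>m<j. (K_smooth *
      (smoothing_profile \<eta> (real (j - m) * h) - smoothing_profile \<eta> (real (j - Suc m) * h))) * defect m \<omega>)"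

text \<open>The semigroup over \<open>j - m\<close> steps absorbs the factor \<open>lam i powr \<eta>\<close> that turns the bounded
  quantity back into the remainder.\<close>

lemma remainder_sum_bound: "norm (remainder_sum j \<omega>) \<le> remainder_bound j \<omega>"
  unfolding remainder_sum_unroll remainder_bound_def
proof (rule sum_norm_le)
  fix m assume "m \<in> {..<j}"
  then obtain k where k: "j - m = Suc k" "j - Suc m = k" by (metis Suc_diff_Suc lessThan_iff)
  let ?R = "remainder 1 m \<omega> + remainder (- 1) m \<omega>"
  let ?w = "K_smooth * (smoothing_profile \<eta> (real (Suc k) * h) - smoothing_profile \<eta> (real k * h))"
  have w: "h * (lam i powr \<eta> * exp (- (lam i * (real (Suc k) * h)))) \<le> ?w" if "i \<in> low" for i
    unfolding K_smooth_def using that lam_pos[of 1] lam_mono[of 1 i] h eta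
    by (intro smoothing_increment) auto
  have w0: "0 \<le> ?w"
  proof -
    have "1 \<in> low" using n by simp
    from w[OF this] show ?thesis
      by (rule order_trans[rotated]) (use h in \<open>intro mult_nonneg_nonneg\<close>, auto)
  qed
  have eq: "h *\<^sub>R diag e low (\<lambda>i. exp (- (lam i * (real (Suc k) * h)))) ?R
      = diag e low (\<lambda>i. h * (lam i powr \<eta> * exp (- (lam i * (real (Suc k) * h))))) (diag e low (\<lambda>i. lam i powr (- \<eta>)) ?R)"
  proof -
    have "h * (lam i powr \<eta> * exp (- (lam i * (real (Suc k) * h)))) * lam i powr (- \<eta>)
        = h * exp (- (lam i * (real (Suc k) * h)))" if "i \<in> low" for i
    proof -
      have "lam i powr \<eta> * lam i powr (- \<eta>) = 1" using that lam_pos[of i] by (simp add: powr_add[symmetric])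
      then show ?thesis by (metis mult.assoc mult.commute mult_1)
    qed
    then show ?thesis
      using level_sets by (subst diag_diag) (auto simp: diag_def scaleR_sum_right mult.assoc[symmetric] intro!: sum.cong)
  qed
  have "norm (h *\<^sub>R diag e low (\<lambda>i. exp (- (lam i * (real (Suc k) * h)))) ?R)
      \<le> ?w * norm (diag e low (\<lambda>i. lam i powr (- \<eta>)) ?R)"
    unfolding eq
  proof (rule norm_diag_le[OF level_sets(1,2) _ w0])
    fix i assume i: "i \<in> low"
    have "0 \<le> h * (lam i powr \<eta> * exp (- (lam i * (real (Suc k) * h))))" using h by simp
    then show "\<bar>h * (lam i powr \<eta> * exp (- (lam i * (real (Suc k) * h))))\<bar> \<le> ?w" using w[OF i] by linarith
  qed
  also have "\<dots> \<le> ?w * defect m \<omega>"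
  proof (rule mult_left_mono[OF _ w0])
    have "norm (diag e low (\<lambda>i. lam i powr (- \<eta>)) (remainder s m \<omega>)) \<le> L * (norm (refined s m \<omega> - coarse m \<omega>))\<^sup>2" for s
      unfolding remainder_def by (rule F_taylor[OF level_sets(1,2)])
    then show "norm (diag e low (\<lambda>i. lam i powr (- \<eta>)) ?R) \<le> defect m \<omega>"
      unfolding diag_add by (intro order_trans[OF norm_triangle_ineq] add_mono)
  qed
  finally show "norm (h *\<^sub>R diag e low (\<lambda>i. exp (- (lam i * (real (j - m) * h)))) ?R)
      \<le> (K_smooth * (smoothing_profile \<eta> (real (j - m) * h) - smoothing_profile \<eta> (real (j - Suc m) * h))) * defect m \<omega>"
    unfolding k .
qed

lemma defect_mean: "mean_le (defect j) (2 * L * K_strong * lam n powr (- \<beta>))"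
proof -
  have "mean_le (defect j) (L * (K_strong * lam n powr (- \<beta>)) + L * (K_strong * lam n powr (- \<beta>)))"
    using L_pos by (intro mean_le_add mean_le_cmult strong_error) auto
  then show ?thesis by (rule mean_le_mono) (simp add: algebra_simps)
qed

lemma smoothing_profile_mono: "0 \<le> s \<Longrightarrow> s \<le> t \<Longrightarrow> smoothing_profile \<eta> s \<le> smoothing_profile \<eta> t"
proof -
  assume "0 \<le> s" "s \<le> t"
  then have le: "s powr (1 - \<eta>) \<le> t powr (1 - \<eta>)" using eta by (intro powr_mono2) auto
  have "0 < 1 + s powr (1 - \<eta>)" "0 < 1 + t powr (1 - \<eta>)" by (simp_all add: add_pos_nonneg)
  then show ?thesis using le by (simp add: smoothing_profile_def field_simps)
qed

lemma remainder_bound_mean: "mean_le (remainder_bound j) (K_remainder * lam n powr (- \<beta>))"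
proof -
  let ?f = "\<lambda>k. smoothing_profile \<eta> (real k * h)"
  let ?D = "2 * L * K_strong * lam n powr (- \<beta>)"
  have inc: "0 \<le> ?f (j - m) - ?f (j - Suc m)" for m
    using h smoothing_profile_mono[of "real (j - Suc m) * h" "real (j - m) * h"] by (simp add: mult_right_mono)
  have "mean_le (remainder_bound j) (\<Sum>m<j. (K_smooth * (?f (j - m) - ?f (j - Suc m))) * ?D)"
    unfolding remainder_bound_def[abs_def]
    by (intro mean_le_sum mean_le_cmult defect_mean mult_nonneg_nonneg K_nonneg inc)
  moreover have "(\<Sum>m<j. (K_smooth * (?f (j - m) - ?f (j - Suc m))) * ?D) \<le> K_remainder * lam n powr (- \<beta>)"
  proof -
    \<comment> \<open>The increments telescope, so their sum is at most 1 for every number of steps.\<close>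
    have "(\<Sum>m<j. ?f (j - m) - ?f (j - Suc m)) = ?f j - ?f 0"
      using sum_lessThan_telescope'[of "\<lambda>m. ?f (j - m)" j] by simp
    also have "\<dots> \<le> 1" using smoothing_profile_bounds(2)[of \<eta> "real j * h"] smoothing_profile_bounds(1)[of \<eta> "real 0 * h"] by linarith
    finally have "(K_smooth * ?D) * (\<Sum>m<j. ?f (j - m) - ?f (j - Suc m)) \<le> (K_smooth * ?D) * 1"
      using K_nonneg L_pos by (intro mult_left_mono) auto
    then show ?thesis by (simp add: K_remainder_def sum_distrib_left mult_ac)
  qed
  ultimately show ?thesis by (rule mean_le_mono)
qed

definition second_difference :: "nat \<Rightarrow> 'w \<Rightarrow> 'a" where
  "second_difference j \<omega> = P low (refined 1 j \<omega>) + P low (refined (- 1) j \<omega>) - 2 *\<^sub>R coarse j \<omega>"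

text \<open>The reason for the reflection: the Ornstein-Uhlenbeck parts of the high modes, which are
  larger than everything else there, cancel.\<close>

lemma ou_cancel: "ou high (flip 1) j \<omega> + ou high (flip (- 1)) j \<omega> = 0"
  unfolding ou_def flip_def by (simp add: sum.distrib[symmetric] scaleR_add_left[symmetric])

lemma refined_second_difference:
  "refined 1 j \<omega> + refined (- 1) j \<omega> - 2 *\<^sub>R coarse j \<omega> = second_difference j \<omega> + (rest 1 j \<omega> + rest (- 1) j \<omega>)"
proof -
  have "rest 1 j \<omega> + rest (- 1) j \<omega> = P high (refined 1 j \<omega>) + P high (refined (- 1) j \<omega>)"
    using ou_cancel[of j \<omega>] unfolding rest_def
    by (metis (no_types, lifting) add_diff_add diff_zero)
  then show ?thesis
    using refined_split[of 1 j \<omega>] refined_split[of "- 1" j \<omega>] unfolding second_difference_def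
    by (simp add: algebra_simps)
qed

text \<open>Adding the equations of both refined chains and subtracting the coarse one twice cancels
  the noise. By Taylor expansion the drift becomes \<open>F' y\<close> applied to the second
  difference, plus the remainders. The latter make up \<open>remainder_sum\<close>; for the rest \<open>F' y\<close>
  is dissipative, and the forcing is \<open>F' y\<close> applied to the remainder sum and the high
  modes.\<close>

lemma second_difference_step:
  "norm (second_difference (Suc j) \<omega> - remainder_sum (Suc j) \<omega>)
    \<le> (1 - weight) * norm (second_difference j \<omega> - remainder_sum j \<omega>)
      + weight * ((4 / c) * (L * (remainder_bound j \<omega> + (norm (rest 1 j \<omega>) + norm (rest (- 1) j \<omega>)))))"
proof -
  let ?y = "coarse j \<omega>" and ?z = "second_difference j \<omega>" and ?k = "remainder_sum j \<omega>"
  let ?r = "rest 1 j \<omega> + rest (- 1) j \<omega>"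
  let ?xp = "refined 1 j \<omega>" and ?xm = "refined (- 1) j \<omega>"
  let ?b = "F' ?y (?k + ?r)" and ?R = "remainder 1 j \<omega> + remainder (- 1) j \<omega>"
  note lin = linear_add[OF F'_linear] linear_diff[OF F'_linear] linear_scale[OF F'_linear]
  have "(?xp - ?y) + (?xm - ?y) = (?z - ?k) + (?k + ?r)"
    using refined_second_difference[of j \<omega>] by (simp add: algebra_simps scaleR_2)
  then have "F' ?y (?xp - ?y) + F' ?y (?xm - ?y) = F' ?y (?z - ?k) + ?b"
    by (metis linear_add[OF F'_linear])
  \<comment> \<open>The linear part of the expansion depends on the two first differences only through their
    sum.\<close>
  then have drift: "F ?xp + F ?xm - (F ?y + F ?y) = F' ?y (?z - ?k) + ?b + ?R"
    unfolding remainder_def by (simp add: algebra_simps scaleR_2)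
  let ?w = "noise low (\<lambda>_. 1) j \<omega>"
  have "(P low ?xp + h *\<^sub>R F ?xp + ?w) + (P low ?xm + h *\<^sub>R F ?xm + ?w) - 2 *\<^sub>R (?y + h *\<^sub>R F ?y + ?w)
      = ?z + h *\<^sub>R (F ?xp + F ?xm - (F ?y + F ?y))"
    unfolding second_difference_def scaleR_2 by (simp add: algebra_simps)
  then have "second_difference (Suc j) \<omega> = S low (?z + h *\<^sub>R (F ?xp + F ?xm - (F ?y + F ?y)))"
    unfolding second_difference_def[of "Suc j"] P_low_refined_Suc chain.simps(2)[of low]
    by (simp only: diag_add[symmetric] diag_diff[symmetric] diag_scaleR[symmetric])
  also have "\<dots> = S low ((?z - ?k) + h *\<^sub>R F' ?y (?z - ?k) + h *\<^sub>R ?b) + remainder_sum (Suc j) \<omega>"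
    unfolding drift remainder_sum.simps diag_add[symmetric] by (simp add: algebra_simps)
  finally have "second_difference (Suc j) \<omega> - remainder_sum (Suc j) \<omega>
      = S low ((?z - ?k) + h *\<^sub>R F' ?y (?z - ?k) + h *\<^sub>R ?b)" by simp
  then have "norm (second_difference (Suc j) \<omega> - remainder_sum (Suc j) \<omega>)
      \<le> (1 - weight) * norm (?z - ?k) + weight * ((4 / c) * norm ?b)"
    using contraction_step[OF level_sets(1,2) h F'_dissipative F'_bound refl, of "?z - ?k" ?y ?b] by simp
  moreover have "norm ?b \<le> L * (remainder_bound j \<omega> + (norm (rest 1 j \<omega>) + norm (rest (- 1) j \<omega>)))"
    by (rule order_trans[OF F'_bound])
       (intro mult_left_mono order_trans[OF norm_triangle_ineq] add_mono norm_triangle_ineq less_imp_le[OF L_pos]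
          remainder_sum_bound)
  then have "weight * ((4 / c) * norm ?b)
      \<le> weight * ((4 / c) * (L * (remainder_bound j \<omega> + (norm (rest 1 j \<omega>) + norm (rest (- 1) j \<omega>)))))"
    by (intro mult_left_mono weight_bounds) (use c_pos in auto)
  ultimately show ?thesis by linarith
qed

text \<open>A pathwise majorant defined by the recursion that the preceding lemma establishes as an
  inequality.\<close>

primrec linear_bound :: "nat \<Rightarrow> 'w \<Rightarrow> real" where
  "linear_bound 0 \<omega> = 0"
| "linear_bound (Suc j) \<omega> = (1 - weight) * linear_bound j \<omega>
    + weight * ((4 / c) * (L * (remainder_bound j \<omega> + (norm (rest 1 j \<omega>) + norm (rest (- 1) j \<omega>)))))"

lemma second_difference_le_linear_bound: "norm (second_difference j \<omega> - remainder_sum j \<omega>) \<le> linear_bound j \<omega>"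
proof (induction j)
  case 0
  have "P low (P {1..N} X0) = P low X0" using level_sets by (subst diag_diag) auto
  then show ?case by (simp add: second_difference_def scaleR_2)
next
  case (Suc j)
  show ?case
    unfolding linear_bound.simps
    by (rule order_trans[OF second_difference_step], intro add_mono mult_left_mono Suc order_refl)
       (use weight_bounds in simp)
qed

lemma linear_bound_mean: "mean_le (linear_bound j) (K_linear * lam n powr (- \<beta>))"
proof (induction j)
  case 0
  show ?case using K_nonneg by (simp add: linear_bound.simps[abs_def] mean_le_const)
next
  case (Suc j)
  let ?l = "lam n powr (- \<beta>)" and ?t = "weight"
  let ?C = "(4 / c) * (L * (K_remainder * ?l + ((K_high + 1) / 2 * ?l + (K_high + 1) / 2 * ?l)))"
  have "K_remainder * ?l + ((K_high + 1) / 2 * ?l + (K_high + 1) / 2 * ?l) = (K_remainder + K_high + 1) * ?l"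
    by (simp add: field_simps)
  then have C: "?C = K_linear * ?l" unfolding K_linear_def by simp
  have "mean_le (linear_bound (Suc j)) ((1 - ?t) * (K_linear * ?l) + ?t * ?C)"
    unfolding linear_bound.simps[abs_def]
    by (intro mean_le_add mean_le_cmult Suc remainder_bound_mean rest_first_moment)
       (use weight_bounds L_pos c_pos in auto)
  then show ?case by (rule mean_le_mono) (simp only: C, simp add: algebra_simps)
qed

text \<open>The symmetric expression \<open>\<Phi> x\<^sup>+ + \<Phi> x\<^sup>- - 2 \<Phi> y\<close> has twice the weak error as its mean, and
  its Taylor expansion at \<open>y\<close> contains the first differences only through their sum.\<close>

lemma weak_error:
  fixes \<Phi> :: "'a \<Rightarrow> real" and \<Phi>' :: "'a \<Rightarrow> 'a \<Rightarrow> real"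
  assumes meas [measurable]: "\<Phi> \<in> borel_measurable borel" and C: "0 \<le> C1" "0 \<le> C2"
    and lin: "\<And>x. linear (\<Phi>' x)" and D1: "\<And>x v. \<bar>\<Phi>' x v\<bar> \<le> C1 * norm v"
    and D2: "\<And>x y. \<bar>\<Phi> x - \<Phi> y - \<Phi>' y (x - y)\<bar> \<le> C2 * (norm (x - y))\<^sup>2"
  shows "\<bar>expectation (\<lambda>\<omega>. \<Phi> (chain {1..N} (\<lambda>_. 1) j \<omega>)) - expectation (\<lambda>\<omega>. \<Phi> (coarse j \<omega>))\<bar>
    \<le> (C1 * (K_remainder + K_linear + K_high + 1) + 2 * C2 * K_strong) * lam n powr (- \<beta>)"
proof -
  let ?l = "lam n powr (- \<beta>)"
  have int: "integrable M (\<lambda>\<omega>. \<Phi> (chain I \<sigma> j \<omega>))"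
    if I: "finite I" "I \<subseteq> {1..}" and \<sigma>: "\<And>i. \<sigma> i = 1 \<or> \<sigma> i = - 1" for I \<sigma>
  proof -
    note [measurable] = chain_measurable[OF I(2), of \<sigma> j]
    have "integrable M (\<lambda>\<omega>. \<bar>\<Phi> 0\<bar> + (C1 + (C1 + C2) * (norm (chain I \<sigma> j \<omega>))\<^sup>2))"
      using mean_leD(1)[OF chain_second_moment[OF I \<sigma>, where j = j]] by simp
    then show ?thesis
    proof (rule Bochner_Integration.integrable_bound)
      show "AE \<omega> in M. norm (\<Phi> (chain I \<sigma> j \<omega>)) \<le> norm (\<bar>\<Phi> 0\<bar> + (C1 + (C1 + C2) * (norm (chain I \<sigma> j \<omega>))\<^sup>2))"
      proof (rule AE_I2)
        fix \<omega>
        let ?x = "chain I \<sigma> j \<omega>"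
        have "2 * norm ?x \<le> (norm ?x)\<^sup>2 + 1"
          using zero_le_power2[of "norm ?x - 1"] by (simp add: power2_diff)
        then have "norm ?x \<le> 1 + (norm ?x)\<^sup>2" using norm_ge_zero[of ?x] by linarith
        then have "C1 * norm ?x \<le> C1 * (1 + (norm ?x)\<^sup>2)" using C by (intro mult_left_mono)
        then have "\<bar>\<Phi> ?x\<bar> \<le> \<bar>\<Phi> 0\<bar> + (C1 + (C1 + C2) * (norm ?x)\<^sup>2)"
          using D2[of ?x 0] D1[of 0 ?x] by (simp add: algebra_simps)
        then show "norm (\<Phi> ?x) \<le> norm (\<bar>\<Phi> 0\<bar> + (C1 + (C1 + C2) * (norm ?x)\<^sup>2))" by simp
      qed
    qed measurable
  qed
  have sgn: "flip s i = 1 \<or> flip s i = - 1" if "s = 1 \<or> s = - 1" for s i using that by (rule flip_sign)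
  have one: "flip 1 = (\<lambda>_. 1)" by (simp add: flip_def fun_eq_iff)
  have i1: "integrable M (\<lambda>\<omega>. \<Phi> (refined 1 j \<omega>))" by (intro int level_sets sgn) auto
  have i2: "integrable M (\<lambda>\<omega>. \<Phi> (refined (- 1) j \<omega>))" by (intro int level_sets sgn) auto
  have i3: "integrable M (\<lambda>\<omega>. \<Phi> (coarse j \<omega>))" by (intro int level_sets) auto
  have "expectation (\<lambda>\<omega>. \<Phi> (refined (- 1) j \<omega>)) = integral\<^sup>L (distr M borel (refined (- 1) j)) \<Phi>"
    by (rule integral_distr[symmetric]) measurable
  also have "distr M borel (refined (- 1) j) = distr M borel (refined 1 j)"
    unfolding one by (intro chain_law_symmetric level_sets sgn) auto
  also have "integral\<^sup>L (distr M borel (refined 1 j)) \<Phi> = expectation (\<lambda>\<omega>. \<Phi> (refined 1 j \<omega>))"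
    by (rule integral_distr) measurable
  finally have sym: "expectation (\<lambda>\<omega>. \<Phi> (refined (- 1) j \<omega>)) = expectation (\<lambda>\<omega>. \<Phi> (refined 1 j \<omega>))" .
  let ?g = "\<lambda>\<omega>. \<Phi> (refined 1 j \<omega>) + \<Phi> (refined (- 1) j \<omega>) - 2 * \<Phi> (coarse j \<omega>)"
  let ?b = "\<lambda>\<omega>. C1 * ((linear_bound j \<omega> + remainder_bound j \<omega>) + (norm (rest 1 j \<omega>) + norm (rest (- 1) j \<omega>)))
      + C2 * ((norm (refined 1 j \<omega> - coarse j \<omega>))\<^sup>2 + (norm (refined (- 1) j \<omega> - coarse j \<omega>))\<^sup>2)"
  have pointwise: "\<bar>?g \<omega>\<bar> \<le> ?b \<omega>" for \<omega>
  proof -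
    let ?y = "coarse j \<omega>" and ?p = "refined 1 j \<omega>" and ?m = "refined (- 1) j \<omega>"
    let ?v = "second_difference j \<omega> + (rest 1 j \<omega> + rest (- 1) j \<omega>)"
    have "\<Phi>' ?y (?p - ?y) + \<Phi>' ?y (?m - ?y) = \<Phi>' ?y ?v"
      unfolding linear_add[OF lin, symmetric] refined_second_difference[symmetric] by (simp add: scaleR_2 algebra_simps)
    then have "\<bar>?g \<omega>\<bar> \<le> \<bar>\<Phi>' ?y ?v\<bar> + (C2 * (norm (?p - ?y))\<^sup>2 + C2 * (norm (?m - ?y))\<^sup>2)"
      using D2[of ?p ?y] D2[of ?m ?y] by linarith
    moreover have "\<bar>\<Phi>' ?y ?v\<bar> \<le> C1 * norm ?v" by (rule D1)
    moreover have "C1 * norm ?v \<le> C1 * ((linear_bound j \<omega> + remainder_bound j \<omega>) + (norm (rest 1 j \<omega>) + norm (rest (- 1) j \<omega>)))"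
    proof (rule mult_left_mono[OF _ C(1)])
      have "norm (second_difference j \<omega>) \<le> linear_bound j \<omega> + remainder_bound j \<omega>"
        using norm_triangle_ineq[of "second_difference j \<omega> - remainder_sum j \<omega>" "remainder_sum j \<omega>"]
          second_difference_le_linear_bound[of j \<omega>] remainder_sum_bound[of j \<omega>] by simp
      then show "norm ?v \<le> (linear_bound j \<omega> + remainder_bound j \<omega>) + (norm (rest 1 j \<omega>) + norm (rest (- 1) j \<omega>))"
        by (intro order_trans[OF norm_triangle_ineq] add_mono norm_triangle_ineq)
    qed
    ultimately show ?thesis by (simp add: distrib_left)
  qed
  have mb: "mean_le ?b (C1 * ((K_linear * ?l + K_remainder * ?l) + ((K_high + 1) / 2 * ?l + (K_high + 1) / 2 * ?l))
      + C2 * (K_strong * ?l + K_strong * ?l))"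
    by (intro mean_le_add mean_le_cmult linear_bound_mean remainder_bound_mean rest_first_moment strong_error C) auto
  have eg: "2 * (expectation (\<lambda>\<omega>. \<Phi> (refined 1 j \<omega>)) - expectation (\<lambda>\<omega>. \<Phi> (coarse j \<omega>))) = expectation ?g"
    using i1 i2 i3 sym by simp
  have "\<bar>2 * (expectation (\<lambda>\<omega>. \<Phi> (refined 1 j \<omega>)) - expectation (\<lambda>\<omega>. \<Phi> (coarse j \<omega>)))\<bar>
      \<le> expectation (\<lambda>\<omega>. \<bar>?g \<omega>\<bar>)" unfolding eg by (rule integral_abs_bound)
  also have "\<dots> \<le> expectation ?b"
    using i1 i2 i3 mean_leD(1)[OF mb] pointwise by (intro integral_mono) auto
  also have "\<dots> \<le> C1 * ((K_linear * ?l + K_remainder * ?l) + ((K_high + 1) / 2 * ?l + (K_high + 1) / 2 * ?l))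
      + C2 * (K_strong * ?l + K_strong * ?l)" by (rule mean_leD(2)[OF mb])
  also have "\<dots> = C1 * (K_linear + K_remainder + K_high + 1) * ?l + 2 * C2 * K_strong * ?l"
    by (simp add: algebra_simps)
  finally have "2 * \<bar>expectation (\<lambda>\<omega>. \<Phi> (refined 1 j \<omega>)) - expectation (\<lambda>\<omega>. \<Phi> (coarse j \<omega>))\<bar>
      \<le> C1 * (K_linear + K_remainder + K_high + 1) * ?l + 2 * C2 * K_strong * ?l"
    unfolding abs_mult by simp
  moreover have "x \<le> b" if "2 * x \<le> b" "0 \<le> x" for x b :: real using that by linarith
  ultimately have "\<bar>expectation (\<lambda>\<omega>. \<Phi> (refined 1 j \<omega>)) - expectation (\<lambda>\<omega>. \<Phi> (coarse j \<omega>))\<bar>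
      \<le> C1 * (K_linear + K_remainder + K_high + 1) * ?l + 2 * C2 * K_strong * ?l"
    using abs_ge_zero by blast
  also have "\<dots> = (C1 * (K_remainder + K_linear + K_high + 1) + 2 * C2 * K_strong) * ?l"
    by (simp add: algebra_simps)
  finally show ?thesis unfolding one .
qed

end

section \<open>Brownian increments\<close>

context prob_space
begin

lemma indep_var_of_subalgebras:
  assumes ind: "indep_set (sets G) (sets N)" and sp: "space G = space M" "space N = space M"
    and Y: "Y \<in> measurable G S" and X: "X \<in> measurable N T"
  shows "indep_var S Y T X"
proof -
  have ev: "sets G \<subseteq> events" "sets N \<subseteq> events"
    using ind unfolding indep_set_def indep_sets_def UNIV_bool by auto
  have rY: "Y \<in> measurable M S" and rX: "X \<in> measurable M T"
    using Y X ev sp by (auto intro: measurable_mono[THEN subsetD, OF order_refl refl])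
  have "sigma_sets (space M) {Y -` A \<inter> space M | A. A \<in> sets S} \<subseteq> sets G"
    using Y unfolding sp(1)[symmetric] by (intro sets.sigma_sets_subset) (auto intro: measurable_sets)
  moreover have "sigma_sets (space M) {X -` A \<inter> space M | A. A \<in> sets T} \<subseteq> sets N"
    using X unfolding sp(2)[symmetric] by (intro sets.sigma_sets_subset) (auto intro: measurable_sets)
  ultimately have "indep_set (sigma_sets (space M) {Y -` A \<inter> space M | A. A \<in> sets S})
      (sigma_sets (space M) {X -` A \<inter> space M | A. A \<in> sets T})"
    using ind unfolding indep_set_def
    by (elim indep_sets_mono_sets) (auto split: bool.split)
  then show ?thesis using rX rY by (simp add: indep_var_eq)
qed

lemma centered_normal_moments:
  assumes X: "distributed M lborel X (normal_density 0 s)" and s: "s > 0"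
  shows "integrable M X" "expectation X = 0" "integrable M (\<lambda>\<omega>. (X \<omega>)\<^sup>2)" "expectation (\<lambda>\<omega>. (X \<omega>)\<^sup>2) = s\<^sup>2"
proof -
  show 1: "integrable M X"
    using distributed_integrable[OF X, of "\<lambda>x. x"] integrable_normal_moment[where \<mu> = 0 and \<sigma> = s and k = 1] s
    by simp
  show 2: "expectation X = 0" by (rule normal_distributed_expectation[OF s X])
  show "integrable M (\<lambda>\<omega>. (X \<omega>)\<^sup>2)"
    using distributed_integrable[OF X, of "\<lambda>x. x\<^sup>2"] integrable_normal_moment[where \<mu> = 0 and \<sigma> = s and k = 2] s
    by simp
  show "expectation (\<lambda>\<omega>. (X \<omega>)\<^sup>2) = s\<^sup>2"
    using normal_distributed_variance[OF s X] 2 by simp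
qed

lemma centered_normal_symmetric:
  assumes X: "distributed M lborel X (normal_density 0 s)" and s: "s > 0" and a: "a = 1 \<or> a = - 1"
  shows "distr M borel (\<lambda>\<omega>. a * X \<omega>) = distr M borel X"
proof -
  have "distributed M lborel (\<lambda>\<omega>. 0 + a * X \<omega>) (normal_density (0 + a * 0) (\<bar>a\<bar> * s))"
    using a by (intro normal_density_affine X s) auto
  then have "distributed M lborel (\<lambda>\<omega>. a * X \<omega>) (normal_density 0 s)" using a by auto
  then have "distr M lborel (\<lambda>\<omega>. a * X \<omega>) = distr M lborel X"
    using X by (simp add: distributed_def)
  then show ?thesis by (simp cong: distr_cong)
qed

end

locale wiener = prob_space M for M :: "'w measure" +
  fixes Fil :: "real \<Rightarrow> 'w measure" and B :: "nat \<Rightarrow> real \<Rightarrow> 'w \<Rightarrow> real"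
  assumes filtr: "filtration_of M Fil" and wiener: "wiener_coordinates M Fil B"
begin

lemma filtration: "t \<ge> 0 \<Longrightarrow> space (Fil t) = space M" "t \<ge> 0 \<Longrightarrow> sets (Fil t) \<subseteq> sets M"
  "0 \<le> s \<Longrightarrow> s \<le> t \<Longrightarrow> sets (Fil s) \<subseteq> sets (Fil t)"
  using filtr unfolding filtration_of_def by auto

lemma brownian: "i \<ge> 1 \<Longrightarrow> brownian_motion M Fil (B i)"
  using wiener by (simp add: wiener_coordinates_def)

lemma measurable_Fil_mono: "0 \<le> s \<Longrightarrow> s \<le> t \<Longrightarrow> f \<in> borel_measurable (Fil s) \<Longrightarrow> f \<in> borel_measurable (Fil t)"
  by (rule measurable_mono[THEN subsetD, OF order_refl refl filtration(3), rotated 3]) (auto simp: filtration)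

lemma measurable_Fil: "0 \<le> s \<Longrightarrow> f \<in> borel_measurable (Fil s) \<Longrightarrow> f \<in> borel_measurable M"
  by (rule measurable_mono[THEN subsetD, OF order_refl refl filtration(2), rotated 2]) (auto simp: filtration)

lemma B_measurable_Fil: "i \<ge> 1 \<Longrightarrow> t \<ge> 0 \<Longrightarrow> B i t \<in> borel_measurable (Fil t)"
  using brownian by (auto simp: brownian_motion_def adapted_def)

lemma B_measurable: "i \<ge> 1 \<Longrightarrow> t \<ge> 0 \<Longrightarrow> B i t \<in> borel_measurable M"
  using measurable_Fil B_measurable_Fil by blast

lemma B_zero: "i \<ge> 1 \<Longrightarrow> AE \<omega> in M. B i 0 \<omega> = 0"
  using brownian by (auto simp: brownian_motion_def)

lemma B_continuous: "i \<ge> 1 \<Longrightarrow> AE \<omega> in M. continuous_on {0..} (\<lambda>t. B i t \<omega>)"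
  using brownian by (auto simp: brownian_motion_def)

lemma increment_normal:
  "i \<ge> 1 \<Longrightarrow> 0 \<le> s \<Longrightarrow> s < t \<Longrightarrow>
    distributed M lborel (\<lambda>\<omega>. B i t \<omega> - B i s \<omega>) (normal_density 0 (sqrt (t - s)))"
  using brownian by (auto simp: brownian_motion_def)

text \<open>The future increments of all modes form one random element independent of the past, hence
  any measurable function of them is independent of the past too.\<close>

lemma increments_indep_of_past:
  assumes s: "0 \<le> s" and Y: "Y \<in> measurable (Fil s) S"
    and g: "g \<in> measurable (PiM ({1..} \<times> {s..}) (\<lambda>_. borel)) T"
  shows "indep_var S Y T (\<lambda>\<omega>. g (\<lambda>k\<in>{1..} \<times> {s..}. B (fst k) (snd k) \<omega> - B (fst k) s \<omega>))"
proof -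
  let ?W = "\<lambda>\<omega>. \<lambda>k\<in>{1..} \<times> {s..}. B (fst k) (snd k) \<omega> - B (fst k) s \<omega>"
  let ?P = "PiM ({1..} \<times> {s..}) (\<lambda>_. borel) :: (nat \<times> real \<Rightarrow> real) measure"
  have ind: "indep_set (sets (Fil s)) (sets (vimage_algebra (space M) ?W ?P))"
    using wiener s by (simp add: wiener_coordinates_def)
  have W: "?W \<in> measurable (vimage_algebra (space M) ?W ?P) ?P"
    by (rule measurable_vimage_algebra1) (auto simp: space_PiM)
  show ?thesis
    by (rule indep_var_of_subalgebras[OF ind _ _ Y]) (use s filtration measurable_compose[OF W g] in auto)
qed

lemma increment_indep_of_past:
  assumes "i \<ge> 1" "0 \<le> s" "s \<le> t" and Y: "Y \<in> measurable (Fil s) S"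
  shows "indep_var S Y borel (\<lambda>\<omega>. B i t \<omega> - B i s \<omega>)"
proof -
  have "(\<lambda>f. f (i, t)) \<in> measurable (PiM ({1..} \<times> {s..}) (\<lambda>_. borel)) (borel :: real measure)"
    using assms by (intro measurable_component_singleton) auto
  from increments_indep_of_past[OF assms(2) Y this] show ?thesis using assms by simp
qed

lemma increments_indep_modes:
  assumes "finite I" "I \<subseteq> {1..}" "0 \<le> s" "s \<le> t"
  shows "indep_vars (\<lambda>_. borel) (\<lambda>i \<omega>. B i t \<omega> - B i s \<omega>) I"
proof -
  have "indep_vars (\<lambda>_. PiM {0..} (\<lambda>_. borel)) (\<lambda>i \<omega>. \<lambda>t\<in>{0..}. B i t \<omega>) I"
    using wiener assms(2) by (auto simp: wiener_coordinates_def intro: indep_vars_subset)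
  from indep_vars_compose2[OF this, of "\<lambda>_ f. f t - f s" "\<lambda>_. borel"]
  have "indep_vars (\<lambda>_. borel) (\<lambda>i \<omega>. (\<lambda>t\<in>{0..}. B i t \<omega>) t - (\<lambda>t\<in>{0..}. B i t \<omega>) s) I"
    using assms by (auto intro!: borel_measurable_diff measurable_component_singleton)
  then show ?thesis using assms by simp
qed

text \<open>The increments of the modes are independent, so their joint law is the product of the
  marginal laws, and each centred normal law is even.\<close>

lemma modes_law_symmetric:
  fixes v :: "nat \<Rightarrow> 'a::{real_normed_vector,second_countable_topology}"
  assumes I: "finite I" "I \<subseteq> {1..}" and st: "0 \<le> s" "s < t" and \<sigma>: "\<And>i. \<sigma> i = 1 \<or> \<sigma> i = - 1"
  shows "distr M borel (\<lambda>\<omega>. \<Sum>i\<in>I. (\<sigma> i * a i * (B i t \<omega> - B i s \<omega>)) *\<^sub>R v i)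
    = distr M borel (\<lambda>\<omega>. \<Sum>i\<in>I. (1 * a i * (B i t \<omega> - B i s \<omega>)) *\<^sub>R v i)"
proof (cases "I = {}")
  case False
  let ?\<xi> = "\<lambda>i \<omega>. B i t \<omega> - B i s \<omega>"
  have rv: "?\<xi> i \<in> borel_measurable M" if "i \<in> I" for i
    using that I st by (auto intro!: borel_measurable_diff B_measurable)
  have ind: "indep_vars (\<lambda>_. borel) ?\<xi> I" by (rule increments_indep_modes) (use I st in auto)
  have ind': "indep_vars (\<lambda>_. borel) (\<lambda>i \<omega>. \<sigma> i * ?\<xi> i \<omega>) I"
    by (rule indep_vars_compose2[OF ind]) auto
  define g where "g f = (\<Sum>i\<in>I. (a i * f i) *\<^sub>R v i)" for f
  have g: "g \<in> borel_measurable (PiM I (\<lambda>_. borel))"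
    unfolding g_def[abs_def] by measurable
  have law: "distr M borel (\<lambda>\<omega>. \<Sum>i\<in>I. (\<tau> i * a i * ?\<xi> i \<omega>) *\<^sub>R v i)
      = distr (PiM I (\<lambda>i. distr M borel (?\<xi> i))) borel g"
    if \<tau>: "\<And>i. \<tau> i = 1 \<or> \<tau> i = - 1" and ind: "indep_vars (\<lambda>_. borel) (\<lambda>i \<omega>. \<tau> i * ?\<xi> i \<omega>) I" for \<tau>
  proof -
    have rv': "(\<lambda>\<omega>. \<tau> i * ?\<xi> i \<omega>) \<in> borel_measurable M" if "i \<in> I" for i using rv[OF that] by simp
    have m: "(\<lambda>\<omega>. \<lambda>i\<in>I. \<tau> i * ?\<xi> i \<omega>) \<in> measurable M (PiM I (\<lambda>_. borel))"
      by (intro measurable_restrict rv')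
    have "distr M borel (\<lambda>\<omega>. \<Sum>i\<in>I. (\<tau> i * a i * ?\<xi> i \<omega>) *\<^sub>R v i) = distr M borel (g \<circ> (\<lambda>\<omega>. \<lambda>i\<in>I. \<tau> i * ?\<xi> i \<omega>))"
      by (rule arg_cong[where f = "distr M borel"]) (auto simp: g_def fun_eq_iff mult_ac intro!: sum.cong)
    also have "\<dots> = distr (distr M (PiM I (\<lambda>_. borel)) (\<lambda>\<omega>. \<lambda>i\<in>I. \<tau> i * ?\<xi> i \<omega>)) borel g"
      by (rule distr_distr[OF g m, symmetric])
    also have "distr M (PiM I (\<lambda>_. borel)) (\<lambda>\<omega>. \<lambda>i\<in>I. \<tau> i * ?\<xi> i \<omega>) = PiM I (\<lambda>i. distr M borel (\<lambda>\<omega>. \<tau> i * ?\<xi> i \<omega>))"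
      using indep_vars_iff_distr_eq_PiM'[OF False, where M' = "\<lambda>_. borel" and X = "\<lambda>i \<omega>. \<tau> i * ?\<xi> i \<omega>"] rv' ind by simp
    also have "\<dots> = PiM I (\<lambda>i. distr M borel (?\<xi> i))"
      using I st \<tau> by (intro PiM_cong refl centered_normal_symmetric[OF increment_normal]) auto
    finally show ?thesis .
  qed
  have "distr M borel (\<lambda>\<omega>. \<Sum>i\<in>I. (1 * a i * ?\<xi> i \<omega>) *\<^sub>R v i)
      = distr (PiM I (\<lambda>i. distr M borel (?\<xi> i))) borel g"
    by (rule law) (use ind in auto)
  then show ?thesis using law[OF \<sigma> ind'] by (simp only:)
qed simp

end

section \<open>The Ito isometry for step functions\<close>

lemma integral_grid_sum:
  fixes f :: "real \<Rightarrow> 'a::banach"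
  assumes h: "0 \<le> h" and f: "f integrable_on {0..real k * h}"
  shows "integral {0..real k * h} f = (\<Sum>j<k. integral {real j * h..real (Suc j) * h} f)"
  using f
proof (induction k)
  case (Suc k)
  have le: "0 \<le> real k * h" "real k * h \<le> real (Suc k) * h" using h by (auto simp: distrib_right)
  have "f integrable_on {0..real k * h}"
    by (rule integrable_on_subinterval[OF Suc.prems]) (use le in auto)
  then have "integral {0..real k * h} f = (\<Sum>j<k. integral {real j * h..real (Suc j) * h} f)" by (rule Suc.IH)
  then show ?case using Henstock_Kurzweil_Integration.integral_combine[OF le Suc.prems] by simp
qed simp

lemma exp_kernel_has_integral:
  fixes l t :: real
  assumes "a \<le> b"
  shows "((\<lambda>s. l * exp (- (l * (t - s)))) has_integral (exp (- (l * (t - b))) - exp (- (l * (t - a))))) {a..b}"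
  by (rule fundamental_theorem_of_calculus[OF assms])
     (auto intro!: derivative_eq_intros simp: has_real_derivative_iff_has_vector_derivative[symmetric])

lemma uniform_grid_oscillation:
  fixes b :: "real \<Rightarrow> 'a::metric_space"
  assumes b: "continuous_on {0..t} b" and t: "0 \<le> t" and \<epsilon>: "0 < \<epsilon>"
  shows "\<forall>\<^sub>F m in sequentially. \<forall>j<m. \<forall>s. real j * (t / real m) \<le> s \<longrightarrow> s \<le> real (Suc j) * (t / real m) \<longrightarrow>
    dist (b s) (b (real j * (t / real m))) < \<epsilon>"
proof -
  have "uniformly_continuous_on {0..t} b" by (rule compact_uniformly_continuous[OF b]) simp
  then obtain d where d: "d > 0" "\<And>x x'. x \<in> {0..t} \<Longrightarrow> x' \<in> {0..t} \<Longrightarrow> dist x' x < d \<Longrightarrow> dist (b x') (b x) < \<epsilon>"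
    unfolding uniformly_continuous_on_def using \<epsilon> by meson
  have "(\<lambda>m. t / real m) \<longlonglongrightarrow> 0" by (rule lim_const_over_n)
  then have "\<forall>\<^sub>F m in sequentially. t / real m < d" using d(1) by (rule order_tendstoD(2))
  then show ?thesis
    using eventually_gt_at_top[of 0]
  proof eventually_elim
    case (elim m)
    show ?case
    proof (intro allI impI)
      fix j s assume j: "j < m" and s: "real j * (t / real m) \<le> s" "s \<le> real (Suc j) * (t / real m)"
      have h: "0 \<le> t / real m" using t by simp
      have "real (Suc j) * (t / real m) \<le> real m * (t / real m)" using j h by (intro mult_right_mono) auto
      then have top: "real (Suc j) * (t / real m) \<le> t" using elim(2) by simp
      have bot: "0 \<le> real j * (t / real m)" using h by (intro mult_nonneg_nonneg) auto
      have "real (Suc j) * x = real j * x + x" for x by (simp add: algebra_simps)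
      from this[of "t / real m"] have "0 \<le> s - real j * (t / real m)" "s - real j * (t / real m) < d" using s elim(1) by linarith+
      then have "dist s (real j * (t / real m)) < d" by (simp only: dist_real_def abs_of_nonneg)
      then show "dist (b s) (b (real j * (t / real m))) < \<epsilon>" using s top bot by (intro d(2)) auto
    qed
  qed
qed

text \<open>Abel summation moves the differences from the path \<open>b\<close>, whose variation may be infinite,
  to the smooth kernel; uniform continuity of \<open>b\<close> then makes the sums converge to an
  integral.\<close>

lemma stieltjes_sum_tendsto:
  fixes b :: "real \<Rightarrow> real"
  assumes b: "continuous_on {0..t} b" and t: "0 \<le> t" and l: "0 \<le> l"
  defines "\<phi> \<equiv> \<lambda>s. exp (- (l * (t - s)))"
  shows "(\<lambda>m. \<Sum>j<m. (b (real (Suc j) * (t / real m)) - b (real j * (t / real m))) * \<phi> (real (Suc j) * (t / real m)))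
    \<longlonglongrightarrow> b t - \<phi> 0 * b 0 - l * integral {0..t} (\<lambda>s. \<phi> s * b s)"
proof (rule LIMSEQ_I)
  fix r :: real assume r: "r > 0"
  have "\<forall>\<^sub>F m in sequentially. \<forall>j<m. \<forall>s. real j * (t / real m) \<le> s \<longrightarrow> s \<le> real (Suc j) * (t / real m) \<longrightarrow>
    dist (b s) (b (real j * (t / real m))) < r / 2"
    by (rule uniform_grid_oscillation[OF b t]) (use r in simp)
  then have "\<forall>\<^sub>F m in sequentially. norm ((\<Sum>j<m. (b (real (Suc j) * (t / real m)) - b (real j * (t / real m))) * \<phi> (real (Suc j) * (t / real m)))
     - (b t - \<phi> 0 * b 0 - l * integral {0..t} (\<lambda>s. \<phi> s * b s))) < r"
    using eventually_gt_at_top[of 0]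
  proof eventually_elim
    case (elim m)
    define h where "h = t / real m"
    have h: "0 \<le> h" "real m * h = t" using t elim(2) by (simp_all add: h_def)
    define g where "g j = real j * h" for j
    have mono: "g j \<le> g (Suc j)" for j using h by (simp add: g_def distrib_right)
    have g0: "g 0 = 0" "g m = t" using h by (simp_all add: g_def)
    have top: "g (Suc j) \<le> t" if "j < m" for j
    proof -
      have "g (Suc j) \<le> real m * h" unfolding g_def using that h by (intro mult_right_mono) auto
      then show ?thesis using h by simp
    qed
    have bot: "0 \<le> g j" for j using h by (simp add: g_def)
    have ci: "continuous_on {0..t} (\<lambda>s. l * \<phi> s * b s)"
      unfolding \<phi>_def by (intro continuous_intros b)
    have int: "integral {0..t} (\<lambda>s. l * \<phi> s * b s) = (\<Sum>j<m. integral {g j..g (Suc j)} (\<lambda>s. l * \<phi> s * b s))"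
      using integral_grid_sum[OF h(1), of "\<lambda>s. l * \<phi> s * b s" m] integrable_continuous_real[OF ci] h
      by (simp add: g_def)
    have local: "\<bar>integral {g j..g (Suc j)} (\<lambda>s. l * \<phi> s * b s) - b (g j) * (\<phi> (g (Suc j)) - \<phi> (g j))\<bar>
        \<le> (r / 2) * (\<phi> (g (Suc j)) - \<phi> (g j))" if j: "j < m" for j
    proof -
      have k: "((\<lambda>s. l * \<phi> s) has_integral (\<phi> (g (Suc j)) - \<phi> (g j))) {g j..g (Suc j)}"
        unfolding \<phi>_def by (rule exp_kernel_has_integral[OF mono])
      have sub: "{g j..g (Suc j)} \<subseteq> {0..t}" using bot[of j] top[OF j] by auto
      have i1: "(\<lambda>s. l * \<phi> s * b s) integrable_on {g j..g (Suc j)}"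
        by (intro integrable_continuous_real continuous_on_subset[OF ci sub])
      have i2: "((\<lambda>s. b (g j) * (l * \<phi> s)) has_integral (b (g j) * (\<phi> (g (Suc j)) - \<phi> (g j)))) {g j..g (Suc j)}"
        by (rule has_integral_mult_right[OF k])
      have i3: "((\<lambda>s. (r / 2) * (l * \<phi> s)) has_integral ((r / 2) * (\<phi> (g (Suc j)) - \<phi> (g j)))) {g j..g (Suc j)}"
        by (rule has_integral_mult_right[OF k])
      have d: "((\<lambda>s. l * \<phi> s * b s - b (g j) * (l * \<phi> s)) has_integral
          (integral {g j..g (Suc j)} (\<lambda>s. l * \<phi> s * b s) - b (g j) * (\<phi> (g (Suc j)) - \<phi> (g j)))) {g j..g (Suc j)}"
        by (rule has_integral_diff[OF integrable_integral[OF i1] i2])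
      have "norm (integral {g j..g (Suc j)} (\<lambda>s. l * \<phi> s * b s - b (g j) * (l * \<phi> s)))
          \<le> integral {g j..g (Suc j)} (\<lambda>s. (r / 2) * (l * \<phi> s))"
      proof (rule integral_norm_bound_integral)
        fix s assume s: "s \<in> {g j..g (Suc j)}"
        have "dist (b s) (b (g j)) < r / 2" using elim(1) j s unfolding g_def h_def by auto
        then have "\<bar>b s - b (g j)\<bar> \<le> r / 2" by (simp add: dist_real_def)
        moreover have "0 \<le> l * \<phi> s" using l by (simp add: \<phi>_def)
        ultimately have "(l * \<phi> s) * \<bar>b s - b (g j)\<bar> \<le> (l * \<phi> s) * (r / 2)" by (intro mult_left_mono)
        moreover have "norm (l * \<phi> s * b s - b (g j) * (l * \<phi> s)) = (l * \<phi> s) * \<bar>b s - b (g j)\<bar>"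
          unfolding mult.commute[of "b (g j)"] right_diff_distrib[symmetric] real_norm_def abs_mult[of "l * \<phi> s"]
          using \<open>0 \<le> l * \<phi> s\<close> by (simp only: abs_of_nonneg)
        ultimately show "norm (l * \<phi> s * b s - b (g j) * (l * \<phi> s)) \<le> (r / 2) * (l * \<phi> s)"
          by (simp add: mult.commute)
      qed (use d i3 in \<open>auto dest: has_integral_integrable\<close>)
      then show ?thesis unfolding integral_unique[OF d] integral_unique[OF i3] real_norm_def .
    qed
    have tele: "(\<Sum>j<m. \<phi> (g (Suc j)) * b (g (Suc j)) - \<phi> (g j) * b (g j)) = \<phi> t * b t - \<phi> 0 * b 0"
      using sum_lessThan_telescope[of "\<lambda>j. \<phi> (g j) * b (g j)" m] g0 by simp
    have abel: "(\<Sum>j<m. (b (g (Suc j)) - b (g j)) * \<phi> (g (Suc j)))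
        = \<phi> t * b t - \<phi> 0 * b 0 - (\<Sum>j<m. b (g j) * (\<phi> (g (Suc j)) - \<phi> (g j)))"
      unfolding tele[symmetric] sum_subtractf[symmetric] by (intro sum.cong refl) (simp add: algebra_simps)
    have \<phi>t: "\<phi> t = 1" by (simp add: \<phi>_def)
    have "integral {0..t} (\<lambda>s. l * \<phi> s * b s) = l * integral {0..t} (\<lambda>s. \<phi> s * b s)"
      by (simp add: mult.assoc)
    then have "(\<Sum>j<m. (b (g (Suc j)) - b (g j)) * \<phi> (g (Suc j))) - (b t - \<phi> 0 * b 0 - l * integral {0..t} (\<lambda>s. \<phi> s * b s))
        = (\<Sum>j<m. integral {g j..g (Suc j)} (\<lambda>s. l * \<phi> s * b s) - b (g j) * (\<phi> (g (Suc j)) - \<phi> (g j)))"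
      unfolding abel sum_subtractf using int \<phi>t by simp
    also have "norm \<dots> \<le> (\<Sum>j<m. (r / 2) * (\<phi> (g (Suc j)) - \<phi> (g j)))"
      by (intro sum_norm_le) (use local in auto)
    also have "\<dots> = (r / 2) * (\<phi> t - \<phi> 0)"
      unfolding sum_distrib_left[symmetric] using sum_lessThan_telescope[of "\<lambda>j. \<phi> (g j)" m] g0 by simp
    also have "\<dots> \<le> (r / 2) * 1" using r \<phi>t by (intro mult_left_mono) (auto simp: \<phi>_def)
    also have "\<dots> < r" using r by simp
    finally show ?case unfolding g_def h_def .
  qed
  then show "\<exists>no. \<forall>m\<ge>no. norm ((\<Sum>j<m. (b (real (Suc j) * (t / real m)) - b (real j * (t / real m))) * \<phi> (real (Suc j) * (t / real m)))
     - (b t - \<phi> 0 * b 0 - l * integral {0..t} (\<lambda>s. \<phi> s * b s))) < r"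
    unfolding eventually_sequentially .
qed

lemma step_fun_Cons: "step_fun ((a, c, x) # p) s = indicat_real {a<..c} s *\<^sub>R x + step_fun p s"
  and step_integral_Cons: "step_integral b ((a, c, x) # p) \<omega> = (b c \<omega> - b a \<omega>) *\<^sub>R x + step_integral b p \<omega>"
  by (simp_all add: step_fun_def step_integral_def)

context wiener
begin

lemma increment_moments:
  assumes "i \<ge> 1" "0 \<le> s" "s \<le> t"
  shows "integrable M (\<lambda>\<omega>. B i t \<omega> - B i s \<omega>)" "expectation (\<lambda>\<omega>. B i t \<omega> - B i s \<omega>) = 0"
    "integrable M (\<lambda>\<omega>. (B i t \<omega> - B i s \<omega>)\<^sup>2)" "expectation (\<lambda>\<omega>. (B i t \<omega> - B i s \<omega>)\<^sup>2) = t - s"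
proof -
  have *: "integrable M (\<lambda>\<omega>. B i t \<omega> - B i s \<omega>) \<and> expectation (\<lambda>\<omega>. B i t \<omega> - B i s \<omega>) = 0 \<and>
    integrable M (\<lambda>\<omega>. (B i t \<omega> - B i s \<omega>)\<^sup>2) \<and> expectation (\<lambda>\<omega>. (B i t \<omega> - B i s \<omega>)\<^sup>2) = t - s"
  proof (cases "s = t")
    case False
    then have "s < t" using assms by simp
    then show ?thesis using centered_normal_moments[OF increment_normal[OF assms(1,2)]] by auto
  qed simp
  then show "integrable M (\<lambda>\<omega>. B i t \<omega> - B i s \<omega>)" "expectation (\<lambda>\<omega>. B i t \<omega> - B i s \<omega>) = 0"
    "integrable M (\<lambda>\<omega>. (B i t \<omega> - B i s \<omega>)\<^sup>2)" "expectation (\<lambda>\<omega>. (B i t \<omega> - B i s \<omega>)\<^sup>2) = t - s" by auto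
qed

text \<open>The later increment is independent of the earlier one.\<close>

lemma brownian_covariance:
  assumes i: "i \<ge> 1" and "0 \<le> s" "0 \<le> t"
  shows "integrable M (\<lambda>\<omega>. (B i s \<omega> - B i 0 \<omega>) * (B i t \<omega> - B i 0 \<omega>)) \<and>
    expectation (\<lambda>\<omega>. (B i s \<omega> - B i 0 \<omega>) * (B i t \<omega> - B i 0 \<omega>)) = min s t"
proof -
  have *: "integrable M (\<lambda>\<omega>. (B i s \<omega> - B i 0 \<omega>) * (B i t \<omega> - B i 0 \<omega>)) \<and>
    expectation (\<lambda>\<omega>. (B i s \<omega> - B i 0 \<omega>) * (B i t \<omega> - B i 0 \<omega>)) = s" if st: "0 \<le> s" "s \<le> t" for s t
  proof -
    let ?X = "\<lambda>\<omega>. B i s \<omega> - B i 0 \<omega>" and ?Y = "\<lambda>\<omega>. B i t \<omega> - B i s \<omega>"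
    have "?X \<in> borel_measurable (Fil s)"
      using st i by (intro borel_measurable_diff B_measurable_Fil measurable_Fil_mono[of 0 s]) auto
    then have ind: "indep_var borel ?X borel ?Y" by (rule increment_indep_of_past[OF i st])
    note X = increment_moments[OF i order_refl st(1)] and Y = increment_moments[OF i st]
    have "integrable M (\<lambda>\<omega>. ?X \<omega> * ?Y \<omega>)" by (rule indep_var_integrable[OF ind X(1) Y(1)])
    moreover have "expectation (\<lambda>\<omega>. ?X \<omega> * ?Y \<omega>) = 0"
      using indep_var_lebesgue_integral[OF ind X(1) Y(1)] Y(2) by simp
    moreover have "(B i s \<omega> - B i 0 \<omega>) * (B i t \<omega> - B i 0 \<omega>) = (?X \<omega>)\<^sup>2 + ?X \<omega> * ?Y \<omega>" for \<omega>
      by (simp add: power2_eq_square algebra_simps)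
    ultimately show ?thesis using X(3,4) by simp
  qed
  show ?thesis
  proof (cases "s \<le> t")
    case True
    then show ?thesis using *[of s t] assms by (simp add: min_def)
  next
    case False
    then show ?thesis using *[of t s] assms by (simp add: min_def mult.commute)
  qed
qed

lemma increment_covariance:
  assumes i: "i \<ge> 1" and "0 \<le> a" "a \<le> c" "0 \<le> a'" "a' \<le> c'"
  shows "integrable M (\<lambda>\<omega>. (B i c \<omega> - B i a \<omega>) * (B i c' \<omega> - B i a' \<omega>)) \<and>
    integrable lborel (\<lambda>s. indicat_real {a<..c} s * indicat_real {a'<..c'} s) \<and>
    expectation (\<lambda>\<omega>. (B i c \<omega> - B i a \<omega>) * (B i c' \<omega> - B i a' \<omega>))
      = (LINT s|lborel. indicat_real {a<..c} s * indicat_real {a'<..c'} s)"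
proof -
  let ?X = "\<lambda>t \<omega>. B i t \<omega> - B i 0 \<omega>"
  have eq: "(B i c \<omega> - B i a \<omega>) * (B i c' \<omega> - B i a' \<omega>)
     = ?X c \<omega> * ?X c' \<omega> - ?X c \<omega> * ?X a' \<omega> - ?X a \<omega> * ?X c' \<omega> + ?X a \<omega> * ?X a' \<omega>" for \<omega>
    by (simp add: algebra_simps)
  have c: "integrable M (\<lambda>\<omega>. ?X s \<omega> * ?X t \<omega>)" "expectation (\<lambda>\<omega>. ?X s \<omega> * ?X t \<omega>) = min s t"
    if "0 \<le> s" "0 \<le> t" for s t using brownian_covariance[OF i that] by auto
  have "0 \<le> c" "0 \<le> c'" using assms by auto
  then have L: "integrable M (\<lambda>\<omega>. (B i c \<omega> - B i a \<omega>) * (B i c' \<omega> - B i a' \<omega>))"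
    "expectation (\<lambda>\<omega>. (B i c \<omega> - B i a \<omega>) * (B i c' \<omega> - B i a' \<omega>)) = min c c' - min c a' - min a c' + min a a'"
    unfolding eq using assms c by auto
  have ind: "indicat_real {a<..c} s * indicat_real {a'<..c'} s = indicat_real {max a a'<..min c c'} s" for s
    by (auto simp: indicator_def)
  have R: "integrable lborel (indicat_real {max a a'<..min c c'})"
    "measure lborel {max a a'<..min c c'} = min c c' - min c a' - min a c' + min a a'"
  proof -
    consider "max a a' \<le> min c c'" | "min c c' < max a a'" by linarith
    then have "emeasure lborel {max a a'<..min c c'} < \<infinity> \<and>
        measure lborel {max a a'<..min c c'} = min c c' - min c a' - min a c' + min a a'"
    proof cases
      case 1
      then have "measure lborel {max a a'<..min c c'} = min c c' - max a a'" by simp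
      also have "\<dots> = min c c' - min c a' - min a c' + min a a'"
      proof -
        have "a \<le> c'" "a' \<le> c" using 1 by auto
        then show ?thesis using assms by (auto simp: min_def max_def)
      qed
      finally show ?thesis using 1 by simp
    next
      case 2
      then have e: "{max a a'<..min c c'} = {}" by auto
      have "min c c' - min c a' - min a c' + min a a' = 0"
        using 2 assms by (auto simp: min_def max_def split: if_splits)
      then show ?thesis unfolding e by simp
    qed
    then show "integrable lborel (indicat_real {max a a'<..min c c'})"
      "measure lborel {max a a'<..min c c'} = min c c' - min c a' - min a c' + min a a'"
      by (auto intro: integrable_real_indicator)
  qed
  have "(LINT s|lborel. indicat_real {max a a'<..min c c'} s) = measure lborel {max a a'<..min c c'}" by simp
  also note R(2)
  finally show ?thesis unfolding ind using L R(1) by simp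
qed

text \<open>Both sides are bilinear in the lists, which reduces the claim to two intervals. The
  intervals within a list may overlap, so the two-interval case has to cover every
  relative position.\<close>

lemma step_isometry:
  fixes p p' :: "(real \<times> real \<times> 'a::{real_inner,banach,second_countable_topology}) list"
  assumes i: "i \<ge> 1" and p: "\<forall>(a, c, x)\<in>set p. 0 \<le> a \<and> a \<le> c" and p': "\<forall>(a, c, x)\<in>set p'. 0 \<le> a \<and> a \<le> c"
  shows "integrable M (\<lambda>\<omega>. inner (step_integral (B i) p \<omega>) (step_integral (B i) p' \<omega>)) \<and>
    integrable lborel (\<lambda>s. inner (step_fun p s) (step_fun p' s)) \<and>
    expectation (\<lambda>\<omega>. inner (step_integral (B i) p \<omega>) (step_integral (B i) p' \<omega>))
      = (LINT s|lborel. inner (step_fun p s) (step_fun p' s))"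
  using p
proof (induction p)
  case Nil
  show ?case by (simp add: step_integral_def step_fun_def)
next
  case (Cons y p)
  obtain a c x where y: "y = (a, c, x)" by (cases y)
  have ac: "0 \<le> a" "a \<le> c" using Cons.prems y by auto
  have one: "integrable M (\<lambda>\<omega>. inner ((B i c \<omega> - B i a \<omega>) *\<^sub>R x) (step_integral (B i) p' \<omega>)) \<and>
    integrable lborel (\<lambda>s. inner (indicat_real {a<..c} s *\<^sub>R x) (step_fun p' s)) \<and>
    expectation (\<lambda>\<omega>. inner ((B i c \<omega> - B i a \<omega>) *\<^sub>R x) (step_integral (B i) p' \<omega>))
      = (LINT s|lborel. inner (indicat_real {a<..c} s *\<^sub>R x) (step_fun p' s))"
    using p'
  proof (induction p')
    case Nil
    show ?case by (simp add: step_integral_def step_fun_def)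
  next
    case (Cons z p')
    obtain a' c' x' where z: "z = (a', c', x')" by (cases z)
    have ac': "0 \<le> a'" "a' \<le> c'" using Cons.prems z by auto
    note cov = increment_covariance[OF i ac ac']
    have IH: "integrable M (\<lambda>\<omega>. inner ((B i c \<omega> - B i a \<omega>) *\<^sub>R x) (step_integral (B i) p' \<omega>))"
      "integrable lborel (\<lambda>s. inner (indicat_real {a<..c} s *\<^sub>R x) (step_fun p' s))"
      "expectation (\<lambda>\<omega>. inner ((B i c \<omega> - B i a \<omega>) *\<^sub>R x) (step_integral (B i) p' \<omega>))
      = (LINT s|lborel. inner (indicat_real {a<..c} s *\<^sub>R x) (step_fun p' s))" using Cons by auto
    have e1: "inner ((B i c \<omega> - B i a \<omega>) *\<^sub>R x) (step_integral (B i) (z # p') \<omega>)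
      = inner x x' * ((B i c \<omega> - B i a \<omega>) * (B i c' \<omega> - B i a' \<omega>))
        + inner ((B i c \<omega> - B i a \<omega>) *\<^sub>R x) (step_integral (B i) p' \<omega>)" for \<omega>
      by (simp add: step_integral_Cons z inner_add_right algebra_simps)
    have e2: "inner (indicat_real {a<..c} s *\<^sub>R x) (step_fun (z # p') s)
      = inner x x' * (indicat_real {a<..c} s * indicat_real {a'<..c'} s)
        + inner (indicat_real {a<..c} s *\<^sub>R x) (step_fun p' s)" for s
      by (simp add: step_fun_Cons z inner_add_right algebra_simps)
    have m1: "integrable M (\<lambda>\<omega>. inner x x' * ((B i c \<omega> - B i a \<omega>) * (B i c' \<omega> - B i a' \<omega>)))"
      and m2: "integrable lborel (\<lambda>s. inner x x' * (indicat_real {a<..c} s * indicat_real {a'<..c'} s))"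
      using cov by (auto intro!: integrable_mult_right)
    show ?case
      unfolding e1 e2 Bochner_Integration.integral_add[OF m1 IH(1)] Bochner_Integration.integral_add[OF m2 IH(2)]
      using Bochner_Integration.integrable_add[OF m1 IH(1)] Bochner_Integration.integrable_add[OF m2 IH(2)] cov IH(3)
      by (simp only: integral_mult_right_zero)
  qed
  have IH: "integrable M (\<lambda>\<omega>. inner (step_integral (B i) p \<omega>) (step_integral (B i) p' \<omega>))"
    "integrable lborel (\<lambda>s. inner (step_fun p s) (step_fun p' s))"
    "expectation (\<lambda>\<omega>. inner (step_integral (B i) p \<omega>) (step_integral (B i) p' \<omega>))
      = (LINT s|lborel. inner (step_fun p s) (step_fun p' s))" using Cons by auto
  have e1: "inner (step_integral (B i) (y # p) \<omega>) (step_integral (B i) p' \<omega>)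
    = inner ((B i c \<omega> - B i a \<omega>) *\<^sub>R x) (step_integral (B i) p' \<omega>)
      + inner (step_integral (B i) p \<omega>) (step_integral (B i) p' \<omega>)" for \<omega>
    by (simp add: step_integral_Cons y inner_add_left)
  have e2: "inner (step_fun (y # p) s) (step_fun p' s)
    = inner (indicat_real {a<..c} s *\<^sub>R x) (step_fun p' s) + inner (step_fun p s) (step_fun p' s)" for s
    by (simp add: step_fun_Cons y inner_add_left)
  show ?case
    unfolding e1 e2 using one IH by simp
qed

lemma step_isometry_diff:
  fixes p p' :: "(real \<times> real \<times> 'a::{real_inner,banach,second_countable_topology}) list"
  assumes i: "i \<ge> 1" and p: "\<forall>(a, c, x)\<in>set p. 0 \<le> a \<and> a \<le> c" and p': "\<forall>(a, c, x)\<in>set p'. 0 \<le> a \<and> a \<le> c"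
  shows "(\<integral>\<^sup>+ \<omega>. ennreal ((norm (step_integral (B i) p \<omega> - step_integral (B i) p' \<omega>))\<^sup>2) \<partial>M)
    = (\<integral>\<^sup>+ s. ennreal ((norm (step_fun p s - step_fun p' s))\<^sup>2) \<partial>lborel)"
proof -
  note iso = step_isometry[OF i p p] step_isometry[OF i p p'] step_isometry[OF i p' p']
  have sq: "(norm (x - y))\<^sup>2 = inner x x - 2 * inner x y + inner y y" for x y :: 'a
    by (simp add: power2_norm_eq_inner inner_diff_left inner_diff_right inner_commute)
  have i1: "integrable M (\<lambda>\<omega>. (norm (step_integral (B i) p \<omega> - step_integral (B i) p' \<omega>))\<^sup>2)"
    and i2: "integrable lborel (\<lambda>s. (norm (step_fun p s - step_fun p' s))\<^sup>2)"
    unfolding sq using iso by auto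
  have "(\<integral>\<^sup>+ \<omega>. ennreal ((norm (step_integral (B i) p \<omega> - step_integral (B i) p' \<omega>))\<^sup>2) \<partial>M)
    = ennreal (expectation (\<lambda>\<omega>. (norm (step_integral (B i) p \<omega> - step_integral (B i) p' \<omega>))\<^sup>2))"
    by (rule nn_integral_eq_integral[OF i1]) simp
  also have "expectation (\<lambda>\<omega>. (norm (step_integral (B i) p \<omega> - step_integral (B i) p' \<omega>))\<^sup>2)
    = (LINT s|lborel. (norm (step_fun p s - step_fun p' s))\<^sup>2)"
    unfolding sq using iso by simp
  also have "ennreal \<dots> = (\<integral>\<^sup>+ s. ennreal ((norm (step_fun p s - step_fun p' s))\<^sup>2) \<partial>lborel)"
    by (rule nn_integral_eq_integral[OF i2, symmetric]) simp
  finally show ?thesis .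
qed

lemma step_integral_measurable:
  fixes p :: "(real \<times> real \<times> 'a::{real_inner,banach,second_countable_topology}) list"
  assumes "i \<ge> 1" "\<forall>(a, c, x)\<in>set p. 0 \<le> a \<and> a \<le> c"
  shows "step_integral (B i) p \<in> borel_measurable M"
  using assms(2)
proof (induction p)
  case Nil
  show ?case by (simp add: step_integral_def[abs_def])
next
  case (Cons y p)
  obtain a c x where y: "y = (a, c, x)" by (cases y)
  have "0 \<le> a" "0 \<le> c" using Cons.prems y by auto
  note [measurable] = B_measurable[OF assms(1) this(1)] B_measurable[OF assms(1) this(2)]
  have "step_integral (B i) p \<in> borel_measurable M" using Cons by auto
  then have "(\<lambda>\<omega>. (B i c \<omega> - B i a \<omega>) *\<^sub>R x + step_integral (B i) p \<omega>) \<in> borel_measurable M" by measurable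
  then show ?case unfolding y step_integral_Cons[abs_def] .
qed

end

section \<open>Wiener integrals of exponential kernels\<close>

lemma grid_cell:
  fixes h s :: real
  assumes "0 < s" "s \<le> real m * h"
  shows "\<exists>k<m. real k * h < s \<and> s \<le> real (Suc k) * h"
  using assms(2)
proof (induction m)
  case (Suc m)
  show ?case
  proof (cases "s \<le> real m * h")
    case True
    then show ?thesis using Suc.IH less_Suc_eq by blast
  next
    case False
    then show ?thesis using Suc.prems by (intro exI[of _ m]) auto
  qed
qed (use assms(1) in simp)

lemma norm_sq_triangle_ennreal:
  fixes a b c :: "'a::real_normed_vector"
  shows "ennreal ((norm (a - b))\<^sup>2) \<le> 2 * ennreal ((norm (a - c))\<^sup>2) + 2 * ennreal ((norm (c - b))\<^sup>2)"
proof -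
  have "(norm (a - b))\<^sup>2 \<le> 2 * (norm (a - c))\<^sup>2 + 2 * (norm (c - b))\<^sup>2"
    using norm_add_sq_le[of "a - c" "c - b"] by simp
  then have "ennreal ((norm (a - b))\<^sup>2) \<le> ennreal (2 * (norm (a - c))\<^sup>2 + 2 * (norm (c - b))\<^sup>2)"
    by (rule ennreal_leI)
  also have "\<dots> = 2 * ennreal ((norm (a - c))\<^sup>2) + 2 * ennreal ((norm (c - b))\<^sup>2)"
    by (simp add: ennreal_plus ennreal_mult)
  finally show ?thesis .
qed

lemma nn_integral_norm_sq_triangle:
  fixes a b c :: "'x \<Rightarrow> 'a::{real_normed_vector,second_countable_topology}"
  assumes [measurable]: "a \<in> borel_measurable N" "b \<in> borel_measurable N" "c \<in> borel_measurable N"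
  shows "(\<integral>\<^sup>+ x. ennreal ((norm (a x - b x))\<^sup>2) \<partial>N)
    \<le> 2 * (\<integral>\<^sup>+ x. ennreal ((norm (a x - c x))\<^sup>2) \<partial>N) + 2 * (\<integral>\<^sup>+ x. ennreal ((norm (c x - b x))\<^sup>2) \<partial>N)"
proof -
  have "(\<integral>\<^sup>+ x. ennreal ((norm (a x - b x))\<^sup>2) \<partial>N)
    \<le> (\<integral>\<^sup>+ x. 2 * ennreal ((norm (a x - c x))\<^sup>2) + 2 * ennreal ((norm (c x - b x))\<^sup>2) \<partial>N)"
    by (rule nn_integral_mono) (rule norm_sq_triangle_ennreal)
  also have "\<dots> = 2 * (\<integral>\<^sup>+ x. ennreal ((norm (a x - c x))\<^sup>2) \<partial>N) + 2 * (\<integral>\<^sup>+ x. ennreal ((norm (c x - b x))\<^sup>2) \<partial>N)"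
    by (subst nn_integral_add) (auto simp: nn_integral_cmult)
  finally show ?thesis .
qed

lemma tendsto_double_zero_ennreal:
  assumes "f \<longlonglongrightarrow> (0::ennreal)" shows "(\<lambda>k. 2 * f k) \<longlonglongrightarrow> 0"
  using tendsto_add[OF assms assms] by (simp add: mult_2)

lemma measurable_step_fun [measurable]:
  "step_fun p \<in> borel_measurable (borel :: real measure)" for p :: "(real \<times> real \<times> 'a::{real_normed_vector,second_countable_topology}) list"
proof (induction p)
  case Nil
  show ?case by (simp add: step_fun_def[abs_def])
next
  case (Cons y p)
  note [measurable] = Cons
  obtain a c x where y: "y = (a, c, x)" by (cases y)
  show ?case unfolding y step_fun_Cons[abs_def] by measurable
qed

lemma step_fun_outside:
  assumes "\<forall>(a, c, x)\<in>set p. 0 \<le> a \<and> c \<le> t" "s \<notin> {0..t}"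
  shows "step_fun p s = 0"
  using assms(1)
proof (induction p)
  case (Cons y p)
  obtain a c x where y: "y = (a, c, x)" by (cases y)
  show ?case using Cons assms(2) by (auto simp: y step_fun_Cons indicator_def)
qed (simp add: step_fun_def)

text \<open>The exponential kernel, sampled at the right end points of an equidistant grid.\<close>

definition exp_steps :: "real \<Rightarrow> real \<Rightarrow> 'a::real_vector \<Rightarrow> nat \<Rightarrow> (real \<times> real \<times> 'a) list" where
  "exp_steps l t v m = map (\<lambda>j. (real j * (t / real m), real (Suc j) * (t / real m),
      exp (- (l * (t - real (Suc j) * (t / real m)))) *\<^sub>R v)) [0..<m]"

lemma exp_steps_bounds:
  assumes "0 \<le> t"
  shows "\<forall>(a, c, x)\<in>set (exp_steps l t v m). 0 \<le> a \<and> a \<le> c \<and> c \<le> t"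
proof -
  have "0 \<le> real j * (t / real m) \<and> real j * (t / real m) \<le> real (Suc j) * (t / real m) \<and> real (Suc j) * (t / real m) \<le> t"
    if "j < m" for j
  proof -
    have h: "0 \<le> t / real m" using assms by simp
    have "real (Suc j) * (t / real m) \<le> real m * (t / real m)" using that h by (intro mult_right_mono) auto
    moreover have "real m * (t / real m) = t" using that by simp
    moreover have "0 \<le> real j * (t / real m)" using h by (intro mult_nonneg_nonneg) auto
    moreover have "real j * (t / real m) \<le> real (Suc j) * (t / real m)" using h by (intro mult_right_mono) auto
    ultimately show ?thesis by linarith
  qed
  then show ?thesis unfolding exp_steps_def by auto
qed

lemma step_integral_exp_steps:
  "step_integral b (exp_steps l t v m) \<omega> = (\<Sum>j<m. (b (real (Suc j) * (t / real m)) \<omega> - b (real j * (t / real m)) \<omega>)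
      * exp (- (l * (t - real (Suc j) * (t / real m))))) *\<^sub>R v"
  unfolding step_integral_def exp_steps_def
  by (simp add: comp_def interv_sum_list_conv_sum_set_nat atLeast0LessThan scaleR_sum_left del: of_nat_Suc)

lemma exp_steps_error:
  fixes v :: "'a::real_normed_vector"
  assumes t: "0 < t" and l: "0 \<le> l" and s: "0 < s" "s \<le> t" and m: "m > 0"
  shows "norm (exp (- (l * (t - s))) *\<^sub>R v - step_fun (exp_steps l t v m) s) \<le> l * (t / real m) * norm v"
proof -
  define h where "h = t / real m"
  have h: "0 < h" "real m * h = t" using t m by (auto simp: h_def)
  obtain k where k: "k < m" "real k * h < s" "s \<le> real (Suc k) * h"
    using grid_cell[of s m h] s h by auto
  have ind: "indicat_real {real j * h<..real (Suc j) * h} s = (if j = k then 1 else 0)" for j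
  proof -
    consider "j < k" | "j = k" | "k < j" by linarith
    then show ?thesis
    proof cases
      case 1
      then have "real (Suc j) * h \<le> real k * h" using h by (intro mult_right_mono) auto
      then show ?thesis using 1 k by (auto simp: indicator_def)
    next
      case 2
      then show ?thesis using k by (auto simp: indicator_def)
    next
      case 3
      then have "real (Suc k) * h \<le> real j * h" using h by (intro mult_right_mono) auto
      then show ?thesis using 3 k by (auto simp: indicator_def)
    qed
  qed
  let ?u = "real (Suc k) * h"
  have sf: "step_fun (exp_steps l t v m) s = exp (- (l * (t - ?u))) *\<^sub>R v"
  proof -
    have "step_fun (exp_steps l t v m) s
        = (\<Sum>j<m. indicat_real {real j * h<..real (Suc j) * h} s *\<^sub>R exp (- (l * (t - real (Suc j) * h))) *\<^sub>R v)"
      unfolding step_fun_def exp_steps_def h_def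
      by (simp only: map_map comp_def split_conv interv_sum_list_conv_sum_set_nat set_upt atLeast0LessThan)
    also have "\<dots> = (\<Sum>j<m. if j = k then exp (- (l * (t - ?u))) *\<^sub>R v else 0)"
      unfolding ind by (intro sum.cong refl) simp
    also have "\<dots> = exp (- (l * (t - ?u))) *\<^sub>R v" using k by simp
    finally show ?thesis .
  qed
  have u: "?u \<le> t"
  proof -
    have "real (Suc k) * h \<le> real m * h" using k h by (intro mult_right_mono) auto
    then show ?thesis using h by simp
  qed
  have "\<bar>exp (- (l * (t - s))) - exp (- (l * (t - ?u)))\<bar> \<le> l * h"
  proof -
    let ?y = "l * (?u - s)"
    have y: "0 \<le> ?y" "?y \<le> l * h"
    proof -
      show "0 \<le> ?y" using l k by simp
      have "?u = real k * h + h" by (simp add: distrib_right)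
      then have "?u - s \<le> h" using k by linarith
      then show "?y \<le> l * h" using l by (rule mult_left_mono)
    qed
    have e: "exp (- (l * (t - s))) = exp (- (l * (t - ?u))) * exp (- ?y)"
      by (simp add: exp_add[symmetric] algebra_simps)
    have "exp (- (l * (t - ?u))) \<le> 1" using l u by simp
    moreover have "0 \<le> 1 - exp (- ?y)" "1 - exp (- ?y) \<le> ?y"
      using exp_ge_add_one_self[of "- ?y"] y(1) by auto
    ultimately have "exp (- (l * (t - ?u))) * (1 - exp (- ?y)) \<le> 1 * ?y" by (intro mult_mono) auto
    moreover have "\<bar>exp (- (l * (t - s))) - exp (- (l * (t - ?u)))\<bar> = exp (- (l * (t - ?u))) * (1 - exp (- ?y))"
    proof -
      have "\<bar>x * z - x\<bar> = x * (1 - z)" if "0 \<le> x" "0 \<le> 1 - z" for x z :: real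
      proof -
        have "x * z - x = - (x * (1 - z))" by (simp add: algebra_simps)
        then show ?thesis using that by (simp only: abs_minus_cancel abs_of_nonneg mult_nonneg_nonneg)
      qed
      then show ?thesis unfolding e using \<open>0 \<le> 1 - exp (- ?y)\<close> by (simp only: exp_ge_zero)
    qed
    ultimately show ?thesis using y(2) by linarith
  qed
  then have "\<bar>exp (- (l * (t - s))) - exp (- (l * (t - ?u)))\<bar> * norm v \<le> l * h * norm v"
    by (rule mult_right_mono) simp
  then show ?thesis unfolding sf scaleR_diff_left[symmetric] norm_scaleR h_def .
qed

context wiener
begin

text \<open>The integral is given as the mean-square limit of the integrals of some unknown step
  functions \<open>p k\<close>. By the isometry the integrals of the steps \<open>exp_steps\<close> have the same
  mean-square limit. Along almost every path they converge to the right-hand side by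
  \<open>stieltjes_sum_tendsto\<close>, and Fatou's lemma identifies the two limits.\<close>

lemma wiener_integral_formula:
  fixes v :: "'a::{real_inner,banach,second_countable_topology}"
  assumes i: "i \<ge> 1" and t: "0 \<le> t" and l: "0 \<le> l" and W: "has_wiener_integral M (B i) g t J"
    and g: "\<And>s. 0 \<le> s \<Longrightarrow> s \<le> t \<Longrightarrow> g s = exp (- (l * (t - s))) *\<^sub>R v"
  shows "AE \<omega> in M. J \<omega> = (B i t \<omega> - l * integral {0..t} (\<lambda>s. exp (- (l * (t - s))) * B i s \<omega>)) *\<^sub>R v"
proof -
  obtain p where Jm [measurable]: "J \<in> borel_measurable M"
    and p: "\<And>k. \<forall>(a, c, x)\<in>set (p k). 0 \<le> a \<and> a \<le> c \<and> c \<le> t"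
    and pg: "(\<lambda>k. \<integral>\<^sup>+ s\<in>{0..t}. ennreal ((norm (g s - step_fun (p k) s))\<^sup>2) \<partial>lborel) \<longlonglongrightarrow> 0"
    and pJ: "(\<lambda>k. \<integral>\<^sup>+ \<omega>. ennreal ((norm (J \<omega> - step_integral (B i) (p k) \<omega>))\<^sup>2) \<partial>M) \<longlonglongrightarrow> 0"
    using W unfolding has_wiener_integral_def by blast
  define r where "r m = exp_steps l t v m" for m
  note r = exp_steps_bounds[OF t, where l = l and v = v, folded r_def]
  have p': "\<forall>(a, c, x)\<in>set (p k). 0 \<le> a \<and> a \<le> c" "\<forall>(a, c, x)\<in>set (p k). 0 \<le> a \<and> c \<le> t" for k
    using p[of k] by auto
  have r': "\<forall>(a, c, x)\<in>set (r m). 0 \<le> a \<and> a \<le> c" "\<forall>(a, c, x)\<in>set (r m). 0 \<le> a \<and> c \<le> t" for m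
    using r[of m] by auto
  have [measurable]: "step_integral (B i) (p k) \<in> borel_measurable M" "step_integral (B i) (r m) \<in> borel_measurable M" for k m
    by (rule step_integral_measurable[OF i p'(1)], rule step_integral_measurable[OF i r'(1)])
  define g0 where "g0 s = indicat_real {0..t} s *\<^sub>R exp (- (l * (t - s))) *\<^sub>R v" for s
  have [measurable]: "g0 \<in> borel_measurable borel" unfolding g0_def[abs_def] by measurable
  define a where "a k = (\<integral>\<^sup>+ s. ennreal ((norm (g0 s - step_fun (p k) s))\<^sup>2) \<partial>lborel)" for k
  define b where "b m = (\<integral>\<^sup>+ s. ennreal ((norm (step_fun (r m) s - g0 s))\<^sup>2) \<partial>lborel)" for m
  have a: "a \<longlonglongrightarrow> 0"
  proof -
    have "a k = (\<integral>\<^sup>+ s\<in>{0..t}. ennreal ((norm (g s - step_fun (p k) s))\<^sup>2) \<partial>lborel)" for k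
      unfolding a_def using g step_fun_outside[OF p'(2)[of k]]
      by (intro nn_integral_cong) (auto simp: g0_def indicator_def)
    then have "a = (\<lambda>k. \<integral>\<^sup>+ s\<in>{0..t}. ennreal ((norm (g s - step_fun (p k) s))\<^sup>2) \<partial>lborel)" by (rule ext)
    then show ?thesis using pg by (simp only:)
  qed
  have b: "b \<longlonglongrightarrow> 0"
  proof (rule tendsto_sandwich[of "\<lambda>_. 0"])
    show "\<forall>\<^sub>F m in sequentially. b m \<le> ennreal (t * (l * (t / real m) * norm v)\<^sup>2)"
      using eventually_gt_at_top[of 0]
    proof eventually_elim
      case (elim m)
      have "b m \<le> (\<integral>\<^sup>+ s. ennreal ((l * (t / real m) * norm v)\<^sup>2) * indicator {0..t} s \<partial>lborel)"
        unfolding b_def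
      proof (rule nn_integral_mono_AE)
        have "AE s in lborel. s \<noteq> (0::real)" by (rule AE_lborel_singleton)
        then show "AE s in lborel. ennreal ((norm (step_fun (r m) s - g0 s))\<^sup>2)
            \<le> ennreal ((l * (t / real m) * norm v)\<^sup>2) * indicator {0..t} s"
        proof eventually_elim
          case (elim s)
          show ?case
          proof (cases "s \<in> {0..t}")
            case True
            then have "norm (exp (- (l * (t - s))) *\<^sub>R v - step_fun (r m) s) \<le> l * (t / real m) * norm v"
              unfolding r_def using elim \<open>0 < m\<close> l by (intro exp_steps_error) auto
            then have "(norm (step_fun (r m) s - g0 s))\<^sup>2 \<le> (l * (t / real m) * norm v)\<^sup>2"
              using True by (intro power_mono) (auto simp: g0_def norm_minus_commute)
            then show ?thesis using True by (simp add: ennreal_leI)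
          next
            case False
            then show ?thesis using step_fun_outside[OF r'(2)[of m]] by (simp add: g0_def)
          qed
        qed
      qed
      also have "\<dots> = ennreal ((l * (t / real m) * norm v)\<^sup>2) * emeasure lborel {0..t}"
        by (rule nn_integral_cmult_indicator) simp
      also have "emeasure lborel {0..t} = ennreal t" using t by simp
      also have "ennreal ((l * (t / real m) * norm v)\<^sup>2) * ennreal t = ennreal (t * (l * (t / real m) * norm v)\<^sup>2)"
        by (subst mult.commute[of t]) (rule ennreal_mult[symmetric], use t in auto)
      finally show ?case .
    qed
    have "(\<lambda>m. t * (l * (t / real m) * norm v)\<^sup>2) \<longlonglongrightarrow> t * (l * 0 * norm v)\<^sup>2"
      by (intro tendsto_intros lim_const_over_n)
    then show "(\<lambda>m. ennreal (t * (l * (t / real m) * norm v)\<^sup>2)) \<longlonglongrightarrow> 0"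
      using tendsto_ennrealI by fastforce
  qed auto
  let ?E = "\<lambda>m. \<integral>\<^sup>+ \<omega>. ennreal ((norm (J \<omega> - step_integral (B i) (r m) \<omega>))\<^sup>2) \<partial>M"
  \<comment> \<open>The distance from \<open>J\<close> passes through the integrals of \<open>p k\<close>, and \<open>k\<close> tends to infinity.\<close>
  have E: "?E m \<le> 2 * (2 * b m)" for m
  proof -
    let ?d = "\<lambda>k. \<integral>\<^sup>+ \<omega>. ennreal ((norm (J \<omega> - step_integral (B i) (p k) \<omega>))\<^sup>2) \<partial>M"
    have "?E m \<le> 2 * ?d k + 2 * (2 * a k + 2 * b m)" for k
    proof -
      have "?E m \<le> 2 * ?d k + 2 * (\<integral>\<^sup>+ \<omega>. ennreal ((norm (step_integral (B i) (p k) \<omega> - step_integral (B i) (r m) \<omega>))\<^sup>2) \<partial>M)"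
        by (rule nn_integral_norm_sq_triangle) measurable
      also have "(\<integral>\<^sup>+ \<omega>. ennreal ((norm (step_integral (B i) (p k) \<omega> - step_integral (B i) (r m) \<omega>))\<^sup>2) \<partial>M)
          = (\<integral>\<^sup>+ s. ennreal ((norm (step_fun (r m) s - step_fun (p k) s))\<^sup>2) \<partial>lborel)"
        unfolding step_isometry_diff[OF i p'(1) r'(1)] by (simp add: norm_minus_commute)
      also have "\<dots> \<le> 2 * b m + 2 * a k"
        unfolding a_def b_def by (rule nn_integral_norm_sq_triangle) measurable
      finally show ?thesis by (simp add: add.commute distrib_left mult_left_mono add_left_mono)
    qed
    moreover have "(\<lambda>k. 2 * ?d k + 2 * (2 * a k + 2 * b m)) \<longlonglongrightarrow> 0 + 2 * (0 + 2 * b m)"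
    proof -
      have "(\<lambda>k. (2 * a k + 2 * b m) + (2 * a k + 2 * b m)) \<longlonglongrightarrow> (0 + 2 * b m) + (0 + 2 * b m)"
        by (intro tendsto_add tendsto_double_zero_ennreal a tendsto_const)
      then have "(\<lambda>k. 2 * (2 * a k + 2 * b m)) \<longlonglongrightarrow> 2 * (0 + 2 * b m)"
        by (simp only: mult_2[of "2 * a _ + 2 * b m"] mult_2[of "0 + 2 * b m"])
      then show ?thesis by (intro tendsto_add tendsto_double_zero_ennreal pJ)
    qed
    ultimately show ?thesis using LIMSEQ_le_const by fastforce
  qed
  have E0: "?E \<longlonglongrightarrow> 0"
  proof (rule tendsto_sandwich[of "\<lambda>_. 0"])
    show "\<forall>\<^sub>F m in sequentially. ?E m \<le> 2 * (2 * b m)" using E by simp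
    show "(\<lambda>m. 2 * (2 * b m)) \<longlonglongrightarrow> 0" by (intro tendsto_double_zero_ennreal b)
  qed auto
  have "(\<integral>\<^sup>+ \<omega>. liminf (\<lambda>m. ennreal ((norm (J \<omega> - step_integral (B i) (r m) \<omega>))\<^sup>2)) \<partial>M) \<le> liminf ?E"
    by (rule nn_integral_liminf) measurable
  also have "liminf ?E = 0" using E0 by (intro lim_imp_Liminf) auto
  finally have "(\<integral>\<^sup>+ \<omega>. liminf (\<lambda>m. ennreal ((norm (J \<omega> - step_integral (B i) (r m) \<omega>))\<^sup>2)) \<partial>M) = 0" by simp
  then have "AE \<omega> in M. liminf (\<lambda>m. ennreal ((norm (J \<omega> - step_integral (B i) (r m) \<omega>))\<^sup>2)) = 0"
    by (subst (asm) nn_integral_0_iff_AE) auto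
  then show ?thesis
    using B_continuous[OF i] B_zero[OF i]
  proof eventually_elim
    case (elim \<omega>)
    let ?G = "(B i t \<omega> - l * integral {0..t} (\<lambda>s. exp (- (l * (t - s))) * B i s \<omega>)) *\<^sub>R v"
    have "continuous_on {0..t} (\<lambda>s. B i s \<omega>)" using elim(2) by (rule continuous_on_subset) auto
    from stieltjes_sum_tendsto[OF this t l]
    have "(\<lambda>m. step_integral (B i) (r m) \<omega>) \<longlonglongrightarrow> ?G"
      unfolding r_def step_integral_exp_steps using elim(3) by (intro tendsto_scaleR tendsto_const) simp
    then have "(\<lambda>m. ennreal ((norm (J \<omega> - step_integral (B i) (r m) \<omega>))\<^sup>2)) \<longlonglongrightarrow> ennreal ((norm (J \<omega> - ?G))\<^sup>2)"
      by (intro tendsto_ennrealI tendsto_intros)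
    then have "liminf (\<lambda>m. ennreal ((norm (J \<omega> - step_integral (B i) (r m) \<omega>))\<^sup>2)) = ennreal ((norm (J \<omega> - ?G))\<^sup>2)"
      by (intro lim_imp_Liminf) auto
    then have "ennreal ((norm (J \<omega> - ?G))\<^sup>2) = 0" using elim(1) by simp
    then show ?case by simp
  qed
qed

end

section \<open>Integral equations and limits of expectations\<close>

lemma gronwall:
  fixes u :: "real \<Rightarrow> real"
  assumes u: "continuous_on {0..T} u" and T: "0 \<le> T" and L: "0 \<le> L"
    and le: "\<And>t. 0 \<le> t \<Longrightarrow> t \<le> T \<Longrightarrow> u t \<le> R + L * integral {0..t} u"
  shows "u T \<le> R * exp (L * T)"
proof -
  define g where "g t = exp (- (L * t)) * (R + L * integral {0..t} u)" for t
  have d: "((\<lambda>x. integral {0..x} u) has_real_derivative u t) (at t within {0..T})" if "t \<in> {0..T}" for t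
    using integral_has_real_derivative[OF u that] .
  have "g T \<le> g 0"
  proof (rule DERIV_nonpos_imp_decreasing_open[OF T])
    fix x assume x: "0 < x" "x < T"
    have "((\<lambda>x. integral {0..x} u) has_real_derivative u x) (at x)"
      using d[of x] x at_within_Icc_at[of 0 x T] by simp
    then have "(g has_real_derivative exp (- (L * x)) * (L * (u x - (R + L * integral {0..x} u)))) (at x)"
      unfolding g_def[abs_def] by (auto intro!: derivative_eq_intros simp: algebra_simps)
    moreover have "exp (- (L * x)) * (L * (u x - (R + L * integral {0..x} u))) \<le> 0"
      using le[of x] x L by (intro mult_nonneg_nonpos) auto
    ultimately show "\<exists>y. (g has_real_derivative y) (at x) \<and> y \<le> 0" by blast
  next
    have "continuous_on {0..T} (\<lambda>x. integral {0..x} u)"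
      using d by (intro DERIV_continuous_on)
    then show "continuous_on {0..T} g" unfolding g_def[abs_def] by (intro continuous_intros)
  qed
  then have "exp (- (L * T)) * (R + L * integral {0..T} u) \<le> R" by (simp add: g_def)
  then have "exp (L * T) * (exp (- (L * T)) * (R + L * integral {0..T} u)) \<le> exp (L * T) * R"
    by (rule mult_left_mono) simp
  then have "R + L * integral {0..T} u \<le> R * exp (L * T)"
    by (simp add: mult.assoc[symmetric] exp_add[symmetric] mult.commute)
  then show ?thesis using le[of T] T by simp
qed

text \<open>The path \<open>w\<close> need not be differentiable, but \<open>u = y - w\<close> is: it solves
  \<open>u' = - l u + f - l w\<close>.\<close>

lemma variation_of_constants:
  fixes y f w :: "real \<Rightarrow> real"
  assumes cont: "continuous_on {0..T} y" "continuous_on {0..T} f" "continuous_on {0..T} w" and w0: "w 0 = 0"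
    and eq: "\<And>t. 0 \<le> t \<Longrightarrow> t \<le> T \<Longrightarrow> y t = x0 + integral {0..t} (\<lambda>s. - (l * y s) + f s) + w t"
    and t: "0 \<le> t" "t \<le> T"
  shows "y t = exp (- (l * t)) * x0 + integral {0..t} (\<lambda>s. exp (- (l * (t - s))) * f s)
    + (w t - l * integral {0..t} (\<lambda>s. exp (- (l * (t - s))) * w s))"
proof -
  define u where "u s = y s - w s" for s
  have T: "0 \<le> T" using t by simp
  have du: "(u has_real_derivative (- (l * y s) + f s)) (at s within {0..T})" if s: "s \<in> {0..T}" for s
  proof -
    have "continuous_on {0..T} (\<lambda>s. - (l * y s) + f s)" by (intro continuous_intros cont)
    from integral_has_real_derivative[OF this s]
    have "((\<lambda>t. x0 + integral {0..t} (\<lambda>s. - (l * y s) + f s)) has_real_derivative (- (l * y s) + f s)) (at s within {0..T})"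
      by (auto intro!: derivative_eq_intros)
    then show ?thesis
      by (rule has_field_derivative_transform_within[where d = 1]) (use eq s in \<open>auto simp: u_def\<close>)
  qed
  have "((\<lambda>s. exp (l * s) * (f s - l * w s)) has_integral (exp (l * t) * u t - exp (l * 0) * u 0)) {0..t}"
  proof (rule fundamental_theorem_of_calculus[OF t(1)])
    fix s assume s: "s \<in> {0..t}"
    then have "s \<in> {0..T}" using t by auto
    have E: "((\<lambda>s. exp (l * s)) has_real_derivative l * exp (l * s)) (at s within {0..T})"
      by (auto intro!: derivative_eq_intros)
    have "((\<lambda>s. exp (l * s) * u s) has_real_derivative exp (l * s) * (f s - l * w s)) (at s within {0..T})"
      by (rule DERIV_cong[OF DERIV_mult[OF E du[OF \<open>s \<in> {0..T}\<close>]]]) (simp add: u_def algebra_simps)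
    then have "((\<lambda>s. exp (l * s) * u s) has_real_derivative exp (l * s) * (f s - l * w s)) (at s within {0..t})"
      by (rule DERIV_subset) (use t in auto)
    then show "((\<lambda>s. exp (l * s) * u s) has_vector_derivative exp (l * s) * (f s - l * w s)) (at s within {0..t})"
      by (simp add: has_real_derivative_iff_has_vector_derivative)
  qed
  moreover have "u 0 = x0" using eq[of 0] T by (simp add: u_def)
  ultimately have "((\<lambda>s. exp (- (l * t)) * (exp (l * s) * (f s - l * w s))) has_integral
      (exp (- (l * t)) * (exp (l * t) * u t - x0))) {0..t}"
    by (intro has_integral_mult_right) simp
  moreover have "exp (- (l * t)) * (exp (l * s) * (f s - l * w s))
      = exp (- (l * (t - s))) * f s - l * (exp (- (l * (t - s))) * w s)" for s
  proof -
    have "exp (- (l * t)) * exp (l * s) = exp (- (l * (t - s)))" by (simp add: exp_add[symmetric] algebra_simps)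
    then show ?thesis by (simp only: mult.assoc[symmetric] right_diff_distrib) (simp add: mult_ac)
  qed
  ultimately have I: "((\<lambda>s. exp (- (l * (t - s))) * f s - l * (exp (- (l * (t - s))) * w s)) has_integral
      (exp (- (l * t)) * (exp (l * t) * u t - x0))) {0..t}" by simp
  have sub: "{0..t} \<subseteq> {0..T}" using t by auto
  have "integral {0..t} (\<lambda>s. exp (- (l * (t - s))) * f s - l * (exp (- (l * (t - s))) * w s))
      = integral {0..t} (\<lambda>s. exp (- (l * (t - s))) * f s) - integral {0..t} (\<lambda>s. l * (exp (- (l * (t - s))) * w s))"
    by (intro Henstock_Kurzweil_Integration.integral_diff integrable_continuous_real continuous_intros
        continuous_on_subset[OF cont(2) sub] continuous_on_subset[OF cont(3) sub])
  then have "exp (- (l * t)) * (exp (l * t) * u t - x0)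
      = integral {0..t} (\<lambda>s. exp (- (l * (t - s))) * f s) - l * integral {0..t} (\<lambda>s. exp (- (l * (t - s))) * w s)"
    using integral_unique[OF I] by simp
  moreover have "exp (- (l * t)) * (exp (l * t) * u t - x0) = u t - exp (- (l * t)) * x0"
    by (simp add: right_diff_distrib mult.assoc[symmetric] exp_add[symmetric])
  ultimately show ?thesis by (simp add: u_def)
qed

context prob_space
begin

text \<open>Truncation at level \<open>R\<close> changes each expectation by at most \<open>C / R\<close>, and the truncated
  variables converge by dominated convergence.\<close>

lemma expectation_tendsto_L2_bounded:
  fixes Z :: "nat \<Rightarrow> 'a \<Rightarrow> real"
  assumes Z: "\<And>k. mean_le (\<lambda>\<omega>. (Z k \<omega>)\<^sup>2) C" "\<And>k. Z k \<in> borel_measurable M"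
    and Y: "mean_le (\<lambda>\<omega>. (Y \<omega>)\<^sup>2) C" "Y \<in> borel_measurable M"
    and lim: "AE \<omega> in M. (\<lambda>k. Z k \<omega>) \<longlonglongrightarrow> Y \<omega>"
  shows "(\<lambda>k. expectation (Z k)) \<longlonglongrightarrow> expectation Y"
proof (rule LIMSEQ_I)
  fix r :: real assume r: "r > 0"
  have "0 \<le> expectation (\<lambda>\<omega>. (Y \<omega>)\<^sup>2)" by (intro Bochner_Integration.integral_nonneg) simp
  then have C0: "0 \<le> C" using mean_leD(2)[OF Y(1)] by linarith
  \<comment> \<open>With this level both truncation errors are below \<open>r / 3\<close>.\<close>
  define R where "R = 3 * (C + 1) / r"
  have R: "R > 0" using r C0 by (simp add: R_def)
  define \<tau> where "\<tau> x = max (- R) (min R x)" for x :: real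
  have \<tau>b: "\<bar>\<tau> x\<bar> \<le> R" for x using R by (auto simp: \<tau>_def)
  have \<tau>e: "\<bar>x - \<tau> x\<bar> \<le> (1 / R) * x\<^sup>2" for x
  proof (cases "\<bar>x\<bar> \<le> R")
    case True
    then have "\<tau> x = x" by (auto simp: \<tau>_def)
    then show ?thesis using R by simp
  next
    case False
    then have "\<bar>x - \<tau> x\<bar> \<le> \<bar>x\<bar>" using R by (auto simp: \<tau>_def)
    moreover have "R * \<bar>x\<bar> \<le> \<bar>x\<bar> * \<bar>x\<bar>" using False by (intro mult_right_mono) auto
    moreover have "\<bar>x\<bar> * \<bar>x\<bar> = x\<^sup>2" by (simp add: power2_eq_square)
    ultimately have "R * \<bar>x - \<tau> x\<bar> \<le> x\<^sup>2"
      using R mult_left_mono[of "\<bar>x - \<tau> x\<bar>" "\<bar>x\<bar>" R] by linarith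
    then show ?thesis using R by (simp add: field_simps)
  qed
  have \<tau>m [measurable]: "\<tau> \<in> borel_measurable borel" unfolding \<tau>_def[abs_def] by measurable
  note [measurable] = Z(2) Y(2)
  have close: "\<bar>expectation V - expectation (\<lambda>\<omega>. \<tau> (V \<omega>))\<bar> \<le> (1 / R) * C"
    if V: "mean_le (\<lambda>\<omega>. (V \<omega>)\<^sup>2) C" and [measurable]: "V \<in> borel_measurable M" for V
  proof -
    have iV: "integrable M V"
      by (rule square_integrable_imp_integrable) (use mean_leD(1)[OF V] in auto)
    have i\<tau>: "integrable M (\<lambda>\<omega>. \<tau> (V \<omega>))"
      by (rule integrable_const_bound[where B = R]) (use \<tau>b in auto)
    have "\<bar>expectation V - expectation (\<lambda>\<omega>. \<tau> (V \<omega>))\<bar> = \<bar>expectation (\<lambda>\<omega>. V \<omega> - \<tau> (V \<omega>))\<bar>"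
      using iV i\<tau> by simp
    also have "\<dots> \<le> expectation (\<lambda>\<omega>. \<bar>V \<omega> - \<tau> (V \<omega>)\<bar>)" by (rule integral_abs_bound)
    also have "\<dots> \<le> expectation (\<lambda>\<omega>. (1 / R) * (V \<omega>)\<^sup>2)"
      using iV i\<tau> mean_leD(1)[OF V] \<tau>e by (intro integral_mono) auto
    also have "\<dots> \<le> (1 / R) * C" using mean_leD(2)[OF V] R by (simp add: divide_right_mono)
    finally show ?thesis .
  qed
  have "(\<lambda>k. expectation (\<lambda>\<omega>. \<tau> (Z k \<omega>))) \<longlonglongrightarrow> expectation (\<lambda>\<omega>. \<tau> (Y \<omega>))"
  proof (rule integral_dominated_convergence[where w = "\<lambda>_. R"])
    show "AE \<omega> in M. (\<lambda>k. \<tau> (Z k \<omega>)) \<longlonglongrightarrow> \<tau> (Y \<omega>)"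
      using lim by eventually_elim (auto simp: \<tau>_def intro!: tendsto_intros)
  qed (use \<tau>b in auto)
  then obtain k0 where k0: "\<And>k. k \<ge> k0 \<Longrightarrow> \<bar>expectation (\<lambda>\<omega>. \<tau> (Z k \<omega>)) - expectation (\<lambda>\<omega>. \<tau> (Y \<omega>))\<bar> < r / 3"
    using r unfolding LIMSEQ_def dist_real_def by (meson divide_pos_pos zero_less_numeral)
  have RC: "(1 / R) * C < r / 3" using r C0 by (simp add: R_def field_simps)
  have "\<bar>expectation (Z k) - expectation Y\<bar> < r" if "k \<ge> k0" for k
    using close[OF Z(1) Z(2), of k] close[OF Y] k0[OF that] RC by linarith
  then show "\<exists>no. \<forall>k\<ge>no. norm (expectation (Z k) - expectation Y) < r" by (auto simp: real_norm_def)
qed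

lemma second_moment_limit:
  fixes Z :: "nat \<Rightarrow> 'a \<Rightarrow> 'b::{real_normed_vector,second_countable_topology}"
  assumes Z: "\<And>k. mean_le (\<lambda>\<omega>. (norm (Z k \<omega>))\<^sup>2) C" and [measurable]: "\<And>k. Z k \<in> borel_measurable M" "Y \<in> borel_measurable M"
    and lim: "AE \<omega> in M. (\<lambda>k. Z k \<omega>) \<longlonglongrightarrow> Y \<omega>"
  shows "mean_le (\<lambda>\<omega>. (norm (Y \<omega>))\<^sup>2) C"
proof -
  have "0 \<le> expectation (\<lambda>\<omega>. (norm (Z 0 \<omega>))\<^sup>2)" by (intro Bochner_Integration.integral_nonneg) simp
  then have C0: "0 \<le> C" using mean_leD(2)[OF Z[of 0]] by linarith
  have "(\<integral>\<^sup>+ \<omega>. ennreal ((norm (Y \<omega>))\<^sup>2) \<partial>M) = (\<integral>\<^sup>+ \<omega>. liminf (\<lambda>k. ennreal ((norm (Z k \<omega>))\<^sup>2)) \<partial>M)"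
  proof (rule nn_integral_cong_AE)
    show "AE \<omega> in M. ennreal ((norm (Y \<omega>))\<^sup>2) = liminf (\<lambda>k. ennreal ((norm (Z k \<omega>))\<^sup>2))"
      using lim
    proof eventually_elim
      case (elim \<omega>)
      have "(\<lambda>k. ennreal ((norm (Z k \<omega>))\<^sup>2)) \<longlonglongrightarrow> ennreal ((norm (Y \<omega>))\<^sup>2)"
        by (intro tendsto_ennrealI tendsto_intros elim)
      then show ?case by (intro lim_imp_Liminf[symmetric]) auto
    qed
  qed
  also have "\<dots> \<le> liminf (\<lambda>k. \<integral>\<^sup>+ \<omega>. ennreal ((norm (Z k \<omega>))\<^sup>2) \<partial>M)" by (rule nn_integral_liminf) measurable
  also have "\<dots> \<le> ennreal C"
  proof (rule Liminf_le)
    have "(\<integral>\<^sup>+ \<omega>. ennreal ((norm (Z k \<omega>))\<^sup>2) \<partial>M) \<le> ennreal C" for k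
      using nn_integral_eq_integral[OF mean_leD(1)[OF Z[of k]]] mean_leD(2)[OF Z[of k]] by (simp add: ennreal_leI)
    then show "\<forall>\<^sub>F k in sequentially. (\<integral>\<^sup>+ \<omega>. ennreal ((norm (Z k \<omega>))\<^sup>2) \<partial>M) \<le> ennreal C" by simp
  qed simp
  finally have le: "(\<integral>\<^sup>+ \<omega>. ennreal ((norm (Y \<omega>))\<^sup>2) \<partial>M) \<le> ennreal C" .
  have int: "integrable M (\<lambda>\<omega>. (norm (Y \<omega>))\<^sup>2)"
    by (rule integrableI_bounded) (use le in \<open>auto intro: le_less_trans\<close>)
  have "ennreal (expectation (\<lambda>\<omega>. (norm (Y \<omega>))\<^sup>2)) \<le> ennreal C"
    using le nn_integral_eq_integral[OF int] by simp
  then show ?thesis using int C0 by (simp add: mean_le_def)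
qed

text \<open>Fubini's theorem exchanges "at every time almost surely" with "almost surely at almost
  every time", which is what path arguments can use.\<close>

lemma AE_swap_paths:
  fixes U V :: "real \<Rightarrow> 'a \<Rightarrow> 'b::{second_countable_topology,t2_space}"
  assumes U: "jointly_measurable M U" and V: "jointly_measurable M V"
    and eq: "\<And>t. 0 \<le> t \<Longrightarrow> t \<le> T \<Longrightarrow> AE \<omega> in M. U t \<omega> = V t \<omega>"
  shows "AE \<omega> in M. AE t in lborel. t \<in> {0..T} \<longrightarrow> U t \<omega> = V t \<omega>"
proof -
  interpret pair_sigma_finite lborel M ..
  have sh: "(\<lambda>p. (max 0 (fst p), snd p)) \<in> (lborel \<Otimes>\<^sub>M M) \<rightarrow>\<^sub>M (restrict_space borel {0::real..} \<Otimes>\<^sub>M M)"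
    by (intro measurable_Pair measurable_restrict_space2) auto
  have m [measurable]: "(\<lambda>p. W (max 0 (fst p)) (snd p)) \<in> borel_measurable (lborel \<Otimes>\<^sub>M M)"
    if "jointly_measurable M W" for W :: "real \<Rightarrow> 'a \<Rightarrow> 'b"
    using measurable_compose[OF sh that[unfolded jointly_measurable_def]] by (simp add: case_prod_beta)
  note [measurable] = m[OF U] m[OF V]
  let ?P = "\<lambda>t \<omega>. t \<in> {0..T} \<longrightarrow> U (max 0 t) \<omega> = V (max 0 t) \<omega>"
  have "AE t in lborel. AE \<omega> in M. ?P t \<omega>"
  proof (rule AE_I2)
    fix t :: real
    show "AE \<omega> in M. ?P t \<omega>" using eq[of t] by (cases "t \<in> {0..T}") auto
  qed
  then have "AE \<omega> in M. AE t in lborel. ?P t \<omega>"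
    by (subst AE_commute[symmetric]) measurable
  then show ?thesis by (auto elim!: eventually_mono)
qed

text \<open>Where the path is continuous, it is the limit of its values at the grid times below \<open>t\<close>,
  and those are jointly measurable; on the exceptional null set the path is replaced by 0.\<close>

lemma continuous_version:
  fixes b :: "real \<Rightarrow> 'a \<Rightarrow> real"
  assumes meas: "\<And>t. t \<ge> 0 \<Longrightarrow> b t \<in> borel_measurable M" and cont: "AE \<omega> in M. continuous_on {0..} (\<lambda>t. b t \<omega>)"
  shows "\<exists>b'. jointly_measurable M b' \<and> (AE \<omega> in M. \<forall>t\<ge>0. b' t \<omega> = b t \<omega>)"
proof -
  obtain N where N: "N \<in> null_sets M" "{\<omega> \<in> space M. \<not> continuous_on {0..} (\<lambda>t. b t \<omega>)} \<subseteq> N"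
    using cont unfolding eventually_ae_filter by blast
  have [measurable]: "N \<in> sets M" using N(1) by auto
  define b' where "b' t \<omega> = (if \<omega> \<in> N then 0 else b t \<omega>)" for t \<omega>
  define bm where "bm m t \<omega> = (if \<omega> \<in> N then 0 else b (real (nat \<lfloor>t * real (Suc m)\<rfloor>) / real (Suc m)) \<omega>)" for m :: nat and t \<omega>
  let ?R = "restrict_space borel {0::real..} \<Otimes>\<^sub>M M"
  have [measurable]: "fst \<in> borel_measurable ?R"
    by (rule measurable_compose[OF measurable_fst]) (rule measurable_restrict_space1, simp)
  have bm: "(\<lambda>p. bm m (fst p) (snd p)) \<in> borel_measurable ?R" for m
  proof -
    have 1: "(\<lambda>\<omega>. if \<omega> \<in> N then 0 else b (real k / real (Suc m)) \<omega>) \<in> borel_measurable M" for k :: nat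
    proof -
      have [measurable]: "b (real k / real (Suc m)) \<in> borel_measurable M" by (rule meas) simp
      show ?thesis by measurable
    qed
    have f: "(\<lambda>p. if snd p \<in> N then 0 else b (real k / real (Suc m)) (snd p)) \<in> borel_measurable ?R" for k :: nat
      using measurable_compose[OF measurable_snd[of "restrict_space borel {0::real..}" M] 1] by simp
    have g: "(\<lambda>p. nat \<lfloor>fst p * real (Suc m)\<rfloor>) \<in> ?R \<rightarrow>\<^sub>M count_space UNIV" by measurable
    have "(\<lambda>p. if snd p \<in> N then 0 else b (real (nat \<lfloor>fst p * real (Suc m)\<rfloor>) / real (Suc m)) (snd p)) \<in> borel_measurable ?R"
      by (rule measurable_compose_countable[where g = "\<lambda>p. nat \<lfloor>fst p * real (Suc m)\<rfloor>"
            and f = "\<lambda>k p. if snd p \<in> N then 0 else b (real k / real (Suc m)) (snd p)", OF f g])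
    then show ?thesis by (simp add: bm_def)
  qed
  have lim: "(\<lambda>m. bm m (fst p) (snd p)) \<longlonglongrightarrow> b' (fst p) (snd p)" if p: "p \<in> space ?R" for p
  proof (cases "snd p \<in> N")
    case True
    then show ?thesis by (simp add: bm_def b'_def)
  next
    case False
    let ?t = "fst p" and ?\<omega> = "snd p"
    have t: "?t \<ge> 0" and \<omega>: "?\<omega> \<in> space M" using p by (auto simp: space_pair_measure space_restrict_space)
    have c: "continuous_on {0..} (\<lambda>t. b t ?\<omega>)" using N(2) False \<omega> by blast
    have "(\<lambda>m. real (nat \<lfloor>?t * real (Suc m)\<rfloor>) / real (Suc m)) \<longlonglongrightarrow> ?t"
    proof (rule tendsto_sandwich[of "\<lambda>m. ?t - 1 / real (Suc m)" _ _ "\<lambda>_. ?t"])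
      have fl: "?t * real (Suc m) - 1 \<le> real (nat \<lfloor>?t * real (Suc m)\<rfloor>)" "real (nat \<lfloor>?t * real (Suc m)\<rfloor>) \<le> ?t * real (Suc m)" for m
      proof -
        have "0 \<le> ?t * real (Suc m)" using t by (intro mult_nonneg_nonneg) auto
        then have e: "real (nat \<lfloor>?t * real (Suc m)\<rfloor>) = of_int \<lfloor>?t * real (Suc m)\<rfloor>" by (simp only: of_nat_nat zero_le_floor)
        show "?t * real (Suc m) - 1 \<le> real (nat \<lfloor>?t * real (Suc m)\<rfloor>)" "real (nat \<lfloor>?t * real (Suc m)\<rfloor>) \<le> ?t * real (Suc m)"
          unfolding e by linarith+
      qed
      have "?t - 1 / real (Suc m) \<le> real (nat \<lfloor>?t * real (Suc m)\<rfloor>) / real (Suc m)" for m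
      proof -
        have "(?t * real (Suc m) - 1) / real (Suc m) \<le> real (nat \<lfloor>?t * real (Suc m)\<rfloor>) / real (Suc m)"
          by (rule divide_right_mono[OF fl(1)]) simp
        then show ?thesis by (simp add: diff_divide_distrib del: of_nat_Suc)
      qed
      then show "\<forall>\<^sub>F m in sequentially. ?t - 1 / real (Suc m) \<le> real (nat \<lfloor>?t * real (Suc m)\<rfloor>) / real (Suc m)" by simp
      have "real (nat \<lfloor>?t * real (Suc m)\<rfloor>) / real (Suc m) \<le> ?t" for m
        using fl(2)[of m] by (subst pos_divide_le_eq) auto
      then show "\<forall>\<^sub>F m in sequentially. real (nat \<lfloor>?t * real (Suc m)\<rfloor>) / real (Suc m) \<le> ?t" by simp
      show "(\<lambda>m. ?t - 1 / real (Suc m)) \<longlonglongrightarrow> ?t"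
        using tendsto_diff[OF tendsto_const[of ?t] LIMSEQ_inverse_real_of_nat] by (simp add: inverse_eq_divide)
    qed simp
    then have "(\<lambda>m. b (real (nat \<lfloor>?t * real (Suc m)\<rfloor>) / real (Suc m)) ?\<omega>) \<longlonglongrightarrow> b ?t ?\<omega>"
      by (rule continuous_on_tendsto_compose[OF c]) (use t in auto)
    then show ?thesis using False by (simp add: bm_def b'_def)
  qed
  have "(\<lambda>p. b' (fst p) (snd p)) \<in> borel_measurable ?R"
    by (rule borel_measurable_LIMSEQ_metric[OF bm lim])
  then have "jointly_measurable M b'" by (simp add: jointly_measurable_def case_prod_beta)
  moreover have "AE \<omega> in M. \<forall>t\<ge>0. b' t \<omega> = b t \<omega>"
  proof (rule AE_I'[OF N(1)])
    show "{\<omega> \<in> space M. \<not> (\<forall>t\<ge>0. b' t \<omega> = b t \<omega>)} \<subseteq> N" by (auto simp: b'_def)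
  qed
  ultimately show ?thesis by blast
qed

end

section \<open>Pathwise convergence of the Euler chain\<close>

context onb
begin

lemma diag_coeff_diff: "diag e I c z - diag e I d z = diag e I (\<lambda>i. c i - d i) z"
  unfolding diag_def by (simp add: sum_subtractf[symmetric] scaleR_diff_left[symmetric] left_diff_distrib)

end

lemma exp_minus_bounds:
  fixes x :: real assumes "0 \<le> x"
  shows "\<bar>1 - exp (- x)\<bar> \<le> x" "\<bar>1 - x - exp (- x)\<bar> \<le> x\<^sup>2"
proof -
  have lo: "1 - x \<le> exp (- x)" using exp_ge_add_one_self[of "- x"] by simp
  have "exp (- x) \<le> 1" using assms by simp
  then show "\<bar>1 - exp (- x)\<bar> \<le> x" using lo by simp
  have "1 \<le> (1 - x + x\<^sup>2) * (1 + x)"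
  proof -
    have "(1 - x + x\<^sup>2) * (1 + x) = 1 + x ^ 3" by (simp add: power2_eq_square power3_eq_cube algebra_simps)
    then show ?thesis using assms by simp
  qed
  also have "\<dots> \<le> (1 - x + x\<^sup>2) * exp x"
  proof (rule mult_left_mono)
    have "0 \<le> (1 - x)\<^sup>2 + x" using assms by simp
    then show "0 \<le> 1 - x + x\<^sup>2" by (simp add: power2_eq_square algebra_simps)
  qed simp
  finally have "exp (- x) \<le> 1 - x + x\<^sup>2" by (simp add: exp_minus field_simps)
  then show "\<bar>1 - x - exp (- x)\<bar> \<le> x\<^sup>2" using lo by simp
qed

context semilinear
begin

definition galerkin_drift :: "nat set \<Rightarrow> 'a \<Rightarrow> 'a" where
  "galerkin_drift I v = diag e I (\<lambda>_. 1) (F v) - diag e I lam v"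

lemma galerkin_drift_lipschitz:
  assumes I: "finite I" "I \<subseteq> {1..}"
  shows "norm (galerkin_drift I v - galerkin_drift I v') \<le> (sum lam I + L) * norm (v - v')"
proof -
  have l: "\<bar>lam i\<bar> \<le> sum lam I" if "i \<in> I" for i
  proof -
    have nn: "0 \<le> lam j" if "j \<in> I" for j using lam_pos[of j] that I by force
    have "lam i \<le> sum lam I" by (rule member_le_sum[OF that]) (use nn I in auto)
    then show ?thesis using nn[OF that] by simp
  qed
  have L0: "0 \<le> sum lam I" using lam_pos I by (intro sum_nonneg) (force intro: less_imp_le)
  have "galerkin_drift I v - galerkin_drift I v' = diag e I (\<lambda>_. 1) (F v - F v') - diag e I lam (v - v')"
    by (simp add: galerkin_drift_def diag_diff)
  also have "norm \<dots> \<le> norm (diag e I (\<lambda>_. 1) (F v - F v')) + norm (diag e I lam (v - v'))"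
    by (rule norm_triangle_ineq4)
  also have "\<dots> \<le> L * norm (v - v') + sum lam I * norm (v - v')"
  proof (rule add_mono)
    have "norm (diag e I (\<lambda>_. 1) (F v - F v')) \<le> 1 * norm (F v - F v')" by (rule norm_diag_le[OF I]) auto
    then show "norm (diag e I (\<lambda>_. 1) (F v - F v')) \<le> L * norm (v - v')" using F_lipschitz[of v v'] by simp
    show "norm (diag e I lam (v - v')) \<le> sum lam I * norm (v - v')" by (rule norm_diag_le[OF I l L0])
  qed
  finally show ?thesis by (simp add: algebra_simps)
qed

lemma galerkin_drift_continuous:
  assumes I: "finite I" "I \<subseteq> {1..}"
  shows "continuous_on UNIV (galerkin_drift I)"
  unfolding galerkin_drift_def[abs_def]
  by (intro continuous_on_diff linear_continuous_on bounded_linear_diag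
      continuous_on_compose2[OF linear_continuous_on[OF bounded_linear_diag] F_continuous]) auto

text \<open>One step of the explicit Euler scheme for the finite-dimensional equation and one step of
  the exponential scheme differ by the second-order error of \<open>exp (- (lam i * h))\<close>. The
  constant grows with \<open>I\<close>, which is harmless because \<open>I\<close> is fixed while the step size
  tends to 0.\<close>

lemma euler_local_error:
  assumes I: "finite I" "I \<subseteq> {1..}" and h: "0 < h" and v: "diag e I (\<lambda>_. 1) v = v" and w: "diag e I (\<lambda>_. 1) w = w"
  shows "norm (v + h *\<^sub>R galerkin_drift I v + w - diag e I (\<lambda>i. exp (- (lam i * h))) (v + h *\<^sub>R F v + w))
    \<le> h * (sum lam I * (h * (sum lam I * norm v + norm (F v)) + norm w))"
proof -
  let ?\<Lambda> = "sum lam I"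
  have li: "0 \<le> lam i \<and> lam i \<le> ?\<Lambda>" if "i \<in> I" for i
  proof -
    have nn: "0 \<le> lam j" if "j \<in> I" for j using lam_pos[of j] that I by force
    have "lam i \<le> sum lam I" by (rule member_le_sum[OF that]) (use nn I in auto)
    then show ?thesis using nn[OF that] by simp
  qed
  have L0: "0 \<le> ?\<Lambda>" using li by (intro sum_nonneg) auto
  have c1: "\<bar>1 - exp (- (lam i * h))\<bar> \<le> ?\<Lambda> * h" if "i \<in> I" for i
  proof -
    have "0 \<le> lam i * h" "lam i * h \<le> ?\<Lambda> * h" using li[OF that] h by (auto intro: mult_right_mono)
    then show ?thesis using exp_minus_bounds(1)[of "lam i * h"] by linarith
  qed
  have c2: "\<bar>1 - lam i * h - exp (- (lam i * h))\<bar> \<le> (?\<Lambda> * h)\<^sup>2" if "i \<in> I" for i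
  proof -
    have "0 \<le> lam i * h" "lam i * h \<le> ?\<Lambda> * h" using li[OF that] h by (auto intro: mult_right_mono)
    then show ?thesis using exp_minus_bounds(2)[of "lam i * h"] power_mono[of "lam i * h" "?\<Lambda> * h" 2] by linarith
  qed
  let ?S = "diag e I (\<lambda>i. exp (- (lam i * h)))" and ?P = "diag e I (\<lambda>_. 1)"
  have hl: "h *\<^sub>R diag e I lam v = diag e I (\<lambda>i. lam i * h) v"
    by (simp add: diag_def scaleR_sum_right mult_ac)
  have "v + h *\<^sub>R galerkin_drift I v + w - ?S (v + h *\<^sub>R F v + w)
      = (?P v - h *\<^sub>R diag e I lam v - ?S v) + h *\<^sub>R (?P (F v) - ?S (F v)) + (?P w - ?S w)"
    unfolding v w by (simp add: galerkin_drift_def diag_add diag_scaleR algebra_simps)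
  also have "\<dots> = diag e I (\<lambda>i. 1 - lam i * h - exp (- (lam i * h))) v
      + h *\<^sub>R diag e I (\<lambda>i. 1 - exp (- (lam i * h))) (F v) + diag e I (\<lambda>i. 1 - exp (- (lam i * h))) w"
    unfolding hl diag_coeff_diff ..
  finally have eq: "v + h *\<^sub>R galerkin_drift I v + w - ?S (v + h *\<^sub>R F v + w)
      = diag e I (\<lambda>i. 1 - lam i * h - exp (- (lam i * h))) v
      + h *\<^sub>R diag e I (\<lambda>i. 1 - exp (- (lam i * h))) (F v) + diag e I (\<lambda>i. 1 - exp (- (lam i * h))) w" .
  have n1: "norm (diag e I (\<lambda>i. 1 - lam i * h - exp (- (lam i * h))) v) \<le> (?\<Lambda> * h)\<^sup>2 * norm v"
    by (rule norm_diag_le[OF I c2]) auto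
  have n2: "norm (h *\<^sub>R diag e I (\<lambda>i. 1 - exp (- (lam i * h))) (F v)) \<le> h * (?\<Lambda> * h * norm (F v))"
    using norm_diag_le[OF I c1, where z = "F v"] L0 h by (simp add: mult_left_mono)
  have n3: "norm (diag e I (\<lambda>i. 1 - exp (- (lam i * h))) w) \<le> ?\<Lambda> * h * norm w"
    by (rule norm_diag_le[OF I c1]) (use L0 h in auto)
  have "norm (v + h *\<^sub>R galerkin_drift I v + w - ?S (v + h *\<^sub>R F v + w))
      \<le> (?\<Lambda> * h)\<^sup>2 * norm v + h * (?\<Lambda> * h * norm (F v)) + ?\<Lambda> * h * norm w"
    unfolding eq by (intro order_trans[OF norm_triangle_ineq] add_mono n1 n2 n3)
  also have "\<dots> = h * (?\<Lambda> * (h * (?\<Lambda> * norm v + norm (F v)) + norm w))"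
    by (simp add: power2_eq_square algebra_simps)
  finally show ?thesis .
qed

text \<open>For a fixed continuous path \<open>W\<close> the local error of a step is \<open>h\<close> times a quantity that is
  small by uniform continuity. As a step of the scheme does not increase distances, the
  local errors only add up.\<close>

lemma euler_path_convergence:
  fixes y W :: "real \<Rightarrow> 'a" and x :: "nat \<Rightarrow> nat \<Rightarrow> 'a"
  assumes I: "finite I" "I \<subseteq> {1..}" and T: "0 < T"
    and y: "continuous_on {0..T} y" and W: "continuous_on {0..T} W" and W0: "W 0 = 0"
    and Py: "\<And>t. 0 \<le> t \<Longrightarrow> t \<le> T \<Longrightarrow> diag e I (\<lambda>_. 1) (y t) = y t"
    and PW: "\<And>t. 0 \<le> t \<Longrightarrow> t \<le> T \<Longrightarrow> diag e I (\<lambda>_. 1) (W t) = W t"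
    and eq: "\<And>t. 0 \<le> t \<Longrightarrow> t \<le> T \<Longrightarrow> y t = diag e I (\<lambda>_. 1) X0 + integral {0..t} (\<lambda>s. galerkin_drift I (y s)) + W t"
    and x0: "\<And>m. x m 0 = diag e I (\<lambda>_. 1) X0"
    and xS: "\<And>m j. x m (Suc j) = diag e I (\<lambda>i. exp (- (lam i * (T / real m))))
      (x m j + (T / real m) *\<^sub>R F (x m j) + (W (real (Suc j) * (T / real m)) - W (real j * (T / real m))))"
  shows "(\<lambda>m. x m m) \<longlonglongrightarrow> y T"
proof (rule LIMSEQ_I)
  fix r :: real assume r: "r > 0"
  let ?\<Lambda> = "sum lam I"
  define \<epsilon> where "\<epsilon> = r / (2 * T)"
  have \<epsilon>: "\<epsilon> > 0" using r T by (simp add: \<epsilon>_def)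
  have L0: "0 \<le> ?\<Lambda>" using lam_pos I by (intro sum_nonneg) (force intro: less_imp_le)
  have cont: "continuous_on {0..T} (\<lambda>s. galerkin_drift I (y s))"
    by (rule continuous_on_compose2[OF galerkin_drift_continuous[OF I] y]) auto
  have "compact (y ` {0..T})" by (rule compact_continuous_image[OF y]) simp
  then obtain Y where Y: "\<And>t. 0 \<le> t \<Longrightarrow> t \<le> T \<Longrightarrow> norm (y t) \<le> Y"
    using compact_imp_bounded[of "y ` {0..T}"] by (force simp: bounded_iff)
  have "continuous_on {0..T} (\<lambda>s. F (y s))" by (rule continuous_on_compose2[OF F_continuous y]) auto
  then have "compact ((\<lambda>s. F (y s)) ` {0..T})" by (rule compact_continuous_image) simp
  then obtain Z where Z: "\<And>t. 0 \<le> t \<Longrightarrow> t \<le> T \<Longrightarrow> norm (F (y t)) \<le> Z"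
    using compact_imp_bounded[of "(\<lambda>s. F (y s)) ` {0..T}"] by (force simp: bounded_iff)
  \<comment> \<open>The admissible oscillation of \<open>y\<close> and of \<open>W\<close> over one grid interval.\<close>
  define \<rho> where "\<rho> = \<epsilon> / (2 * (2 * ?\<Lambda> + L))"
  have \<rho>: "\<rho> > 0" "(2 * ?\<Lambda> + L) * \<rho> = \<epsilon> / 2"
  proof -
    have "2 * ?\<Lambda> + L > 0" using L0 L_pos by simp
    then show "\<rho> > 0" using \<epsilon> by (simp add: \<rho>_def)
    have "k * (\<epsilon> / (2 * k)) = \<epsilon> / 2" if "k > 0" for k :: real using that by simp
    from this[OF \<open>2 * ?\<Lambda> + L > 0\<close>] show "(2 * ?\<Lambda> + L) * \<rho> = \<epsilon> / 2" by (simp only: \<rho>_def)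
  qed
  have small: "\<forall>\<^sub>F m in sequentially. ?\<Lambda> * ((T / real m) * (?\<Lambda> * Y + Z)) < \<epsilon> / 2"
  proof -
    have "(\<lambda>m. ?\<Lambda> * ((T / real m) * (?\<Lambda> * Y + Z))) \<longlonglongrightarrow> ?\<Lambda> * (0 * (?\<Lambda> * Y + Z))"
      by (intro tendsto_intros lim_const_over_n)
    then show ?thesis by (rule order_tendstoD(2)) (use \<epsilon> in simp)
  qed
  have hsmall: "\<forall>\<^sub>F m in sequentially. T / real m < min (c / L\<^sup>2) (2 / c)"
    using lim_const_over_n[of T] by (rule order_tendstoD(2)) (use c_pos L_pos in simp)
  have "\<forall>\<^sub>F m in sequentially. norm (x m m - y T) < r"
    using uniform_grid_oscillation[OF y less_imp_le[OF T] \<rho>(1)] uniform_grid_oscillation[OF W less_imp_le[OF T] \<rho>(1)]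
      small hsmall eventually_gt_at_top[of 0]
  proof eventually_elim
    case (elim m)
    define h where "h = T / real m"
    have h: "0 < h" "real m * h = T" using T elim(5) by (auto simp: h_def)
    have hL: "h * L\<^sup>2 \<le> c" "c * h \<le> 2"
      using elim(4) c_pos L_pos unfolding h_def[symmetric] by (auto simp: field_simps)
    define g where "g j = real j * h" for j
    have g: "0 \<le> g j" "g j \<le> g (Suc j)" "g (Suc j) - g j = h" for j using h by (auto simp: g_def algebra_simps)
    have gT: "g (Suc j) \<le> T" if "j < m" for j
    proof -
      have "real (Suc j) * h \<le> real m * h" using that h by (intro mult_right_mono) auto
      then show ?thesis using h by (simp add: g_def)
    qed
    have gT': "g j \<le> T" if "j \<le> m" for j
    proof -
      have "real j * h \<le> real m * h" using that h by (intro mult_right_mono) auto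
      then show ?thesis using h by (simp add: g_def)
    qed
    let ?S = "diag e I (\<lambda>i. exp (- (lam i * h)))"
    \<comment> \<open>The path \<open>y\<close> satisfies the scheme up to \<open>h * \<epsilon>\<close> in each step.\<close>
    have local: "norm (y (g (Suc j)) - ?S (y (g j) + h *\<^sub>R F (y (g j)) + (W (g (Suc j)) - W (g j)))) \<le> h * \<epsilon>"
      if j: "j < m" for j
    proof -
      let ?v = "y (g j)" and ?w = "W (g (Suc j)) - W (g j)"
      have sub: "{g j..g (Suc j)} \<subseteq> {0..T}" "{0..g (Suc j)} \<subseteq> {0..T}" using g(1)[of j] gT[OF j] by auto
      have jm: "g j \<le> T" using gT'[of j] j by simp
      have split: "integral {0..g (Suc j)} (\<lambda>s. galerkin_drift I (y s))
          = integral {0..g j} (\<lambda>s. galerkin_drift I (y s)) + integral {g j..g (Suc j)} (\<lambda>s. galerkin_drift I (y s))"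
        by (rule Henstock_Kurzweil_Integration.integral_combine[symmetric, OF g(1,2)])
           (intro integrable_continuous_real continuous_on_subset[OF cont sub(2)])
      have "0 \<le> g (Suc j)" using g(1,2)[of j] by linarith
      then have inc: "y (g (Suc j)) = ?v + integral {g j..g (Suc j)} (\<lambda>s. galerkin_drift I (y s)) + ?w"
        using eq[of "g (Suc j)"] eq[of "g j"] split gT[OF j] jm g(1) by simp
      have c1: "continuous_on {g j..g (Suc j)} (\<lambda>s. galerkin_drift I (y s))" by (rule continuous_on_subset[OF cont sub(1)])
      have "integral {g j..g (Suc j)} (\<lambda>s. galerkin_drift I (y s) - galerkin_drift I ?v)
          = integral {g j..g (Suc j)} (\<lambda>s. galerkin_drift I (y s)) - integral {g j..g (Suc j)} (\<lambda>s. galerkin_drift I ?v)"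
        by (intro Henstock_Kurzweil_Integration.integral_diff integrable_continuous_real c1 continuous_on_const)
      then have ieq: "integral {g j..g (Suc j)} (\<lambda>s. galerkin_drift I (y s))
          = integral {g j..g (Suc j)} (\<lambda>s. galerkin_drift I (y s) - galerkin_drift I ?v) + h *\<^sub>R galerkin_drift I ?v"
        using g(2,3)[of j] by simp
      have i: "norm (integral {g j..g (Suc j)} (\<lambda>s. galerkin_drift I (y s) - galerkin_drift I ?v)) \<le> ((?\<Lambda> + L) * \<rho>) * (g (Suc j) - g j)"
      proof (rule integral_bound[OF g(2)])
        show "continuous_on {g j..g (Suc j)} (\<lambda>s. galerkin_drift I (y s) - galerkin_drift I ?v)"
          by (intro continuous_intros c1)
        fix s assume s: "s \<in> {g j..g (Suc j)}"
        have "dist (y s) ?v < \<rho>" using elim(1) j s unfolding g_def h_def by auto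
        then have "(?\<Lambda> + L) * norm (y s - ?v) \<le> (?\<Lambda> + L) * \<rho>"
          using L0 L_pos by (intro mult_left_mono) (auto simp: dist_norm)
        then show "norm (galerkin_drift I (y s) - galerkin_drift I ?v) \<le> (?\<Lambda> + L) * \<rho>"
          using galerkin_drift_lipschitz[OF I, of "y s" ?v] by linarith
      qed
      have Pw: "diag e I (\<lambda>_. 1) ?w = ?w"
        using PW[of "g j"] PW[of "g (Suc j)"] g(1) \<open>0 \<le> g (Suc j)\<close> gT[OF j] jm by (simp add: diag_diff)
      have w\<rho>: "norm ?w \<le> \<rho>"
      proof -
        have "dist (W (g (Suc j))) (W (g j)) < \<rho>" using elim(2) j g(2)[of j] unfolding g_def h_def by auto
        then show ?thesis by (simp add: dist_norm)
      qed
      have "norm (?v + h *\<^sub>R galerkin_drift I ?v + ?w - ?S (?v + h *\<^sub>R F ?v + ?w))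
          \<le> h * (?\<Lambda> * (h * (?\<Lambda> * norm ?v + norm (F ?v)) + norm ?w))"
        by (rule euler_local_error[OF I h(1) Py[OF g(1) jm] Pw])
      also have "\<dots> \<le> h * (?\<Lambda> * (h * (?\<Lambda> * Y + Z) + \<rho>))"
        using h L0 Y[OF g(1) jm] Z[OF g(1) jm] w\<rho> by (intro mult_left_mono add_mono) auto
      finally have loc: "norm (?v + h *\<^sub>R galerkin_drift I ?v + ?w - ?S (?v + h *\<^sub>R F ?v + ?w))
          \<le> h * (?\<Lambda> * (h * (?\<Lambda> * Y + Z) + \<rho>))" .
      have dec: "y (g (Suc j)) - ?S (?v + h *\<^sub>R F ?v + ?w)
          = integral {g j..g (Suc j)} (\<lambda>s. galerkin_drift I (y s) - galerkin_drift I ?v)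
            + (?v + h *\<^sub>R galerkin_drift I ?v + ?w - ?S (?v + h *\<^sub>R F ?v + ?w))"
        unfolding inc ieq by simp
      have "norm (y (g (Suc j)) - ?S (?v + h *\<^sub>R F ?v + ?w))
          \<le> ((?\<Lambda> + L) * \<rho>) * h + h * (?\<Lambda> * (h * (?\<Lambda> * Y + Z) + \<rho>))"
        unfolding dec by (rule norm_triangle_mono[OF i[unfolded g(3)] loc])
      also have "\<dots> = h * ((2 * ?\<Lambda> + L) * \<rho> + ?\<Lambda> * (h * (?\<Lambda> * Y + Z)))" by (simp add: algebra_simps)
      also have "\<dots> \<le> h * (\<epsilon> / 2 + \<epsilon> / 2)"
        using elim(3) h(1) unfolding \<rho>(2) h_def[symmetric] by (intro mult_left_mono add_mono) auto
      finally show ?thesis by simp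
    qed
    have "norm (y (g j) - x m j) \<le> real j * (h * \<epsilon>)" if "j \<le> m" for j
      using that
    proof (induction j)
      case 0
      have "y 0 = diag e I (\<lambda>_. 1) X0" using eq[of 0] T W0 by simp
      then show ?case by (simp add: g_def x0)
    next
      case (Suc j)
      let ?v = "y (g j)" and ?w = "W (g (Suc j)) - W (g j)" and ?x = "x m j"
      have j: "j < m" using Suc.prems by simp
      have "norm (?S ((?v - ?x) + h *\<^sub>R (F ?v - F ?x) + h *\<^sub>R 0)) \<le>
         (1 - (c * h / 2) / (1 + c * h / 2)) * norm (?v - ?x) + (c * h / 2) / (1 + c * h / 2) * ((4 / c) * norm (0::'a))"
        by (rule contraction_step[OF I h(1) hL F_dissipative F_lipschitz refl])
      also have "\<dots> \<le> 1 * norm (?v - ?x)"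
      proof -
        have "0 \<le> (c * h / 2) / (1 + c * h / 2)" using c_pos h(1) by simp
        then have "(1 - (c * h / 2) / (1 + c * h / 2)) * norm (?v - ?x) \<le> 1 * norm (?v - ?x)"
          by (intro mult_right_mono) auto
        then show ?thesis by simp
      qed
      finally have stab: "norm (?S ((?v - ?x) + h *\<^sub>R (F ?v - F ?x))) \<le> norm (?v - ?x)" by simp
      have "x m (Suc j) = ?S (?x + h *\<^sub>R F ?x + ?w)" unfolding xS g_def h_def ..
      then have dec: "y (g (Suc j)) - x m (Suc j)
          = (y (g (Suc j)) - ?S (?v + h *\<^sub>R F ?v + ?w)) + ?S ((?v - ?x) + h *\<^sub>R (F ?v - F ?x))"
        by (simp add: diag_add diag_diff diag_scaleR algebra_simps)
      have "norm (y (g (Suc j)) - x m (Suc j)) \<le> h * \<epsilon> + norm (?v - ?x)"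
        unfolding dec by (rule norm_triangle_mono[OF local[OF j] stab])
      also have "\<dots> \<le> h * \<epsilon> + real j * (h * \<epsilon>)" using Suc.IH Suc.prems by simp
      finally show ?case by (simp add: algebra_simps)
    qed
    from this[of m] have "norm (y T - x m m) \<le> T * \<epsilon>"
      using h(2) by (simp add: g_def mult.assoc[symmetric])
    also have "\<dots> < r" using r T by (simp add: \<epsilon>_def)
    finally show ?case by (simp add: norm_minus_commute)
  qed
  then show "\<exists>no. \<forall>m\<ge>no. norm (x m m - y T) < r" unfolding eventually_sequentially .
qed

end

section \<open>Distance of a Galerkin path from the mild solution\<close>

context semilinear
begin

lemma F_linear_growth: "norm (F x) \<le> norm (F 0) + L * norm x"
  using F_lipschitz[of x 0] norm_triangle_ineq[of "F 0" "F x - F 0"] by simp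

lemma set_integrable_F:
  fixes a b :: real
  assumes "set_integrable lborel {a..b} x"
  shows "set_integrable lborel {a..b} (\<lambda>s. F (x s))"
  unfolding set_integrable_def
proof (rule Bochner_Integration.integrable_bound[where f = "\<lambda>s. norm (F 0) * indicat_real {a..b} s + L * norm (indicat_real {a..b} s *\<^sub>R x s)"])
  have ix: "integrable lborel (\<lambda>s. indicat_real {a..b} s *\<^sub>R x s)" using assms by (simp add: set_integrable_def)
  have [measurable]: "(\<lambda>s. indicat_real {a..b} s *\<^sub>R x s) \<in> borel_measurable lborel" using ix by auto
  have "integrable lborel (indicat_real {a..b})" by (rule integrable_real_indicator) (auto simp: emeasure_lborel_Icc_eq)
  then show "integrable lborel (\<lambda>s. norm (F 0) * indicat_real {a..b} s + L * norm (indicat_real {a..b} s *\<^sub>R x s))"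
    by (intro Bochner_Integration.integrable_add Bochner_Integration.integrable_mult_right Bochner_Integration.integrable_norm ix)
  have "(\<lambda>s. indicat_real {a..b} s *\<^sub>R F (indicat_real {a..b} s *\<^sub>R x s)) \<in> borel_measurable lborel" by measurable
  moreover have "indicat_real {a..b} s *\<^sub>R F (indicat_real {a..b} s *\<^sub>R x s) = indicat_real {a..b} s *\<^sub>R F (x s)" for s
    by (simp add: indicator_def)
  ultimately show "(\<lambda>s. indicat_real {a..b} s *\<^sub>R F (x s)) \<in> borel_measurable lborel" by simp
  show "AE s in lborel. norm (indicat_real {a..b} s *\<^sub>R F (x s)) \<le> norm (norm (F 0) * indicat_real {a..b} s + L * norm (indicat_real {a..b} s *\<^sub>R x s))"
    using order_trans[OF F_linear_growth abs_ge_self] by (intro AE_I2) (auto simp: indicator_def)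
qed

text \<open>In coordinates the mild equations of \<open>x\<close> and \<open>y\<close> contain the same noise term. Their
  difference leaves \<open>norm (P x t - y t) \<le> L * \<integral> norm (x s - y s)\<close> over \<open>[0, t]\<close>, with \<open>P\<close>
  the projection on the modes in \<open>I\<close>, and Gronwall's lemma reduces the right-hand side to
  the distance of \<open>x\<close> from its projection.\<close>

lemma galerkin_path_error:
  fixes x y :: "real \<Rightarrow> 'a" and b :: "nat \<Rightarrow> real \<Rightarrow> real"
  assumes I: "finite I" "I \<subseteq> {1..}" and T: "0 < T" and x: "set_integrable lborel {0..T} x"
    and b: "\<And>i. i \<in> I \<Longrightarrow> continuous_on {0..T} (b i)" "\<And>i. i \<in> I \<Longrightarrow> b i 0 = 0"
    and y: "continuous_on {0..T} y" and Py: "\<And>t. 0 \<le> t \<Longrightarrow> t \<le> T \<Longrightarrow> diag e I (\<lambda>_. 1) (y t) = y t"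
    and yeq: "\<And>t. 0 \<le> t \<Longrightarrow> t \<le> T \<Longrightarrow> y t = diag e I (\<lambda>_. 1) X0 + integral {0..t} (\<lambda>s. galerkin_drift I (y s))
      + (\<Sum>i\<in>I. (sqrt (q i) * b i t) *\<^sub>R e i)"
    and xT: "\<And>i. i \<in> I \<Longrightarrow> inner (e i) (x T) = exp (- (lam i * T)) * inner (e i) X0
        + (LINT s:{0..T}|lborel. exp (- (lam i * (T - s))) * inner (e i) (F (x s)))
        + sqrt (q i) * (b i T - lam i * integral {0..T} (\<lambda>s. exp (- (lam i * (T - s))) * b i s))"
    and xt: "\<And>i. i \<in> I \<Longrightarrow> AE t in lborel. t \<in> {0..T} \<longrightarrow> inner (e i) (x t) = exp (- (lam i * t)) * inner (e i) X0
        + (LINT s:{0..t}|lborel. exp (- (lam i * (t - s))) * inner (e i) (F (x s)))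
        + sqrt (q i) * (b i t - lam i * integral {0..t} (\<lambda>s. exp (- (lam i * (t - s))) * b i s))"
  shows "norm (diag e I (\<lambda>_. 1) (x T) - y T) \<le> L * exp (L * T) * (LINT s:{0..T}|lborel. norm (x s - diag e I (\<lambda>_. 1) (x s)))"
proof -
  let ?P = "diag e I (\<lambda>_. 1)"
  have cy: "set_integrable lborel {0..T} y"
    using borel_integrable_atLeastAtMost'[OF y] by simp
  have iFx: "set_integrable lborel {0..T} (\<lambda>s. F (x s))" by (rule set_integrable_F[OF x])
  have iFy: "set_integrable lborel {0..T} (\<lambda>s. F (y s))" by (rule set_integrable_F[OF cy])
  have ixy: "set_integrable lborel {0..T} (\<lambda>s. x s - y s)" by (rule set_integral_diff(1)[OF x cy])
  have nxy: "set_integrable lborel {0..T} (\<lambda>s. norm (x s - y s))" by (rule set_integrable_norm[OF ixy])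
  have iP: "set_integrable lborel {0..T} (\<lambda>s. ?P (x s))"
    using integrable_bounded_linear[OF bounded_linear_diag x[unfolded set_integrable_def], of I "\<lambda>_. 1"]
    unfolding set_integrable_def by (simp add: diag_scaleR)
  have ir: "set_integrable lborel {0..T} (\<lambda>s. norm (x s - ?P (x s)))"
    by (intro set_integrable_norm set_integral_diff(1) x iP)
  have iz: "set_integrable lborel {0..T} (\<lambda>s. norm (?P (x s) - y s))"
    by (intro set_integrable_norm set_integral_diff(1) cy iP)
  define R where "R = (LINT s:{0..T}|lborel. norm (x s - ?P (x s)))"
  define \<phi> where "\<phi> s = norm (?P (x s) - y s) + norm (x s - ?P (x s))" for s
  have i\<phi>: "set_integrable lborel {0..T} \<phi>" unfolding \<phi>_def by (rule set_integral_add(1)[OF iz ir])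
  \<comment> \<open>Gronwall's lemma is applied to the integral of the distance, because \<open>x\<close> need not be
    continuous.\<close>
  define u where "u t = integral {0..t} \<phi>" for t
  have sub: "set_integrable lborel {0..t} f" if "set_integrable lborel {0..T} f" "t \<le> T" for t and f :: "real \<Rightarrow> 'c::{banach,second_countable_topology}"
    by (rule set_integrable_subset[OF that(1)]) (use that in auto)
  have cu: "continuous_on {0..T} u"
    unfolding u_def[abs_def] using set_borel_integral_eq_integral(1)[OF i\<phi>] by (rule indefinite_integral_continuous_1)
  have ueq: "u t = (LINT s:{0..t}|lborel. \<phi> s)" if "t \<le> T" for t
    unfolding u_def using set_borel_integral_eq_integral(2)[OF sub[OF i\<phi> that]] by simp
  \<comment> \<open>The Galerkin path in mild form, by variation of constants in each coordinate.\<close>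
  have ymild: "inner (e i) (y t) = exp (- (lam i * t)) * inner (e i) X0
        + integral {0..t} (\<lambda>s. exp (- (lam i * (t - s))) * inner (e i) (F (y s)))
        + sqrt (q i) * (b i t - lam i * integral {0..t} (\<lambda>s. exp (- (lam i * (t - s))) * b i s))"
    if i: "i \<in> I" and t: "0 \<le> t" "t \<le> T" for i t
  proof -
    have i1: "i \<ge> 1" using i I by auto
    have cg: "continuous_on {0..T} (\<lambda>s. galerkin_drift I (y s))"
      by (rule continuous_on_compose2[OF galerkin_drift_continuous[OF I] y]) auto
    have coord: "inner (e i) (y s) = inner (e i) X0 + integral {0..s} (\<lambda>r. - (lam i * inner (e i) (y r)) + inner (e i) (F (y r)))
        + sqrt (q i) * b i s" if s: "0 \<le> s" "s \<le> T" for s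
    proof -
      have ig: "(\<lambda>r. galerkin_drift I (y r)) integrable_on {0..s}"
        by (intro integrable_continuous_real continuous_on_subset[OF cg]) (use s in auto)
      have "inner (e i) (integral {0..s} (\<lambda>r. galerkin_drift I (y r))) = integral {0..s} (\<lambda>r. inner (e i) (galerkin_drift I (y r)))"
        using integral_linear[OF ig bounded_linear_inner_right[of "e i"]] by (simp only: comp_def)
      also have "\<dots> = integral {0..s} (\<lambda>r. - (lam i * inner (e i) (y r)) + inner (e i) (F (y r)))"
        using i I i1 by (simp add: galerkin_drift_def inner_diff_right inner_diag)
      finally show ?thesis
        using yeq[OF s] i I i1 by (simp add: inner_add_right inner_diag inner_basis_sum)
    qed
    have "inner (e i) (y t) = exp (- (lam i * t)) * inner (e i) X0
        + integral {0..t} (\<lambda>s. exp (- (lam i * (t - s))) * inner (e i) (F (y s)))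
        + (sqrt (q i) * b i t - lam i * integral {0..t} (\<lambda>s. exp (- (lam i * (t - s))) * (sqrt (q i) * b i s)))"
    proof (rule variation_of_constants[where T = T])
      show "continuous_on {0..T} (\<lambda>s. inner (e i) (y s))" by (intro continuous_intros y)
      show "continuous_on {0..T} (\<lambda>s. inner (e i) (F (y s)))"
        by (intro continuous_on_inner continuous_on_const continuous_on_compose2[OF F_continuous y]) auto
      show "continuous_on {0..T} (\<lambda>s. sqrt (q i) * b i s)" by (intro continuous_intros b(1)[OF i])
    qed (use coord b(2)[OF i] t in auto)
    moreover have "integral {0..t} (\<lambda>s. exp (- (lam i * (t - s))) * (sqrt (q i) * b i s))
        = sqrt (q i) * integral {0..t} (\<lambda>s. exp (- (lam i * (t - s))) * b i s)"
      unfolding integral_mult_right[symmetric] by (simp add: mult.left_commute)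
    ultimately show ?thesis by (simp add: right_diff_distrib mult.left_commute)
  qed
  have zbound: "norm (?P (x t) - y t) \<le> L * u t"
    if t: "0 \<le> t" "t \<le> T" and xt: "\<And>i. i \<in> I \<Longrightarrow> inner (e i) (x t) = exp (- (lam i * t)) * inner (e i) X0
        + (LINT s:{0..t}|lborel. exp (- (lam i * (t - s))) * inner (e i) (F (x s)))
        + sqrt (q i) * (b i t - lam i * integral {0..t} (\<lambda>s. exp (- (lam i * (t - s))) * b i s))" for t
  proof -
    let ?D = "\<lambda>s. diag e I (\<lambda>i. exp (- (lam i * (t - s)))) (F (x s) - F (y s))"
    have ker: "set_integrable lborel {0..t} (\<lambda>s. exp (- (lam i * (t - s))) * inner (e i) (f s))"
      if f: "set_integrable lborel {0..t} f" and i: "i \<in> I" for f :: "real \<Rightarrow> 'a" and i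
    proof (rule set_integrable_bound[OF set_integrable_norm[OF f]])
      have "(\<lambda>s. indicat_real {0..t} s *\<^sub>R f s) \<in> borel_measurable lborel" using f by (auto simp: set_integrable_def)
      then have "(\<lambda>s. exp (- (lam i * (t - s))) * inner (e i) (indicat_real {0..t} s *\<^sub>R f s)) \<in> borel_measurable lborel" by measurable
      then show "set_borel_measurable lborel {0..t} (\<lambda>s. exp (- (lam i * (t - s))) * inner (e i) (f s))"
        unfolding set_borel_measurable_def by (simp add: mult_ac)
      have i1: "i \<ge> 1" using i I by auto
      show "AE s in lborel. s \<in> {0..t} \<longrightarrow> norm (exp (- (lam i * (t - s))) * inner (e i) (f s)) \<le> norm (norm (f s))"
      proof (intro AE_I2 impI)
        fix s assume s: "s \<in> {0..t}"
        have "\<bar>inner (e i) (f s)\<bar> \<le> norm (e i) * norm (f s)" by (rule Cauchy_Schwarz_ineq2)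
        then have "exp (- (lam i * (t - s))) * \<bar>inner (e i) (f s)\<bar> \<le> 1 * norm (f s)"
          using lam_pos[OF i1] s norm_basis[OF i1] by (intro mult_mono) auto
        then show "norm (exp (- (lam i * (t - s))) * inner (e i) (f s)) \<le> norm (norm (f s))" by (simp add: abs_mult)
      qed
    qed
    have d: "set_integrable lborel {0..t} (\<lambda>s. F (x s) - F (y s))"
      by (rule set_integral_diff(1)[OF sub[OF iFx t(2)] sub[OF iFy t(2)]])
    have iD: "set_integrable lborel {0..t} ?D"
    proof -
      have "set_integrable lborel {0..t} (\<lambda>s. (exp (- (lam i * (t - s))) * inner (e i) (F (x s) - F (y s))) *\<^sub>R e i)" if "i \<in> I" for i
        by (rule set_integrable_scaleR_left) (use ker[OF d that] in auto)
      then show ?thesis unfolding diag_def set_integrable_def scaleR_sum_right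
        by (intro Bochner_Integration.integrable_sum)
    qed
    let ?V = "LINT s:{0..t}|lborel. ?D s"
    have "inner (e i) (?P (x t) - y t) = inner (e i) ?V" if i: "i \<in> I" for i
    proof -
      have i1: "i \<ge> 1" using i I by auto
      have yi: "integral {0..t} (\<lambda>s. exp (- (lam i * (t - s))) * inner (e i) (F (y s)))
          = (LINT s:{0..t}|lborel. exp (- (lam i * (t - s))) * inner (e i) (F (y s)))"
        by (rule set_borel_integral_eq_integral(2)[symmetric]) (rule ker[OF sub[OF iFy t(2)] i])
      have "inner (e i) (?P (x t) - y t) = inner (e i) (x t) - inner (e i) (y t)"
        using i I i1 by (simp add: inner_diff_right inner_diag)
      also have "\<dots> = (LINT s:{0..t}|lborel. exp (- (lam i * (t - s))) * inner (e i) (F (x s)))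
          - (LINT s:{0..t}|lborel. exp (- (lam i * (t - s))) * inner (e i) (F (y s)))"
        using xt[OF i] ymild[OF i t] yi by simp
      also have "\<dots> = (LINT s:{0..t}|lborel. exp (- (lam i * (t - s))) * inner (e i) (F (x s))
            - exp (- (lam i * (t - s))) * inner (e i) (F (y s)))"
        by (rule set_integral_diff(2)[OF ker[OF sub[OF iFx t(2)] i] ker[OF sub[OF iFy t(2)] i], symmetric])
      also have "\<dots> = (LINT s:{0..t}|lborel. inner (e i) (?D s))"
        using i I i1 by (simp add: inner_diag inner_diff_right right_diff_distrib)
      also have "\<dots> = inner (e i) ?V"
        using integral_bounded_linear[OF bounded_linear_inner_right iD[unfolded set_integrable_def], of "e i"]
        unfolding set_lebesgue_integral_def by simp
      finally show ?thesis .
    qed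
    then have "?P (?P (x t) - y t) = ?P ?V" by (rule diag_cong_inner)
    moreover have "?P (?P (x t) - y t) = ?P (x t) - y t"
      using Py[OF t] I by (simp add: diag_diff diag_diag)
    ultimately have "norm (?P (x t) - y t) \<le> norm ?V"
      using norm_diag_le[OF I, of "\<lambda>_. 1" 1 ?V] by simp
    also have "\<dots> \<le> (LINT s:{0..t}|lborel. norm (?D s))" by (rule set_integral_norm_bound[OF iD])
    also have "\<dots> \<le> (LINT s:{0..t}|lborel. L * \<phi> s)"
    proof (rule set_integral_mono[OF set_integrable_norm[OF iD]])
      show "set_integrable lborel {0..t} (\<lambda>s. L * \<phi> s)" using sub[OF i\<phi> t(2)] by simp
      fix s assume s: "s \<in> {0..t}"
      have "norm (?D s) \<le> 1 * norm (F (x s) - F (y s))"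
      proof (rule norm_diag_le[OF I])
        fix i assume "i \<in> I"
        then show "\<bar>exp (- (lam i * (t - s)))\<bar> \<le> 1" using lam_pos[of i] I s by force
      qed simp
      also have "\<dots> \<le> L * norm (x s - y s)" using F_lipschitz by simp
      also have "\<dots> \<le> L * \<phi> s"
      proof (rule mult_left_mono)
        show "norm (x s - y s) \<le> \<phi> s"
          using norm_triangle_ineq[of "?P (x s) - y s" "x s - ?P (x s)"] by (simp add: \<phi>_def)
      qed (use L_pos in simp)
      finally show "norm (?D s) \<le> L * \<phi> s" .
    qed
    also have "\<dots> = L * u t" using ueq[OF t(2)] by simp
    finally show ?thesis .
  qed
  have "u T \<le> R * exp (L * T)"
  proof (rule gronwall[OF cu])
    fix t assume t: "0 \<le> t" "t \<le> T"
    have "u t = (LINT s:{0..t}|lborel. norm (?P (x s) - y s)) + (LINT s:{0..t}|lborel. norm (x s - ?P (x s)))"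
      unfolding ueq[OF t(2)] \<phi>_def by (rule set_integral_add(2)[OF sub[OF iz t(2)] sub[OF ir t(2)]])
    also have "(LINT s:{0..t}|lborel. norm (x s - ?P (x s))) \<le> R"
      unfolding R_def set_lebesgue_integral_def
      using sub[OF ir t(2), unfolded set_integrable_def] ir[unfolded set_integrable_def] t
      by (intro Bochner_Integration.integral_mono) (auto simp: indicator_def)
    also have "(LINT s:{0..t}|lborel. norm (?P (x s) - y s)) \<le> (LINT s:{0..t}|lborel. L * u s)"
    proof (rule set_integral_mono_AE[OF sub[OF iz t(2)]])
      have "continuous_on {0..t} (\<lambda>s. L * u s)" by (intro continuous_intros continuous_on_subset[OF cu]) (use t in auto)
      then show "set_integrable lborel {0..t} (\<lambda>s. L * u s)" by (rule borel_integrable_atLeastAtMost')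
      have "AE s in lborel. \<forall>i\<in>I. s \<in> {0..T} \<longrightarrow> inner (e i) (x s) = exp (- (lam i * s)) * inner (e i) X0
        + (LINT r:{0..s}|lborel. exp (- (lam i * (s - r))) * inner (e i) (F (x r)))
        + sqrt (q i) * (b i s - lam i * integral {0..s} (\<lambda>r. exp (- (lam i * (s - r))) * b i r))"
        using xt by (intro AE_finite_allI I)
      then show "AE s\<in>{0..t} in lborel. norm (?P (x s) - y s) \<le> L * u s"
        by eventually_elim (use t in \<open>auto intro!: zbound\<close>)
    qed
    also have "(LINT s:{0..t}|lborel. L * u s) = L * integral {0..t} u"
    proof -
      have "continuous_on {0..t} u" by (rule continuous_on_subset[OF cu]) (use t in auto)
      then have "set_integrable lborel {0..t} u" by (rule borel_integrable_atLeastAtMost')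
      then show ?thesis using set_borel_integral_eq_integral(2)[of "{0..t}" u] by simp
    qed
    finally show "u t \<le> R + L * integral {0..t} u" by simp
  qed (use T L_pos in auto)
  then have "L * u T \<le> L * (R * exp (L * T))" using L_pos by (intro mult_left_mono) auto
  moreover have "norm (?P (x T) - y T) \<le> L * u T" by (rule zbound) (use T xT in auto)
  ultimately show ?thesis unfolding R_def by (simp add: mult_ac)
qed

end

section \<open>Solutions as paths\<close>

context prob_space
begin

lemma jointly_measurable_iff:
  "jointly_measurable M X \<longleftrightarrow> (\<lambda>p. X (fst p) (snd p)) \<in> borel_measurable (restrict_space borel {0..} \<Otimes>\<^sub>M M)"
  unfolding jointly_measurable_def case_prod_beta' ..

lemma measurable_time: "fst \<in> borel_measurable (restrict_space borel {0::real..} \<Otimes>\<^sub>M M)"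
  by (rule measurable_compose[OF measurable_fst]) (rule measurable_restrict_space1, simp)

lemma jointly_measurable_integral:
  fixes g :: "real \<Rightarrow> 'a \<Rightarrow> 'b::{banach,second_countable_topology}"
  assumes g: "jointly_measurable M g"
  shows "jointly_measurable M (\<lambda>t \<omega>. LINT s:{0..t}|lborel. g s \<omega>)"
proof -
  let ?R = "restrict_space borel {0::real..} \<Otimes>\<^sub>M M"
  have [measurable]: "fst \<in> borel_measurable ?R" by (rule measurable_time)
  have sh: "(\<lambda>z. (max 0 (snd z), snd (fst z))) \<in> (?R \<Otimes>\<^sub>M (lborel :: real measure)) \<rightarrow>\<^sub>M ?R"
    by (intro measurable_Pair measurable_restrict_space2) auto
  have [measurable]: "(\<lambda>z. g (max 0 (snd z)) (snd (fst z))) \<in> borel_measurable (?R \<Otimes>\<^sub>M lborel)"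
    using measurable_compose[OF sh g[unfolded jointly_measurable_iff]] by simp
  have [measurable]: "(\<lambda>z. fst (fst z)) \<in> borel_measurable (?R \<Otimes>\<^sub>M (lborel :: real measure))"
    by (rule measurable_compose[OF measurable_fst]) measurable
  have "(\<lambda>z. (if 0 \<le> snd z \<and> snd z \<le> fst (fst z) then g (max 0 (snd z)) (snd (fst z)) else 0)) \<in> borel_measurable (?R \<Otimes>\<^sub>M lborel)"
    by measurable
  then have "(\<lambda>p. LINT s|lborel. (if 0 \<le> s \<and> s \<le> fst p then g (max 0 s) (snd p) else 0)) \<in> borel_measurable ?R"
    by (intro lborel.borel_measurable_lebesgue_integral) (simp add: case_prod_beta)
  moreover have "(LINT s|lborel. (if 0 \<le> s \<and> s \<le> t then g (max 0 s) \<omega> else 0)) = (LINT s:{0..t}|lborel. g s \<omega>)" for t \<omega>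
    unfolding set_lebesgue_integral_def by (intro Bochner_Integration.integral_cong refl) (auto simp: indicator_def)
  ultimately show ?thesis by (simp add: jointly_measurable_iff)
qed

end

context onb
begin

lemma in_range_expansion: "diag e I (\<lambda>_. 1) x = x \<Longrightarrow> x = (\<Sum>i\<in>I. inner (e i) x *\<^sub>R e i)"
  by (simp add: diag_def)

text \<open>The integral of a function with values in a finite-dimensional space by its coordinates,
  which passes from the Bochner integral to the real Henstock-Kurzweil integrals.\<close>

lemma set_integral_in_range:
  fixes g :: "real \<Rightarrow> 'a"
  assumes P: "\<And>s. diag e I (\<lambda>_. 1) (g s) = g s" and g: "set_integrable lborel {0..t} g"
  shows "(LINT s:{0..t}|lborel. g s) = (\<Sum>i\<in>I. integral {0..t} (\<lambda>s. inner (e i) (g s)) *\<^sub>R e i)"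
proof -
  have gi: "set_integrable lborel {0..t} (\<lambda>s. inner (e i) (g s))" for i
    using integrable_bounded_linear[OF bounded_linear_inner_right g[unfolded set_integrable_def], of "e i"]
    unfolding set_integrable_def by simp
  have ieq: "inner (e i) (LINT s:{0..t}|lborel. g s) = integral {0..t} (\<lambda>s. inner (e i) (g s))" for i
    using integral_bounded_linear[OF bounded_linear_inner_right g[unfolded set_integrable_def], of "e i"]
      set_borel_integral_eq_integral(2)[OF gi[of i]]
    unfolding set_lebesgue_integral_def by simp
  have "diag e I (\<lambda>_. 1) (LINT s:{0..t}|lborel. g s) = (LINT s:{0..t}|lborel. g s)"
    using integral_bounded_linear[OF bounded_linear_diag g[unfolded set_integrable_def], of I "\<lambda>_. 1", symmetric]
    unfolding set_lebesgue_integral_def by (simp only: diag_scaleR P)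
  from in_range_expansion[OF this] show ?thesis unfolding ieq .
qed

lemma integral_in_range:
  fixes g :: "real \<Rightarrow> 'a"
  assumes P: "\<And>s. diag e I (\<lambda>_. 1) (g s) = g s" and g: "continuous_on {0..t} g"
  shows "integral {0..t} g = (\<Sum>i\<in>I. integral {0..t} (\<lambda>s. inner (e i) (g s)) *\<^sub>R e i)"
proof -
  note gi = integrable_continuous_real[OF g]
  have ieq: "inner (e i) (integral {0..t} g) = integral {0..t} (\<lambda>s. inner (e i) (g s))" for i
    using integral_linear[OF gi bounded_linear_inner_right[of "e i"]] by (simp add: comp_def)
  have "diag e I (\<lambda>_. 1) (integral {0..t} g) = integral {0..t} g"
    using integral_linear[OF gi bounded_linear_diag[of I "\<lambda>_. 1"], symmetric] by (simp only: comp_def P)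
  from in_range_expansion[OF this] show ?thesis unfolding ieq .
qed

end

locale spde = semilinear e lam q F F' L c \<beta> \<eta> CQ CX X0 + wiener M Fil B
  for e :: "nat \<Rightarrow> 'a::{real_inner,banach,second_countable_topology}" and lam q F F' L c \<beta> \<eta> CQ CX X0
    and M :: "'w measure" and Fil B
begin

text \<open>The analysis of the chain meets the Brownian motions only here. Independence of the past
  is needed for the increments of all modes together, because the chain adds them up.\<close>

lemma brownian_grid:
  assumes h: "h > 0" "h * L\<^sup>2 \<le> c" "c * h \<le> 2"
  shows "semilinear_grid e lam q F F' L c \<beta> \<eta> CQ CX X0 M h
    (\<lambda>i j \<omega>. B i (real (Suc j) * h) \<omega> - B i (real j * h) \<omega>) (\<lambda>j. Fil (real j * h))"
proof -
  have s: "0 \<le> real j * h" "real j * h \<le> real (Suc j) * h" "real (Suc j) * h - real j * h = h" "real j * h < real (Suc j) * h"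
    "0 \<le> real (Suc j) * h" for j :: nat
    using h(1) by (auto simp: algebra_simps)
  show ?thesis
  proof (unfold_locales, goal_cases)
    case (4 j) show ?case by (rule filtration(1)[OF s(1)])
  next
    case (5 j) show ?case by (rule filtration(2)[OF s(1)])
  next
    case (6 j) show ?case by (rule filtration(3)[OF s(1,2)])
  next
    case (7 i j)
    show ?case by (intro borel_measurable_diff B_measurable_Fil 7 s measurable_Fil_mono[OF s(1,2)])
  next
    case (8 i j) show ?case by (rule increment_moments(1)[OF 8 s(1,2)])
  next
    case (9 i j) show ?case by (rule increment_moments(2)[OF 9 s(1,2)])
  next
    case (10 i j) show ?case by (rule increment_moments(3)[OF 10 s(1,2)])
  next
    case (11 i j) show ?case using increment_moments(4)[OF 11 s(1,2)[of j]] unfolding s(3) .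
  next
    case (12 i j Y) show ?case by (rule increment_indep_of_past[OF 12(1) s(1,2) 12(2)])
  next
    case (13 I \<sigma> j Y)
    let ?g = "\<lambda>f. \<Sum>i\<in>I. (\<sigma> i * sqrt (q i) * f (i, real (Suc j) * h)) *\<^sub>R e i"
    have "?g \<in> borel_measurable (PiM ({1..} \<times> {real j * h..}) (\<lambda>_. borel))"
      using 13(2) s(2)[of j]
      by (intro borel_measurable_sum borel_measurable_scaleR borel_measurable_times borel_measurable_const
          measurable_component_singleton) auto
    from increments_indep_of_past[OF s(1) 13(3) this]
    have "indep_var borel Y borel (\<lambda>\<omega>. ?g (\<lambda>k\<in>{1..} \<times> {real j * h..}. B (fst k) (snd k) \<omega> - B (fst k) (real j * h) \<omega>))" .
    moreover have "?g (\<lambda>k\<in>{1..} \<times> {real j * h..}. B (fst k) (snd k) \<omega> - B (fst k) (real j * h) \<omega>)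
        = (\<Sum>i\<in>I. (\<sigma> i * sqrt (q i) * (B i (real (Suc j) * h) \<omega> - B i (real j * h) \<omega>)) *\<^sub>R e i)" for \<omega>
      using 13(2) s(2)[of j] by (intro sum.cong refl) auto
    ultimately show ?case by simp
  next
    case (14 I \<sigma> j)
    show ?case by (rule modes_law_symmetric[OF 14(1,2) s(1,4) 14(3)])
  qed (use h in auto)
qed

definition mode_noise :: "nat set \<Rightarrow> real \<Rightarrow> 'w \<Rightarrow> 'a" where
  "mode_noise I t \<omega> = (\<Sum>i\<in>I. (sqrt (q i) * B i t \<omega>) *\<^sub>R e i)"

text \<open>The chain with all signs positive, expressed by the Brownian paths themselves, for the
  passage to the limit along a path.\<close>

primrec euler :: "real \<Rightarrow> nat set \<Rightarrow> nat \<Rightarrow> 'w \<Rightarrow> 'a" where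
  "euler h I 0 \<omega> = diag e I (\<lambda>_. 1) X0"
| "euler h I (Suc j) \<omega> = diag e I (\<lambda>i. exp (- (lam i * h)))
    (euler h I j \<omega> + h *\<^sub>R F (euler h I j \<omega>) + (mode_noise I (real (Suc j) * h) \<omega> - mode_noise I (real j * h) \<omega>))"

lemma euler_moments:
  assumes h: "h > 0" "h * L\<^sup>2 \<le> c" "c * h \<le> 2" and I: "finite I" "I \<subseteq> {1..}"
  shows "euler h I j \<in> borel_measurable M" "mean_le (\<lambda>\<omega>. (norm (euler h I j \<omega>))\<^sup>2) (2 * K_drift + 2 * K_ou)"
proof -
  interpret G: semilinear_grid e lam q F F' L c \<beta> \<eta> CQ CX X0 M h
    "\<lambda>i j \<omega>. B i (real (Suc j) * h) \<omega> - B i (real j * h) \<omega>" "\<lambda>j. Fil (real j * h)"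
    by (rule brownian_grid[OF h])
  have noise: "G.noise I (\<lambda>_. 1) j \<omega> = mode_noise I (real (Suc j) * h) \<omega> - mode_noise I (real j * h) \<omega>" for j \<omega>
    unfolding G.noise_def mode_noise_def sum_subtractf[symmetric]
    by (intro sum.cong refl) (simp add: algebra_simps)
  have eq: "G.chain I (\<lambda>_. 1) j \<omega> = euler h I j \<omega>" for j \<omega>
    by (induction j) (simp_all only: G.chain.simps euler.simps noise)
  have "G.chain I (\<lambda>_. 1) j = euler h I j" by (rule ext) (rule eq)
  then show "euler h I j \<in> borel_measurable M"
    using G.chain_measurable[OF I(2), of "\<lambda>_. 1" j] by (simp only:)
  show "mean_le (\<lambda>\<omega>. (norm (euler h I j \<omega>))\<^sup>2) (2 * K_drift + 2 * K_ou)"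
    using G.chain_second_moment[OF I, of "\<lambda>_. 1" j] unfolding eq by simp
qed

lemma euler_weak_error:
  fixes \<Phi> :: "'a \<Rightarrow> real" and \<Phi>' :: "'a \<Rightarrow> 'a \<Rightarrow> real"
  assumes h: "h > 0" "h * L\<^sup>2 \<le> c" "c * h \<le> 2" and n: "1 \<le> n" "n \<le> N"
    and \<Phi>: "\<Phi> \<in> borel_measurable borel" "0 \<le> C1" "0 \<le> C2" "\<And>x. linear (\<Phi>' x)" "\<And>x v. \<bar>\<Phi>' x v\<bar> \<le> C1 * norm v"
      "\<And>x y. \<bar>\<Phi> x - \<Phi> y - \<Phi>' y (x - y)\<bar> \<le> C2 * (norm (x - y))\<^sup>2"
  shows "\<bar>expectation (\<lambda>\<omega>. \<Phi> (euler h {1..N} j \<omega>)) - expectation (\<lambda>\<omega>. \<Phi> (euler h {1..n} j \<omega>))\<bar>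
    \<le> (C1 * (K_remainder + K_linear + K_high + 1) + 2 * C2 * K_strong) * lam n powr (- \<beta>)"
proof -
  interpret G: semilinear_grid e lam q F F' L c \<beta> \<eta> CQ CX X0 M h
    "\<lambda>i j \<omega>. B i (real (Suc j) * h) \<omega> - B i (real j * h) \<omega>" "\<lambda>j. Fil (real j * h)"
    by (rule brownian_grid[OF h])
  interpret T: two_levels e lam q F F' L c \<beta> \<eta> CQ CX X0 M h
    "\<lambda>i j \<omega>. B i (real (Suc j) * h) \<omega> - B i (real j * h) \<omega>" "\<lambda>j. Fil (real j * h)" n N
    by unfold_locales (use n in auto)
  have noise: "G.noise I (\<lambda>_. 1) j \<omega> = mode_noise I (real (Suc j) * h) \<omega> - mode_noise I (real j * h) \<omega>" for I j \<omega>
    unfolding G.noise_def mode_noise_def sum_subtractf[symmetric]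
    by (intro sum.cong refl) (simp add: algebra_simps)
  have eq: "G.chain I (\<lambda>_. 1) j \<omega> = euler h I j \<omega>" for I j \<omega>
    by (induction j) (simp_all only: G.chain.simps euler.simps noise)
  show ?thesis using T.weak_error[OF \<Phi>, of j] by (simp only: eq)
qed

lemma continuous_noise_versions:
  "\<exists>B'. \<forall>i\<ge>1. jointly_measurable M (B' i) \<and> (AE \<omega> in M. \<forall>t\<ge>0. B' i t \<omega> = B i t \<omega>)"
proof -
  have "\<forall>i. \<exists>b'. i \<ge> 1 \<longrightarrow> jointly_measurable M b' \<and> (AE \<omega> in M. \<forall>t\<ge>0. b' t \<omega> = B i t \<omega>)"
    using continuous_version[OF B_measurable B_continuous] by blast
  then show ?thesis by metis
qed

text \<open>The equation of a Galerkin solution holds at each time outside a null set that depends on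
  the time. Its right-hand side is continuous in time and agrees with the solution at
  almost all times, so it satisfies the equation at all times simultaneously.\<close>

lemma galerkin_path:
  assumes n: "n \<ge> 1" and T: "0 < T" and X: "galerkin_solution M Fil A F e q B X0 n X"
    and A: "\<And>x. A (galerkin_proj e n x) = - diag e {1..n} lam x"
  shows "AE \<omega> in M. \<exists>y. continuous_on {0..T} y \<and> y T = X T \<omega> \<and>
    (\<forall>t. 0 \<le> t \<longrightarrow> t \<le> T \<longrightarrow> diag e {1..n} (\<lambda>_. 1) (y t) = y t \<and>
      y t = diag e {1..n} (\<lambda>_. 1) X0 + integral {0..t} (\<lambda>s. galerkin_drift {1..n} (y s)) + mode_noise {1..n} t \<omega>)"
proof -
  let ?I = "{1..n}" and ?P = "diag e {1..n} (\<lambda>_. 1)"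
  have I: "finite ?I" "?I \<subseteq> {1..}" by auto
  have drift: "A (galerkin_proj e n x) + galerkin_proj e n (F x) = galerkin_drift ?I x" for x
    by (simp only: A galerkin_drift_def) (simp add: galerkin_proj_eq_diag)
  have jm: "jointly_measurable M X" and int: "\<And>t. t \<ge> 0 \<Longrightarrow> AE \<omega> in M. set_integrable lborel {0..t} (\<lambda>s. galerkin_drift ?I (X s \<omega>))"
    and eq: "\<And>t. t \<ge> 0 \<Longrightarrow> AE \<omega> in M. X t \<omega> = ?P X0 + (LINT s:{0..t}|lborel. galerkin_drift ?I (X s \<omega>)) + mode_noise ?I t \<omega>"
    using X unfolding galerkin_solution_def drift mode_noise_def by (auto simp: galerkin_proj_eq_diag)
  obtain B' where B': "\<And>i. i \<ge> 1 \<Longrightarrow> jointly_measurable M (B' i)" "\<And>i. i \<ge> 1 \<Longrightarrow> AE \<omega> in M. \<forall>t\<ge>0. B' i t \<omega> = B i t \<omega>"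
    using continuous_noise_versions by blast
  have allB: "AE \<omega> in M. \<forall>i\<in>?I. \<forall>t\<ge>0. B' i t \<omega> = B i t \<omega>"
    using B'(2) by (intro AE_finite_allI) auto
  have allC: "AE \<omega> in M. \<forall>i\<in>?I. continuous_on {0..} (\<lambda>t. B i t \<omega>)"
    using B_continuous by (intro AE_finite_allI) auto
  \<comment> \<open>The right-hand side of the equation, built from jointly measurable versions of the
    Brownian motions so that Fubini's theorem applies to it.\<close>
  define V where "V t \<omega> = ?P X0 + (LINT s:{0..t}|lborel. galerkin_drift ?I (X s \<omega>)) + (\<Sum>i\<in>?I. (sqrt (q i) * B' i t \<omega>) *\<^sub>R e i)" for t \<omega>
  have jV: "jointly_measurable M V"
  proof -
    let ?R = "restrict_space borel {0::real..} \<Otimes>\<^sub>M M"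
    note jm[unfolded jointly_measurable_iff, measurable]
    have [measurable]: "galerkin_drift ?I \<in> borel_measurable borel"
      by (rule borel_measurable_continuous_onI[OF galerkin_drift_continuous[OF I]])
    have "jointly_measurable M (\<lambda>t \<omega>. galerkin_drift ?I (X t \<omega>))" unfolding jointly_measurable_iff by measurable
    note jointly_measurable_integral[OF this, unfolded jointly_measurable_iff, measurable]
    have "(\<lambda>p. \<Sum>i\<in>?I. (sqrt (q i) * B' i (fst p) (snd p)) *\<^sub>R e i) \<in> borel_measurable ?R"
      by (intro borel_measurable_sum borel_measurable_scaleR borel_measurable_times borel_measurable_const
          B'(1)[unfolded jointly_measurable_iff]) auto
    then show ?thesis unfolding jointly_measurable_iff V_def by measurable
  qed
  have VX: "AE \<omega> in M. X t \<omega> = V t \<omega>" if "t \<ge> 0" for t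
    using eq[OF that] allB
  proof eventually_elim
    case (elim \<omega>)
    then show ?case using that unfolding V_def mode_noise_def by simp
  qed
  have "AE \<omega> in M. AE t in lborel. t \<in> {0..T} \<longrightarrow> X t \<omega> = V t \<omega>"
    by (rule AE_swap_paths[OF jm jV VX])
  then show ?thesis
    using int[OF less_imp_le[OF T]] VX[OF less_imp_le[OF T]] allB allC
  proof eventually_elim
    case (elim \<omega>)
    let ?y = "\<lambda>t. V t \<omega>" and ?f = "\<lambda>i s. inner (e i) (galerkin_drift ?I (X s \<omega>))"
    have Pdrift: "?P (galerkin_drift ?I v) = galerkin_drift ?I v" for v
      unfolding galerkin_drift_def by (simp add: diag_diff diag_diag)
    have sub: "set_integrable lborel {0..t} (\<lambda>s. galerkin_drift ?I (X s \<omega>))" if "t \<le> T" for t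
      by (rule set_integrable_subset[OF elim(2)]) (use that in auto)
    have fi: "set_integrable lborel {0..t} (?f i)" if "t \<le> T" for i t
      using integrable_bounded_linear[OF bounded_linear_inner_right sub[OF that, unfolded set_integrable_def], of "e i"]
      unfolding set_integrable_def by simp
    have noise: "(\<Sum>i\<in>?I. (sqrt (q i) * B' i t \<omega>) *\<^sub>R e i) = mode_noise ?I t \<omega>" if "t \<ge> 0" for t
      using elim(4) that unfolding mode_noise_def by (intro sum.cong refl) auto
    have V: "V t \<omega> = ?P X0 + (\<Sum>i\<in>?I. integral {0..t} (?f i) *\<^sub>R e i) + mode_noise ?I t \<omega>" if "0 \<le> t" "t \<le> T" for t
      unfolding V_def set_integral_in_range[OF Pdrift sub[OF that(2)]] noise[OF that(1)] ..
    have cW: "continuous_on {0..T} (\<lambda>t. mode_noise ?I t \<omega>)"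
      unfolding mode_noise_def
      by (intro continuous_intros continuous_on_subset[OF elim(5)[rule_format]]) auto
    have "continuous_on {0..T} (\<lambda>t. integral {0..t} (?f i))" for i
      by (rule indefinite_integral_continuous_1[OF set_borel_integral_eq_integral(1)[OF fi[OF order_refl]]])
    then have "continuous_on {0..T} (\<lambda>t. ?P X0 + (\<Sum>i\<in>?I. integral {0..t} (?f i) *\<^sub>R e i) + mode_noise ?I t \<omega>)"
      by (intro continuous_on_add continuous_on_sum continuous_on_scaleR continuous_on_const cW)
    then have cy: "continuous_on {0..T} ?y"
      by (rule continuous_on_eq) (use V in auto)
    have iy: "(\<Sum>i\<in>?I. integral {0..t} (?f i) *\<^sub>R e i) = integral {0..t} (\<lambda>s. galerkin_drift ?I (?y s))" if t: "0 \<le> t" "t \<le> T" for t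
    proof -
      have cg: "continuous_on {0..t} (\<lambda>s. galerkin_drift ?I (?y s))"
        by (rule continuous_on_compose2[OF galerkin_drift_continuous[OF I] continuous_on_subset[OF cy]]) (use t in auto)
      have "integral {0..t} (?f i) = integral {0..t} (\<lambda>s. inner (e i) (galerkin_drift ?I (?y s)))" for i
      proof -
        have "continuous_on {0..t} (\<lambda>s. inner (e i) (galerkin_drift ?I (?y s)))"
          by (intro continuous_on_inner continuous_on_const cg)
        then have sy: "set_integrable lborel {0..t} (\<lambda>s. inner (e i) (galerkin_drift ?I (?y s)))"
          by (rule borel_integrable_atLeastAtMost')
        have "(LINT s:{0..t}|lborel. ?f i s) = (LINT s:{0..t}|lborel. inner (e i) (galerkin_drift ?I (?y s)))"
          unfolding set_lebesgue_integral_def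
        proof (rule integral_cong_AE)
          show "AE s in lborel. indicat_real {0..t} s *\<^sub>R ?f i s = indicat_real {0..t} s *\<^sub>R inner (e i) (galerkin_drift ?I (?y s))"
            using elim(1) by eventually_elim (use t in \<open>auto simp: indicator_def\<close>)
        qed (use fi[OF t(2), of i] sy in \<open>auto simp: set_integrable_def\<close>)
        then show ?thesis
          using set_borel_integral_eq_integral(2)[OF fi[OF t(2), of i]] set_borel_integral_eq_integral(2)[OF sy] by simp
      qed
      then show ?thesis unfolding integral_in_range[OF Pdrift cg] by simp
    qed
    have Psum: "?P (\<Sum>i\<in>?I. r i *\<^sub>R e i) = (\<Sum>i\<in>?I. r i *\<^sub>R e i)" for r
      unfolding diag_def[of e ?I] by (intro sum.cong refl) (simp add: inner_basis_sum)
    show ?case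
    proof (intro exI[of _ ?y] conjI allI impI)
      show "V T \<omega> = X T \<omega>" using elim(3) by simp
      fix t assume t: "0 \<le> t" "t \<le> T"
      show "?P (V t \<omega>) = V t \<omega>"
        unfolding V[OF t] mode_noise_def diag_add Psum by (simp add: diag_diag)
      show "V t \<omega> = ?P X0 + integral {0..t} (\<lambda>s. galerkin_drift ?I (V s \<omega>)) + mode_noise ?I t \<omega>"
        unfolding V[OF t] iy[OF t] ..
    qed (rule cy)
  qed
qed

lemma euler_tendsto_galerkin:
  assumes n: "n \<ge> 1" and T: "0 < T" and X: "galerkin_solution M Fil A F e q B X0 n X"
    and A: "\<And>x. A (galerkin_proj e n x) = - diag e {1..n} lam x"
  shows "AE \<omega> in M. (\<lambda>m. euler (T / real m) {1..n} m \<omega>) \<longlonglongrightarrow> X T \<omega>"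
proof -
  have I: "finite {1..n}" "{1..n} \<subseteq> {1..}" by auto
  have "AE \<omega> in M. \<forall>i\<in>{1..n}. continuous_on {0..} (\<lambda>t. B i t \<omega>) \<and> B i 0 \<omega> = 0"
    using B_continuous B_zero by (intro AE_finite_allI AE_conjI) auto
  with galerkin_path[OF n T X A] show ?thesis
  proof eventually_elim
    case (elim \<omega>)
    then obtain y where y: "continuous_on {0..T} y" "y T = X T \<omega>"
      "\<And>t. 0 \<le> t \<Longrightarrow> t \<le> T \<Longrightarrow> diag e {1..n} (\<lambda>_. 1) (y t) = y t"
      "\<And>t. 0 \<le> t \<Longrightarrow> t \<le> T \<Longrightarrow> y t = diag e {1..n} (\<lambda>_. 1) X0 + integral {0..t} (\<lambda>s. galerkin_drift {1..n} (y s)) + mode_noise {1..n} t \<omega>"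
      by blast
    have "(\<lambda>m. euler (T / real m) {1..n} m \<omega>) \<longlonglongrightarrow> y T"
    proof (rule euler_path_convergence[OF I T y(1), where x = "\<lambda>m j. euler (T / real m) {1..n} j \<omega>" and W = "\<lambda>t. mode_noise {1..n} t \<omega>"])
      show "continuous_on {0..T} (\<lambda>t. mode_noise {1..n} t \<omega>)"
        unfolding mode_noise_def
        by (intro continuous_intros continuous_on_subset[OF conjunct1[OF elim(2)[rule_format]]]) auto
      show "mode_noise {1..n} 0 \<omega> = 0" unfolding mode_noise_def using elim(2) by simp
      show "diag e {1..n} (\<lambda>_. 1) (mode_noise {1..n} t \<omega>) = mode_noise {1..n} t \<omega>" for t
        unfolding mode_noise_def diag_def[of e "{1..n}"] by (intro sum.cong refl) (simp add: inner_basis_sum)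
      show "euler (T / real m) {1..n} (Suc j) \<omega> = diag e {1..n} (\<lambda>i. exp (- (lam i * (T / real m))))
        (euler (T / real m) {1..n} j \<omega> + (T / real m) *\<^sub>R F (euler (T / real m) {1..n} j \<omega>)
          + (mode_noise {1..n} (real (Suc j) * (T / real m)) \<omega> - mode_noise {1..n} (real j * (T / real m)) \<omega>))" for m j
        by (rule euler.simps(2))
    qed (use y in auto)
    then show ?case using y(2) by simp
  qed
qed

text \<open>The \<open>i\<close>-th coordinate of the partial sums of the series no longer changes after the \<open>i\<close>-th
  term.\<close>

lemma noise_coordinate:
  assumes t: "0 \<le> t" and i: "i \<ge> 1" and Z: "has_Q_wiener_integral M e q B (\<lambda>s. E (t - s)) t Z"
    and E: "\<And>s k. 0 \<le> s \<Longrightarrow> k \<ge> 1 \<Longrightarrow> E s (e k) = exp (- (lam k * s)) *\<^sub>R e k"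
  shows "AE \<omega> in M. inner (e i) (Z \<omega>)
    = sqrt (q i) * (B i t \<omega> - lam i * integral {0..t} (\<lambda>s. exp (- (lam i * (t - s))) * B i s \<omega>))"
proof -
  obtain J where Zm [measurable]: "Z \<in> borel_measurable M"
    and J: "\<And>k. k \<ge> 1 \<Longrightarrow> has_wiener_integral M (B k) (\<lambda>s. E (t - s) (e k)) t (J k)"
    and lim: "(\<lambda>N. \<integral>\<^sup>+ \<omega>. ennreal ((norm (Z \<omega> - (\<Sum>k=1..N. sqrt (q k) *\<^sub>R J k \<omega>)))\<^sup>2) \<partial>M) \<longlonglongrightarrow> 0"
    using Z unfolding has_Q_wiener_integral_def by blast
  let ?O = "\<lambda>k \<omega>. B k t \<omega> - lam k * integral {0..t} (\<lambda>s. exp (- (lam k * (t - s))) * B k s \<omega>)"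
  have JO: "AE \<omega> in M. J k \<omega> = ?O k \<omega> *\<^sub>R e k" if k: "k \<ge> 1" for k
    by (rule wiener_integral_formula[OF k t _ J[OF k]]) (use lam_pos[OF k] E k in auto)
  have [measurable]: "J i \<in> borel_measurable M" using J[OF i] by (simp add: has_wiener_integral_def)
  let ?D = "\<lambda>\<omega>. inner (e i) (Z \<omega>) - sqrt (q i) * inner (e i) (J i \<omega>)"
  have "(\<integral>\<^sup>+ \<omega>. ennreal ((?D \<omega>)\<^sup>2) \<partial>M)
      \<le> (\<integral>\<^sup>+ \<omega>. ennreal ((norm (Z \<omega> - (\<Sum>k=1..N. sqrt (q k) *\<^sub>R J k \<omega>)))\<^sup>2) \<partial>M)" if N: "N \<ge> i" for N
  proof (rule nn_integral_mono_AE)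
    have "AE \<omega> in M. \<forall>k\<in>{1..N}. J k \<omega> = ?O k \<omega> *\<^sub>R e k" using JO by (intro AE_finite_allI) auto
    then show "AE \<omega> in M. ennreal ((?D \<omega>)\<^sup>2) \<le> ennreal ((norm (Z \<omega> - (\<Sum>k=1..N. sqrt (q k) *\<^sub>R J k \<omega>)))\<^sup>2)"
    proof eventually_elim
      case (elim \<omega>)
      let ?S = "\<Sum>k=1..N. sqrt (q k) *\<^sub>R J k \<omega>"
      have "?S = (\<Sum>k\<in>{1..N}. (sqrt (q k) * ?O k \<omega>) *\<^sub>R e k)" using elim by (intro sum.cong refl) auto
      then have "inner (e i) ?S = sqrt (q i) * ?O i \<omega>" using i N by (simp add: inner_basis_sum)
      moreover have "inner (e i) (J i \<omega>) = ?O i \<omega>" using elim i N by (simp add: inner_basis)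
      ultimately have "?D \<omega> = inner (e i) (Z \<omega> - ?S)" by (simp add: inner_diff_right)
      then have "\<bar>?D \<omega>\<bar> \<le> norm (Z \<omega> - ?S)"
        using Cauchy_Schwarz_ineq2[of "e i" "Z \<omega> - ?S"] norm_basis[OF i] by simp
      then have "\<bar>?D \<omega>\<bar>\<^sup>2 \<le> (norm (Z \<omega> - ?S))\<^sup>2" by (intro power_mono) auto
      then show ?case by (simp add: ennreal_leI)
    qed
  qed
  then have "(\<integral>\<^sup>+ \<omega>. ennreal ((?D \<omega>)\<^sup>2) \<partial>M) \<le> 0"
    by (intro LIMSEQ_le_const[OF lim]) blast
  then have "(\<integral>\<^sup>+ \<omega>. ennreal ((?D \<omega>)\<^sup>2) \<partial>M) = 0" by simp
  then have "AE \<omega> in M. ennreal ((?D \<omega>)\<^sup>2) = 0" by (subst (asm) nn_integral_0_iff_AE) auto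
  then show ?thesis
    using JO[OF i]
  proof eventually_elim
    case (elim \<omega>)
    then have "?D \<omega> = 0" by (simp add: ennreal_eq_0_iff)
    then show ?case using elim(2) i by (simp add: inner_basis)
  qed
qed

text \<open>The \<open>i\<close>-th coordinate of the right-hand side of the mild equation, with the stochastic
  convolution integrated by parts.\<close>

abbreviation mild_coordinate :: "(real \<Rightarrow> 'w \<Rightarrow> 'a) \<Rightarrow> nat \<Rightarrow> real \<Rightarrow> 'w \<Rightarrow> real" where
  "mild_coordinate X i t \<omega> \<equiv> exp (- (lam i * t)) * inner (e i) X0
    + (LINT s:{0..t}|lborel. exp (- (lam i * (t - s))) * inner (e i) (F (X s \<omega>)))
    + sqrt (q i) * (B i t \<omega> - lam i * integral {0..t} (\<lambda>s. exp (- (lam i * (t - s))) * B i s \<omega>))"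

lemma mild_solution_coordinate:
  assumes X: "mild_solution M Fil E F e q B X0 X" and t: "0 \<le> t" and i: "i \<ge> 1"
    and Ei: "\<And>s x k. 0 \<le> s \<Longrightarrow> k \<ge> 1 \<Longrightarrow> inner (e k) (E s x) = exp (- (lam k * s)) * inner (e k) x"
    and E: "\<And>s k. 0 \<le> s \<Longrightarrow> k \<ge> 1 \<Longrightarrow> E s (e k) = exp (- (lam k * s)) *\<^sub>R e k"
  shows "AE \<omega> in M. inner (e i) (X t \<omega>) = mild_coordinate X i t \<omega>"
proof -
  obtain Z where Z: "has_Q_wiener_integral M e q B (\<lambda>s. E (t - s)) t Z"
    and eq: "AE \<omega> in M. X t \<omega> = E t X0 + (LINT s:{0..t}|lborel. E (t - s) (F (X s \<omega>))) + Z \<omega>"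
    using X t unfolding mild_solution_def by blast
  have int: "AE \<omega> in M. set_integrable lborel {0..t} (\<lambda>s. E (t - s) (F (X s \<omega>)))"
    using X t unfolding mild_solution_def by blast
  have "AE \<omega> in M. inner (e i) (Z \<omega>)
    = sqrt (q i) * (B i t \<omega> - lam i * integral {0..t} (\<lambda>s. exp (- (lam i * (t - s))) * B i s \<omega>))"
    by (rule noise_coordinate[OF t i Z]) (use E in auto)
  with eq int show ?thesis
  proof eventually_elim
    case (elim \<omega>)
    have "inner (e i) (LINT s:{0..t}|lborel. E (t - s) (F (X s \<omega>)))
        = (LINT s:{0..t}|lborel. inner (e i) (E (t - s) (F (X s \<omega>))))"
      using integral_bounded_linear[OF bounded_linear_inner_right elim(2)[unfolded set_integrable_def], of "e i"]
      unfolding set_lebesgue_integral_def by simp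
    also have "\<dots> = (LINT s:{0..t}|lborel. exp (- (lam i * (t - s))) * inner (e i) (F (X s \<omega>)))"
      by (rule set_lebesgue_integral_cong) (use Ei i in auto)
    finally show ?case using elim(1,3) Ei[OF t i] by (simp add: inner_add_right)
  qed
qed

text \<open>The form of the preceding lemma needed for an argument along a path: one null set for
  almost all times.\<close>

lemma mild_solution_coordinate_paths:
  assumes X: "mild_solution M Fil E F e q B X0 X" and T: "0 \<le> T" and i: "i \<ge> 1"
    and Ei: "\<And>s x k. 0 \<le> s \<Longrightarrow> k \<ge> 1 \<Longrightarrow> inner (e k) (E s x) = exp (- (lam k * s)) * inner (e k) x"
    and E: "\<And>s k. 0 \<le> s \<Longrightarrow> k \<ge> 1 \<Longrightarrow> E s (e k) = exp (- (lam k * s)) *\<^sub>R e k"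
  shows "AE \<omega> in M. AE t in lborel. t \<in> {0..T} \<longrightarrow> inner (e i) (X t \<omega>) = mild_coordinate X i t \<omega>"
proof -
  let ?R = "restrict_space borel {0::real..} \<Otimes>\<^sub>M M"
  obtain B' where B': "\<And>i. i \<ge> 1 \<Longrightarrow> jointly_measurable M (B' i)" "\<And>i. i \<ge> 1 \<Longrightarrow> AE \<omega> in M. \<forall>t\<ge>0. B' i t \<omega> = B i t \<omega>"
    using continuous_noise_versions by blast
  \<comment> \<open>The factor \<open>exp (- (lam i * t))\<close> is taken out of the integrals: an integrand that does
    not depend on the upper limit gives a jointly measurable integral.\<close>
  define V where "V t \<omega> = exp (- (lam i * t)) * inner (e i) X0
    + exp (- (lam i * t)) * (LINT s:{0..t}|lborel. exp (lam i * s) * inner (e i) (F (X s \<omega>)))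
    + sqrt (q i) * (B' i t \<omega> - lam i * (exp (- (lam i * t)) * (LINT s:{0..t}|lborel. exp (lam i * s) * B' i s \<omega>)))" for t \<omega>
  have jX: "jointly_measurable M X" using X by (simp add: mild_solution_def)
  note [measurable] = measurable_time
  note jX[unfolded jointly_measurable_iff, measurable] B'(1)[OF i, unfolded jointly_measurable_iff, measurable]
  have jU: "jointly_measurable M (\<lambda>t \<omega>. inner (e i) (X t \<omega>))" unfolding jointly_measurable_iff by measurable
  have jV: "jointly_measurable M V"
  proof -
    have "jointly_measurable M (\<lambda>t \<omega>. exp (lam i * t) * inner (e i) (F (X t \<omega>)))" unfolding jointly_measurable_iff by measurable
    note jointly_measurable_integral[OF this, unfolded jointly_measurable_iff, measurable]
    have "jointly_measurable M (\<lambda>t \<omega>. exp (lam i * t) * B' i t \<omega>)" unfolding jointly_measurable_iff by measurable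
    note jointly_measurable_integral[OF this, unfolded jointly_measurable_iff, measurable]
    show ?thesis unfolding jointly_measurable_iff V_def by measurable
  qed
  have k: "exp (- (lam i * (t - s))) = exp (- (lam i * t)) * exp (lam i * s)" for t s
    by (simp add: exp_add[symmetric] algebra_simps)
  have V: "V t \<omega> = mild_coordinate X i t \<omega>"
    if t: "0 \<le> t" and b: "\<forall>t\<ge>0. B' i t \<omega> = B i t \<omega>" and c: "continuous_on {0..} (\<lambda>t. B i t \<omega>)" for t \<omega>
  proof -
    have "continuous_on {0..t} (\<lambda>s. exp (- (lam i * (t - s))) * B i s \<omega>)"
      by (intro continuous_intros continuous_on_subset[OF c]) auto
    then have "set_integrable lborel {0..t} (\<lambda>s. exp (- (lam i * (t - s))) * B i s \<omega>)" by (rule borel_integrable_atLeastAtMost')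
    then have "integral {0..t} (\<lambda>s. exp (- (lam i * (t - s))) * B i s \<omega>)
        = (LINT s:{0..t}|lborel. exp (- (lam i * (t - s))) * B i s \<omega>)"
      by (rule set_borel_integral_eq_integral(2)[symmetric])
    also have "\<dots> = (LINT s:{0..t}|lborel. exp (- (lam i * t)) * (exp (lam i * s) * B' i s \<omega>))"
      by (rule set_lebesgue_integral_cong) (use b in \<open>auto simp: k\<close>)
    finally have 1: "integral {0..t} (\<lambda>s. exp (- (lam i * (t - s))) * B i s \<omega>)
        = exp (- (lam i * t)) * (LINT s:{0..t}|lborel. exp (lam i * s) * B' i s \<omega>)" by simp
    have 2: "(LINT s:{0..t}|lborel. exp (- (lam i * (t - s))) * inner (e i) (F (X s \<omega>)))
        = exp (- (lam i * t)) * (LINT s:{0..t}|lborel. exp (lam i * s) * inner (e i) (F (X s \<omega>)))"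
      unfolding k mult.assoc by simp
    show ?thesis unfolding V_def 1 2 using b t by simp
  qed
  have UV: "AE \<omega> in M. inner (e i) (X t \<omega>) = V t \<omega>" if t: "0 \<le> t" for t
  proof -
    have "AE \<omega> in M. inner (e i) (X t \<omega>) = mild_coordinate X i t \<omega>"
      by (rule mild_solution_coordinate[OF X t i]) (use Ei E in auto)
    then show ?thesis using B'(2)[OF i] B_continuous[OF i]
      by eventually_elim (simp only: V[OF t])
  qed
  have "AE \<omega> in M. AE t in lborel. t \<in> {0..T} \<longrightarrow> inner (e i) (X t \<omega>) = V t \<omega>"
    by (rule AE_swap_paths[OF jU jV UV])
  then show ?thesis
    using B'(2)[OF i] B_continuous[OF i]
  proof eventually_elim
    case (elim \<omega>)
    show ?case using elim(1) by eventually_elim (use V[OF _ elim(2,3)] in auto)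
  qed
qed

end

section \<open>The weak convergence rate\<close>

context spde
begin

text \<open>By \<open>galerkin_path_error\<close> the distance from the projected solution is controlled by the
  integral of the distance between the solution and its projection, which tends to 0 by
  dominated convergence.\<close>

lemma galerkin_tendsto_mild:
  assumes T: "0 < T" and X: "mild_solution M Fil E F e q B X0 X"
    and Xn: "\<And>n. n \<ge> 1 \<Longrightarrow> galerkin_solution M Fil A F e q B X0 n (Xn n)"
    and A: "\<And>n x. n \<ge> 1 \<Longrightarrow> A (galerkin_proj e n x) = - diag e {1..n} lam x"
    and Ei: "\<And>s x k. 0 \<le> s \<Longrightarrow> k \<ge> 1 \<Longrightarrow> inner (e k) (E s x) = exp (- (lam k * s)) * inner (e k) x"
    and E: "\<And>s k. 0 \<le> s \<Longrightarrow> k \<ge> 1 \<Longrightarrow> E s (e k) = exp (- (lam k * s)) *\<^sub>R e k"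
  shows "AE \<omega> in M. (\<lambda>n. Xn (Suc n) T \<omega>) \<longlonglongrightarrow> X T \<omega>"
proof -
  have T0: "0 \<le> T" using T by simp
  have iX: "AE \<omega> in M. set_integrable lborel {0..T} (\<lambda>s. X s \<omega>)" using X T0 unfolding mild_solution_def by blast
  have B0: "AE \<omega> in M. \<forall>i. i \<ge> 1 \<longrightarrow> continuous_on {0..} (\<lambda>t. B i t \<omega>) \<and> B i 0 \<omega> = 0"
    unfolding AE_all_countable
  proof
    fix i
    show "AE \<omega> in M. i \<ge> 1 \<longrightarrow> continuous_on {0..} (\<lambda>t. B i t \<omega>) \<and> B i 0 \<omega> = 0"
    proof (cases "i \<ge> 1")
      case True
      then show ?thesis using B_continuous[OF True] B_zero[OF True] by (simp add: AE_conj_iff)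
    qed simp
  qed
  have xT: "AE \<omega> in M. \<forall>i. i \<ge> 1 \<longrightarrow> inner (e i) (X T \<omega>) = mild_coordinate X i T \<omega>"
    unfolding AE_all_countable
  proof
    fix i
    show "AE \<omega> in M. i \<ge> 1 \<longrightarrow> inner (e i) (X T \<omega>) = mild_coordinate X i T \<omega>"
    proof (cases "i \<ge> 1")
      case True
      have "AE \<omega> in M. inner (e i) (X T \<omega>) = mild_coordinate X i T \<omega>"
        by (rule mild_solution_coordinate[OF X T0 True]) (use Ei E in auto)
      then show ?thesis using True by simp
    qed simp
  qed
  have xt: "AE \<omega> in M. \<forall>i. i \<ge> 1 \<longrightarrow> (AE t in lborel. t \<in> {0..T} \<longrightarrow> inner (e i) (X t \<omega>) = mild_coordinate X i t \<omega>)"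
    unfolding AE_all_countable
  proof
    fix i
    show "AE \<omega> in M. i \<ge> 1 \<longrightarrow> (AE t in lborel. t \<in> {0..T} \<longrightarrow> inner (e i) (X t \<omega>) = mild_coordinate X i t \<omega>)"
    proof (cases "i \<ge> 1")
      case True
      have "AE \<omega> in M. AE t in lborel. t \<in> {0..T} \<longrightarrow> inner (e i) (X t \<omega>) = mild_coordinate X i t \<omega>"
        by (rule mild_solution_coordinate_paths[OF X T0 True]) (use Ei E in auto)
      then show ?thesis using True by simp
    qed simp
  qed
  have paths: "AE \<omega> in M. \<forall>n. \<exists>y. continuous_on {0..T} y \<and> y T = Xn (Suc n) T \<omega> \<and>
    (\<forall>t. 0 \<le> t \<longrightarrow> t \<le> T \<longrightarrow> diag e {1..Suc n} (\<lambda>_. 1) (y t) = y t \<and>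
      y t = diag e {1..Suc n} (\<lambda>_. 1) X0 + integral {0..t} (\<lambda>s. galerkin_drift {1..Suc n} (y s)) + mode_noise {1..Suc n} t \<omega>)"
    unfolding AE_all_countable
  proof
    fix n
    have n: "Suc n \<ge> 1" by simp
    show "AE \<omega> in M. \<exists>y. continuous_on {0..T} y \<and> y T = Xn (Suc n) T \<omega> \<and>
      (\<forall>t. 0 \<le> t \<longrightarrow> t \<le> T \<longrightarrow> diag e {1..Suc n} (\<lambda>_. 1) (y t) = y t \<and>
        y t = diag e {1..Suc n} (\<lambda>_. 1) X0 + integral {0..t} (\<lambda>s. galerkin_drift {1..Suc n} (y s)) + mode_noise {1..Suc n} t \<omega>)"
      by (rule galerkin_path[OF n T Xn[OF n] A[OF n]])
  qed
  show ?thesis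
    using iX B0 xT xt paths
  proof eventually_elim
    case (elim \<omega>)
    let ?P = "\<lambda>n. diag e {1..n} (\<lambda>_. 1)" and ?x = "\<lambda>s. X s \<omega>"
    let ?R = "\<lambda>n. LINT s:{0..T}|lborel. norm (?x s - ?P n (?x s))"
    have Plim: "(\<lambda>n. ?P n v) \<longlonglongrightarrow> v" for v using galerkin_proj_tendsto[of v] by (simp add: galerkin_proj_eq_diag)
    have err: "norm (?P (Suc n) (?x T) - Xn (Suc n) T \<omega>) \<le> L * exp (L * T) * ?R (Suc n)" for n
    proof -
      obtain y where y: "continuous_on {0..T} y" "y T = Xn (Suc n) T \<omega>"
        "\<And>t. 0 \<le> t \<Longrightarrow> t \<le> T \<Longrightarrow> ?P (Suc n) (y t) = y t"
        "\<And>t. 0 \<le> t \<Longrightarrow> t \<le> T \<Longrightarrow> y t = ?P (Suc n) X0 + integral {0..t} (\<lambda>s. galerkin_drift {1..Suc n} (y s)) + mode_noise {1..Suc n} t \<omega>"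
        using elim(5) by blast
      have "norm (?P (Suc n) (?x T) - y T) \<le> L * exp (L * T) * ?R (Suc n)"
      proof (rule galerkin_path_error[where I = "{1..Suc n}" and x = ?x and y = y and b = "\<lambda>i t. B i t \<omega>", OF _ _ T elim(1)])
        show "continuous_on {0..T} (\<lambda>t. B i t \<omega>)" if "i \<in> {1..Suc n}" for i
          using elim(2) that by (auto intro: continuous_on_subset)
        show "inner (e i) (?x T) = mild_coordinate X i T \<omega>" if "i \<in> {1..Suc n}" for i
          using elim(3) that by simp
        show "AE t in lborel. t \<in> {0..T} \<longrightarrow> inner (e i) (?x t) = mild_coordinate X i t \<omega>" if "i \<in> {1..Suc n}" for i
          using elim(4) that by simp
        show "B i 0 \<omega> = 0" if "i \<in> {1..Suc n}" for i using elim(2) that by simp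
        show "y t = ?P (Suc n) X0 + integral {0..t} (\<lambda>s. galerkin_drift {1..Suc n} (y s)) + (\<Sum>i\<in>{1..Suc n}. (sqrt (q i) * B i t \<omega>) *\<^sub>R e i)"
          if "0 \<le> t" "t \<le> T" for t
          using y(4)[OF that] unfolding mode_noise_def .
      qed (use y(1,3) in auto)
      then show ?thesis unfolding y(2) .
    qed
    have ix: "integrable lborel (\<lambda>s. indicat_real {0..T} s *\<^sub>R ?x s)" using elim(1) by (simp add: set_integrable_def)
    have "(\<lambda>n. ?R n) \<longlonglongrightarrow> (LINT s::real|lborel. (0::real))"
      unfolding set_lebesgue_integral_def
    proof (rule integral_dominated_convergence[where w = "\<lambda>s. 2 * norm (indicat_real {0..T} s *\<^sub>R ?x s)"])
      show "integrable lborel (\<lambda>s. 2 * norm (indicat_real {0..T} s *\<^sub>R ?x s))"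
        by (intro Bochner_Integration.integrable_mult_right Bochner_Integration.integrable_norm ix)
      have [measurable]: "(\<lambda>s. indicat_real {0..T} s *\<^sub>R ?x s) \<in> borel_measurable lborel" using ix by auto
      show "(\<lambda>s. indicat_real {0..T} s *\<^sub>R norm (?x s - ?P n (?x s))) \<in> borel_measurable lborel" for n
      proof -
        have "(\<lambda>s. norm (indicat_real {0..T} s *\<^sub>R ?x s - ?P n (indicat_real {0..T} s *\<^sub>R ?x s))) \<in> borel_measurable lborel" by measurable
        moreover have "norm (indicat_real {0..T} s *\<^sub>R ?x s - ?P n (indicat_real {0..T} s *\<^sub>R ?x s))
            = indicat_real {0..T} s *\<^sub>R norm (?x s - ?P n (?x s))" for s by (auto simp: indicator_def diag_zero)
        ultimately show ?thesis by (simp only:)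
      qed
      show "AE s in lborel. (\<lambda>n. indicat_real {0..T} s *\<^sub>R norm (?x s - ?P n (?x s))) \<longlonglongrightarrow> 0"
      proof (rule AE_I2)
        fix s
        have "(\<lambda>n. indicat_real {0..T} s *\<^sub>R norm (?x s - ?P n (?x s))) \<longlonglongrightarrow> indicat_real {0..T} s *\<^sub>R norm (?x s - ?x s)"
          by (intro tendsto_scaleR tendsto_const tendsto_norm tendsto_diff Plim)
        then show "(\<lambda>n. indicat_real {0..T} s *\<^sub>R norm (?x s - ?P n (?x s))) \<longlonglongrightarrow> 0" by simp
      qed
      show "AE s in lborel. norm (indicat_real {0..T} s *\<^sub>R norm (?x s - ?P n (?x s))) \<le> 2 * norm (indicat_real {0..T} s *\<^sub>R ?x s)" for n
      proof (rule AE_I2)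
        fix s
        have "norm (?P n (?x s)) \<le> 1 * norm (?x s)" by (rule norm_diag_le) auto
        then have "norm (?x s - ?P n (?x s)) \<le> 2 * norm (?x s)"
          using norm_triangle_ineq4[of "?x s" "?P n (?x s)"] by simp
        then show "norm (indicat_real {0..T} s *\<^sub>R norm (?x s - ?P n (?x s))) \<le> 2 * norm (indicat_real {0..T} s *\<^sub>R ?x s)"
          by (auto simp: indicator_def)
      qed
    qed simp
    then have R: "(\<lambda>n. ?R n) \<longlonglongrightarrow> 0" by simp
    have "(\<lambda>n. ?P (Suc n) (?x T) - Xn (Suc n) T \<omega>) \<longlonglongrightarrow> 0"
    proof (rule Lim_null_comparison[where g = "\<lambda>n. L * exp (L * T) * ?R (Suc n)"])
      show "(\<lambda>n. L * exp (L * T) * ?R (Suc n)) \<longlonglongrightarrow> 0"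
        using tendsto_mult[OF tendsto_const LIMSEQ_Suc[OF R], of "L * exp (L * T)"] by simp
    qed (use err in simp)
    then have "(\<lambda>n. ?P (Suc n) (?x T) - (?P (Suc n) (?x T) - Xn (Suc n) T \<omega>)) \<longlonglongrightarrow> ?x T - 0"
      by (rule tendsto_diff[OF LIMSEQ_Suc[OF Plim[of "?x T"]]])
    then show ?case by simp
  qed
qed

text \<open>A function of linear growth keeps second moments bounded.\<close>

lemma expectation_tendsto_lipschitz:
  fixes Y :: "nat \<Rightarrow> 'w \<Rightarrow> 'a" and \<Phi> :: "'a \<Rightarrow> real"
  assumes Y: "\<And>k. mean_le (\<lambda>\<omega>. (norm (Y k \<omega>))\<^sup>2) C" and [measurable]: "\<And>k. Y k \<in> borel_measurable M" "Y' \<in> borel_measurable M"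
    and lim: "AE \<omega> in M. (\<lambda>k. Y k \<omega>) \<longlonglongrightarrow> Y' \<omega>"
    and \<Phi>: "continuous_on UNIV \<Phi>" "\<And>x. \<bar>\<Phi> x\<bar> \<le> a + b * norm x"
  shows "(\<lambda>k. expectation (\<lambda>\<omega>. \<Phi> (Y k \<omega>))) \<longlonglongrightarrow> expectation (\<lambda>\<omega>. \<Phi> (Y' \<omega>))"
    "mean_le (\<lambda>\<omega>. (norm (Y' \<omega>))\<^sup>2) C"
proof -
  have [measurable]: "\<Phi> \<in> borel_measurable borel" by (rule borel_measurable_continuous_onI[OF \<Phi>(1)])
  show Y': "mean_le (\<lambda>\<omega>. (norm (Y' \<omega>))\<^sup>2) C" by (rule second_moment_limit[OF Y _ _ lim]) measurable
  have sq: "mean_le (\<lambda>\<omega>. (\<Phi> (V \<omega>))\<^sup>2) (2 * a\<^sup>2 + 2 * b\<^sup>2 * C)"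
    if V: "mean_le (\<lambda>\<omega>. (norm (V \<omega>))\<^sup>2) C" and [measurable]: "V \<in> borel_measurable M" for V
  proof -
    have "mean_le (\<lambda>\<omega>. 2 * a\<^sup>2 + 2 * b\<^sup>2 * (norm (V \<omega>))\<^sup>2) (2 * a\<^sup>2 + 2 * b\<^sup>2 * C)"
      by (intro mean_le_add mean_le_const mean_le_cmult V) auto
    then show ?thesis
    proof (rule mean_le_dominated)
      fix \<omega>
      have "(\<Phi> (V \<omega>))\<^sup>2 \<le> (a + b * norm (V \<omega>))\<^sup>2"
        using \<Phi>(2)[of "V \<omega>"] by (intro power2_le_iff_abs_le[THEN iffD2]) auto
      also have "\<dots> \<le> 2 * a\<^sup>2 + 2 * (b * norm (V \<omega>))\<^sup>2"
        using norm_add_sq_le[of a "b * norm (V \<omega>)"] by (simp add: power2_abs)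
      finally show "(\<Phi> (V \<omega>))\<^sup>2 \<le> 2 * a\<^sup>2 + 2 * b\<^sup>2 * (norm (V \<omega>))\<^sup>2" by (simp add: power_mult_distrib)
    qed auto
  qed
  show "(\<lambda>k. expectation (\<lambda>\<omega>. \<Phi> (Y k \<omega>))) \<longlonglongrightarrow> expectation (\<lambda>\<omega>. \<Phi> (Y' \<omega>))"
  proof (rule expectation_tendsto_L2_bounded[OF sq[OF Y] _ sq[OF Y']])
    show "AE \<omega> in M. (\<lambda>k. \<Phi> (Y k \<omega>)) \<longlonglongrightarrow> \<Phi> (Y' \<omega>)"
      using lim by eventually_elim (rule continuous_on_tendsto_compose[OF \<Phi>(1)], auto)
  qed measurable
qed

text \<open>The weak error between the Euler chains of levels \<open>n\<close> and \<open>N\<close> is bounded uniformly in the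
  step size and in \<open>N\<close>; first the step size tends to 0, then \<open>N\<close> to infinity.\<close>

lemma weak_convergence_rate:
  fixes \<Phi> :: "'a \<Rightarrow> real" and \<Phi>' :: "'a \<Rightarrow> 'a \<Rightarrow> real"
  assumes T: "0 < T" and X: "mild_solution M Fil E F e q B X0 X"
    and Xn: "\<And>n. n \<ge> 1 \<Longrightarrow> galerkin_solution M Fil A F e q B X0 n (Xn n)"
    and A: "\<And>n x. n \<ge> 1 \<Longrightarrow> A (galerkin_proj e n x) = - diag e {1..n} lam x"
    and Ei: "\<And>s x k. 0 \<le> s \<Longrightarrow> k \<ge> 1 \<Longrightarrow> inner (e k) (E s x) = exp (- (lam k * s)) * inner (e k) x"
    and E: "\<And>s k. 0 \<le> s \<Longrightarrow> k \<ge> 1 \<Longrightarrow> E s (e k) = exp (- (lam k * s)) *\<^sub>R e k"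
    and n: "n \<ge> 1"
    and \<Phi>: "continuous_on UNIV \<Phi>" "0 \<le> C1" "0 \<le> C2" "\<And>x. linear (\<Phi>' x)" "\<And>x v. \<bar>\<Phi>' x v\<bar> \<le> C1 * norm v"
      "\<And>x y. \<bar>\<Phi> x - \<Phi> y - \<Phi>' y (x - y)\<bar> \<le> C2 * (norm (x - y))\<^sup>2" "\<And>x. \<bar>\<Phi> x\<bar> \<le> a + b * norm x"
  shows "\<bar>expectation (\<lambda>\<omega>. \<Phi> (X T \<omega>)) - expectation (\<lambda>\<omega>. \<Phi> (Xn n T \<omega>))\<bar>
    \<le> (C1 * (K_remainder + K_linear + K_high + 1) + 2 * C2 * K_strong) * lam n powr (- \<beta>)"
proof -
  let ?K = "(C1 * (K_remainder + K_linear + K_high + 1) + 2 * C2 * K_strong) * lam n powr (- \<beta>)"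
  have T0: "0 \<le> T" using T by simp
  have \<Phi>m: "\<Phi> \<in> borel_measurable borel" by (rule borel_measurable_continuous_onI[OF \<Phi>(1)])
  have Xm: "X T \<in> borel_measurable M"
    using X T0 unfolding mild_solution_def adapted_def by (blast intro: measurable_Fil[OF T0])
  have Xnm: "Xn k T \<in> borel_measurable M" if "k \<ge> 1" for k
    using Xn[OF that] T0 unfolding galerkin_solution_def adapted_def by (blast intro: measurable_Fil[OF T0])
  have "\<forall>\<^sub>F m in sequentially. T / real m < min (c / L\<^sup>2) (2 / c)"
    using lim_const_over_n[of T] by (rule order_tendstoD(2)) (use c_pos L_pos in simp)
  \<comment> \<open>Beyond \<open>m1\<close> steps the grid is fine enough for the contraction.\<close>
  then obtain m1 where m1: "\<And>m. m \<ge> m1 \<Longrightarrow> T / real m < min (c / L\<^sup>2) (2 / c)"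
    unfolding eventually_sequentially by blast
  have h: "T / real (m + Suc m1) > 0" "(T / real (m + Suc m1)) * L\<^sup>2 \<le> c" "c * (T / real (m + Suc m1)) \<le> 2" for m
  proof -
    have "x * L\<^sup>2 \<le> c \<and> c * x \<le> 2" if "x < min (c / L\<^sup>2) (2 / c)" for x
      using that c_pos L_pos by (auto simp: field_simps)
    from this[OF m1[of "m + Suc m1"]] show "(T / real (m + Suc m1)) * L\<^sup>2 \<le> c" "c * (T / real (m + Suc m1)) \<le> 2" by auto
    show "T / real (m + Suc m1) > 0" using T by simp
  qed
  let ?Y = "\<lambda>k m \<omega>. euler (T / real (m + Suc m1)) {1..k} (m + Suc m1) \<omega>"
  have conv: "(\<lambda>m. expectation (\<lambda>\<omega>. \<Phi> (?Y k m \<omega>))) \<longlonglongrightarrow> expectation (\<lambda>\<omega>. \<Phi> (Xn k T \<omega>))"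
    "mean_le (\<lambda>\<omega>. (norm (Xn k T \<omega>))\<^sup>2) (2 * K_drift + 2 * K_ou)" if k: "k \<ge> 1" for k
  proof -
    have "AE \<omega> in M. (\<lambda>m. euler (T / real m) {1..k} m \<omega>) \<longlonglongrightarrow> Xn k T \<omega>"
      by (rule euler_tendsto_galerkin[OF k T Xn[OF k] A[OF k]])
    then have lim: "AE \<omega> in M. (\<lambda>m. ?Y k m \<omega>) \<longlonglongrightarrow> Xn k T \<omega>"
      by eventually_elim (rule LIMSEQ_ignore_initial_segment)
    show "(\<lambda>m. expectation (\<lambda>\<omega>. \<Phi> (?Y k m \<omega>))) \<longlonglongrightarrow> expectation (\<lambda>\<omega>. \<Phi> (Xn k T \<omega>))"
      "mean_le (\<lambda>\<omega>. (norm (Xn k T \<omega>))\<^sup>2) (2 * K_drift + 2 * K_ou)"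
      by (rule expectation_tendsto_lipschitz[OF euler_moments(2)[OF h] euler_moments(1)[OF h] Xnm[OF k] lim \<Phi>(1,7)]; auto)+
  qed
  have gal: "\<bar>expectation (\<lambda>\<omega>. \<Phi> (Xn N T \<omega>)) - expectation (\<lambda>\<omega>. \<Phi> (Xn n T \<omega>))\<bar> \<le> ?K" if N: "N \<ge> n" for N
  proof -
    have N1: "N \<ge> 1" using N n by simp
    have "(\<lambda>m. \<bar>expectation (\<lambda>\<omega>. \<Phi> (?Y N m \<omega>)) - expectation (\<lambda>\<omega>. \<Phi> (?Y n m \<omega>))\<bar>)
        \<longlonglongrightarrow> \<bar>expectation (\<lambda>\<omega>. \<Phi> (Xn N T \<omega>)) - expectation (\<lambda>\<omega>. \<Phi> (Xn n T \<omega>))\<bar>"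
      by (intro tendsto_rabs tendsto_diff conv(1)[OF N1] conv(1)[OF n])
    then show ?thesis
      by (rule LIMSEQ_le_const2) (use euler_weak_error[OF h n N \<Phi>m \<Phi>(2-6)] in blast)
  qed
  have "AE \<omega> in M. (\<lambda>N. Xn (Suc N) T \<omega>) \<longlonglongrightarrow> X T \<omega>"
    by (rule galerkin_tendsto_mild[OF T X Xn A]) (use Ei E in auto)
  then have "(\<lambda>N. expectation (\<lambda>\<omega>. \<Phi> (Xn (Suc N) T \<omega>))) \<longlonglongrightarrow> expectation (\<lambda>\<omega>. \<Phi> (X T \<omega>))"
    by (intro expectation_tendsto_lipschitz(1)[where Y = "\<lambda>N. Xn (Suc N) T" and Y' = "X T" and C = "2 * K_drift + 2 * K_ou", OF _ _ Xm _ \<Phi>(1,7)]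
        conv(2) Xnm) auto
  then have "(\<lambda>N. \<bar>expectation (\<lambda>\<omega>. \<Phi> (Xn (Suc N) T \<omega>)) - expectation (\<lambda>\<omega>. \<Phi> (Xn n T \<omega>))\<bar>)
      \<longlonglongrightarrow> \<bar>expectation (\<lambda>\<omega>. \<Phi> (X T \<omega>)) - expectation (\<lambda>\<omega>. \<Phi> (Xn n T \<omega>))\<bar>"
    by (intro tendsto_rabs tendsto_diff tendsto_const)
  then show ?thesis
  proof (rule LIMSEQ_le_const2)
    show "\<exists>N0. \<forall>N\<ge>N0. \<bar>expectation (\<lambda>\<omega>. \<Phi> (Xn (Suc N) T \<omega>)) - expectation (\<lambda>\<omega>. \<Phi> (Xn n T \<omega>))\<bar> \<le> ?K"
      using gal by (intro exI[of _ n]) auto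
  qed
qed

end

text \<open>The mean value theorem, applied twice to a real function on the segment. Scalarising by
  \<open>l\<close> allows a bound on the second derivative in a weaker norm than that of the target
  space.\<close>

lemma second_order_taylor_functional:
  fixes G :: "'a::real_normed_vector \<Rightarrow> 'b::real_normed_vector"
    and D1 :: "'a \<Rightarrow> 'a \<Rightarrow>\<^sub>L 'b" and D2 :: "'a \<Rightarrow> 'a \<Rightarrow>\<^sub>L ('a \<Rightarrow>\<^sub>L 'b)"
  assumes D1: "\<And>x. (G has_derivative blinfun_apply (D1 x)) (at x)"
    and D2: "\<And>x. (D1 has_derivative blinfun_apply (D2 x)) (at x)"
    and l: "bounded_linear l" and C: "\<And>z. \<bar>l (D2 z v v)\<bar> \<le> (C::real)"
  shows "\<bar>l (G (y + v)) - l (G y) - l (D1 y v)\<bar> \<le> C"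
proof -
  let ?f = "\<lambda>t. l (G (y + t *\<^sub>R v))" and ?g = "\<lambda>t. l (D1 (y + t *\<^sub>R v) v)"
  have line: "((\<lambda>t. y + t *\<^sub>R v) has_derivative (\<lambda>s. s *\<^sub>R v)) (at t)" for t :: real
    by (auto intro!: derivative_eq_intros)
  have f: "(?f has_real_derivative ?g t) (at t)" for t
  proof -
    have "((\<lambda>t. l (G (y + t *\<^sub>R v))) has_derivative (\<lambda>s. l (D1 (y + t *\<^sub>R v) (s *\<^sub>R v)))) (at t)"
      by (rule bounded_linear.has_derivative[OF l has_derivative_compose[OF line D1]])
    moreover have "l (D1 (y + t *\<^sub>R v) (s *\<^sub>R v)) = ?g t * s" for s
      using bounded_linear.linear[OF l] by (simp add: blinfun.scaleR_right linear_scale)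
    ultimately show ?thesis by (simp add: has_field_derivative_def)
  qed
  have g: "(?g has_real_derivative l (D2 (y + t *\<^sub>R v) v v)) (at t)" for t
  proof -
    have "((\<lambda>t. D1 (y + t *\<^sub>R v)) has_derivative (\<lambda>s. D2 (y + t *\<^sub>R v) (s *\<^sub>R v))) (at t)"
      by (rule has_derivative_compose[OF line D2])
    then have "((\<lambda>t. D1 (y + t *\<^sub>R v) v) has_derivative (\<lambda>s. D2 (y + t *\<^sub>R v) (s *\<^sub>R v) v)) (at t)"
      by (rule bounded_linear.has_derivative[OF blinfun.bounded_linear_left])
    then have "((\<lambda>t. l (D1 (y + t *\<^sub>R v) v)) has_derivative (\<lambda>s. l (D2 (y + t *\<^sub>R v) (s *\<^sub>R v) v))) (at t)"
      by (rule bounded_linear.has_derivative[OF l])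
    moreover have "l (D2 (y + t *\<^sub>R v) (s *\<^sub>R v) v) = l (D2 (y + t *\<^sub>R v) v v) * s" for s
      using bounded_linear.linear[OF l] by (simp add: blinfun.scaleR_right blinfun.scaleR_left linear_scale)
    ultimately show ?thesis by (simp add: has_field_derivative_def)
  qed
  obtain z where z: "0 < z" "z < 1" "?f 1 - ?f 0 = (1 - 0) * ?g z" using MVT2[of 0 1 ?f ?g] f by auto
  obtain w where w: "0 < w" "w < z" "?g z - ?g 0 = (z - 0) * l (D2 (y + w *\<^sub>R v) v v)"
    using MVT2[of 0 z ?g "\<lambda>t. l (D2 (y + t *\<^sub>R v) v v)"] g z by auto
  have "l (G (y + v)) - l (G y) - l (D1 y v) = z * l (D2 (y + w *\<^sub>R v) v v)" using z(3) w(3) by simp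
  also have "\<bar>\<dots>\<bar> \<le> 1 * C" unfolding abs_mult using z C[of "y + w *\<^sub>R v"] by (intro mult_mono) auto
  finally show ?thesis by simp
qed

theorem theorem3p6:
  fixes D :: "'a::{real_inner,banach,second_countable_topology} set"
    and A Q Qhalf F :: "'a \<Rightarrow> 'a"
    and E :: "real \<Rightarrow> 'a \<Rightarrow> 'a"
    and e :: "nat \<Rightarrow> 'a"
    and lam q :: "nat \<Rightarrow> real"
    and M :: "'w measure"
    and Fil :: "real \<Rightarrow> 'w measure"
    and B :: "nat \<Rightarrow> real \<Rightarrow> 'w \<Rightarrow> real"
    and F' :: "'a \<Rightarrow> 'a \<Rightarrow>\<^sub>L 'a"
    and F'' :: "'a \<Rightarrow> 'a \<Rightarrow>\<^sub>L ('a \<Rightarrow>\<^sub>L 'a)"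
    and X0 :: 'a
    and X :: "real \<Rightarrow> 'w \<Rightarrow> 'a"
    and Xn :: "nat \<Rightarrow> real \<Rightarrow> 'w \<Rightarrow> 'a"
    and \<beta> \<delta> \<eta> L L\<^sub>F :: real
  assumes A_self_adjoint: "self_adjoint_operator D A"
    and A_neg: "negative_definite_on D A"
    and A_inverse: "has_compact_inverse D A"
    and basis: "orthonormal_basis e"
    and lam_pos: "\<And>i. i \<ge> 1 \<Longrightarrow> 0 < lam i"
    and lam_mono: "\<And>i j. 1 \<le> i \<Longrightarrow> i \<le> j \<Longrightarrow> lam i \<le> lam j"
    and lam_lim: "filterlim lam at_top sequentially"
    and A_eigen: "\<And>i. i \<ge> 1 \<Longrightarrow> e i \<in> D \<and> - A (e i) = lam i *\<^sub>R e i"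
    and semigroup: "generates_semigroup D A E"
    and Q_bounded: "bounded_linear Q"
    and Q_self_adjoint: "self_adjoint_operator UNIV Q"
    and Q_pos: "positive_definite_on UNIV Q"
    and Q_commutes: "\<And>x. x \<in> D \<Longrightarrow> Q x \<in> D \<and> A (Q x) = Q (A x)"
    and Q_eigen: "\<And>i. i \<ge> 1 \<Longrightarrow> Q (e i) = q i *\<^sub>R e i"
    and Qhalf: "is_positive_sqrt Q Qhalf"
    and beta: "0 < \<beta>" "\<beta> \<le> 1"
    and AQ_hilbert_schmidt: "hilbert_schmidt (\<lambda>x. frac_pow e lam ((\<beta> - 1) / 2) (Qhalf x))"
    and prob: "prob_space M"
    and filtr: "filtration_of M Fil"
    and wiener: "wiener_coordinates M Fil B"
    and X0: "X0 \<in> Hdot e lam (max (2 * \<beta>) 1)"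
    and F_deriv: "\<And>\<phi>. (F has_derivative blinfun_apply (F' \<phi>)) (at \<phi>)"
    and F_deriv2: "\<And>\<phi>. (F' has_derivative blinfun_apply (F'' \<phi>)) (at \<phi>)"
    and F_one_sided: "\<And>\<phi>\<^sub>1 \<phi>\<^sub>2. inner (\<phi>\<^sub>1 - \<phi>\<^sub>2) (F \<phi>\<^sub>1 - F \<phi>\<^sub>2) \<le> L\<^sub>F * (norm (\<phi>\<^sub>1 - \<phi>\<^sub>2))\<^sup>2"
    and L\<^sub>F: "L\<^sub>F < lam 1"
    and L_pos: "L > 0"
    and delta: "1 \<le> \<delta>" "\<delta> < 2"
    and eta: "0 \<le> \<eta>" "\<eta> < 1"
    and F'_bound: "\<And>\<phi> \<psi>. norm (F' \<phi> \<psi>) \<le> L * norm \<psi>"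
    and F'_neg_bound: "\<And>\<phi> \<psi>. \<phi> \<in> Hdot e lam 1 \<Longrightarrow>
          norm (frac_pow e lam (- \<delta> / 2) (F' \<phi> \<psi>))
            \<le> L * (1 + Hdot_norm e lam 1 \<phi>) * Hdot_norm e lam (-1) \<psi>"
    and F''_bound: "\<And>\<phi> \<psi>\<^sub>1 \<psi>\<^sub>2.
          norm (frac_pow e lam (- \<eta>) (F'' \<phi> \<psi>\<^sub>1 \<psi>\<^sub>2)) \<le> L * norm \<psi>\<^sub>1 * norm \<psi>\<^sub>2"
    and X: "mild_solution M Fil E F e q B X0 X"
    and Xn: "\<And>n. n \<ge> 1 \<Longrightarrow> galerkin_solution M Fil A F e q B X0 n (Xn n)"
  shows "\<forall>\<Phi>. Cb2 \<Phi> \<longrightarrow>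
           (\<forall>\<epsilon>>0. \<exists>C>0. \<forall>T>0. \<forall>n\<ge>1.
              \<bar>prob_space.expectation M (\<lambda>\<omega>. \<Phi> (X T \<omega>))
                - prob_space.expectation M (\<lambda>\<omega>. \<Phi> (Xn n T \<omega>))\<bar>
              \<le> C * lam n powr (- \<beta> + \<epsilon>))"
proof (intro allI impI)
  fix \<Phi> :: "'a \<Rightarrow> real" and \<epsilon> :: real
  assume Cb2: "Cb2 \<Phi>" and \<epsilon>: "\<epsilon> > 0"
  interpret onb e by unfold_locales (rule basis)
  have lam1: "lam 1 > 0" using lam_pos by simp
  have lam1_le: "lam 1 \<le> lam i" if "i \<ge> 1" for i using lam_mono[of 1 i] that by simp
  define c where "c = lam 1 - L\<^sub>F"
  have c: "c > 0" using L\<^sub>F by (simp add: c_def)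
  have q: "0 \<le> q i" if i: "i \<ge> 1" for i
  proof -
    have "e i \<noteq> 0" using norm_basis[OF i] by auto
    then have "0 < inner (Q (e i)) (e i)" using Q_pos by (auto simp: positive_definite_on_def)
    then show ?thesis using Q_eigen[OF i] inner_basis[OF i i] by simp
  qed
  obtain CQ where CQ: "\<And>I. finite I \<Longrightarrow> I \<subseteq> {1..} \<Longrightarrow> (\<Sum>i\<in>I. q i * lam i powr (2 * ((\<beta> - 1) / 2))) \<le> CQ"
    using noise_trace_bound[OF lam_pos lam1_le Q_eigen Qhalf _ AQ_hilbert_schmidt] beta by auto
  obtain CX where CX: "CX \<ge> 0" "\<And>I n. finite I \<Longrightarrow> I \<subseteq> {1..} \<Longrightarrow> n \<ge> 1 \<Longrightarrow> (\<forall>i\<in>I. lam n \<le> lam i) \<Longrightarrow>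
      (\<Sum>i\<in>I. (inner (e i) X0)\<^sup>2) \<le> CX * lam n powr (- 2 * \<beta>)"
    using initial_value_tail[OF lam_pos lam1_le X0, of \<beta>] beta by auto
  have F_lip: "norm (F x - F y) \<le> L * norm (x - y)" for x y
  proof -
    have "onorm (blinfun_apply (F' z)) \<le> L" for z
      using F'_bound[of z] L_pos by (intro onorm_bound) auto
    then show ?thesis
      by (rule differentiable_bound[where S = UNIV and f' = "\<lambda>z. blinfun_apply (F' z)",
            OF convex_UNIV has_derivative_at_withinI[OF F_deriv] _ UNIV_I UNIV_I])
  qed
  \<comment> \<open>The derivative inherits the one-sided bound from the difference quotients.\<close>
  have F_diss: "inner v (F' x v) \<le> L\<^sub>F * (norm v)\<^sup>2" for x v
  proof -
    have "((\<lambda>t. F (x + t *\<^sub>R v)) has_vector_derivative F' x v) (at 0)"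
    proof -
      have "((\<lambda>t. x + t *\<^sub>R v) has_derivative (\<lambda>s. s *\<^sub>R v)) (at 0)" by (auto intro!: derivative_eq_intros)
      from has_derivative_compose[OF this, of F "blinfun_apply (F' x)"] F_deriv[of x]
      show ?thesis by (simp add: has_vector_derivative_def blinfun.scaleR_right)
    qed
    then have "((\<lambda>t. inner v (F (x + t *\<^sub>R v))) has_vector_derivative inner v (F' x v)) (at 0)"
      by (rule bounded_linear.has_vector_derivative[OF bounded_linear_inner_right])
    then have "((\<lambda>t. (inner v (F (x + t *\<^sub>R v)) - inner v (F x)) / t) \<longlongrightarrow> inner v (F' x v)) (at 0)"
      by (simp add: has_real_derivative_iff_has_vector_derivative[symmetric] DERIV_def)
    then have "((\<lambda>t. (inner v (F (x + t *\<^sub>R v)) - inner v (F x)) / t) \<longlongrightarrow> inner v (F' x v)) (at_right 0)"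
      by (rule tendsto_mono[rotated]) (simp add: at_le)
    then show ?thesis
    proof (rule tendsto_upperbound)
      show "\<forall>\<^sub>F t in at_right 0. (inner v (F (x + t *\<^sub>R v)) - inner v (F x)) / t \<le> L\<^sub>F * (norm v)\<^sup>2"
        using eventually_at_right_less[of "0::real"]
      proof eventually_elim
        case (elim t)
        have "inner ((x + t *\<^sub>R v) - x) (F (x + t *\<^sub>R v) - F x) \<le> L\<^sub>F * (norm ((x + t *\<^sub>R v) - x))\<^sup>2" by (rule F_one_sided)
        moreover have "(x + t *\<^sub>R v) - x = t *\<^sub>R v" by simp
        ultimately have "t * (inner v (F (x + t *\<^sub>R v)) - inner v (F x)) \<le> L\<^sub>F * (t\<^sup>2 * (norm v)\<^sup>2)"
          by (simp only: inner_scaleR_left inner_diff_right norm_scaleR power_mult_distrib power2_abs right_diff_distrib)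
        also have "\<dots> = t * (t * (L\<^sub>F * (norm v)\<^sup>2))" by (simp add: power2_eq_square)
        finally have "inner v (F (x + t *\<^sub>R v)) - inner v (F x) \<le> t * (L\<^sub>F * (norm v)\<^sup>2)"
          using elim by simp
        then show ?case using elim by (simp add: divide_le_eq mult.commute)
      qed
    qed simp
  qed
  have F_taylor: "norm (diag e I (\<lambda>i. lam i powr (- \<eta>)) (F x - F y - F' y (x - y))) \<le> L * (norm (x - y))\<^sup>2"
    if I: "finite I" "I \<subseteq> {1..}" for I x y
  proof -
    let ?D = "diag e I (\<lambda>i. lam i powr (- \<eta>))"
    \<comment> \<open>The smoothed Taylor remainder, tested against itself.\<close>
    define w where "w = ?D (F x - F y - F' y (x - y))"
    have "\<bar>inner w (?D (F (y + (x - y)))) - inner w (?D (F y)) - inner w (?D (F' y (x - y)))\<bar> \<le> norm w * (L * (norm (x - y))\<^sup>2)"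
    proof (rule second_order_taylor_functional[OF F_deriv F_deriv2, where l = "\<lambda>z. inner w (?D z)"])
      show "bounded_linear (\<lambda>z. inner w (?D z))"
        by (rule bounded_linear_compose[OF bounded_linear_inner_right bounded_linear_diag])
      fix z
      have "norm (?D (F'' z (x - y) (x - y))) \<le> norm (frac_pow e lam (- \<eta>) (F'' z (x - y) (x - y)))"
        by (rule norm_diag_frac_pow_le) (use lam_pos lam1_le eta I in auto)
      also have "\<dots> \<le> L * (norm (x - y))\<^sup>2" using F''_bound[of z "x - y" "x - y"] by (simp add: power2_eq_square mult.assoc)
      finally have "norm w * norm (?D (F'' z (x - y) (x - y))) \<le> norm w * (L * (norm (x - y))\<^sup>2)" by (rule mult_left_mono) simp
      then show "\<bar>inner w (?D (F'' z (x - y) (x - y)))\<bar> \<le> norm w * (L * (norm (x - y))\<^sup>2)"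
        using Cauchy_Schwarz_ineq2[of w "?D (F'' z (x - y) (x - y))"] by linarith
    qed
    moreover have "inner w w = inner w (?D (F x)) - inner w (?D (F y)) - inner w (?D (F' y (x - y)))"
      by (subst (2) w_def) (simp only: diag_diff inner_diff_right)
    ultimately have "norm w * norm w \<le> norm w * (L * (norm (x - y))\<^sup>2)"
      by (simp add: dot_square_norm power2_eq_square)
    then show ?thesis using L_pos by (cases "w = 0") (auto simp: w_def)
  qed
  interpret S: spde e lam q F "\<lambda>x. blinfun_apply (F' x)" L c \<beta> \<eta> CQ CX X0 M Fil B
  proof (intro spde.intro semilinear.intro semilinear_axioms.intro wiener.intro wiener_axioms.intro)
    show "inner (x - y) (F x - F y) \<le> (lam 1 - c) * (norm (x - y))\<^sup>2" for x y
      using F_one_sided[of x y] by (simp add: c_def)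
    show "inner v (F' x v) \<le> (lam 1 - c) * (norm v)\<^sup>2" for x v using F_diss by (simp add: c_def)
    show "linear (blinfun_apply (F' x))" for x by (rule bounded_linear.linear[OF blinfun.bounded_linear_right])
    show "(\<Sum>i\<in>I. q i * lam i powr (\<beta> - 1)) \<le> CQ" if "finite I" "I \<subseteq> {1..}" for I
    proof -
      have "2 * ((\<beta> - 1) / 2) = \<beta> - 1" by simp
      then show ?thesis using CQ[OF that] by metis
    qed
  qed (use lam_pos lam_mono q L_pos c beta eta F_lip F'_bound F_taylor CX prob filtr wiener in \<open>auto intro: onb_axioms\<close>)
  obtain D1 :: "'a \<Rightarrow> 'a \<Rightarrow>\<^sub>L real" and D2 :: "'a \<Rightarrow> 'a \<Rightarrow>\<^sub>L ('a \<Rightarrow>\<^sub>L real)"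
    where D: "\<And>x. (\<Phi> has_derivative blinfun_apply (D1 x)) (at x)" "\<And>x. (D1 has_derivative blinfun_apply (D2 x)) (at x)"
      and bD: "bounded (range D1)" "bounded (range D2)"
    using Cb2 unfolding Cb2_def by blast
  obtain C1 where C1: "C1 > 0" "\<And>x. norm (D1 x) \<le> C1" using bD(1) unfolding bounded_pos by auto
  obtain C2 where C2: "C2 > 0" "\<And>x. norm (D2 x) \<le> C2" using bD(2) unfolding bounded_pos by auto
  have D1b: "\<bar>D1 x v\<bar> \<le> C1 * norm v" for x v
    using norm_blinfun[of "D1 x" v] mult_right_mono[OF C1(2)[of x] norm_ge_zero[of v]] by simp
  have D2b: "\<bar>\<Phi> x - \<Phi> y - D1 y (x - y)\<bar> \<le> C2 * (norm (x - y))\<^sup>2" for x y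
  proof -
    have "\<bar>\<Phi> (y + (x - y)) - \<Phi> y - D1 y (x - y)\<bar> \<le> C2 * (norm (x - y))\<^sup>2"
    proof (rule second_order_taylor_functional[OF D, where l = "\<lambda>z. z"])
      fix z
      have "norm (D2 z (x - y) (x - y)) \<le> norm (D2 z) * norm (x - y) * norm (x - y)"
        by (rule order_trans[OF norm_blinfun mult_right_mono[OF norm_blinfun]]) simp
      also have "\<dots> \<le> C2 * norm (x - y) * norm (x - y)" by (intro mult_right_mono C2(2)) auto
      finally show "\<bar>D2 z (x - y) (x - y)\<bar> \<le> C2 * (norm (x - y))\<^sup>2" by (simp add: power2_eq_square mult.assoc)
    qed (rule bounded_linear_ident)
    then show ?thesis by simp
  qed
  have \<Phi>c: "continuous_on UNIV \<Phi>"
    by (rule has_derivative_continuous_on[OF has_derivative_at_withinI[OF D(1)]])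
  have \<Phi>b: "\<bar>\<Phi> x\<bar> \<le> \<bar>\<Phi> 0\<bar> + C1 * norm x" for x
  proof -
    have "onorm (blinfun_apply (D1 z)) \<le> C1" for z
      using D1b[of z] C1(1) by (intro onorm_bound) auto
    then have "norm (\<Phi> x - \<Phi> 0) \<le> C1 * norm (x - 0)"
      by (rule differentiable_bound[where S = UNIV and f' = "\<lambda>z. blinfun_apply (D1 z)",
            OF convex_UNIV has_derivative_at_withinI[OF D(1)] _ UNIV_I UNIV_I])
    then show ?thesis by simp
  qed
  \<comment> \<open>The unbounded operator is met only on the span of finitely many eigenvectors.\<close>
  have A_diag: "A (galerkin_proj e n x) = - diag e {1..n} lam x" for n x
  proof -
    have linA: "linear_operator_on D A" using A_self_adjoint by (simp add: self_adjoint_operator_def)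
    then have sub: "subspace D" and addA: "\<And>x y. x \<in> D \<Longrightarrow> y \<in> D \<Longrightarrow> A (x + y) = A x + A y"
      and scA: "\<And>r x. x \<in> D \<Longrightarrow> A (r *\<^sub>R x) = r *\<^sub>R A x" by (auto simp: linear_operator_on_def)
    have Ae: "A (e i) = - (lam i *\<^sub>R e i)" if "i \<ge> 1" for i
      using A_eigen[OF that] by (metis minus_minus)
    have "(\<Sum>i\<in>I. r i *\<^sub>R e i) \<in> D \<and> A (\<Sum>i\<in>I. r i *\<^sub>R e i) = (\<Sum>i\<in>I. - ((lam i * r i) *\<^sub>R e i))"
      if "finite I" "I \<subseteq> {1..}" for I r
      using that
    proof (induction I rule: finite_induct)
      case empty
      have "A (0 *\<^sub>R 0) = 0 *\<^sub>R A 0" using scA subspace_0[OF sub] by blast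
      then show ?case using subspace_0[OF sub] by simp
    next
      case (insert i I)
      have i: "i \<ge> 1" using insert.prems by simp
      have eD: "e i \<in> D" using A_eigen[OF i] by simp
      have rD: "r i *\<^sub>R e i \<in> D" by (rule subspace_scale[OF sub eD])
      have IH: "(\<Sum>i\<in>I. r i *\<^sub>R e i) \<in> D" "A (\<Sum>i\<in>I. r i *\<^sub>R e i) = (\<Sum>i\<in>I. - ((lam i * r i) *\<^sub>R e i))"
        using insert by auto
      show ?case
        unfolding sum.insert[OF insert.hyps] addA[OF rD IH(1)] scA[OF eD] Ae[OF i] IH(2)
        using subspace_add[OF sub rD IH(1)] by (simp add: mult.commute)
    qed
    then have "A (galerkin_proj e n x) = (\<Sum>i\<in>{1..n}. - ((lam i * inner (e i) x) *\<^sub>R e i))"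
      unfolding galerkin_proj_def by auto
    then show ?thesis by (simp add: diag_def sum_negf)
  qed
  have Ei: "inner (e k) (E s x) = exp (- (lam k * s)) * inner (e k) x" if "0 \<le> s" "k \<ge> 1" for s x k
    by (rule inner_semigroup[OF semigroup A_eigen lam_pos that])
  have Ee: "E s (e k) = exp (- (lam k * s)) *\<^sub>R e k" if "0 \<le> s" "k \<ge> 1" for s k
  proof (rule semigroup_eigenvector[OF semigroup])
    show "A (e k) = - (lam k *\<^sub>R e k)" using A_eigen[OF that(2)] by (metis minus_minus)
  qed (use A_eigen[OF that(2)] lam_pos[OF that(2)] that in auto)
  let ?K = "C1 * (S.K_remainder + S.K_linear + S.K_high + 1) + 2 * C2 * S.K_strong"
  have K0: "?K > 0"
  proof -
    have "0 < C1 * (S.K_remainder + S.K_linear + S.K_high + 1)"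
      using C1(1) S.K_nonneg by (intro mult_pos_pos) (simp_all add: add_nonneg_pos)
    moreover have "0 \<le> 2 * C2 * S.K_strong" using C2(1) S.K_nonneg by simp
    ultimately show ?thesis by linarith
  qed
  show "\<exists>C>0. \<forall>T>0. \<forall>n\<ge>1.
      \<bar>prob_space.expectation M (\<lambda>\<omega>. \<Phi> (X T \<omega>)) - prob_space.expectation M (\<lambda>\<omega>. \<Phi> (Xn n T \<omega>))\<bar>
      \<le> C * lam n powr (- \<beta> + \<epsilon>)"
  proof (intro exI[of _ "?K * lam 1 powr (- \<epsilon>)"] conjI allI impI)
    show "?K * lam 1 powr (- \<epsilon>) > 0" using K0 lam1 by simp
    fix T :: real and n :: nat assume T: "T > 0" and n: "n \<ge> 1"
    have "\<bar>prob_space.expectation M (\<lambda>\<omega>. \<Phi> (X T \<omega>)) - prob_space.expectation M (\<lambda>\<omega>. \<Phi> (Xn n T \<omega>))\<bar>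
        \<le> ?K * lam n powr (- \<beta>)"
    proof (rule S.weak_convergence_rate[OF T X Xn A_diag _ _ n \<Phi>c _ _ _ D1b D2b \<Phi>b])
      show "linear (blinfun_apply (D1 x))" for x by (rule bounded_linear.linear[OF blinfun.bounded_linear_right])
    qed (use C1(1) C2(1) Ei Ee in auto)
    \<comment> \<open>Since \<open>lam n \<ge> lam 1\<close>, the power \<open>- \<epsilon>\<close> of \<open>lam n\<close> is bounded.\<close>
    also have "\<dots> \<le> ?K * (lam 1 powr (- \<epsilon>) * lam n powr (- \<beta> + \<epsilon>))"
      using S.lam_powr_le[OF n, of "- \<beta>" "- \<beta> + \<epsilon>"] \<epsilon> K0 by (intro mult_left_mono) auto
    finally show "\<bar>prob_space.expectation M (\<lambda>\<omega>. \<Phi> (X T \<omega>)) - prob_space.expectation M (\<lambda>\<omega>. \<Phi> (Xn n T \<omega>))\<bar>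
        \<le> ?K * lam 1 powr (- \<epsilon>) * lam n powr (- \<beta> + \<epsilon>)" by (simp only: mult.assoc)
  qed
qed

end
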